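(* Let $\Theta$ be an inner function belonging to the class $\mathcal{M}$. Then either $\sup\{\eta_\Theta(t):0<t<1\}=1$ (which means that $\Theta$ satisfies the Sharp Invertibility Property (SIP)) or $\eta_\Theta(t)=0$ for every $0<t<1$.
   Context: $\mathbb{D}$ is the open unit disc; $H^\infty$ is the algebra of bounded analytic functions on $\mathbb{D}$ with the sup norm $\|\cdot\|_\infty$. $\Theta\in H^\infty$ is inner if it has radial limits of modulus $1$ at almost every point of $\partial\mathbb{D}$. $\mathcal{Z}(\Theta)$ is the zero set of $\Theta$ in $\mathbb{D}$. $\rho(z,w)=\left|\frac{z-w}{1-\bar w z}\right|$, $\rho(z,A)=\inf_{a\in A}\rho(z,a)$ (with $\inf\emptyset=+\infty$). For $0<t<1$, $\eta_\Theta(t)=\inf\{|\Theta(z)|: z\in\mathbb{D},\ \rho(z,\mathcal{Z}(\Theta))\ge t\}$. A Blaschke product with zeros $\{a_j\}$ (listed with multiplicity) is Carleson--Newman, written $\in(CN)$, if $\mu=\sum_j(1-|a_j|)\delta_{a_j}$ is a Carleson measure, i.e. there is $C>0$ with $\mu(Q(I))\le C|I|$ for every arc $I\subset\partial\mathbb{D}$, where $Q(I)=\{z\in\mathbb{D}: z/|z|\in I,\ 1-|z|\le|I|\}$. For $a\in\mathbb{D}$, $\varphi_a(w)=\frac{a-w}{1-\bar a w}$. The class $\mathcal{M}$ is the set of inner functions $\Theta$ such that $\varphi_a\circ\Theta\in(CN)$ (up to a unimodular constant) for every $a\in\mathbb{D}\setminus\{0\}$. SIP: for every $\varepsilon>0$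 there exists $\delta>0$ such that for every $f\in H^\infty$, the conditions $\|[f]\|\le1$ and $\inf_{\mathcal{Z}(\Theta)}|f|\ge1-\delta$ imply that $[f]$ is invertible in $H^\infty/\Theta H^\infty$ and $\|[f]^{-1}\|\le1+\varepsilon$, where $\|[f]\|=\inf\{\|f+g\Theta\|_\infty:g\in H^\infty\}$. *)

theory Defs
  imports "HOL-Complex_Analysis.Complex_Analysis"
begin

abbreviation unit_disc :: "complex set" where
  "unit_disc \<equiv> ball 0 1"

text \<open>Functions on the disc are total functions on the complex plane; their values
  outside the disc are never used.\<close>

definition Hinf :: "(complex \<Rightarrow> complex) set" where
  "Hinf = {f. f holomorphic_on unit_disc \<and> bounded (f ` unit_disc)}"

definition Hinf_norm :: "(complex \<Rightarrow> complex) \<Rightarrow> real" where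
  "Hinf_norm f = (SUP z\<in>unit_disc. cmod (f z))"

text \<open>The set of good angles is \<open>2 * pi\<close>-periodic, so almost every angle on the real line
  means almost every point of the circle.\<close>

definition inner_function :: "(complex \<Rightarrow> complex) \<Rightarrow> bool" where
  "inner_function \<Theta> \<longleftrightarrow> \<Theta> \<in> Hinf \<and>
     (AE t in lborel. \<exists>L. cmod L = 1 \<and> ((\<lambda>r. \<Theta> (of_real r * cis t)) \<longlongrightarrow> L) (at_left 1))"

definition zero_set :: "(complex \<Rightarrow> complex) \<Rightarrow> complex set" where
  "zero_set \<Theta> = {z \<in> unit_disc. \<Theta> z = 0}"

definition rho :: "complex \<Rightarrow> complex \<Rightarrow> real" where
  "rho z w = cmod ((z - w) / (1 - cnj w * z))"

text \<open>Infima are taken in \<^typ>\<open>ereal\<close>, where the infimum of the empty set is \<open>\<infinity>\<close>.\<close>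

definition rho_set :: "complex \<Rightarrow> complex set \<Rightarrow> ereal" where
  "rho_set z A = (INF a\<in>A. ereal (rho z a))"

definition eta :: "(complex \<Rightarrow> complex) \<Rightarrow> real \<Rightarrow> ereal" where
  "eta \<Theta> t = (INF z\<in>{z \<in> unit_disc. rho_set z (zero_set \<Theta>) \<ge> ereal t}. ereal (cmod (\<Theta> z)))"

text \<open>The Carleson window over the closed arc \<open>{cis t | \<alpha> \<le> t \<le> \<beta>}\<close> of length \<open>\<beta> - \<alpha>\<close>.
  The origin, where \<open>z / |z|\<close> is undefined, belongs to no window.\<close>

definition carleson_window :: "real \<Rightarrow> real \<Rightarrow> complex set" where
  "carleson_window \<alpha> \<beta> =
     {z \<in> unit_disc. z / of_real (cmod z) \<in> cis ` {\<alpha>..\<beta>} \<and> 1 - cmod z \<le> \<beta> - \<alpha>}"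

text \<open>Closed arcs suffice: any arc lies in a closed arc of the same length.\<close>

definition carleson_measure :: "complex measure \<Rightarrow> bool" where
  "carleson_measure \<mu> \<longleftrightarrow>
     (\<exists>C>0. \<forall>\<alpha> \<beta>. \<alpha> < \<beta> \<and> \<beta> \<le> \<alpha> + 2 * pi \<longrightarrow>
        emeasure \<mu> (carleson_window \<alpha> \<beta>) \<le> ennreal (C * (\<beta> - \<alpha>)))"

definition blaschke_factor :: "complex \<Rightarrow> complex \<Rightarrow> complex" where
  "blaschke_factor a z =
     (if a = 0 then z else of_real (cmod a) / a * ((a - z) / (1 - cnj a * z)))"

text \<open>A family of zeros, repeated according to multiplicity, is indexed by an arbitrary
  set \<open>J\<close> of natural numbers: \<open>J\<close> may be empty, finite or infinite.\<close>

definition blaschke_product :: "nat set \<Rightarrow> (nat \<Rightarrow> complex) \<Rightarrow> (complex \<Rightarrow> complex) \<Rightarrow> bool" where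
  "blaschke_product J a B \<longleftrightarrow>
     (\<forall>j\<in>J. a j \<in> unit_disc) \<and> (\<lambda>j. 1 - cmod (a j)) summable_on J \<and>
     (\<forall>z\<in>unit_disc. (\<lambda>j. if j \<in> J then blaschke_factor (a j) z else 1) has_prod B z)"

text \<open>The sum over \<open>j \<in> J\<close> of the point masses \<open>1 - |a j|\<close> at \<open>a j\<close>, as the image under \<open>a\<close>
  of a weighted counting measure on \<open>J\<close>; every set is measurable.\<close>

definition zeros_measure :: "nat set \<Rightarrow> (nat \<Rightarrow> complex) \<Rightarrow> complex measure" where
  "zeros_measure J a =
     distr (point_measure J (\<lambda>j. ennreal (1 - cmod (a j)))) (count_space UNIV) a"

definition carleson_newman :: "(complex \<Rightarrow> complex) \<Rightarrow> bool" where
  "carleson_newman B \<longleftrightarrow>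
     (\<exists>J a. blaschke_product J a B \<and> carleson_measure (zeros_measure J a))"

definition phi :: "complex \<Rightarrow> complex \<Rightarrow> complex" where
  "phi a w = (a - w) / (1 - cnj a * w)"

definition class_M :: "(complex \<Rightarrow> complex) set" where
  "class_M = {\<Theta>. inner_function \<Theta> \<and>
     (\<forall>a\<in>unit_disc - {0}. \<exists>c B. cmod c = 1 \<and> carleson_newman B \<and>
        (\<forall>z\<in>unit_disc. phi a (\<Theta> z) = c * B z))}"

text \<open>\<open>quot_eq \<Theta> f g\<close> is the equality of the classes of \<open>f\<close> and \<open>g\<close> modulo the ideal
  \<open>\<Theta> Hinf\<close>, and \<open>quot_norm \<Theta> f\<close> is the quotient norm of the class of \<open>f\<close>.\<close>

definition quot_eq ::
  "(complex \<Rightarrow> complex) \<Rightarrow> (complex \<Rightarrow> complex) \<Rightarrow> (complex \<Rightarrow> complex) \<Rightarrow> bool" where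
  "quot_eq \<Theta> f g \<longleftrightarrow> (\<exists>h\<in>Hinf. \<forall>z\<in>unit_disc. f z - g z = \<Theta> z * h z)"

definition quot_norm :: "(complex \<Rightarrow> complex) \<Rightarrow> (complex \<Rightarrow> complex) \<Rightarrow> real" where
  "quot_norm \<Theta> f = (INF g\<in>Hinf. Hinf_norm (\<lambda>z. f z + g z * \<Theta> z))"

definition quot_inverse ::
  "(complex \<Rightarrow> complex) \<Rightarrow> (complex \<Rightarrow> complex) \<Rightarrow> (complex \<Rightarrow> complex) \<Rightarrow> bool" where
  "quot_inverse \<Theta> f h \<longleftrightarrow> h \<in> Hinf \<and> quot_eq \<Theta> (\<lambda>z. f z * h z) (\<lambda>z. 1)"

definition SIP :: "(complex \<Rightarrow> complex) \<Rightarrow> bool" where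
  "SIP \<Theta> \<longleftrightarrow>
     (\<forall>\<epsilon>>0. \<exists>\<delta>>0. \<forall>f\<in>Hinf.
        quot_norm \<Theta> f \<le> 1 \<and> (INF z\<in>zero_set \<Theta>. ereal (cmod (f z))) \<ge> ereal (1 - \<delta>) \<longrightarrow>
        (\<exists>h. quot_inverse \<Theta> f h \<and> quot_norm \<Theta> h \<le> 1 + \<epsilon>))"

end

(*
  The dichotomy: suppose that 0 < m = sup eta < 1 and choose z_n with rho(z_n, Z) -> 1 and
  |Theta(z_n)| -> m, Theta(z_n) -> a. Then Theta o phi_(z_n) is zero free on large discs and bounded
  below there by nearly m, hence nearly constant equal to a on compact sets. So phi_a o Theta is
  small on whole pseudohyperbolic discs, which a Carleson-Newman Blaschke product cannot be.
  If eta vanishes identically, the functions f = phi_z violate the SIP.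

  If sup eta = 1, the SIP follows from a sharp corona theorem: when (1 - |f|^2) (1 - |Theta|^2) is
  uniformly small, f u + Theta v = 1 has a solution with |u|, |v| <= 1 + eps. In the half plane let
  psi be constant on dyadic cells, equal to 0 where only |Theta| is known to be close to 1, equal to
  1 where only |f| is, and changing in steps of 1/m. With a hysteresis the jumps of psi satisfy a
  Carleson packing condition independent of m. Correcting psi/f and (1 - psi)/Theta by multiples of
  a Cauchy integral of the jumps makes them holomorphic; with Jones' kernel that integral is O(1/m)
  on the real line, and the maximum principle gives the bound.
*)
theory Submission
  imports Defs
begin

section \<open>Schwarz--Pick estimates\<close>

text \<open>Jumps of size 1/m help only if their packing constant does not grow with m. This rests
  on a square root in the Carleson embedding: below a point where the defect 1 - |F|^2 is at most x,
  the intervals on which it reaches y cover a fraction O(sqrt x / y). If each threshold is a large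
  multiple of the square root of the one before, at most half of an interval changes its state again
  after a change, and the changes form a geometric series. Hence the order of choice: m from the
  error allowed, then the thresholds, then tau, and only then f. Boundary values are avoided by
  dilation. The functions f(rz) and Theta(rz) continue across the circle, so finitely many
  generations of cells suffice, the last one reaching below the real line. No bound depends on r or
  on the number of generations, and a normal family argument lets r tend to 1. A Cayley map with a
  small parameter brings the dilate of Theta close to the constant Theta(r) outside a central
  rectangle, so psi vanishes on the border cells and summation by parts leaves no side terms. When
  |f(r)| rather than |Theta(r)| is near 1, the two functions are exchanged.\<close>

lemma pick_identity:
  "(cmod (1 - cnj w * z))\<^sup>2 - (cmod (z - w))\<^sup>2 = (1 - (cmod z)\<^sup>2) * (1 - (cmod w)\<^sup>2)"
proof -
  obtain a b c d where "z = Complex a b" "w = Complex c d" by (meson complex.exhaust)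
  then show ?thesis
    unfolding cmod_power2 by (simp) (simp add: power2_eq_square algebra_simps)
qed

lemma one_minus_cnj_mult_nonzero:
  assumes "cmod w < 1" "cmod z \<le> 1"
  shows "1 - cnj w * z \<noteq> 0"
proof
  assume "1 - cnj w * z = 0"
  then have "cmod (cnj w * z) = 1" by simp
  moreover have "cmod (cnj w * z) < 1"
    using assms mult_mono[of "cmod w" "cmod w" "cmod z" 1] by (simp add: norm_mult)
  ultimately show False by simp
qed

lemma one_minus_rho_power2:
  assumes "1 - cnj w * z \<noteq> 0"
  shows "1 - (rho z w)\<^sup>2 = (1 - (cmod z)\<^sup>2) * (1 - (cmod w)\<^sup>2) / (cmod (1 - cnj w * z))\<^sup>2"
  using assms pick_identity[of w z]
  by (simp add: rho_def norm_divide power_divide field_simps)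

lemma rho_nonneg: "0 \<le> rho z w"
  by (simp add: rho_def)

lemma rho_commute: "rho z w = rho w z"
proof -
  have "cmod (1 - cnj w * z) = cmod (1 - cnj z * w)"
    by (metis complex_cnj_cnj complex_cnj_diff complex_cnj_mult complex_cnj_one complex_mod_cnj mult.commute)
  then show ?thesis by (simp add: rho_def norm_divide norm_minus_commute)
qed

lemma rho_less_1:
  assumes "cmod z < 1" "cmod w < 1"
  shows "rho z w < 1"
  using Moebius_function_norm_lt_1[OF assms(2,1), of 0]
  by (simp add: rho_def Moebius_function_simple)

lemma norm_phi: "cmod (phi a w) = rho w a"
  by (simp add: phi_def rho_def norm_divide norm_minus_commute)

lemma phi_0 [simp]: "phi a 0 = a" and phi_self [simp]: "phi a a = 0"
  by (simp_all add: phi_def)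

lemma phi_in_disc: "cmod a < 1 \<Longrightarrow> cmod z < 1 \<Longrightarrow> cmod (phi a z) < 1"
  by (simp add: norm_phi rho_less_1)

lemma phi_holomorphic: "cmod a < 1 \<Longrightarrow> phi a holomorphic_on ball 0 1"
  unfolding phi_def
  by (intro holomorphic_intros one_minus_cnj_mult_nonzero) auto

lemma phi_phi:
  assumes "cmod a < 1" "cmod z < 1"
  shows "phi a (phi a z) = z"
proof -
  have n: "1 - cnj a * z \<noteq> 0" "1 - cnj a * a \<noteq> 0"
    using assms one_minus_cnj_mult_nonzero[of a] by auto
  have e1: "a - (a - z) / (1 - cnj a * z) = (1 - cnj a * a) * z / (1 - cnj a * z)"
    using n by (simp add: field_simps)
  have e2: "1 - cnj a * ((a - z) / (1 - cnj a * z)) = (1 - cnj a * a) / (1 - cnj a * z)"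
    using n by (simp add: field_simps)
  have "x * z / y / (x / y) = z" if "x \<noteq> 0" "y \<noteq> 0" for x y :: complex
    using that by simp
  from this[OF n(2,1)] show ?thesis unfolding phi_def e1 e2 .
qed

lemma schwarz_pick_0:
  assumes hol: "f holomorphic_on ball 0 1" and le: "\<And>z. cmod z < 1 \<Longrightarrow> cmod (f z) \<le> 1"
    and z: "cmod z < 1"
  shows "cmod (f z - f 0) \<le> cmod z * cmod (1 - cnj (f 0) * f z)"
proof -
  have *: "cmod (of_real s * f z - of_real s * f 0)
      \<le> cmod z * cmod (1 - cnj (of_real s * f 0) * (of_real s * f z))"
    if s: "0 < s" "s < 1" for s :: real
  proof -
    define F where "F = (\<lambda>z. of_real s * f z)"
    have F1: "cmod (F z) < 1" if "cmod z < 1" for z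
    proof -
      have "cmod (F z) = s * cmod (f z)" using s by (simp add: F_def norm_mult)
      also have "\<dots> \<le> s" using s le[OF that] mult_left_mono[of "cmod (f z)" 1 s] by simp
      finally show ?thesis using s by simp
    qed
    have Fh: "F holomorphic_on ball 0 1" unfolding F_def using hol by (intro holomorphic_intros)
    define G where "G = (\<lambda>z. phi (F 0) (F z))"
    have Gh: "G holomorphic_on ball 0 1"
      unfolding G_def
      by (rule holomorphic_on_compose_gen[OF Fh phi_holomorphic, unfolded o_def])
        (use F1 in auto)
    have G1: "cmod (G z) < 1" if "cmod z < 1" for z
      unfolding G_def by (intro phi_in_disc F1) (use that in auto)
    have "G 0 = 0" by (simp add: G_def)
    have "cmod (G z) \<le> cmod z" by (rule Schwarz_Lemma(1)[OF Gh \<open>G 0 = 0\<close> G1 z])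
    moreover have "1 - cnj (F 0) * F z \<noteq> 0"
      using F1[of 0] F1[OF z] by (intro one_minus_cnj_mult_nonzero) auto
    moreover have "cmod (G z) = cmod (F z - F 0) / cmod (1 - cnj (F 0) * F z)"
      unfolding G_def phi_def by (metis norm_divide norm_minus_commute)
    ultimately have "cmod (F z - F 0) \<le> cmod z * cmod (1 - cnj (F 0) * F z)"
      by (simp add: divide_le_eq)
    then show ?thesis unfolding F_def .
  qed
  let ?l = "\<lambda>s::real. cmod (of_real s * f z - of_real s * f 0)"
  let ?r = "\<lambda>s::real. cmod z * cmod (1 - cnj (of_real s * f 0) * (of_real s * f z))"
  have "(?l \<longlongrightarrow> ?l 1) (at_left 1)" "(?r \<longlongrightarrow> ?r 1) (at_left 1)"
    by (intro tendsto_intros)+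
  moreover have "eventually (\<lambda>s. ?l s \<le> ?r s) (at_left 1)"
    by (rule eventually_at_leftI[of 0]) (use * in auto)
  ultimately have "?l 1 \<le> ?r 1"
    using tendsto_le[of "at_left (1::real)" ?r "?r 1" ?l "?l 1"] by simp
  then show ?thesis by simp
qed

lemma schwarz_pick_ball:
  assumes hol: "f holomorphic_on ball w r" and le: "\<And>z. z \<in> ball w r \<Longrightarrow> cmod (f z) \<le> 1"
    and z: "z \<in> ball w r"
  shows "cmod (f z - f w) \<le> (cmod (z - w) / r) * cmod (1 - cnj (f w) * f z)"
proof -
  have r: "0 < r" using z by (metis ball_eq_empty empty_iff linorder_not_le)
  define F where "F = (\<lambda>u. f (w + of_real r * u))"
  have m: "w + of_real r * u \<in> ball w r" if "cmod u < 1" for u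
    using that r by (simp add: dist_norm norm_mult)
  have "F holomorphic_on ball 0 1"
    unfolding F_def using m
    by (intro holomorphic_on_compose_gen[OF _ hol, unfolded o_def] holomorphic_intros) auto
  moreover have "cmod (F u) \<le> 1" if "cmod u < 1" for u
    unfolding F_def using m that le by auto
  moreover have "cmod ((z - w) / of_real r) < 1"
    using z r by (simp add: norm_divide dist_norm norm_minus_commute)
  ultimately have "cmod (F ((z - w) / of_real r) - F 0)
      \<le> cmod ((z - w) / of_real r) * cmod (1 - cnj (F 0) * F ((z - w) / of_real r))"
    by (intro schwarz_pick_0)
  then show ?thesis using r by (simp add: F_def norm_divide)
qed

lemma schwarz_pick:
  assumes hol: "f holomorphic_on ball 0 1" and le: "\<And>z. cmod z < 1 \<Longrightarrow> cmod (f z) \<le> 1"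
    and z: "cmod z < 1" and w: "cmod w < 1"
  shows "cmod (f z - f w) \<le> rho z w * cmod (1 - cnj (f w) * f z)"
proof -
  have "(\<lambda>u. f (phi w u)) holomorphic_on ball 0 1"
    by (rule holomorphic_on_compose_gen[OF phi_holomorphic[OF w] hol, unfolded o_def])
      (auto intro: phi_in_disc[OF w])
  then have "cmod (f (phi w (phi w z)) - f (phi w 0))
      \<le> cmod (phi w z) * cmod (1 - cnj (f (phi w 0)) * f (phi w (phi w z)))"
    using phi_in_disc[OF w] z le by (intro schwarz_pick_0) auto
  then show ?thesis using phi_phi[OF w z] by (simp add: norm_phi)
qed

text \<open>Since \<open>1 - cnj b * a\<close> differs from \<open>1 - |b|^2\<close> by
  \<open>cnj b * (a - b)\<close>, the Pick inequality lets the difference be absorbed on the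
  left.\<close>

lemma pick_denominator_le:
  assumes "cmod (a - b) \<le> q * cmod (1 - cnj b * a)" "cmod b \<le> 1" "0 \<le> q"
  shows "(1 - q) * cmod (1 - cnj b * a) \<le> 1 - (cmod b)\<^sup>2"
proof -
  have "1 - cnj b * a = of_real (1 - (cmod b)\<^sup>2) - cnj b * (a - b)"
    by (simp add: complex_norm_square algebra_simps flip: of_real_power)
  then have "cmod (1 - cnj b * a) \<le> cmod (of_real (1 - (cmod b)\<^sup>2)) + cmod (cnj b * (a - b))"
    by (metis norm_triangle_ineq4)
  also have "\<dots> \<le> (1 - (cmod b)\<^sup>2) + 1 * cmod (a - b)"
    using assms(2) by (intro add_mono) (auto simp: norm_mult abs_square_le_1 power_le_one mult_left_le_one_le simp del: of_real_diff)
  finally show ?thesis using assms(1) by (simp add: algebra_simps)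
qed

text \<open>The defect at \<open>a\<close> is at most twice \<open>|1 - cnj b * a|\<close>, which
  \<open>pick_denominator_le\<close> bounds by the defect at \<open>b\<close>. This Harnack
  inequality underlies the later comparisons of \<open>1 - |f|^2\<close> at nearby points.\<close>

lemma pick_harnack:
  assumes "cmod (a - b) \<le> q * cmod (1 - cnj b * a)" "cmod a \<le> 1" "cmod b \<le> 1" "0 \<le> q" "q < 1"
  shows "1 - (cmod a)\<^sup>2 \<le> 2 / (1 - q) * (1 - (cmod b)\<^sup>2)"
proof -
  have "1 - (cmod a)\<^sup>2 = (1 - cmod a) * (1 + cmod a)" by (simp add: power2_eq_square algebra_simps)
  also have "\<dots> \<le> (1 - cmod a) * 2" using assms by (intro mult_left_mono) auto
  also have "1 - cmod a \<le> 1 - cmod (cnj b * a)"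
    using assms by (simp add: norm_mult mult_left_le_one_le)
  also have "\<dots> \<le> cmod (1 - cnj b * a)" by (metis norm_one norm_triangle_ineq2)
  finally have "1 - (cmod a)\<^sup>2 \<le> 2 * cmod (1 - cnj b * a)" by simp
  also have "\<dots> \<le> 2 * ((1 - (cmod b)\<^sup>2) / (1 - q))"
    using pick_denominator_le[OF assms(1,3,4)] assms by (simp add: field_simps)
  finally show ?thesis by simp
qed

text \<open>Rigidity in quantitative form: where \<open>|b|\<close> is close to 1, an analytic
  function bounded by 1 is nearly constant on a disc of fixed radius. The dichotomy rests on
  this.\<close>

lemma pick_dist_le:
  assumes "cmod (a - b) \<le> q * cmod (1 - cnj b * a)" "cmod b \<le> 1" "0 \<le> q" "q < 1"
  shows "cmod (a - b) \<le> q / (1 - q) * (1 - (cmod b)\<^sup>2)"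
proof -
  have "cmod (1 - cnj b * a) \<le> (1 - (cmod b)\<^sup>2) / (1 - q)"
    using pick_denominator_le[OF assms(1-3)] assms by (simp add: field_simps)
  then have "q * cmod (1 - cnj b * a) \<le> q * ((1 - (cmod b)\<^sup>2) / (1 - q))"
    using assms by (intro mult_left_mono)
  then show ?thesis using assms(1) by simp
qed

section \<open>Boundary values of inner functions\<close>

lemma cauchy_circle_has_integral:
  assumes "F holomorphic_on cball 0 r" "cmod w < r"
  shows "((\<lambda>t. F (of_real r * cis (2*pi*t)) * (of_real r * cis (2*pi*t)) / (of_real r * cis (2*pi*t) - w))
           has_integral F w) {0..1}"
proof -
  have cp: "circlepath 0 r t = of_real r * cis (2*pi*t)" for t
    by (simp add: circlepath cis_conv_exp mult_ac)
  have "((\<lambda>u. F u / (u - w)) has_contour_integral (2 * of_real pi * \<i> * F w)) (circlepath 0 r)"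
    using assms by (intro Cauchy_integral_circlepath_simple) auto
  then have "((\<lambda>t. F (circlepath 0 r t) / (circlepath 0 r t - w) *
       vector_derivative (circlepath 0 r) (at t within {0..1})) has_integral (2 * of_real pi * \<i> * F w)) {0..1}"
    by (simp add: has_contour_integral_def)
  then have "((\<lambda>t. F (circlepath 0 r t) / (circlepath 0 r t - w) *
       (2 * of_real pi * \<i> * circlepath 0 r t)) has_integral (2 * of_real pi * \<i> * F w)) {0..1}"
    by (rule has_integral_eq[rotated]) (simp add: vector_derivative_circlepath01, simp add: circlepath mult_ac)
  then have "((\<lambda>t. (F (circlepath 0 r t) / (circlepath 0 r t - w) *
       (2 * of_real pi * \<i> * circlepath 0 r t)) * (1 / (2 * of_real pi * \<i>)))
      has_integral (2 * of_real pi * \<i> * F w) * (1 / (2 * of_real pi * \<i>))) {0..1}"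
    by (rule has_integral_mult_left)
  moreover have "x / y * (2 * of_real pi * \<i> * u) * (1 / (2 * of_real pi * \<i>)) = x * u / y" for x y u :: complex
    by (simp add: field_simps)
  ultimately show ?thesis by (simp add: cp)
qed

lemma has_integral_norm_le:
  fixes f :: "real \<Rightarrow> complex"
  assumes "(f has_integral i) S" "(g has_integral j) S" "\<And>x. x \<in> S \<Longrightarrow> cmod (f x) \<le> g x"
  shows "cmod i \<le> j"
  using integral_norm_bound_integral[of f S g] assms by (metis has_integral_integrable integral_unique)

lemma AE_lborel_scale:
  assumes "AE t in lborel. P (t::real)" "c \<noteq> 0"
  shows "AE t in lborel. P (c * t)"
proof -
  from AE_E[OF assms(1)] obtain N where N: "{x \<in> space lborel. \<not> P x} \<subseteq> N" "emeasure lborel N = 0" "N \<in> sets lborel"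
    by blast
  have "AE x in lborel. x \<notin> N" using N by (intro AE_not_in null_setsI) auto
  then have "AE x in lborel. 0 + c * x \<notin> N"
    using assms(2) N(3) by (intro AE_borel_affine[of c "\<lambda>x. x \<notin> N" 0]) auto
  then show ?thesis by eventually_elim (use N(1) in auto)
qed

text \<open>Boundary maximum principle without Poisson integrals: Cauchy's formula for
  \<open>k ^ n\<close> on circles tending to the unit circle gives
  \<open>|k z|^n \<le> M^n / (1 - |z|)\<close>, and the factor independent of \<open>n\<close>
  disappears after taking n-th roots.\<close>

lemma bounded_by_radial_limsup:
  assumes hol: "k holomorphic_on ball 0 1" and bd: "\<And>z. cmod z < 1 \<Longrightarrow> cmod (k z) \<le> K"
    and M: "0 < M"
    and rad: "AE t in lborel. \<forall>e>0. eventually (\<lambda>r. cmod (k (of_real r * cis t)) \<le> M + e) (at_left 1)"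
    and z: "cmod z < 1"
  shows "cmod (k z) \<le> M"
proof -
  have K0: "0 \<le> K" using order_trans[OF norm_ge_zero bd[of 0]] by simp
  define \<rho> where "\<rho> i = 1 - (1 - cmod z) / (2 + real i)" for i :: nat
  have \<rho>1: "\<rho> i < 1" "cmod z < \<rho> i" for i
  proof -
    show "\<rho> i < 1" using z by (simp add: \<rho>_def)
    have "(1 - cmod z) / (2 + real i) < (1 - cmod z) / 1"
      using z by (intro divide_strict_left_mono) auto
    then show "cmod z < \<rho> i" by (simp add: \<rho>_def)
  qed
  have \<rho>0: "0 < \<rho> i" for i using \<rho>1(2)[of i] norm_ge_zero[of z] by linarith
  have \<rho>lim: "\<rho> \<longlonglongrightarrow> 1"
  proof -
    have "(\<lambda>i. 1 - (1 - cmod z) / (2 + real i)) \<longlonglongrightarrow> 1 - 0"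
      by (intro tendsto_diff tendsto_const tendsto_divide_0[OF tendsto_const]
          filterlim_at_top_imp_at_infinity filterlim_tendsto_add_at_top[OF tendsto_const]
          filterlim_real_sequentially)
    moreover have "\<rho> = (\<lambda>i. 1 - (1 - cmod z) / (2 + real i))" by (auto simp: \<rho>_def)
    ultimately show ?thesis by simp
  qed
  have flim: "filterlim \<rho> (at_left 1) sequentially"
    unfolding filterlim_at
  proof (intro conjI \<rho>lim always_eventually allI)
    fix i show "\<rho> i \<in> {..<1}" "\<rho> i \<noteq> 1" using \<rho>1(1)[of i] by auto
  qed
  define e where "e t = cis (2*pi*t)" for t :: real
  have pow: "cmod (k z) ^ n \<le> M ^ n / (1 - cmod z)" for n
  proof -
    \<comment> \<open>Only a limsup of \<open>|k|\<close> along radii is controlled. The maximum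
      with \<open>M ^ n\<close> gives an integrand that converges almost everywhere, so dominated
      convergence applies.\<close>
    define S where "S i t = max (cmod (k (of_real (\<rho> i) * e t)) ^ n) (M ^ n)" for i t
    have inb: "cmod (of_real (\<rho> i) * e t) < 1" for i t
      using \<rho>1(1)[of i] \<rho>0[of i] by (simp add: norm_mult e_def)
    have Sb: "\<bar>S i t\<bar> \<le> K ^ n + M ^ n" for i t
    proof -
      have "cmod (k (of_real (\<rho> i) * e t)) ^ n \<le> K ^ n" by (intro power_mono bd inb) auto
      moreover have "0 \<le> S i t" using M by (simp add: S_def le_max_iff_disj)
      ultimately show ?thesis using K0 M by (auto simp: S_def max_def intro: add_increasing add_increasing2)
    qed
    have kcont: "continuous_on UNIV (\<lambda>t. k (of_real (\<rho> i) * e t))" for i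
      using inb unfolding e_def cis_conv_exp
      by (intro continuous_on_compose2[OF holomorphic_on_imp_continuous_on[OF hol]] continuous_intros) auto
    have Scont: "continuous_on UNIV (S i)" for i
      unfolding S_def by (intro continuous_intros kcont)
    have lim: "AE t in lborel. (\<lambda>i. S i t) \<longlonglongrightarrow> M ^ n"
    proof -
      have "AE t in lborel. \<forall>e>0. eventually (\<lambda>r. cmod (k (of_real r * cis (2*pi*t))) \<le> M + e) (at_left 1)"
        by (rule AE_lborel_scale[OF rad]) auto
      then show ?thesis
      proof eventually_elim
        case (elim t)
        show ?case
        proof (rule LIMSEQ_I)
          fix \<epsilon> :: real assume \<epsilon>: "0 < \<epsilon>"
          have "((\<lambda>d. (M + d) ^ n) \<longlongrightarrow> (M + 0) ^ n) (at_right 0)" by (intro tendsto_intros)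
          then have "eventually (\<lambda>d. (M + d) ^ n < M ^ n + \<epsilon>) (at_right 0)"
            using \<epsilon> by (intro order_tendstoD(2)) auto
          then obtain b where b: "b > 0" "\<And>d. 0 < d \<Longrightarrow> d < b \<Longrightarrow> (M + d) ^ n < M ^ n + \<epsilon>"
            by (auto simp: eventually_at_right_field)
          define d where "d = b / 2"
          have d: "d > 0" "(M + d) ^ n < M ^ n + \<epsilon>" using b(1) b(2)[of d] by (auto simp: d_def)
          have "eventually (\<lambda>i. cmod (k (of_real (\<rho> i) * cis (2*pi*t))) \<le> M + d) sequentially"
            using elim d(1) flim by (auto simp: filterlim_iff)
          then obtain i0 where i0: "\<And>i. i \<ge> i0 \<Longrightarrow> cmod (k (of_real (\<rho> i) * cis (2*pi*t))) \<le> M + d"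
            by (auto simp: eventually_sequentially)
          have "norm (S i t - M ^ n) < \<epsilon>" if "i \<ge> i0" for i
          proof -
            have "cmod (k (of_real (\<rho> i) * e t)) ^ n \<le> (M + d) ^ n"
              unfolding e_def by (intro power_mono i0 that) auto
            then show ?thesis using d \<epsilon> by (auto simp: S_def max_def)
          qed
          then show "\<exists>no. \<forall>i\<ge>no. norm (S i t - M ^ n) < \<epsilon>" by blast
        qed
      qed
    qed
    have conv: "(\<lambda>i. \<integral>t. indicator {0..1} t * S i t \<partial>lborel) \<longlonglongrightarrow> (\<integral>t. indicator {0..1::real} t * M ^ n \<partial>lborel)"
    proof (rule integral_dominated_convergence[where w = "\<lambda>t. indicator {0..1::real} t * (K ^ n + M ^ n)"])
      show "AE t in lborel. (\<lambda>i. indicator {0..1} t * S i t) \<longlonglongrightarrow> indicator {0..1} t * M ^ n"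
        using lim by eventually_elim (intro tendsto_intros)
      show "(\<lambda>t. indicator {0..1} t * S i t) \<in> borel_measurable lborel" for i
        using borel_measurable_continuous_onI[OF Scont[of i]] by (intro borel_measurable_times) auto
      show "AE x in lborel. norm (indicator {0..1} x * S i x) \<le> indicator {0..1} x * (K ^ n + M ^ n)" for i
        using Sb by (auto simp: indicator_def)
    qed (auto intro!: integrable_mult_left)
    have eq: "(\<integral>t. indicator {0..1} t * S i t \<partial>lborel) = integral {0..1} (S i)" for i
    proof -
      have "set_integrable lborel {0..1} (S i)"
        by (intro borel_integrable_atLeastAtMost' continuous_on_subset[OF Scont]) auto
      from set_borel_integral_eq_integral(2)[OF this]
      show ?thesis by (simp add: set_lebesgue_integral_def)
    qed
    have le: "(\<rho> i - cmod z) * cmod (k z) ^ n \<le> integral {0..1} (S i)" for i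
    proof -
      have "(\<lambda>z. k z ^ n) holomorphic_on cball 0 (\<rho> i)"
        using \<rho>1(1)[of i] by (intro holomorphic_intros holomorphic_on_subset[OF hol]) auto
      from cauchy_circle_has_integral[OF this \<rho>1(2)[of i]]
      have I: "((\<lambda>t. k (of_real (\<rho> i) * e t) ^ n * (of_real (\<rho> i) * e t) / (of_real (\<rho> i) * e t - z)) has_integral k z ^ n) {0..1}"
        by (simp add: e_def)
      have "S i integrable_on {0..1}"
        by (intro integrable_continuous_real continuous_on_subset[OF Scont]) auto
      then have J: "((\<lambda>t. S i t / (\<rho> i - cmod z)) has_integral (integral {0..1} (S i) / (\<rho> i - cmod z))) {0..1}"
        by (intro has_integral_divide integrable_integral)
      have "norm (k z ^ n) \<le> integral {0..1} (S i) / (\<rho> i - cmod z)"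
      proof (rule has_integral_norm_le[OF I J])
        fix t :: real
        have n: "cmod (of_real (\<rho> i) * e t) = \<rho> i" using \<rho>0[of i] by (simp add: norm_mult e_def)
        have d: "\<rho> i - cmod z \<le> cmod (of_real (\<rho> i) * e t - z)"
          using norm_triangle_ineq2[of "of_real (\<rho> i) * e t" z] n by simp
        have "cmod (k (of_real (\<rho> i) * e t) ^ n * (of_real (\<rho> i) * e t) / (of_real (\<rho> i) * e t - z))
            = cmod (k (of_real (\<rho> i) * e t)) ^ n * \<rho> i / cmod (of_real (\<rho> i) * e t - z)"
          using \<rho>0[of i] by (simp add: norm_mult norm_divide norm_power e_def)
        also have "\<dots> \<le> S i t * 1 / (\<rho> i - cmod z)"
          using d \<rho>1[of i] \<rho>0[of i] unfolding S_def by (intro frac_le mult_mono) (auto simp: le_max_iff_disj)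
        finally show "cmod (k (of_real (\<rho> i) * e t) ^ n * (of_real (\<rho> i) * e t) / (of_real (\<rho> i) * e t - z))
           \<le> S i t / (\<rho> i - cmod z)" by simp
      qed
      then show ?thesis using \<rho>1(2)[of i] by (simp add: norm_power field_simps)
    qed
    have "(\<lambda>i. (\<rho> i - cmod z) * cmod (k z) ^ n) \<longlonglongrightarrow> (1 - cmod z) * cmod (k z) ^ n"
      by (intro tendsto_intros \<rho>lim)
    moreover have "(\<lambda>i. integral {0..1} (S i)) \<longlonglongrightarrow> M ^ n"
      using conv unfolding eq by simp
    ultimately have "(1 - cmod z) * cmod (k z) ^ n \<le> M ^ n"
      by (rule LIMSEQ_le) (use le in auto)
    then show ?thesis using z by (simp add: field_simps)
  qed
  show ?thesis
  proof (rule ccontr)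
    assume "\<not> ?thesis"
    then have q: "1 < cmod (k z) / M" using M by simp
    obtain n where n: "1 / (1 - cmod z) < (cmod (k z) / M) ^ n" using real_arch_pow[OF q] by blast
    have "(cmod (k z) / M) ^ n \<le> 1 / (1 - cmod z)"
      using pow[of n] M z by (simp add: power_divide field_simps)
    with n show False by simp
  qed
qed

lemma HinfD:
  assumes "f \<in> Hinf"
  shows "f holomorphic_on ball 0 1" "\<exists>K>0. \<forall>z. cmod z < 1 \<longrightarrow> cmod (f z) \<le> K"
  using assms unfolding Hinf_def bounded_pos by auto

lemma HinfI:
  assumes "f holomorphic_on ball 0 1" "\<And>z. cmod z < 1 \<Longrightarrow> cmod (f z) \<le> K"
  shows "f \<in> Hinf"
  using assms unfolding Hinf_def by (auto intro!: boundedI)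

lemma inner_AE:
  assumes "inner_function \<Theta>"
  shows "AE t in lborel. ((\<lambda>r. cmod (\<Theta> (of_real r * cis t))) \<longlongrightarrow> 1) (at_left 1)"
proof -
  have "AE t in lborel. \<exists>L. cmod L = 1 \<and> ((\<lambda>r. \<Theta> (of_real r * cis t)) \<longlongrightarrow> L) (at_left 1)"
    using assms by (simp add: inner_function_def)
  then show ?thesis by eventually_elim (metis tendsto_norm)
qed

lemma inner_radial_limit:
  assumes "inner_function \<Theta>"
  obtains t where "((\<lambda>r. cmod (\<Theta> (of_real r * cis t))) \<longlongrightarrow> 1) (at_left 1)"
proof -
  have "\<exists>t. ((\<lambda>r. cmod (\<Theta> (of_real r * cis t))) \<longlongrightarrow> 1) (at_left 1)"
  proof (rule ccontr)
    assume "\<not> ?thesis"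
    then have "AE t in (lborel :: real measure). False" using inner_AE[OF assms] by simp
    then show False by (simp add: trivial_limit_def[symmetric] ae_filter_eq_bot_iff)
  qed
  with that show thesis by blast
qed

text \<open>Division by an inner function does not increase the norm: on almost every radius
  \<open>|\<Theta>|\<close> tends to 1, so \<open>M\<close> also bounds the radial limsup of
  \<open>|k|\<close>.\<close>

lemma inner_division:
  assumes \<Theta>: "inner_function \<Theta>" and k: "k \<in> Hinf" and M: "0 < M"
    and le: "\<And>z. cmod z < 1 \<Longrightarrow> cmod (\<Theta> z * k z) \<le> M" and z: "cmod z < 1"
  shows "cmod (k z) \<le> M"
proof -
  obtain K where K: "\<And>z. cmod z < 1 \<Longrightarrow> cmod (k z) \<le> K" using HinfD(2)[OF k] by blast
  show ?thesis
  proof (rule bounded_by_radial_limsup[OF HinfD(1)[OF k] K M _ z])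
    show "AE t in lborel. \<forall>e>0. eventually (\<lambda>r. cmod (k (of_real r * cis t)) \<le> M + e) (at_left 1)"
      using inner_AE[OF \<Theta>]
    proof eventually_elim
      case (elim t)
      show ?case
      proof (intro allI impI)
        fix e :: real assume e: "0 < e"
        have "eventually (\<lambda>r. M / (M + e) < cmod (\<Theta> (of_real r * cis t))) (at_left 1)"
          using e M by (intro order_tendstoD(1)[OF elim]) auto
        moreover have "eventually (\<lambda>r. r \<in> {0<..<1}) (at_left (1::real))"
          by (rule eventually_at_leftI[of 0]) auto
        ultimately show "eventually (\<lambda>r. cmod (k (of_real r * cis t)) \<le> M + e) (at_left 1)"
        proof eventually_elim
          case (elim r)
          let ?w = "of_real r * cis t"
          have "cmod ?w < 1" using elim by (simp add: norm_mult)
          then have "cmod (\<Theta> ?w) * cmod (k ?w) \<le> M" using le[of ?w] by (simp add: norm_mult)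
          moreover have "M / (M + e) * cmod (k ?w) \<le> cmod (\<Theta> ?w) * cmod (k ?w)"
            using elim by (intro mult_right_mono) auto
          ultimately have "M / (M + e) * cmod (k ?w) \<le> M" by linarith
          then have "M * cmod (k ?w) \<le> M * (M + e)" using M e by (simp add: field_simps)
          then show ?case using M by simp
        qed
      qed
    qed
  qed
qed

lemma inner_le_1:
  assumes "inner_function \<Theta>" "cmod z < 1"
  shows "cmod (\<Theta> z) \<le> 1"
proof -
  have T: "\<Theta> \<in> Hinf" using assms by (simp add: inner_function_def)
  obtain K where K: "\<And>z. cmod z < 1 \<Longrightarrow> cmod (\<Theta> z) \<le> K" using HinfD(2)[OF T] by blast
  show ?thesis
  proof (rule bounded_by_radial_limsup[OF HinfD(1)[OF T] K _ _ assms(2)])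
    show "AE t in lborel. \<forall>e>0. eventually (\<lambda>r. cmod (\<Theta> (of_real r * cis t)) \<le> 1 + e) (at_left 1)"
      using inner_AE[OF assms(1)]
    proof eventually_elim
      case (elim t)
      show ?case
      proof (intro allI impI)
        fix e :: real assume "0 < e"
        then have "eventually (\<lambda>r. cmod (\<Theta> (of_real r * cis t)) < 1 + e) (at_left 1)"
          by (intro order_tendstoD(2)[OF elim]) auto
        then show "eventually (\<lambda>r. cmod (\<Theta> (of_real r * cis t)) \<le> 1 + e) (at_left 1)"
          by eventually_elim simp
      qed
    qed
  qed auto
qed

section \<open>Carleson--Newman Blaschke products\<close>

lemma abs_le_2_abs_sin:
  assumes "\<bar>x\<bar> \<le> pi / 2"
  shows "\<bar>x\<bar> \<le> 2 * \<bar>sin x\<bar>"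
proof -
  have *: "x \<le> 2 * sin x" if x: "0 \<le> x" "x \<le> pi / 2" for x :: real
  proof (cases "x \<le> pi / 3")
    case True
    have "0 - 2 * sin 0 \<ge> x - 2 * sin x"
    proof (rule DERIV_nonpos_imp_nonincreasing[of 0 x "\<lambda>x. x - 2 * sin x"])
      fix u assume u: "0 \<le> u" "u \<le> x"
      have "cos (pi / 3) \<le> cos u" using u True by (intro cos_monotone_0_pi_le) auto
      then have "1 - 2 * cos u \<le> 0" by (simp add: cos_60)
      moreover have "((\<lambda>x. x - 2 * sin x) has_real_derivative (1 - 2 * cos u)) (at u)"
        by (auto intro!: derivative_eq_intros)
      ultimately show "\<exists>y. ((\<lambda>x. x - 2 * sin x) has_real_derivative y) (at u) \<and> y \<le> 0" by blast
    qed (use x in auto)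
    then show ?thesis by simp
  next
    case False
    have "sin (pi / 3) \<le> sin x" using False x by (intro sin_monotone_2pi_le) auto
    then have "sqrt 3 \<le> 2 * sin x" by (simp add: sin_60)
    moreover have "1.7 \<le> sqrt 3" by (rule real_le_rsqrt) (simp add: power2_eq_square)
    moreover have "pi / 2 \<le> 1.6" using pi_approx by simp
    ultimately show ?thesis using x by linarith
  qed
  show ?thesis
  proof (cases "0 \<le> x")
    case True
    then show ?thesis using *[of x] assms by auto
  next
    case False
    then show ?thesis using *[of "-x"] assms by auto
  qed
qed

lemma norm_1_minus_scaled_ge:
  assumes "cmod u = 1" "0 \<le> s" "s \<le> 1"
  shows "cmod (1 - u) \<le> 2 * cmod (1 - of_real s * u)"
proof -
  have "1 - u = (1 - of_real s * u) - of_real (1 - s) * u" by (simp add: algebra_simps)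
  then have "cmod (1 - u) \<le> cmod (1 - of_real s * u) + cmod (of_real (1 - s) * u)"
    by (metis norm_triangle_ineq4)
  also have "cmod (of_real (1 - s) * u) = 1 - s" using assms by (simp add: norm_mult del: of_real_diff)
  also have "1 - s \<le> cmod (1 - of_real s * u)"
    using norm_triangle_ineq2[of 1 "of_real s * u"] assms by (simp add: norm_mult)
  finally show ?thesis by simp
qed

lemma norm_1_minus_cis: "cmod (1 - cis \<psi>) = 2 * \<bar>sin (\<psi> / 2)\<bar>"
proof -
  have "(cmod (1 - cis \<psi>))\<^sup>2 = 2 - 2 * cos \<psi>"
    unfolding cmod_power2 using sin_cos_squared_add[of \<psi>] by (simp add: power2_eq_square algebra_simps)
  also have "cos \<psi> = 1 - 2 * (sin (\<psi> / 2))\<^sup>2"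
    using cos_double_sin[of "\<psi> / 2"] by simp
  finally have "(cmod (1 - cis \<psi>))\<^sup>2 = (2 * \<bar>sin (\<psi> / 2)\<bar>)\<^sup>2"
    by (simp add: power2_eq_square algebra_simps)
  then show ?thesis by (rule power2_eq_imp_eq) auto
qed

lemma dist_cis_ge:
  assumes "\<bar>\<psi>\<bar> \<le> pi" "0 \<le> s" "s \<le> 1"
  shows "\<bar>\<psi>\<bar> \<le> 4 * cmod (1 - of_real s * cis \<psi>)"
proof -
  have "\<bar>\<psi> / 2\<bar> \<le> 2 * \<bar>sin (\<psi> / 2)\<bar>" using assms by (intro abs_le_2_abs_sin) auto
  then have "\<bar>\<psi>\<bar> \<le> 2 * cmod (1 - cis \<psi>)" by (simp add: norm_1_minus_cis)
  also have "\<dots> \<le> 2 * (2 * cmod (1 - of_real s * cis \<psi>))"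
    using assms by (intro mult_left_mono norm_1_minus_scaled_ge) auto
  finally show ?thesis by simp
qed

lemma zeros_measure_ge:
  assumes F: "finite F" "F \<subseteq> J" and a: "\<And>j. j \<in> F \<Longrightarrow> a j \<in> W \<and> cmod (a j) < 1"
  shows "ennreal (\<Sum>j\<in>F. 1 - cmod (a j)) \<le> emeasure (zeros_measure J a) W"
proof -
  let ?w = "\<lambda>j. ennreal (1 - cmod (a j))"
  have "ennreal (\<Sum>j\<in>F. 1 - cmod (a j)) = (\<Sum>j\<in>F. ?w j)"
    using a by (subst sum_ennreal) (auto simp: less_imp_le)
  also have "\<dots> = emeasure (point_measure J ?w) F"
    using F by (simp add: emeasure_point_measure_finite2)
  also have "\<dots> \<le> emeasure (point_measure J ?w) (a -` W \<inter> J)"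
    using F a by (intro emeasure_mono) (auto simp: sets_point_measure)
  also have "\<dots> = emeasure (zeros_measure J a) W"
    unfolding zeros_measure_def
    by (subst emeasure_distr) (auto simp: space_point_measure measurable_def sets_point_measure)
  finally show ?thesis .
qed

text \<open>\<open>1 - (rho z a)^2\<close> is at most a constant times
  \<open>(1 - |z|) * (1 - |a|) / |1 - cnj a * z|^2\<close>. Zeros are grouped by the dyadic size of
  the last distance; a window of that size has mass proportional to it, which leaves a geometric
  sum.\<close>

lemma carleson_measure_poisson_sum:
  assumes cm: "carleson_measure (zeros_measure J a)" and a: "\<And>j. j \<in> J \<Longrightarrow> cmod (a j) < 1"
    and sm: "(\<lambda>j. 1 - cmod (a j)) summable_on J"
  obtains C where "0 \<le> C" "\<And>z F. cmod z < 1 \<Longrightarrow> finite F \<Longrightarrow> F \<subseteq> J \<Longrightarrow> (\<Sum>j\<in>F. 1 - (rho z (a j))\<^sup>2) \<le> C"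
proof -
  obtain C0 where C0: "C0 > 0" and
    C: "\<And>\<alpha> \<beta>. \<alpha> < \<beta> \<Longrightarrow> \<beta> \<le> \<alpha> + 2*pi \<Longrightarrow> emeasure (zeros_measure J a) (carleson_window \<alpha> \<beta>) \<le> ennreal (C0 * (\<beta> - \<alpha>))"
    using cm unfolding carleson_measure_def by blast
  define S where "S = (\<Sum>\<^sub>\<infinity>j\<in>J. 1 - cmod (a j))"
  have S: "(\<Sum>j\<in>F. 1 - cmod (a j)) \<le> S" if "finite F" "F \<subseteq> J" for F
    unfolding S_def using that a sm by (intro finite_sum_le_infsum) (auto simp: less_imp_le)
  have S0: "0 \<le> S" using S[of "{}"] by simp
  have win: "(\<Sum>j\<in>F. 1 - cmod (a j)) \<le> C0 * (2 * D)"
    if F: "finite F" "F \<subseteq> J" "\<And>j. j \<in> F \<Longrightarrow> a j \<in> carleson_window (\<theta> - D) (\<theta> + D)" and D: "0 < D" "D \<le> pi" for F \<theta> D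
  proof -
    have "ennreal (\<Sum>j\<in>F. 1 - cmod (a j)) \<le> emeasure (zeros_measure J a) (carleson_window (\<theta> - D) (\<theta> + D))"
      using F a by (intro zeros_measure_ge) auto
    also have "\<dots> \<le> ennreal (C0 * ((\<theta> + D) - (\<theta> - D)))"
      using D by (intro C) auto
    finally show ?thesis using C0 D by (subst (asm) ennreal_le_iff) auto
  qed
  have main: "(\<Sum>j\<in>F. 1 - (rho z (a j))\<^sup>2) \<le> 2000 * C0"
    if z: "cmod z < 1" and F: "finite F" "F \<subseteq> J" and nz: "\<And>j. j \<in> F \<Longrightarrow> a j \<noteq> 0" for z F
  proof -
    define r \<theta> where "r = cmod z" and "\<theta> = Arg z"
    have r: "0 \<le> r" "r < 1" using z by (auto simp: r_def)
    have zc: "z = of_real r * cis \<theta>" unfolding r_def \<theta>_def by (metis rcis_cmod_Arg rcis_def)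
    have "\<exists>D. (1 - r) \<le> D \<and> 0 < D \<and> D \<le> pi \<and> a j \<in> carleson_window (\<theta> - D) (\<theta> + D) \<and> D \<le> 4 * cmod (1 - cnj (a j) * z)"
      if j: "j \<in> F" for j
    proof -
      define s where "s = cmod (a j)"
      have s: "0 < s" "s < 1" using j nz F a by (auto simp: s_def)
      define \<psi> where "\<psi> = Arg (a j / cis \<theta>)"
      have \<psi>: "\<bar>\<psi>\<bar> \<le> pi" using Arg_bounded[of "a j / cis \<theta>"] by (auto simp: \<psi>_def abs_le_iff)
      have ac: "a j = of_real s * cis (\<theta> + \<psi>)"
      proof -
        have "a j / cis \<theta> = of_real (cmod (a j / cis \<theta>)) * cis \<psi>"
          unfolding \<psi>_def by (metis rcis_cmod_Arg rcis_def)
        then have "a j = of_real s * cis \<psi> * cis \<theta>" by (simp add: s_def norm_divide field_simps)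
        then show ?thesis by (simp add: cis_mult mult_ac add.commute)
      qed
      \<comment> \<open>Half-width of a window around the angle of \<open>z\<close> that holds
        \<open>a j\<close>. All three terms are at most \<open>4 * |1 - cnj (a j) * z|\<close>, and
        \<open>D \<ge> 1 - r\<close> limits the dyadic scales that occur.\<close>
      define D where "D = max (max (1 - r) (1 - s)) \<bar>\<psi>\<bar>"
      have e: "cnj (a j) * z = of_real (s * r) * cis (- \<psi>)"
      proof -
        have "cnj (a j) * z = of_real (s * r) * (cis (-(\<theta> + \<psi>)) * cis \<theta>)"
          by (subst ac, subst zc) (simp add: cis_cnj mult_ac)
        then show ?thesis by (simp add: cis_mult)
      qed
      have sr: "s * r \<le> s" "s * r \<le> r" "0 \<le> s * r"
        using s r by (auto simp: mult_left_le mult_left_le_one_le)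
      have "\<bar>- \<psi>\<bar> \<le> 4 * cmod (1 - of_real (s * r) * cis (- \<psi>))"
        using \<psi> sr s r by (intro dist_cis_ge) auto
      then have d1: "\<bar>\<psi>\<bar> \<le> 4 * cmod (1 - cnj (a j) * z)" using e by simp
      have "1 - s * r \<le> cmod (1 - cnj (a j) * z)"
        using norm_triangle_ineq2[of 1 "cnj (a j) * z"] e sr by (simp add: norm_mult)
      then have d2: "1 - r \<le> 4 * cmod (1 - cnj (a j) * z)" "1 - s \<le> 4 * cmod (1 - cnj (a j) * z)"
        using sr norm_ge_zero[of "1 - cnj (a j) * z"] by linarith+
      have D4: "D \<le> 4 * cmod (1 - cnj (a j) * z)" using d1 d2 by (simp add: D_def)
      have "1 \<le> pi" using pi_gt3 by simp
      then have Dpi: "D \<le> pi" using \<psi> r s by (simp add: D_def)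
      have "a j / of_real (cmod (a j)) = cis (\<theta> + \<psi>)"
        using s by (subst ac, fold s_def) simp
      moreover have "\<theta> + \<psi> \<in> {\<theta> - D..\<theta> + D}" by (auto simp: D_def)
      moreover have "1 - s \<le> (\<theta> + D) - (\<theta> - D)"
      proof -
        have "1 - s \<le> D" "1 - r \<le> D" by (auto simp: D_def)
        then show ?thesis using r by linarith
      qed
      ultimately have "a j \<in> carleson_window (\<theta> - D) (\<theta> + D)"
        using s unfolding carleson_window_def s_def by auto
      moreover have "0 < D" "1 - r \<le> D" using r by (auto simp: D_def)
      ultimately show ?thesis using D4 Dpi by blast
    qed
    then obtain D where D: "\<And>j. j \<in> F \<Longrightarrow> (1 - r) \<le> D j \<and> 0 < D j \<and> D j \<le> pi \<and>
        a j \<in> carleson_window (\<theta> - D j) (\<theta> + D j) \<and> D j \<le> 4 * cmod (1 - cnj (a j) * z)" by metis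
    \<comment> \<open>Rounds \<open>D j\<close> up to a dyadic scale; scale 0 is \<open>pi\<close>,
      the half-width of the full circle.\<close>
    have "\<exists>k. D j \<le> pi / 2 ^ k \<and> pi / 2 ^ k < 2 * D j" if j: "j \<in> F" for j
    proof -
      have "\<exists>k. pi / 2 ^ k < 2 * D j"
      proof -
        obtain k where "pi / (2 * D j) < 2 ^ k" using real_arch_pow[of 2 "pi / (2 * D j)"] by auto
        then show ?thesis using D[OF j] by (auto simp: field_simps intro!: exI[of _ k])
      qed
      define k where "k = (LEAST k. pi / 2 ^ k < 2 * D j)"
      have k: "pi / 2 ^ k < 2 * D j" unfolding k_def by (rule LeastI_ex) fact
      have "D j \<le> pi / 2 ^ k"
      proof (cases k)
        case 0
        then show ?thesis using D[OF j] by simp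
      next
        case (Suc k')
        then have "\<not> pi / 2 ^ k' < 2 * D j" using not_less_Least[of k' "\<lambda>k. pi / 2 ^ k < 2 * D j"] by (auto simp: k_def)
        then show ?thesis using Suc by simp
      qed
      with k show ?thesis by blast
    qed
    then obtain \<kappa> where \<kappa>: "\<And>j. j \<in> F \<Longrightarrow> D j \<le> pi / 2 ^ \<kappa> j \<and> pi / 2 ^ \<kappa> j < 2 * D j" by metis
    have term_le: "1 - (rho z (a j))\<^sup>2 \<le> 256 * (1 - r) * (1 - cmod (a j)) / (pi / 2 ^ \<kappa> j)\<^sup>2" if j: "j \<in> F" for j
    proof -
      have aj: "cmod (a j) < 1" using j F a by auto
      let ?d = "cmod (1 - cnj (a j) * z)"
      have nz: "1 - cnj (a j) * z \<noteq> 0" using one_minus_cnj_mult_nonzero[OF aj] z by simp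
      have d: "pi / 2 ^ \<kappa> j \<le> 8 * ?d" using D[OF j] \<kappa>[OF j] by linarith
      have "1 - (rho z (a j))\<^sup>2 = (1 - r\<^sup>2) * (1 - (cmod (a j))\<^sup>2) / ?d\<^sup>2"
        unfolding r_def by (rule one_minus_rho_power2[OF nz])
      also have "\<dots> \<le> (2 * (1 - r)) * (2 * (1 - cmod (a j))) / ((pi / 2 ^ \<kappa> j) / 8)\<^sup>2"
      proof (intro frac_le mult_mono power_mono)
        have "1 - t\<^sup>2 \<le> 2 * (1 - t)" if "0 \<le> t" "t \<le> 1" for t :: real
          using zero_le_power2[of "t - 1"] by (simp add: power2_eq_square algebra_simps)
        then show "1 - r\<^sup>2 \<le> 2 * (1 - r)" "1 - (cmod (a j))\<^sup>2 \<le> 2 * (1 - cmod (a j))"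
          using r aj by auto
      qed (use d r aj in \<open>auto simp: power_le_one\<close>)
      also have "\<dots> = 256 * (1 - r) * (1 - cmod (a j)) / (pi / 2 ^ \<kappa> j)\<^sup>2"
        by (simp add: power_divide algebra_simps)
      finally show ?thesis .
    qed
    show ?thesis
    proof (cases "F = {}")
      case True
      then show ?thesis using C0 by simp
    next
      case False
      \<comment> \<open>The finest scale that occurs. The bound for scale \<open>k\<close> grows
        like \<open>2 ^ k\<close>, so the sum is governed by \<open>2 ^ K\<close>, and
        \<open>1 - r \<le> pi / 2 ^ K\<close> compensates it.\<close>
      define K where "K = Max (\<kappa> ` F)"
      have KF: "\<kappa> j \<le> K" if "j \<in> F" for j using that F by (simp add: K_def)
      have "K \<in> \<kappa> ` F" unfolding K_def using F False by (intro Max_in) auto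
      then obtain j0 where j0: "j0 \<in> F" "\<kappa> j0 = K" by auto
      have rK: "(1 - r) \<le> pi / 2 ^ K" using D[OF j0(1)] \<kappa>[OF j0(1)] j0(2) by auto
      have "(\<Sum>j\<in>F. 1 - (rho z (a j))\<^sup>2) \<le> (\<Sum>j\<in>F. 256 * (1 - r) * (1 - cmod (a j)) / (pi / 2 ^ \<kappa> j)\<^sup>2)"
        by (intro sum_mono term_le)
      also have "\<dots> = (\<Sum>k\<le>K. \<Sum>j\<in>{j\<in>F. \<kappa> j = k}. 256 * (1 - r) * (1 - cmod (a j)) / (pi / 2 ^ \<kappa> j)\<^sup>2)"
        using F KF by (intro sum.group[symmetric]) auto
      also have "\<dots> = (\<Sum>k\<le>K. 256 * (1 - r) / (pi / 2 ^ k)\<^sup>2 * (\<Sum>j\<in>{j\<in>F. \<kappa> j = k}. 1 - cmod (a j)))"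
        by (intro sum.cong refl) (simp add: sum_distrib_left)
      also have "\<dots> \<le> (\<Sum>k\<le>K. 256 * (1 - r) / (pi / 2 ^ k)\<^sup>2 * (C0 * (2 * (pi / 2 ^ k))))"
      proof (intro sum_mono mult_left_mono win[where \<theta> = \<theta>])
        fix k j assume "j \<in> {j \<in> F. \<kappa> j = k}"
        then have j: "j \<in> F" "\<kappa> j = k" by auto
        have w: "a j \<in> carleson_window (\<theta> - D j) (\<theta> + D j)" "D j \<le> pi / 2 ^ k"
          using D[OF j(1)] \<kappa>[OF j(1)] j(2) by auto
        have "cis ` {\<theta> - D j..\<theta> + D j} \<subseteq> cis ` {\<theta> - pi / 2 ^ k..\<theta> + pi / 2 ^ k}"
          using w(2) by (intro image_mono) auto
        then show "a j \<in> carleson_window (\<theta> - pi / 2 ^ k) (\<theta> + pi / 2 ^ k)"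
          using w unfolding carleson_window_def by auto
      qed (use F r in \<open>auto simp: field_simps\<close>)
      also have "\<dots> = (\<Sum>k\<le>K. 512 * C0 * (1 - r) / pi * 2 ^ k)"
        by (intro sum.cong refl) (simp add: power2_eq_square field_simps)
      also have "\<dots> = 512 * C0 * (1 - r) / pi * (2 ^ Suc K - 1)"
        unfolding sum_distrib_left[symmetric]
        using geometric_sum[of "2::real" "Suc K"] by (simp add: lessThan_Suc_atMost)
      also have "\<dots> \<le> 512 * C0 * (1 - r) / pi * (2 ^ Suc K)"
        using C0 r by (intro mult_left_mono) auto
      also have "\<dots> = 1024 * C0 * ((1 - r) / pi * 2 ^ K)" by simp
      also have "\<dots> \<le> 1024 * C0 * 1"
        using C0 rK by (intro mult_left_mono) (auto simp: field_simps)
      finally show ?thesis using C0 by simp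
    qed
  qed
  \<comment> \<open>2000 rounds up the 1024 of the dyadic sum. \<open>S\<close> pays for zeros at
    the origin, which lie in no window but have weight \<open>1 - |a j| = 1\<close>.\<close>
  show thesis
  proof (rule that[of "2000 * C0 + S"])
    fix z F assume z: "cmod z < 1" and F: "finite F" "F \<subseteq> J"
    have "(\<Sum>j\<in>F. 1 - (rho z (a j))\<^sup>2) = (\<Sum>j\<in>{j\<in>F. a j \<noteq> 0}. 1 - (rho z (a j))\<^sup>2) + (\<Sum>j\<in>{j\<in>F. a j = 0}. 1 - (rho z (a j))\<^sup>2)"
      by (subst sum.union_disjoint[symmetric]) (use F in \<open>auto intro!: sum.cong\<close>)
    also have "\<dots> \<le> 2000 * C0 + (\<Sum>j\<in>{j\<in>F. a j = 0}. 1 - cmod (a j))"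
      using F by (intro add_mono main z sum_mono) auto
    also have "(\<Sum>j\<in>{j\<in>F. a j = 0}. 1 - cmod (a j)) \<le> S" using F by (intro S) auto
    finally show "(\<Sum>j\<in>F. 1 - (rho z (a j))\<^sup>2) \<le> 2000 * C0 + S" by simp
  qed (use C0 S0 in auto)
qed


lemma rho_phi_phi:
  assumes a: "cmod a < 1" and u: "cmod u < 1" and v: "cmod v < 1"
  shows "rho (phi a u) (phi a v) = rho u v"
proof -
  have le: "rho (phi a u) (phi a v) \<le> rho u v" if u: "cmod u < 1" and v: "cmod v < 1" for u v
  proof -
    have "cmod (phi a u - phi a v) \<le> rho u v * cmod (1 - cnj (phi a v) * phi a u)"
      using a by (intro schwarz_pick phi_holomorphic u v) (auto intro: less_imp_le phi_in_disc)
    moreover have "1 - cnj (phi a v) * phi a u \<noteq> 0"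
      using a u v by (intro one_minus_cnj_mult_nonzero phi_in_disc less_imp_le)
    ultimately show ?thesis unfolding rho_def[of "phi a u"] by (simp add: norm_divide divide_le_eq)
  qed
  have "rho u v \<le> rho (phi a u) (phi a v)"
    using le[of "phi a u" "phi a v"] a u v by (simp add: phi_in_disc phi_phi)
  with le[OF u v] show ?thesis by simp
qed

lemma norm_blaschke_factor: "cmod (blaschke_factor a z) = rho z a"
  by (simp add: blaschke_factor_def rho_def norm_mult norm_divide norm_minus_commute)

lemma sphere_max_ge_center:
  assumes "G holomorphic_on ball 0 1" "0 < r" "r < 1"
  obtains \<zeta> where "cmod \<zeta> = r" "cmod (G 0) \<le> cmod (G \<zeta>)"
proof -
  have sub: "cball (0::complex) r \<subseteq> ball 0 1" using assms by auto
  have cont: "continuous_on (cball 0 r) G"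
    using holomorphic_on_imp_continuous_on[OF assms(1)] sub by (rule continuous_on_subset)
  have "\<exists>\<zeta>\<in>sphere 0 r. \<forall>y\<in>sphere 0 r. cmod (G y) \<le> cmod (G \<zeta>)"
    using assms(2) by (intro continuous_attains_sup continuous_on_norm continuous_on_subset[OF cont]) auto
  then obtain \<zeta> where z: "\<zeta> \<in> sphere 0 r" "\<And>y. y \<in> sphere 0 r \<Longrightarrow> cmod (G y) \<le> cmod (G \<zeta>)" by blast
  have "cmod (G 0) \<le> cmod (G \<zeta>)"
  proof (rule maximum_modulus_frontier[of G "cball 0 r"])
    show "G holomorphic_on interior (cball 0 r)"
      using assms sub by (intro holomorphic_on_subset[OF assms(1)]) auto
  qed (use cont z assms in auto)
  with z that show thesis by simp
qed

text \<open>Zeros within distance 1/2 of \<open>z\<close> are boundedly many and stay at distance at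
  least 1/8 from the pseudohyperbolic circle of radius 3/4. The product over the other zeros is
  bounded below at \<open>z\<close>, hence, by the maximum principle, at some point of that
  circle.\<close>

lemma blaschke_lower_bound:
  assumes B: "blaschke_product J a B" and C: "0 \<le> C"
    and sum: "\<And>z F. cmod z < 1 \<Longrightarrow> finite F \<Longrightarrow> F \<subseteq> J \<Longrightarrow> (\<Sum>j\<in>F. 1 - (rho z (a j))\<^sup>2) \<le> C"
  obtains c where "0 < c" "\<And>z. cmod z < 1 \<Longrightarrow> \<exists>\<zeta>. cmod \<zeta> = 3/4 \<and> c \<le> cmod (B (phi z \<zeta>))"
proof -
  have a: "cmod (a j) < 1" if "j \<in> J" for j using B that by (auto simp: blaschke_product_def)
  define Jn where "Jn n = {j\<in>J. j < n}" for n
  have fin: "finite (Jn n)" "Jn n \<subseteq> J" for n by (auto simp: Jn_def)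
  define P where "P n w = (\<Prod>j\<in>Jn n. rho w (a j))" for n w
  have Plim: "(\<lambda>n. P n w) \<longlonglongrightarrow> cmod (B w)" if w: "cmod w < 1" for w
  proof -
    have "(\<lambda>j. if j \<in> J then blaschke_factor (a j) w else 1) has_prod B w"
      using B w by (auto simp: blaschke_product_def)
    then have "(\<lambda>n. cmod (\<Prod>k<n. if k \<in> J then blaschke_factor (a k) w else 1)) \<longlonglongrightarrow> cmod (B w)"
      by (intro tendsto_norm has_prod_imp_tendsto')
    moreover have "cmod (\<Prod>k<n. if k \<in> J then blaschke_factor (a k) w else 1) = P n w" for n
    proof -
      have "(\<Prod>k<n. if k \<in> J then blaschke_factor (a k) w else 1) = (\<Prod>k\<in>Jn n. blaschke_factor (a k) w)"
        unfolding Jn_def by (subst prod.inter_filter[symmetric]) (auto intro!: prod.cong)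
      then show ?thesis by (simp add: P_def norm_blaschke_factor flip: prod_norm)
    qed
    ultimately show ?thesis by simp
  qed
  obtain m where m: "C < real m" using reals_Archimedean2 by blast
  \<comment> \<open>At most \<open>2 * m\<close> near factors occur, each zero adding 3/4 to a sum
    below \<open>m\<close>; they are at least 1/8. The exponential comes from
    \<open>x \<ge> exp (- 2 * (1 - x^2))\<close> for \<open>1/2 < x < 1\<close>, applied to the far
    factors.\<close>
  define c where "c = (1/8)^(2*m) * exp (- (2 * C))"
  have c0: "0 < c" by (simp add: c_def)
  have fin_bound: "\<exists>\<zeta>. cmod \<zeta> = 3/4 \<and> c \<le> P n (phi z \<zeta>)" if z: "cmod z < 1" for z n
  proof -
    define near far where "near = {j\<in>Jn n. rho z (a j) \<le> 1/2}" and "far = {j\<in>Jn n. \<not> rho z (a j) \<le> 1/2}"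
    have nf: "finite near" "finite far" "near \<subseteq> J" "far \<subseteq> J" "near \<inter> far = {}" "near \<union> far = Jn n"
      using fin[of n] by (auto simp: near_def far_def)
    have "(\<Sum>j\<in>near. 3/4) \<le> (\<Sum>j\<in>near. 1 - (rho z (a j))\<^sup>2)"
    proof (intro sum_mono)
      fix j assume "j \<in> near"
      then have "(rho z (a j))\<^sup>2 \<le> (1/2)\<^sup>2" by (intro power_mono) (auto simp: near_def rho_nonneg)
      then show "3/4 \<le> 1 - (rho z (a j))\<^sup>2" by (simp add: power2_eq_square)
    qed
    also have "\<dots> \<le> C" by (intro sum z nf)
    finally have "real (card near) \<le> 2 * real m" using m by simp
    then have card: "card near \<le> 2 * m" by linarith
    define G where "G \<zeta> = (\<Prod>j\<in>far. phi (a j) (phi z \<zeta>))" for \<zeta>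
    have "G holomorphic_on ball 0 1"
      unfolding G_def
    proof (intro holomorphic_on_prod)
      fix j assume "j \<in> far"
      then have "cmod (a j) < 1" using nf a by auto
      then show "(\<lambda>\<zeta>. phi (a j) (phi z \<zeta>)) holomorphic_on ball 0 1"
        using z by (intro holomorphic_on_compose_gen[OF phi_holomorphic phi_holomorphic, unfolded o_def])
          (auto intro: phi_in_disc)
    qed
    from sphere_max_ge_center[OF this, of "3/4"] obtain \<zeta> where \<zeta>: "cmod \<zeta> = 3/4" "cmod (G 0) \<le> cmod (G \<zeta>)"
      by auto
    have G0: "exp (- (2 * C)) \<le> cmod (G 0)"
    proof -
      have "exp (- (2 * C)) \<le> exp (\<Sum>j\<in>far. - (2 * (1 - (rho z (a j))\<^sup>2)))"
        using sum[OF z nf(2,4)] by (simp only: sum_negf sum_distrib_left[symmetric]) simp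
      also have "\<dots> = (\<Prod>j\<in>far. exp (- (2 * (1 - (rho z (a j))\<^sup>2))))"
        by (rule exp_sum[OF nf(2)])
      also have "\<dots> \<le> (\<Prod>j\<in>far. rho z (a j))"
      proof (intro prod_mono conjI)
        fix j assume j: "j \<in> far"
        define x where "x = rho z (a j)"
        have x: "1/2 < x" "x < 1" using j z a nf by (auto simp: far_def x_def intro!: rho_less_1)
        have "1 / x\<^sup>2 \<le> exp (1 / x\<^sup>2 - 1)" using exp_ge_add_one_self[of "1 / x\<^sup>2 - 1"] by simp
        also have "1 / x\<^sup>2 - 1 \<le> 4 * (1 - x\<^sup>2)"
        proof -
          have "1 / 4 \<le> x\<^sup>2" using power_mono[of "1/2" x 2] x by (simp add: power2_eq_square)
          moreover have "0 \<le> 1 - x\<^sup>2" using x by (simp add: power_le_one)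
          ultimately have "1 * (1 - x\<^sup>2) \<le> (4 * x\<^sup>2) * (1 - x\<^sup>2)" by (intro mult_right_mono) auto
          then show ?thesis using x by (simp add: field_simps)
        qed
        finally have "1 / x\<^sup>2 \<le> exp (2 * (1 - x\<^sup>2)) ^ 2" by (simp flip: exp_double)
        then have "(1 / x)\<^sup>2 \<le> (exp (2 * (1 - x\<^sup>2)))\<^sup>2" by (simp add: power_divide)
        then have "1 / x \<le> exp (2 * (1 - x\<^sup>2))" by (rule power2_le_imp_le) simp
        moreover have "inverse E \<le> x" if "1 / x \<le> E" "0 < E" for E
          using that x by (simp add: field_simps)
        ultimately have "inverse (exp (2 * (1 - x\<^sup>2))) \<le> x" using exp_gt_zero by blast
        then show "exp (- (2 * (1 - (rho z (a j))\<^sup>2))) \<le> rho z (a j)"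
          unfolding exp_minus x_def[symmetric] .
      qed auto
      also have "\<dots> = cmod (G 0)" by (simp add: G_def norm_phi flip: prod_norm)
      finally show ?thesis .
    qed
    have \<zeta>1: "cmod \<zeta> < 1" using \<zeta> by simp
    have near1: "1/8 \<le> rho (phi z \<zeta>) (a j)" if j: "j \<in> near" for j
    proof -
      have aj: "cmod (a j) < 1" using j nf a by auto
      define \<alpha> where "\<alpha> = phi z (a j)"
      have al: "cmod \<alpha> \<le> 1/2" using j by (simp add: \<alpha>_def norm_phi near_def rho_commute)
      have "rho (phi z \<zeta>) (a j) = rho \<zeta> \<alpha>"
        using rho_phi_phi[OF z \<zeta>1, of \<alpha>] phi_phi[OF z aj] al by (simp add: \<alpha>_def)
      also have "rho \<zeta> \<alpha> \<ge> (1/4) / 2"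
      proof -
        have "1/4 \<le> cmod (\<zeta> - \<alpha>)" using norm_triangle_ineq2[of \<zeta> \<alpha>] \<zeta> al by simp
        moreover have "cmod (1 - cnj \<alpha> * \<zeta>) \<le> 1 + (1/2) * (3/4)"
          using norm_triangle_ineq4[of 1 "cnj \<alpha> * \<zeta>"] \<zeta> al by (simp add: norm_mult)
        moreover have "1 - cnj \<alpha> * \<zeta> \<noteq> 0" using al \<zeta>1 by (intro one_minus_cnj_mult_nonzero) auto
        ultimately show ?thesis unfolding rho_def norm_divide by (intro frac_le) auto
      qed
      finally show ?thesis by simp
    qed
    have "(1/8)^(2*m) \<le> (1/8::real)^card near" by (intro power_decreasing card) auto
    also have "\<dots> = (\<Prod>j\<in>near. 1/8)" by simp
    also have "\<dots> \<le> (\<Prod>j\<in>near. rho (phi z \<zeta>) (a j))" by (intro prod_mono) (use near1 in auto)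
    finally have n1: "(1/8)^(2*m) \<le> (\<Prod>j\<in>near. rho (phi z \<zeta>) (a j))" .
    have "c \<le> (\<Prod>j\<in>near. rho (phi z \<zeta>) (a j)) * (\<Prod>j\<in>far. rho (phi z \<zeta>) (a j))"
      unfolding c_def
    proof (intro mult_mono n1)
      show "exp (- (2 * C)) \<le> (\<Prod>j\<in>far. rho (phi z \<zeta>) (a j))"
        using G0 \<zeta>(2) by (simp add: G_def norm_phi flip: prod_norm)
    qed (auto intro!: prod_nonneg simp: rho_nonneg)
    also have "\<dots> = P n (phi z \<zeta>)"
      unfolding P_def using nf by (simp add: prod.union_disjoint[symmetric])
    finally show ?thesis using \<zeta> by blast
  qed
  have "\<exists>\<zeta>. cmod \<zeta> = 3/4 \<and> c \<le> cmod (B (phi z \<zeta>))" if z: "cmod z < 1" for z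
  proof -
    \<comment> \<open>So far the point depends on the partial product. The sets \<open>K n\<close>
      are compact and decreasing, as further factors have modulus at most 1, so one point serves all
      \<open>n\<close>.\<close>
    define K where "K n = {\<zeta>\<in>sphere 0 (3/4). c \<le> P n (phi z \<zeta>)}" for n
    have Pc: "continuous_on (sphere 0 (3/4)) (\<lambda>\<zeta>. P n (phi z \<zeta>))" for n
    proof -
      have ph: "continuous_on (sphere 0 (3/4)) (phi z)"
        by (rule continuous_on_subset[OF holomorphic_on_imp_continuous_on[OF phi_holomorphic[OF z]]]) auto
      have "1 - cnj (a j) * phi z \<zeta> \<noteq> 0" if "j \<in> Jn n" "cmod \<zeta> = 3/4" for j \<zeta>
        using that a fin[of n] phi_in_disc[OF z, of \<zeta>] by (intro one_minus_cnj_mult_nonzero) auto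
      then show ?thesis unfolding P_def rho_def
        by (intro continuous_intros ph) auto
    qed
    have "\<Inter>(range K) \<noteq> {}"
    proof (rule compact_nest)
      show "compact (K n)" for n
      proof -
        have "closed (K n)" unfolding K_def
          by (intro continuous_on_closed_Collect_le continuous_intros Pc closed_sphere)
        moreover have "K n \<subseteq> sphere 0 (3/4)" by (auto simp: K_def)
        ultimately show ?thesis using compact_sphere closed_Int_compact[of "K n" "sphere 0 (3/4)"]
          by (simp add: Int_absorb2)
      qed
      show "K n \<noteq> {}" for n using fin_bound[OF z, of n] by (auto simp: K_def)
      show "K n \<subseteq> K p" if "p \<le> n" for p n
      proof
        fix \<zeta> assume x: "\<zeta> \<in> K n"
        then have z1: "cmod (phi z \<zeta>) < 1" by (intro phi_in_disc z) (auto simp: K_def)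
        have "P n (phi z \<zeta>) = P p (phi z \<zeta>) * (\<Prod>j\<in>Jn n - Jn p. rho (phi z \<zeta>) (a j))"
          unfolding P_def using that
          by (subst prod.subset_diff[of "Jn p" "Jn n"]) (auto simp: fin, auto simp: Jn_def)
        also have "\<dots> \<le> P p (phi z \<zeta>) * 1"
          using fin[of n] a z1
          by (intro mult_left_mono prod_le_1) (auto simp: P_def rho_nonneg intro!: prod_nonneg less_imp_le[OF rho_less_1])
        finally show "\<zeta> \<in> K p" using x by (auto simp: K_def)
      qed
    qed
    then obtain \<zeta> where z1: "\<And>n. \<zeta> \<in> K n" by blast
    have z2: "cmod \<zeta> = 3/4" using z1[of 0] by (simp add: K_def)
    have "c \<le> cmod (B (phi z \<zeta>))"
    proof (rule LIMSEQ_le_const[OF Plim])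
      show "cmod (phi z \<zeta>) < 1" using z2 by (intro phi_in_disc z) auto
    qed (use z1 in \<open>auto simp: K_def\<close>)
    with z2 show ?thesis by blast
  qed
  with c0 that show thesis by blast
qed

lemma carleson_newman_lower_bound:
  assumes "carleson_newman B"
  obtains c where "0 < c" "\<And>z. cmod z < 1 \<Longrightarrow> \<exists>\<zeta>. cmod \<zeta> = 3/4 \<and> c \<le> cmod (B (phi z \<zeta>))"
proof -
  obtain J a where B: "blaschke_product J a B" and cm: "carleson_measure (zeros_measure J a)"
    using assms unfolding carleson_newman_def by blast
  obtain C where C: "0 \<le> C" "\<And>z F. cmod z < 1 \<Longrightarrow> finite F \<Longrightarrow> F \<subseteq> J \<Longrightarrow> (\<Sum>j\<in>F. 1 - (rho z (a j))\<^sup>2) \<le> C"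
    using B carleson_measure_poisson_sum[OF cm] unfolding blaschke_product_def by auto
  show thesis by (rule blaschke_lower_bound[OF B C(1)]) (use C(2) that in auto)
qed

section \<open>The dichotomy\<close>

lemma eta_nonneg: "0 \<le> eta \<Theta> t"
  unfolding eta_def by (intro INF_greatest) auto

lemma eta_le_norm: "cmod z < 1 \<Longrightarrow> ereal t \<le> rho_set z (zero_set \<Theta>) \<Longrightarrow> eta \<Theta> t \<le> ereal (cmod (\<Theta> z))"
  unfolding eta_def by (intro INF_lower) auto

lemma rho_set_geI: "(\<And>a. a \<in> A \<Longrightarrow> t \<le> rho z a) \<Longrightarrow> ereal t \<le> rho_set z A"
  unfolding rho_set_def by (intro INF_greatest) auto

lemma rho_set_geD: "ereal t \<le> rho_set z A \<Longrightarrow> a \<in> A \<Longrightarrow> t \<le> rho z a"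
  unfolding rho_set_def using INF_lower[of a A "\<lambda>a. ereal (rho z a)"]
  by (metis ereal_less_eq(3) order_trans)

lemma inner_holomorphic: "inner_function \<Theta> \<Longrightarrow> \<Theta> holomorphic_on ball 0 1"
  unfolding inner_function_def using HinfD(1) by blast

lemma norm_inner_le_rho:
  assumes "inner_function \<Theta>" "cmod z < 1" "a \<in> zero_set \<Theta>"
  shows "cmod (\<Theta> z) \<le> rho z a"
  using schwarz_pick[OF inner_holomorphic[OF assms(1)] inner_le_1[OF assms(1)] assms(2), of a] assms(3)
  by (auto simp: zero_set_def)

text \<open>A point near the boundary with \<open>|\<Theta>| > t\<close> competes in the infimum, by
  Schwarz--Pick. Thus the infimum is not over the empty set and cannot be infinite.\<close>

lemma eta_le_1:
  assumes "inner_function \<Theta>" "t < 1"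
  shows "eta \<Theta> t \<le> 1"
proof -
  obtain s where s: "((\<lambda>r. cmod (\<Theta> (of_real r * cis s))) \<longlongrightarrow> 1) (at_left 1)"
    by (rule inner_radial_limit[OF assms(1)])
  have "eventually (\<lambda>r. t < cmod (\<Theta> (of_real r * cis s))) (at_left 1)"
    using assms by (intro order_tendstoD(1)[OF s]) auto
  moreover have "eventually (\<lambda>r. r \<in> {0<..<1}) (at_left (1::real))"
    by (rule eventually_at_leftI[of 0]) auto
  ultimately have "eventually (\<lambda>r. t < cmod (\<Theta> (of_real r * cis s)) \<and> r \<in> {0<..<1}) (at_left 1)"
    by eventually_elim auto
  then obtain r where r: "t < cmod (\<Theta> (of_real r * cis s))" "0 < r" "r < 1"
    using eventually_happens[of _ "at_left (1::real)"] by (auto simp: trivial_limit_at_left_real)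
  let ?z = "of_real r * cis s"
  have z: "cmod ?z < 1" using r by (simp add: norm_mult)
  have "ereal t \<le> rho_set ?z (zero_set \<Theta>)"
  proof (rule rho_set_geI)
    fix a assume "a \<in> zero_set \<Theta>"
    from norm_inner_le_rho[OF assms(1) z this] r(1) show "t \<le> rho ?z a" by linarith
  qed
  from eta_le_norm[OF z this] have "eta \<Theta> t \<le> ereal (cmod (\<Theta> ?z))" .
  also have "\<dots> \<le> 1" using inner_le_1[OF assms(1) z] by simp
  finally show ?thesis .
qed

lemma rho_harnack:
  assumes p: "cmod p < 1" and z: "cmod z < 1" and w: "cmod w < 1" and q: "rho w z \<le> q" "q < 1"
  shows "1 - (rho w p)\<^sup>2 \<le> 2 / (1 - q) * (1 - (rho z p)\<^sup>2)"
proof -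
  have "cmod (phi p w - phi p z) \<le> rho w z * cmod (1 - cnj (phi p z) * phi p w)"
    using p by (intro schwarz_pick phi_holomorphic z w) (auto intro: less_imp_le phi_in_disc)
  also have "\<dots> \<le> q * cmod (1 - cnj (phi p z) * phi p w)" using q by (intro mult_right_mono) auto
  finally have "1 - (cmod (phi p w))\<^sup>2 \<le> 2 / (1 - q) * (1 - (cmod (phi p z))\<^sup>2)"
    using p z w q rho_nonneg[of w z] by (intro pick_harnack) (auto intro: less_imp_le phi_in_disc)
  then show ?thesis by (simp add: norm_phi)
qed

lemma SUP_eta_dichotomy:
  assumes inn: "inner_function \<Theta>" and M: "\<Theta> \<in> class_M"
    and t0: "t0 \<in> {0<..<1}" "eta \<Theta> t0 \<noteq> 0"
  shows "(SUP t\<in>{0<..<1}. eta \<Theta> t) = 1"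
proof (rule ccontr)
  define m where "m = (SUP t\<in>{0<..<1}. eta \<Theta> t)"
  assume "\<not> ?thesis"
  moreover have "m \<le> 1" unfolding m_def by (intro SUP_least) (auto intro: eta_le_1[OF inn])
  ultimately have m1: "m < 1" by (simp add: m_def)
  have "0 < eta \<Theta> t0" using t0 eta_nonneg[of \<Theta> t0] by (simp add: less_le)
  also have "\<dots> \<le> m" unfolding m_def using t0 by (intro SUP_upper)
  finally have m0: "0 < m" .
  obtain \<mu> where \<mu>: "m = ereal \<mu>" using m0 m1 by (cases m) auto
  have \<mu>01: "0 < \<mu>" "\<mu> < 1" using m0 m1 \<mu> by (auto simp flip: zero_ereal_def one_ereal_def)
  define T where "T n = 1 - 1 / (real n + 2)" for n
  have T: "T n \<in> {0<..<1}" for n by (auto simp: T_def field_simps)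
  have T_large: "\<exists>N. \<forall>n\<ge>N. s \<le> T n" if "s < 1" for s
  proof -
    obtain N where N: "1 / (1 - s) < real N" using reals_Archimedean2 by blast
    show ?thesis
    proof (intro exI allI impI)
      fix n assume "N \<le> n"
      then have "1 / (1 - s) \<le> real n + 2" using N by linarith
      then show "s \<le> T n" using that by (simp add: T_def field_simps)
    qed
  qed
  have "\<exists>z. cmod z < 1 \<and> ereal (T n) \<le> rho_set z (zero_set \<Theta>) \<and> cmod (\<Theta> z) < \<mu> + 1 / (real n + 1)" for n
  proof -
    have "eta \<Theta> (T n) \<le> m" unfolding m_def using T by (intro SUP_upper)
    also have "\<dots> < ereal (\<mu> + 1 / (real n + 1))" by (simp add: \<mu>)
    finally show ?thesis unfolding eta_def INF_less_iff by auto
  qed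
  then obtain z where z: "\<And>n. cmod (z n) < 1" "\<And>n. ereal (T n) \<le> rho_set (z n) (zero_set \<Theta>)"
      "\<And>n. cmod (\<Theta> (z n)) < \<mu> + 1 / (real n + 1)" by metis
  have low: "\<exists>N. \<forall>n\<ge>N. \<forall>\<zeta>. cmod \<zeta> < 7/8 \<longrightarrow> \<mu> - e \<le> cmod (\<Theta> (phi (z n) \<zeta>))" if e: "0 < e" for e
  proof -
    have "ereal (\<mu> - e) < m" using e by (simp add: \<mu>)
    then obtain t where t: "0 < t" "t < 1" "ereal (\<mu> - e) < eta \<Theta> t"
      unfolding m_def less_SUP_iff by auto
    \<comment> \<open>16 is the Harnack constant \<open>2 / (1 - 7/8)\<close>: distance
      \<open>s\<close> from the zeros at the centre leaves distance at least \<open>t\<close> on the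
      whole disc of radius 7/8.\<close>
    define s where "s = sqrt (1 - (1 - t\<^sup>2) / 16)"
    have t2: "t\<^sup>2 < 1" using t by (simp add: abs_square_less_1)
    define X where "X = 1 - (1 - t\<^sup>2) / 16"
    have X: "0 \<le> X \<and> X < 1" using t2 zero_le_power2[of t] unfolding X_def by (simp add: field_simps)
    have s2: "s\<^sup>2 = 1 - (1 - t\<^sup>2) / 16" using X unfolding s_def X_def[symmetric] by simp
    have s: "0 \<le> s" "s < 1" using X unfolding s_def X_def[symmetric] by simp_all
    obtain N where N: "\<And>n. n \<ge> N \<Longrightarrow> s \<le> T n" using T_large[OF s(2)] by blast
    show ?thesis
    proof (intro exI allI impI)
      fix n \<zeta> assume n: "N \<le> n" and \<zeta>: "cmod \<zeta> < 7/8"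
      let ?w = "phi (z n) \<zeta>"
      have w: "cmod ?w < 1" using z \<zeta> by (intro phi_in_disc) auto
      have rw: "rho ?w (z n) = cmod \<zeta>" using phi_phi[OF z(1), of \<zeta> n] \<zeta> norm_phi[of "z n" ?w] by simp
      have "ereal t \<le> rho_set ?w (zero_set \<Theta>)"
      proof (rule rho_set_geI)
        fix p assume p: "p \<in> zero_set \<Theta>"
        then have p1: "cmod p < 1" by (auto simp: zero_set_def)
        have "s \<le> rho (z n) p" using rho_set_geD[OF z(2) p, of n] N[OF n] by linarith
        then have "s\<^sup>2 \<le> (rho (z n) p)\<^sup>2" using s by (intro power_mono) auto
        moreover have "1 - (rho ?w p)\<^sup>2 \<le> 2 / (1 - 7/8) * (1 - (rho (z n) p)\<^sup>2)"
          using rw \<zeta> by (intro rho_harnack p1 z w) auto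
        ultimately have "t\<^sup>2 \<le> (rho ?w p)\<^sup>2" using s2 by (simp add: field_simps)
        then show "t \<le> rho ?w p" by (rule power2_le_imp_le) (simp add: rho_nonneg)
      qed
      from order_less_le_trans[OF t(3) eta_le_norm[OF w this]]
      show "\<mu> - e \<le> cmod (\<Theta> ?w)" by simp
    qed
  qed
  have "bounded (range (\<lambda>n. \<Theta> (z n)))"
    using inner_le_1[OF inn z(1)] by (auto intro!: boundedI)
  from bounded_imp_convergent_subsequence[OF this] obtain a r where
    r: "strict_mono (r :: nat \<Rightarrow> nat)" and lim: "((\<lambda>n. \<Theta> (z n)) \<circ> r) \<longlonglongrightarrow> a" by auto
  have lim': "(\<lambda>n. \<Theta> (z (r n))) \<longlonglongrightarrow> a" using lim by (simp add: o_def)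
  have anorm: "cmod a = \<mu>"
  proof (rule antisym)
    show "cmod a \<le> \<mu>"
    proof (rule LIMSEQ_le[OF tendsto_norm[OF lim']])
      have "(\<lambda>n. 1 / (real n + 1)) \<longlonglongrightarrow> 0" using LIMSEQ_inverse_real_of_nat by (simp add: inverse_eq_divide add.commute)
      then have "(\<lambda>n. \<mu> + 1 / (real (r n) + 1)) \<longlonglongrightarrow> \<mu> + 0"
        using LIMSEQ_subseq_LIMSEQ[OF _ r] by (intro tendsto_intros) (auto simp: o_def)
      then show "(\<lambda>n. \<mu> + 1 / (real (r n) + 1)) \<longlonglongrightarrow> \<mu>" by simp
    qed (use z(3) in \<open>auto intro: less_imp_le\<close>)
    show "\<mu> \<le> cmod a"
    proof (rule field_le_epsilon)
      fix e :: real assume "0 < e"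
      from low[OF this] obtain N where N: "\<And>n \<zeta>. n \<ge> N \<Longrightarrow> cmod \<zeta> < 7/8 \<Longrightarrow> \<mu> - e \<le> cmod (\<Theta> (phi (z n) \<zeta>))" by blast
      have "\<mu> - e \<le> cmod a"
      proof (rule LIMSEQ_le_const[OF tendsto_norm[OF lim']])
        have "\<mu> - e \<le> cmod (\<Theta> (z (r n)))" if "n \<ge> N" for n
          using N[of "r n" 0] seq_suble[OF r, of n] that by simp
        then show "\<exists>N. \<forall>n\<ge>N. \<mu> - e \<le> cmod (\<Theta> (z (r n)))" by blast
      qed
      then show "\<mu> \<le> cmod a + e" by simp
    qed
  qed
  have "a \<in> unit_disc - {0}" using anorm \<mu>01 by auto
  then obtain c B where cB: "cmod c = 1" "carleson_newman B" "\<And>z. z \<in> unit_disc \<Longrightarrow> phi a (\<Theta> z) = c * B z"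
    using M unfolding class_M_def by blast
  obtain c0 where c0: "0 < c0" "\<And>z. cmod z < 1 \<Longrightarrow> \<exists>\<zeta>. cmod \<zeta> = 3/4 \<and> c0 \<le> cmod (B (phi z \<zeta>))"
    using carleson_newman_lower_bound[OF cB(2)] by metis
  \<comment> \<open>\<open>e * L\<close> will bound \<open>|\<Theta> - a|\<close> at the chosen
    point of the circle of radius 3/4; \<open>e\<close> is so small that the resulting bound for
    \<open>phi a\<close> of that value stays below \<open>c0\<close>.\<close>
  define L where "L = 1 + 48 / \<mu>\<^sup>2"
  have L: "L > 0" using \<mu>01 by (simp add: L_def add_pos_pos)
  define e where "e = min (\<mu> / 2) (c0 * (1 - \<mu>) / (2 * L))"
  have e: "0 < e" "e \<le> \<mu> / 2" using \<mu>01 c0 L by (auto simp: e_def)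
  have eL: "e * L < c0 * (1 - \<mu>)"
  proof -
    have "e * L \<le> (c0 * (1 - \<mu>) / (2 * L)) * L" using L by (intro mult_right_mono) (auto simp: e_def)
    also have "\<dots> < c0 * (1 - \<mu>)" using L c0 \<mu>01 by simp
    finally show ?thesis .
  qed
  from low[OF e(1)] obtain N where N: "\<And>n \<zeta>. n \<ge> N \<Longrightarrow> cmod \<zeta> < 7/8 \<Longrightarrow> \<mu> - e \<le> cmod (\<Theta> (phi (z n) \<zeta>))" by blast
  obtain N2 where N2: "\<And>n. n \<ge> N2 \<Longrightarrow> cmod (\<Theta> (z (r n)) - a) < e"
    using LIMSEQ_D[OF lim' e(1)] by blast
  define n where "n = r (max N N2)"
  have n: "n \<ge> N" "cmod (\<Theta> (z n) - a) < e"
    using seq_suble[OF r, of "max N N2"] N2[of "max N N2"] by (auto simp: n_def)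
  obtain \<zeta> where \<zeta>: "cmod \<zeta> = 3/4" "c0 \<le> cmod (B (phi (z n) \<zeta>))" using c0(2)[OF z(1)] by blast
  let ?w = "phi (z n) \<zeta>"
  have w1: "cmod ?w < 1" using \<zeta> by (intro phi_in_disc z) auto
  define d where "d = \<mu> - e"
  have pos: "0 < d" using e \<mu>01 by (simp add: d_def)
  have Nd: "d \<le> cmod (\<Theta> (phi (z n) u))" if "cmod u < 7/8" for u using N[OF n(1) that] by (simp add: d_def)
  \<comment> \<open>Inversion turns the lower bound \<open>d\<close> into the upper bound 1, and
    \<open>|G 0|\<close> is close to 1, so \<open>pick_dist_le\<close> makes \<open>G\<close> nearly
    constant. The radius 3/4 inside 7/8 gives \<open>q = 6/7\<close>.\<close>
  define G where "G u = of_real d / \<Theta> (phi (z n) u)" for u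
  have nz: "\<Theta> (phi (z n) u) \<noteq> 0" if "cmod u < 7/8" for u using Nd[OF that] pos by auto
  have Gle: "cmod (G u) \<le> 1" if "cmod u < 7/8" for u
    using Nd[OF that] pos nz[OF that] by (simp add: G_def norm_divide)
  have Ghol: "G holomorphic_on ball 0 (7/8)"
    unfolding G_def
  proof (intro holomorphic_intros)
    show "(\<lambda>u. \<Theta> (phi (z n) u)) holomorphic_on ball 0 (7/8)"
    proof (rule holomorphic_on_compose_gen[OF _ inner_holomorphic[OF inn], unfolded o_def])
      show "phi (z n) holomorphic_on ball 0 (7/8)"
        by (rule holomorphic_on_subset[OF phi_holomorphic[OF z(1)]]) auto
    qed (auto intro!: phi_in_disc[OF z(1)])
  qed (use nz in auto)
  have "cmod (G \<zeta> - G 0) \<le> (cmod (\<zeta> - 0) / (7/8)) * cmod (1 - cnj (G 0) * G \<zeta>)"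
    using \<zeta> Gle by (intro schwarz_pick_ball[OF Ghol]) auto
  then have "cmod (G \<zeta> - G 0) \<le> (6/7) / (1 - 6/7) * (1 - (cmod (G 0))\<^sup>2)"
    using \<zeta> Gle[of 0] by (intro pick_dist_le) auto
  then have d1: "cmod (G \<zeta> - G 0) \<le> 6 * (1 - (cmod (G 0))\<^sup>2)" by simp
  have zn: "cmod (\<Theta> (z n)) \<le> \<mu> + e"
    using norm_triangle_ineq2[of "\<Theta> (z n)" a] n(2) anorm by linarith
  have Tz: "\<Theta> (z n) \<noteq> 0" "\<Theta> ?w \<noteq> 0" using nz[of 0] nz[of \<zeta>] \<zeta> by auto
  have g0: "cmod (G 0) = d / cmod (\<Theta> (z n))" using pos by (simp add: G_def norm_divide)
  have "1 - (cmod (G 0))\<^sup>2 \<le> 2 * (1 - cmod (G 0))"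
    using zero_le_power2[of "cmod (G 0) - 1"] by (simp add: power2_eq_square algebra_simps)
  also have "1 - cmod (G 0) \<le> 1 - d / (\<mu> + e)"
    unfolding g0 using zn pos Tz e \<mu>01 by (intro diff_left_mono divide_left_mono) (auto intro!: mult_pos_pos)
  also have "\<dots> = 2 * e / (\<mu> + e)" using \<mu>01 e by (simp add: d_def field_simps)
  also have "\<dots> \<le> 2 * e / \<mu>" using \<mu>01 e by (intro divide_left_mono) auto
  finally have d2: "cmod (G \<zeta> - G 0) \<le> 24 * e / \<mu>" using d1 by simp
  have "\<Theta> ?w - \<Theta> (z n) = - (\<Theta> ?w * \<Theta> (z n) * (G \<zeta> - G 0)) / of_real d"
    unfolding G_def using Tz pos by (simp add: field_simps)
  then have "cmod (\<Theta> ?w - \<Theta> (z n)) = cmod (\<Theta> ?w) * cmod (\<Theta> (z n)) * cmod (G \<zeta> - G 0) / d"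
    using pos by (simp add: norm_mult norm_divide)
  also have "\<dots> \<le> 1 * 1 * (24 * e / \<mu>) / (\<mu> / 2)"
    using inner_le_1[OF inn w1] inner_le_1[OF inn z(1)] d2 e \<mu>01 pos
    by (intro frac_le mult_mono) (auto simp: d_def)
  also have "\<dots> = e * (48 / \<mu>\<^sup>2)" by (simp add: power2_eq_square)
  finally have "cmod (\<Theta> ?w - a) \<le> e * (48 / \<mu>\<^sup>2) + e"
    using n(2) norm_triangle_ineq[of "\<Theta> ?w - \<Theta> (z n)" "\<Theta> (z n) - a"] by simp
  then have d3: "cmod (a - \<Theta> ?w) \<le> e * L" by (simp add: L_def norm_minus_commute algebra_simps)
  have "1 - \<mu> \<le> cmod (1 - cnj a * \<Theta> ?w)"
  proof -
    have "cmod (cnj a * \<Theta> ?w) \<le> \<mu> * 1"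
      using inner_le_1[OF inn w1] anorm \<mu>01 unfolding norm_mult by (intro mult_mono) auto
    then show ?thesis using norm_triangle_ineq2[of 1 "cnj a * \<Theta> ?w"] by simp
  qed
  then have "cmod (a - \<Theta> ?w) / cmod (1 - cnj a * \<Theta> ?w) \<le> e * L / (1 - \<mu>)"
    using d3 \<mu>01 e L by (intro frac_le) auto
  also have "\<dots> < c0" using eL \<mu>01 by (simp add: field_simps)
  finally have "cmod (phi a (\<Theta> ?w)) < c0" by (simp only: phi_def[of a] norm_divide)
  then have "cmod (c * B ?w) < c0" using cB(3)[of ?w] w1 by simp
  then show False using \<zeta>(2) cB(1) by (simp add: norm_mult)
qed

section \<open>Bounded analytic functions and the quotient norm\<close>

lemma Hinf_norm_ge:
  assumes "f \<in> Hinf" "cmod z < 1"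
  shows "cmod (f z) \<le> Hinf_norm f"
proof -
  obtain K where "\<And>z. cmod z < 1 \<Longrightarrow> cmod (f z) \<le> K" using HinfD(2)[OF assms(1)] by blast
  then have "bdd_above ((\<lambda>z. cmod (f z)) ` unit_disc)" by (intro bdd_aboveI) auto
  then show ?thesis unfolding Hinf_norm_def using assms(2) by (intro cSUP_upper) auto
qed

lemma Hinf_norm_le: "(\<And>z. cmod z < 1 \<Longrightarrow> cmod (f z) \<le> K) \<Longrightarrow> Hinf_norm f \<le> K"
  unfolding Hinf_norm_def by (intro cSUP_least) auto

lemma Hinf_norm_nonneg: "f \<in> Hinf \<Longrightarrow> 0 \<le> Hinf_norm f"
  using order_trans[OF norm_ge_zero Hinf_norm_ge[of f 0]] by simp

lemma Hinf_add: "f \<in> Hinf \<Longrightarrow> g \<in> Hinf \<Longrightarrow> (\<lambda>z. f z + g z) \<in> Hinf"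
  and Hinf_mult: "f \<in> Hinf \<Longrightarrow> g \<in> Hinf \<Longrightarrow> (\<lambda>z. f z * g z) \<in> Hinf"
proof -
  assume fg: "f \<in> Hinf" "g \<in> Hinf"
  obtain K where K: "K > 0" "\<And>z. cmod z < 1 \<Longrightarrow> cmod (f z) \<le> K" using HinfD(2)[OF fg(1)] by auto
  obtain L where L: "\<And>z. cmod z < 1 \<Longrightarrow> cmod (g z) \<le> L" using HinfD(2)[OF fg(2)] by auto
  have "cmod (f z + g z) \<le> K + L" if "cmod z < 1" for z
    using K(2)[OF that] L[OF that] norm_triangle_ineq[of "f z" "g z"] by linarith
  then show "(\<lambda>z. f z + g z) \<in> Hinf"
    by (intro HinfI[of _ "K + L"] holomorphic_intros HinfD(1)[OF fg(1)] HinfD(1)[OF fg(2)])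
  have "cmod (f z * g z) \<le> K * L" if "cmod z < 1" for z
    unfolding norm_mult using K(1) K(2)[OF that] L[OF that] by (intro mult_mono) auto
  then show "(\<lambda>z. f z * g z) \<in> Hinf"
    by (intro HinfI[of _ "K * L"] holomorphic_intros HinfD(1)[OF fg(1)] HinfD(1)[OF fg(2)])
qed

lemma Hinf_const: "(\<lambda>z. c) \<in> Hinf"
  by (rule HinfI[of _ "cmod c"]) auto

lemma quot_norm_bdd_below:
  assumes "f \<in> Hinf" "\<Theta> \<in> Hinf"
  shows "bdd_below ((\<lambda>g. Hinf_norm (\<lambda>z. f z + g z * \<Theta> z)) ` Hinf)"
  using assms by (intro bdd_belowI[of _ 0]) (auto intro!: Hinf_norm_nonneg Hinf_add Hinf_mult)

lemma quot_norm_le: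
  assumes "f \<in> Hinf" "\<Theta> \<in> Hinf" "g \<in> Hinf" "\<And>z. cmod z < 1 \<Longrightarrow> cmod (f z + g z * \<Theta> z) \<le> K"
  shows "quot_norm \<Theta> f \<le> K"
proof -
  have "quot_norm \<Theta> f \<le> Hinf_norm (\<lambda>z. f z + g z * \<Theta> z)"
    unfolding quot_norm_def by (intro cINF_lower quot_norm_bdd_below assms)
  also have "\<dots> \<le> K" using assms(4) by (rule Hinf_norm_le)
  finally show ?thesis .
qed

lemma quot_norm_representative:
  assumes "f \<in> Hinf" "\<Theta> \<in> Hinf" "quot_norm \<Theta> f < K"
  obtains g where "g \<in> Hinf" "\<And>z. cmod z < 1 \<Longrightarrow> cmod (f z + g z * \<Theta> z) \<le> K"
proof -
  have "\<exists>x\<in>(\<lambda>g. Hinf_norm (\<lambda>z. f z + g z * \<Theta> z)) ` Hinf. x < K"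
    using assms(3) Hinf_const unfolding quot_norm_def by (intro cInf_lessD) auto
  then obtain g where g: "g \<in> Hinf" "Hinf_norm (\<lambda>z. f z + g z * \<Theta> z) < K" by blast
  have "cmod (f z + g z * \<Theta> z) \<le> K" if "cmod z < 1" for z
    using Hinf_norm_ge[OF Hinf_add[OF assms(1) Hinf_mult[OF g(1) assms(2)]] that] g(2) by simp
  with g(1) show thesis by (rule that)
qed

text \<open>If \<open>phi z * H = 1 + \<Theta> * k'\<close> with \<open>|H| \<le> 3\<close>,
  division by the inner function gives \<open>|k'| \<le> 4\<close>, while at \<open>z\<close> the
  identity reads \<open>\<Theta> z * k' z = - 1\<close>; so \<open>|\<Theta> z| \<ge> 1/4\<close>.
  If \<open>eta\<close> vanishes, this fails at some \<open>z\<close> so far from the zeros that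
  \<open>|phi z|\<close> is at least \<open>1 - \<delta>\<close> on them.\<close>

lemma SIP_imp_eta_nonzero:
  assumes inn: "inner_function \<Theta>" and SIP: "SIP \<Theta>"
  shows "\<exists>t\<in>{0<..<1}. eta \<Theta> t \<noteq> 0"
proof (rule ccontr)
  assume "\<not> ?thesis"
  then have zero: "\<And>t. 0 < t \<Longrightarrow> t < 1 \<Longrightarrow> eta \<Theta> t = 0" by auto
  have TH: "\<Theta> \<in> Hinf" using inn by (simp add: inner_function_def)
  obtain \<delta> where \<delta>: "\<delta> > 0" "\<And>f. f \<in> Hinf \<Longrightarrow> quot_norm \<Theta> f \<le> 1 \<Longrightarrow>
      (INF z\<in>zero_set \<Theta>. ereal (cmod (f z))) \<ge> ereal (1 - \<delta>) \<Longrightarrow>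
      \<exists>h. quot_inverse \<Theta> f h \<and> quot_norm \<Theta> h \<le> 1 + 1"
    using SIP[unfolded SIP_def, rule_format, of 1] by auto
  define t where "t = max (1/2) (1 - \<delta>)"
  have t: "0 < t" "t < 1" "1 - \<delta> \<le> t" using \<delta>(1) by (auto simp: t_def)
  have "eta \<Theta> t < ereal (1/4)" using zero[OF t(1,2)] by simp
  then obtain z where z: "cmod z < 1" "ereal t \<le> rho_set z (zero_set \<Theta>)" "cmod (\<Theta> z) < 1/4"
    unfolding eta_def INF_less_iff by auto
  have f: "phi z \<in> Hinf"
    by (rule HinfI[OF phi_holomorphic[OF z(1)], of 1]) (use z in \<open>auto intro: less_imp_le phi_in_disc\<close>)
  have "quot_norm \<Theta> (phi z) \<le> 1"
    using z by (intro quot_norm_le[OF f TH Hinf_const[of 0]]) (auto intro: less_imp_le phi_in_disc)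
  moreover have "(INF w\<in>zero_set \<Theta>. ereal (cmod (phi z w))) \<ge> ereal (1 - \<delta>)"
  proof (rule INF_greatest)
    fix w assume "w \<in> zero_set \<Theta>"
    from rho_set_geD[OF z(2) this] t(3) show "ereal (1 - \<delta>) \<le> ereal (cmod (phi z w))"
      by (simp add: norm_phi rho_commute)
  qed
  ultimately obtain h where h: "quot_inverse \<Theta> (phi z) h" "quot_norm \<Theta> h \<le> 2" using \<delta>(2)[OF f] by auto
  have hH: "h \<in> Hinf" using h by (simp add: quot_inverse_def)
  obtain g where g: "g \<in> Hinf" "\<And>w. cmod w < 1 \<Longrightarrow> cmod (h w + g w * \<Theta> w) \<le> 3"
    using quot_norm_representative[OF hH TH, of 3] h(2) by auto
  obtain k where k: "k \<in> Hinf" "\<And>w. cmod w < 1 \<Longrightarrow> phi z w * h w - 1 = \<Theta> w * k w"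
    using h(1) unfolding quot_inverse_def quot_eq_def by auto
  \<comment> \<open>Passing from \<open>h\<close> to the representative
    \<open>h + g * \<Theta>\<close> of small norm replaces the cofactor \<open>k\<close> by
    \<open>k'\<close>.\<close>
  define k' where "k' w = k w + phi z w * g w" for w
  have k': "k' \<in> Hinf" unfolding k'_def using k(1) f g(1) by (intro Hinf_add Hinf_mult)
  have eq: "phi z w * (h w + g w * \<Theta> w) - 1 = \<Theta> w * k' w" if "cmod w < 1" for w
    using k(2)[OF that] by (simp add: k'_def algebra_simps)
  have "cmod (k' z) \<le> 4"
  proof (rule inner_division[OF inn k'])
    fix w assume w: "cmod w < 1"
    have "cmod (phi z w * (h w + g w * \<Theta> w)) \<le> 1 * 3"
      unfolding norm_mult using g(2)[OF w] phi_in_disc[OF z(1) w] by (intro mult_mono) auto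
    then show "cmod (\<Theta> w * k' w) \<le> 4"
      unfolding eq[OF w, symmetric] using norm_triangle_ineq4[of "phi z w * (h w + g w * \<Theta> w)" 1] by simp
  qed (use z in auto)
  moreover have "\<Theta> z * k' z = - 1" using eq[OF z(1)] by simp
  then have "cmod (\<Theta> z * k' z) = 1" by simp
  moreover have "cmod (\<Theta> z * k' z) \<le> cmod (\<Theta> z) * 4"
    unfolding norm_mult using calculation(1) by (intro mult_left_mono) auto
  ultimately show False using z(3) by simp
qed

section \<open>Carleson embedding\<close>

text \<open>The left side is dominated by a lower Riemann sum of \<open>exp (- s)\<close>. Elements
  are inserted in order of decreasing level, so the new \<open>x\<close> sees the total of all
  others and the step is \<open>(1 + a x) * exp (- a x) \<le> 1\<close>; equal levels only make the
  terms smaller.\<close>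

lemma jones_telescoping:
  fixes a :: "'i \<Rightarrow> real" and lev :: "'i \<Rightarrow> nat"
  assumes "finite S" "\<And>j. j \<in> S \<Longrightarrow> 0 \<le> a j"
  shows "(\<Sum>j\<in>S. a j * exp (- (\<Sum>l\<in>{l\<in>S. lev j \<le> lev l}. a l))) \<le> 1 - exp (- (\<Sum>l\<in>S. a l))"
  using assms
proof (induction S rule: finite_ranking_induct[where f = "\<lambda>j. - int (lev j)"])
  case empty
  then show ?case by simp
next
  case (insert x S)
  show ?case
  proof (cases "x \<in> S")
    case True
    then show ?thesis using insert by (simp add: insert_absorb)
  next
    case False
    let ?A = "\<Sum>l\<in>S. a l"
    have ax: "0 \<le> a x" and aS: "\<And>j. j \<in> S \<Longrightarrow> 0 \<le> a j" using insert.prems by auto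
    have "{l\<in>insert x S. lev x \<le> lev l} = insert x S" using insert.hyps(2) by force
    then have e1: "(\<Sum>l\<in>{l\<in>insert x S. lev x \<le> lev l}. a l) = a x + ?A"
      using insert.hyps(1) False by simp
    have e2: "(\<Sum>l\<in>{l\<in>S. lev j \<le> lev l}. a l) \<le> (\<Sum>l\<in>{l\<in>insert x S. lev j \<le> lev l}. a l)" for j
      using insert.hyps(1) ax aS by (intro sum_mono2) auto
    have "(\<Sum>j\<in>insert x S. a j * exp (- (\<Sum>l\<in>{l\<in>insert x S. lev j \<le> lev l}. a l)))
        = a x * exp (- (a x + ?A)) + (\<Sum>j\<in>S. a j * exp (- (\<Sum>l\<in>{l\<in>insert x S. lev j \<le> lev l}. a l)))"
      by (subst sum.insert[OF insert.hyps(1) False], subst e1) simp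
    also have "\<dots> \<le> a x * exp (- (a x + ?A)) + (\<Sum>j\<in>S. a j * exp (- (\<Sum>l\<in>{l\<in>S. lev j \<le> lev l}. a l)))"
      using e2 aS by (intro add_left_mono sum_mono mult_left_mono) auto
    also have "\<dots> \<le> a x * exp (- (a x + ?A)) + (1 - exp (- ?A))"
      using insert.IH aS by (intro add_left_mono) auto
    also have "\<dots> \<le> 1 - exp (- (a x + ?A))"
    proof -
      have "(1 + a x) * exp (- a x) \<le> exp (a x) * exp (- a x)"
        using exp_ge_add_one_self by (intro mult_right_mono) auto
      then have "(1 + a x) * exp (- a x) * exp (- ?A) \<le> 1 * exp (- ?A)"
        by (intro mult_right_mono) (auto simp flip: exp_add)
      moreover have "exp (- (a x + ?A)) = exp (- a x) * exp (- ?A)" by (simp flip: exp_add)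
      ultimately show ?thesis by (simp add: algebra_simps)
    qed
    finally show ?thesis using insert.hyps(1) False by simp
  qed
qed

lemma jones_telescoping_le_1:
  fixes a :: "'i \<Rightarrow> real" and lev :: "'i \<Rightarrow> nat"
  assumes "finite S" "\<And>j. j \<in> S \<Longrightarrow> 0 \<le> a j"
  shows "(\<Sum>j\<in>S. a j * exp (- (\<Sum>l\<in>{l\<in>S. lev j \<le> lev l}. a l))) \<le> 1"
proof -
  have "(\<Sum>j\<in>S. a j * exp (- (\<Sum>l\<in>{l\<in>S. lev j \<le> lev l}. a l))) \<le> 1 - exp (- (\<Sum>l\<in>S. a l))"
    by (rule jones_telescoping) (use assms in auto)
  then show ?thesis using exp_ge_zero[of "- (\<Sum>l\<in>S. a l)"] by linarith
qed

text \<open>Herglotz kernel of an interior point: on the unit circle its real part is the Poisson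
  kernel of \<open>w\<close>.\<close>

definition herglotz :: "complex \<Rightarrow> complex \<Rightarrow> complex" where
  "herglotz w z = (1 + cnj w * z) / (1 - cnj w * z)"

lemma Re_herglotz: "Re (herglotz w z) = (1 - (cmod w)\<^sup>2 * (cmod z)\<^sup>2) / (cmod (1 - cnj w * z))\<^sup>2"
proof -
  define u where "u = cnj w * z"
  have "Re ((1 + u) / (1 - u)) = (1 - (cmod u)\<^sup>2) / (cmod (1 - u))\<^sup>2"
    unfolding Re_divide cmod_power2 by (simp add: power2_eq_square algebra_simps)
  then show ?thesis by (simp add: herglotz_def u_def norm_mult power_mult_distrib)
qed

lemma norm_diff_circle:
  assumes "cmod z = 1"
  shows "cmod (1 - cnj w * z) = cmod (z - w)"
  using pick_identity[of w z] assms by (simp add: power2_eq_iff_nonneg)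

text \<open>Jones' proof: Cauchy's formula represents \<open>h (w j)\<close>, up to the factor
  \<open>E j (w j)\<close> of modulus at least \<open>exp (- C)\<close>, by an integral against a
  Poisson kernel damped by \<open>E j\<close>. Weighted by \<open>m j\<close>, the damped kernels
  add up to at most 1 at each boundary point. Any integrable majorant \<open>u\<close> of
  \<open>|h|\<close> may be used.\<close>

lemma carleson_embedding_circle:
  assumes S: "finite S" and w: "\<And>j. j \<in> S \<Longrightarrow> cmod (w j) < 1" and m: "\<And>j. j \<in> S \<Longrightarrow> 0 \<le> m j"
    and C: "\<And>i. i \<in> S \<Longrightarrow> (\<Sum>j\<in>{j\<in>S. lev i \<le> (lev j :: nat)}. m j * Re (herglotz (w j) (w i))) \<le> C"
    and h: "h holomorphic_on cball 0 1"
    and u: "\<And>t. cmod (h (cis (2*pi*t))) \<le> u t" "(u has_integral U) {0..1}"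
  shows "(\<Sum>j\<in>S. m j * cmod (h (w j))) \<le> exp C * U"
proof -
  define E where "E j z = exp (- (\<Sum>l\<in>{l\<in>S. lev j \<le> lev l}. of_real (m l) * herglotz (w l) z))" for j z
  define P where "P j z = (1 - (cmod (w j))\<^sup>2) / (cmod (z - w j))\<^sup>2" for j z
  \<comment> \<open>The last factor is 1 at \<open>w j\<close>, and on the circle it turns the
    modulus of the Cauchy kernel into the Poisson kernel \<open>P j\<close>.\<close>
  define G where "G j z = h z * E j z * (of_real (1 - (cmod (w j))\<^sup>2) / (1 - cnj (w j) * z))" for j z
  define e where "e t = cis (2*pi*t)" for t
  have e1: "cmod (e t) = 1" for t by (simp add: e_def)
  have nz: "1 - cnj (w j) * z \<noteq> 0" if "j \<in> S" "cmod z \<le> 1" for j z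
    using w that by (intro one_minus_cnj_mult_nonzero) auto
  have Ghol: "G j holomorphic_on cball 0 1" if "j \<in> S" for j
    unfolding G_def E_def herglotz_def
    by (intro holomorphic_intros h nz) (use that in auto)
  define I where "I j t = G j (e t) * e t / (e t - w j)" for j t
  have int: "(I j has_integral G j (w j)) {0..1}" if "j \<in> S" for j
    using cauchy_circle_has_integral[OF Ghol[OF that] w[OF that]] by (simp add: I_def[abs_def] e_def)
  have Icont: "continuous_on {0..1} (I j)" if "j \<in> S" for j
    unfolding I_def e_def
  proof (intro continuous_intros)
    have "continuous_on {0..1} (\<lambda>t. G j (e t))"
      unfolding e_def cis_conv_exp
      by (intro continuous_on_compose2[OF holomorphic_on_imp_continuous_on[OF Ghol[OF that]]] continuous_intros) auto
    then show "continuous_on {0..1} (\<lambda>t. G j (cis (2 * pi * t)))" by (simp add: e_def)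
    have "cis (2 * pi * t) \<noteq> w j" for t using w[OF that] norm_cis[of "2 * pi * t"] by force
    then show "\<forall>t\<in>{0..1}. cis (2 * pi * t) - w j \<noteq> 0" by simp
  qed
  have Inorm: "cmod (I j t) = cmod (h (e t)) * (P j (e t) * exp (- (\<Sum>l\<in>{l\<in>S. lev j \<le> lev l}. m l * P l (e t))))"
    if j: "j \<in> S" for j t
  proof -
    have d: "cmod (1 - cnj (w l) * e t) = cmod (e t - w l)" for l by (rule norm_diff_circle[OF e1])
    have "cmod (E j (e t)) = exp (- (\<Sum>l\<in>{l\<in>S. lev j \<le> lev l}. m l * P l (e t)))"
      unfolding E_def norm_exp_eq_Re by (simp add: Re_herglotz d e1 P_def)
    moreover have "0 \<le> 1 - (cmod (w j))\<^sup>2" using w[OF j] by (simp add: power_le_one)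
    ultimately show ?thesis
      by (simp add: I_def G_def norm_mult norm_divide d e1 P_def power2_eq_square del: of_real_diff)
  qed
  have "(\<Sum>j\<in>S. m j * cmod (G j (w j))) \<le> (\<Sum>j\<in>S. m j * integral {0..1} (\<lambda>t. cmod (I j t)))"
  proof (intro sum_mono mult_left_mono m)
    fix j assume j: "j \<in> S"
    show "cmod (G j (w j)) \<le> integral {0..1} (\<lambda>t. cmod (I j t))"
      by (rule has_integral_norm_le[OF int[OF j] integrable_integral])
        (auto intro!: integrable_continuous_real continuous_on_norm Icont j)
  qed
  also have "\<dots> = integral {0..1} (\<lambda>t. \<Sum>j\<in>S. m j * cmod (I j t))"
    by (subst integral_sum) (auto intro!: S integrable_continuous_real continuous_intros Icont)
  also have "\<dots> \<le> integral {0..1} u"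
  proof (rule integral_le)
    show "(\<lambda>t. \<Sum>j\<in>S. m j * cmod (I j t)) integrable_on {0..1}"
      by (auto intro!: S integrable_continuous_real continuous_intros Icont)
    show "u integrable_on {0..1}" using u(2) by blast
    fix t :: real
    have P0: "0 \<le> P j (e t)" if "j \<in> S" for j
      using w[OF that] by (auto simp: P_def power_le_one)
    have "(\<Sum>j\<in>S. m j * cmod (I j t)) = cmod (h (e t)) * (\<Sum>j\<in>S. (m j * P j (e t)) * exp (- (\<Sum>l\<in>{l\<in>S. lev j \<le> lev l}. m l * P l (e t))))"
      by (simp add: Inorm sum_distrib_left mult_ac cong: sum.cong)
    also have "\<dots> \<le> cmod (h (e t)) * 1"
      using m P0 by (intro mult_left_mono jones_telescoping_le_1 S) auto
    also have "\<dots> \<le> u t" using u(1)[of t] by (simp add: e_def)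
    finally show "(\<Sum>j\<in>S. m j * cmod (I j t)) \<le> u t" .
  qed
  also have "\<dots> = U" using u(2) by (rule integral_unique)
  finally have le: "(\<Sum>j\<in>S. m j * cmod (G j (w j))) \<le> U" .
  have "(\<Sum>j\<in>S. m j * cmod (h (w j))) \<le> (\<Sum>j\<in>S. m j * (exp C * cmod (G j (w j))))"
  proof (intro sum_mono mult_left_mono m)
    fix j assume j: "j \<in> S"
    have w1: "1 - (cmod (w j))\<^sup>2 > 0" using w[OF j] by (simp add: abs_square_less_1)
    have "1 - cnj (w j) * w j = of_real (1 - (cmod (w j))\<^sup>2)"
      by (simp add: complex_norm_square mult.commute flip: of_real_power)
    then have "G j (w j) = h (w j) * E j (w j)" using w1 by (simp add: G_def del: of_real_diff)
    moreover have "exp (- C) \<le> cmod (E j (w j))"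
      unfolding E_def norm_exp_eq_Re using C[OF j] by simp
    ultimately have "cmod (h (w j)) * exp (- C) \<le> cmod (G j (w j))"
      by (simp add: norm_mult mult_left_mono)
    then have "exp C * (cmod (h (w j)) * exp (- C)) \<le> exp C * cmod (G j (w j))" by simp
    then show "cmod (h (w j)) \<le> exp C * cmod (G j (w j))" by (simp add: exp_minus field_simps)
  qed
  also have "\<dots> = exp C * (\<Sum>j\<in>S. m j * cmod (G j (w j)))" by (simp add: sum_distrib_left mult_ac)
  also have "\<dots> \<le> exp C * U" using le by simp
  finally show ?thesis .
qed

text \<open>After a rotation, \<open>h = 1 - c * f\<close> satisfies
  \<open>|h|^2 \<le> 2 * Re h\<close>, so the mean of \<open>|h|\<close> over the circle is
  controlled by the square root of \<open>Re (h 0)\<close>. This square root dictates the growth of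
  the thresholds later. The dilation by \<open>r\<close> makes \<open>h\<close> analytic on the
  closed disc.\<close>

lemma sum_defect_le:
  assumes S: "finite S" and w: "\<And>j. j \<in> S \<Longrightarrow> cmod (w j) < 1" and m: "\<And>j. j \<in> S \<Longrightarrow> 0 \<le> m j"
    and C: "\<And>i. i \<in> S \<Longrightarrow> (\<Sum>j\<in>{j\<in>S. lev i \<le> (lev j :: nat)}. m j * Re (herglotz (w j) (w i))) \<le> C"
    and f: "f holomorphic_on ball 0 1" "\<And>z. cmod z < 1 \<Longrightarrow> cmod (f z) \<le> 1"
    and a: "0 < a" "1 - cmod (f 0) \<le> a"
  shows "(\<Sum>j\<in>S. m j * (1 - cmod (f (w j)))) \<le> exp C * (3/2 * sqrt a)"
proof -
  define c where "c = (if f 0 = 0 then 1 else cnj (f 0) / of_real (cmod (f 0)))"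
  have c1: "cmod c = 1" by (simp add: c_def norm_divide)
  have cf0: "c * f 0 = of_real (cmod (f 0))"
  proof (cases "f 0 = 0")
    case False
    then have "c * f 0 = (f 0 * cnj (f 0)) / of_real (cmod (f 0))" by (simp add: c_def mult.commute)
    also have "\<dots> = of_real ((cmod (f 0))\<^sup>2) / of_real (cmod (f 0))" by (simp only: complex_norm_square)
    finally show ?thesis using False by (simp add: power2_eq_square)
  qed (simp add: c_def)
  define \<theta> where "\<theta> = sqrt a"
  have \<theta>: "\<theta> > 0" "\<theta> * \<theta> = a" using a by (auto simp: \<theta>_def)
  have *: "(\<Sum>j\<in>S. m j * (1 - cmod (f (of_real r * w j)))) \<le> exp C * (3/2 * sqrt a)" if r: "0 < r" "r < 1" for r
  proof -
    define h where "h z = 1 - c * f (of_real r * z)" for z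
    have rb: "cmod (of_real r * z) < 1" if "cmod z \<le> 1" for z
    proof -
      have "r * cmod z \<le> r * 1" using r that by (intro mult_left_mono) auto
      with r have "r * cmod z < 1" by linarith
      then show ?thesis using r by (simp add: norm_mult)
    qed
    have hol: "h holomorphic_on cball 0 1"
      unfolding h_def using rb
      by (intro holomorphic_intros holomorphic_on_compose_gen[OF _ f(1), unfolded o_def]) auto
    have hle: "(cmod (h z))\<^sup>2 \<le> 2 * Re (h z)" if "cmod z \<le> 1" for z
    proof -
      define v where "v = c * f (of_real r * z)"
      have "cmod v \<le> 1" using f(2)[OF rb[OF that]] c1 by (simp add: v_def norm_mult)
      then have "(cmod v)\<^sup>2 \<le> 1" by (simp add: power_le_one)
      then have "(cmod (1 - v))\<^sup>2 \<le> 2 * Re (1 - v)"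
        unfolding cmod_power2 by (simp add: power2_eq_square algebra_simps)
      then show ?thesis by (simp add: h_def v_def)
    qed
    \<comment> \<open>Arithmetic-geometric mean in place of Cauchy--Schwarz: a majorant whose mean
      is explicit. \<open>\<theta> = sqrt a\<close> balances its two terms.\<close>
    define u where "u t = \<theta> / 2 + Re (h (cis (2*pi*t))) / \<theta>" for t
    have u1: "cmod (h (cis (2*pi*t))) \<le> u t" for t
    proof -
      define x where "x = cmod (h (cis (2*pi*t)))"
      have x2: "x\<^sup>2 \<le> 2 * Re (h (cis (2*pi*t)))" unfolding x_def by (intro hle) simp
      have "0 \<le> (x - \<theta>)\<^sup>2" by simp
      then have "2 * \<theta> * x \<le> \<theta> * \<theta> + x\<^sup>2" by (simp add: power2_eq_square algebra_simps)
      then have "2 * \<theta> * x \<le> \<theta> * \<theta> + 2 * Re (h (cis (2*pi*t)))" using x2 by linarith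
      then have "x \<le> u t" using \<theta> by (simp add: u_def field_simps)
      then show ?thesis by (simp add: x_def)
    qed
    have "((\<lambda>t. h (cis (2*pi*t))) has_integral h 0) {0..1}"
      using cauchy_circle_has_integral[OF hol, of 0] by simp
    then have "((\<lambda>t. Re (h (cis (2*pi*t)))) has_integral Re (h 0)) {0..1}"
      by (rule has_integral_Re)
    then have "((\<lambda>t. Re (h (cis (2*pi*t))) / \<theta>) has_integral Re (h 0) / \<theta>) {0..1}"
      by (rule has_integral_divide)
    moreover have "((\<lambda>t. \<theta> / 2) has_integral \<theta> / 2) {0..1::real}"
      using has_integral_const_real[of "\<theta> / 2" 0 1] by simp
    ultimately have u2: "(u has_integral \<theta> / 2 + Re (h 0) / \<theta>) {0..1}"
      unfolding u_def[abs_def] by (intro has_integral_add)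
    have "(\<Sum>j\<in>S. m j * (1 - cmod (f (of_real r * w j)))) \<le> (\<Sum>j\<in>S. m j * cmod (h (w j)))"
    proof (intro sum_mono mult_left_mono m)
      fix j
      have "cmod (c * f (of_real r * w j)) = cmod (f (of_real r * w j))" using c1 by (simp add: norm_mult)
      then show "1 - cmod (f (of_real r * w j)) \<le> cmod (h (w j))"
        using norm_triangle_ineq2[of 1 "c * f (of_real r * w j)"] by (simp add: h_def)
    qed
    also have "\<dots> \<le> exp C * (\<theta> / 2 + Re (h 0) / \<theta>)"
      using carleson_embedding_circle[OF S w m C hol u1 u2] by simp
    also have "Re (h 0) \<le> \<theta> * \<theta>" using a \<theta> by (simp add: h_def cf0)
    then have "Re (h 0) / \<theta> \<le> \<theta>" using \<theta> by (simp add: field_simps)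
    then have "\<theta> / 2 + Re (h 0) / \<theta> \<le> 3/2 * \<theta>" by linarith
    then have "exp C * (\<theta> / 2 + Re (h 0) / \<theta>) \<le> exp C * (3/2 * \<theta>)" by (rule mult_left_mono) simp
    finally show ?thesis by (simp add: \<theta>_def)
  qed
  show ?thesis
  proof (rule tendsto_le[of "at_left (1::real)", OF _ tendsto_const])
    show "((\<lambda>r. \<Sum>j\<in>S. m j * (1 - cmod (f (of_real r * w j)))) \<longlongrightarrow> (\<Sum>j\<in>S. m j * (1 - cmod (f (w j))))) (at_left 1)"
    proof (intro tendsto_intros)
      fix j assume j: "j \<in> S"
      have "isCont f (w j)"
        using f(1) w[OF j] by (intro continuous_on_interior[OF holomorphic_on_imp_continuous_on]) auto
      moreover have "((\<lambda>r. of_real r * w j) \<longlongrightarrow> of_real 1 * w j) (at_left (1::real))" by (intro tendsto_intros)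
      ultimately show "((\<lambda>r. f (of_real r * w j)) \<longlongrightarrow> f (w j)) (at_left 1)"
        using isCont_tendsto_compose[of "w j" f "\<lambda>r. of_real r * w j" "at_left 1"] by simp
    qed
    show "eventually (\<lambda>r. (\<Sum>j\<in>S. m j * (1 - cmod (f (of_real r * w j)))) \<le> exp C * (3/2 * sqrt a)) (at_left 1)"
      by (rule eventually_at_leftI[of 0]) (use * in auto)
  qed simp
qed

text \<open>Each term is at most twice the integral of \<open>1 / (1 + s^2)\<close> over a unit
  interval centred at the same place, so the total is at most \<open>2 * pi\<close>.\<close>

lemma sum_inverse_square_shift_le:
  "(\<Sum>k<K. 1 / ((x - (real k + 1/2))\<^sup>2 + 1)) \<le> 7"
proof -
  have step: "1 / (v\<^sup>2 + 1) \<le> 2 * (arctan (v + 1/2) - arctan (v - 1/2))" for v :: real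
  proof -
    obtain \<xi> where \<xi>: "v - 1/2 < \<xi>" "\<xi> < v + 1/2"
      "arctan (v + 1/2) - arctan (v - 1/2) = ((v + 1/2) - (v - 1/2)) * inverse (1 + \<xi>\<^sup>2)"
      using MVT2[of "v - 1/2" "v + 1/2" arctan "\<lambda>x. inverse (1 + x\<^sup>2)"] DERIV_arctan by auto
    have "\<bar>\<xi>\<bar> \<le> \<bar>v\<bar> + 1/2" using \<xi> by linarith
    then have "\<xi>\<^sup>2 \<le> (\<bar>v\<bar> + 1/2)\<^sup>2" using abs_le_square_iff[of \<xi> "\<bar>v\<bar> + 1/2"] by simp
    also have "\<dots> \<le> 2 * v\<^sup>2 + 1/2"
      using zero_le_power2[of "\<bar>v\<bar> - 1/2"] by (simp add: power2_eq_square algebra_simps)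
    finally have "1 + \<xi>\<^sup>2 \<le> 2 * (v\<^sup>2 + 1)" by simp
    moreover have "0 < 1 + \<xi>\<^sup>2" by (simp add: add_pos_nonneg)
    ultimately have "inverse (2 * (v\<^sup>2 + 1)) \<le> inverse (1 + \<xi>\<^sup>2)" by (rule le_imp_inverse_le)
    moreover have "arctan (v + 1/2) - arctan (v - 1/2) = inverse (1 + \<xi>\<^sup>2)" using \<xi>(3) by simp
    ultimately have "inverse (2 * (v\<^sup>2 + 1)) \<le> arctan (v + 1/2) - arctan (v - 1/2)" by linarith
    then have "2 * inverse (2 * (v\<^sup>2 + 1)) \<le> 2 * (arctan (v + 1/2) - arctan (v - 1/2))"
      by (rule mult_left_mono) simp
    moreover have "2 * inverse (2 * X) = 1 / X" for X :: real by (simp add: divide_simps)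
    ultimately show ?thesis by metis
  qed
  have "(\<Sum>k<K. 1 / ((x - (real k + 1/2))\<^sup>2 + 1)) \<le> (\<Sum>k<K. 2 * (arctan (real (Suc k) - x) - arctan (real k - x)))"
  proof (intro sum_mono)
    fix k
    have "1 / ((x - (real k + 1/2))\<^sup>2 + 1) = 1 / ((real k + 1/2 - x)\<^sup>2 + 1)" by (simp add: power2_commute)
    also have "\<dots> \<le> 2 * (arctan (real k + 1/2 - x + 1/2) - arctan (real k + 1/2 - x - 1/2))" by (rule step)
    also have "\<dots> = 2 * (arctan (real (Suc k) - x) - arctan (real k - x))" by (simp add: algebra_simps)
    finally show "1 / ((x - (real k + 1/2))\<^sup>2 + 1) \<le> 2 * (arctan (real (Suc k) - x) - arctan (real k - x))" .
  qed
  also have "\<dots> = 2 * (arctan (real K - x) - arctan (- x))"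
    by (simp only: sum_distrib_left[symmetric] sum_lessThan_telescope[where f = "\<lambda>k. arctan (real k - x)"]) simp
  also have "\<dots> \<le> 2 * (pi / 2 - (- (pi / 2)))"
    using arctan_ubound[of "real K - x"] arctan_lbound[of "- x"] by simp
  also have "\<dots> \<le> 7" using pi_approx by simp
  finally show ?thesis .
qed

section \<open>Sums over the dyadic tree\<close>

text \<open>The node \<open>(n, k)\<close> stands for the dyadic interval from
  \<open>k / 2^n\<close> to \<open>(k + 1) / 2^n\<close>. This is the weight of its Carleson box,
  truncated at generation \<open>N\<close>; the node itself is the term
  \<open>i = 0\<close>.\<close>

definition subsum :: "nat \<Rightarrow> (nat \<Rightarrow> nat \<Rightarrow> real) \<Rightarrow> nat \<Rightarrow> nat \<Rightarrow> real" where
  "subsum N w n k = (\<Sum>i\<le>N-n. \<Sum>j<2^i. w (n+i) (k*2^i+j))"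

lemma sum_nat_block: "(\<Sum>k<m*(n::nat). g k) = (\<Sum>j<m. \<Sum>l<n. (g (j*n+l) :: 'a :: comm_monoid_add))"
proof -
  have "(\<Sum>k<m*n. g k) = (\<Sum>j<m. sum g {j*n..<j*n+n})" by (rule sum.nat_group[symmetric])
  also have "\<dots> = (\<Sum>j<m. \<Sum>l<n. g (j*n+l))"
  proof (rule sum.cong[OF refl])
    fix j
    show "sum g {j*n..<j*n+n} = (\<Sum>l<n. g (j*n+l))"
      using sum.shift_bounds_nat_ivl[of g 0 "j*n" n] by (simp add: atLeast0LessThan add.commute)
  qed
  finally show ?thesis .
qed

lemma subsum_leaf: "subsum N w N k = w N k"
  by (simp add: subsum_def)

lemma subsum_children:
  assumes "n < N"
  shows "subsum N w n k = w n k + subsum N w (Suc n) (2*k) + subsum N w (Suc n) (2*k+1)"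
proof -
  define d where "d = N - Suc n"
  have d: "N - n = Suc d" using assms by (simp add: d_def)
  have "subsum N w n k = w n k + (\<Sum>i\<le>d. \<Sum>j<2^Suc i. w (n + Suc i) (k*2^Suc i+j))"
    unfolding subsum_def d by (subst sum.atMost_Suc_shift) simp
  also have "(\<Sum>i\<le>d. \<Sum>j<2^Suc i. w (n + Suc i) (k*2^Suc i+j))
      = (\<Sum>i\<le>d. (\<Sum>j<2^i. w (Suc n+i) (2*k*2^i+j)) + (\<Sum>j<2^i. w (Suc n+i) ((2*k+1)*2^i+j)))"
  proof (intro sum.cong refl)
    fix i
    have "(\<Sum>j<2*2^i. w (n + Suc i) (k*2^Suc i+j)) = (\<Sum>c<2. \<Sum>l<2^i. w (n + Suc i) (k*2^Suc i+(c*2^i+l)))"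
      by (rule sum_nat_block)
    then show "(\<Sum>j<2^Suc i. w (n + Suc i) (k*2^Suc i+j))
      = (\<Sum>j<2^i. w (Suc n+i) (2*k*2^i+j)) + (\<Sum>j<2^i. w (Suc n+i) ((2*k+1)*2^i+j))"
      by (simp add: numeral_2_eq_2 algebra_simps)
  qed
  also have "\<dots> = subsum N w (Suc n) (2*k) + subsum N w (Suc n) (2*k+1)"
    unfolding subsum_def d_def by (simp add: sum.distrib)
  finally show ?thesis by simp
qed

lemma subsum_add: "subsum N (\<lambda>n k. w n k + w' n k) n k = subsum N w n k + subsum N w' n k"
  unfolding subsum_def by (simp add: sum.distrib)

lemma subsum_ge_node:
  assumes "\<And>n k. 0 \<le> w n k"
  shows "w n k \<le> subsum N w n k"
proof -
  have "(\<Sum>j<2^0. w (n+0) (k*2^0+j)) \<le> (\<Sum>i\<le>N-n. \<Sum>j<2^i. w (n+i) (k*2^i+j))"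
    by (rule member_le_sum[of 0 "{..N-n}" "\<lambda>i. \<Sum>j<2^i. w (n+i) (k*2^i+j)"]) (auto intro: sum_nonneg assms)
  then show ?thesis by (simp add: subsum_def)
qed

lemma sum_levels_eq_subsum:
  assumes "p \<le> N"
  shows "(\<Sum>n\<in>{p..N}. \<Sum>k<2^n. w n k) = (\<Sum>j<2^p. subsum N w p j)"
proof -
  have "(\<Sum>n\<in>{p..N}. \<Sum>k<2^n. w n k) = (\<Sum>i\<le>N-p. \<Sum>k<2^(p+i). w (p+i) k)"
  proof -
    have "{p..N} = (\<lambda>i. p + i) ` {..N-p}" using assms by (simp add: atMost_atLeast0)
    then show ?thesis by (simp add: sum.reindex)
  qed
  also have "\<dots> = (\<Sum>i\<le>N-p. \<Sum>j<2^p. \<Sum>l<2^i. w (p+i) (j*2^i+l))"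
    by (simp only: power_add sum_nat_block)
  also have "\<dots> = (\<Sum>j<2^p. subsum N w p j)"
    unfolding subsum_def by (rule sum.swap)
  finally show ?thesis .
qed

text \<open>\<open>y / |z - cnj p|^2\<close> for \<open>z = x + \<i> * y\<close> and the point
  \<open>p\<close> at height \<open>2 / 2^n\<close> above the middle of the interval
  \<open>(n, k)\<close>.\<close>

definition tree_kernel :: "real \<Rightarrow> real \<Rightarrow> nat \<Rightarrow> nat \<Rightarrow> real" where
  "tree_kernel x y n k = y / ((x - (real k + 1/2) / 2^n)\<^sup>2 + (y + 2/2^n)\<^sup>2)"

text \<open>Levels coarser than the height \<open>y\<close> are summed separately (a geometric series); finer nodes
  are grouped by their ancestors of size comparable to \<open>y\<close>.\<close>

lemma tree_poisson:
  assumes w: "\<And>n k. 0 \<le> w n k" and M: "\<And>n k. n \<le> N \<Longrightarrow> k < 2^n \<Longrightarrow> subsum N w n k \<le> M / 2^n" and y: "0 < y"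
  shows "(\<Sum>n\<le>N. \<Sum>k<2^n. w n k * tree_kernel x y n k) \<le> 60 * M"
proof -
  have "subsum N w 0 0 \<le> M" using M[of 0 0] by simp
  then have M0: "0 \<le> M" using subsum_ge_node[of w 0 0 N, OF w] w[of 0 0] by linarith
  have wM: "w n k \<le> M / 2^n" if "n \<le> N" "k < 2^n" for n k
    using M[OF that] subsum_ge_node[of w n k N] w by simp
  define h where "h n = 1 / (2::real)^n" for n :: nat
  have h0: "0 < h n" for n by (simp add: h_def)
  define c where "c n k = (real k + 1/2) * h n" for n k :: nat
  have tk: "tree_kernel x y n k = y / ((x - c n k)\<^sup>2 + (y + 2 * h n)\<^sup>2)" for n k
    by (simp add: tree_kernel_def c_def h_def)
  have tk0: "0 \<le> tree_kernel x y n k" for n k using y by (simp add: tree_kernel_def)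
  have scale: "(x - c n k)\<^sup>2 + (h n)\<^sup>2 = (h n)\<^sup>2 * ((x / h n - (real k + 1/2))\<^sup>2 + 1)" for n k
  proof -
    have "x - c n k = h n * (x / h n - (real k + 1/2))" using h0[of n] by (simp add: c_def field_simps)
    then show ?thesis by (simp only: power_mult_distrib) (simp add: algebra_simps)
  qed
  \<comment> \<open>Intervals of the generations before \<open>p\<close> have length at least
    \<open>y\<close>; from \<open>p\<close> on they are shorter than \<open>y\<close>.\<close>
  define p where "p = (LEAST p. h p < y)"
  have ex: "\<exists>p. h p < y"
    unfolding h_def using real_arch_pow_inv[OF y, of "1/2"] by (auto simp: power_divide)
  have p: "h p < y" unfolding p_def by (rule LeastI_ex[OF ex])
  have p': "y \<le> h q" if "q < p" for q
    using not_less_Least[of q "\<lambda>p. h p < y"] that by (simp add: p_def)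
  have coarse: "(\<Sum>n<p. if n \<le> N then \<Sum>k<2^n. w n k * tree_kernel x y n k else 0) \<le> 14 * M"
  proof -
    have lev: "(\<Sum>k<2^n. w n k * tree_kernel x y n k) \<le> 7 * M * (y / h n)" if n: "n \<le> N" for n
    proof -
      have "(\<Sum>k<2^n. w n k * tree_kernel x y n k) \<le> (\<Sum>k<2^n. M * y / h n * (1 / ((x / h n - (real k + 1/2))\<^sup>2 + 1)))"
      proof (intro sum_mono)
        fix k :: nat assume k: "k \<in> {..<2^n}"
        have "tree_kernel x y n k \<le> y / ((x - c n k)\<^sup>2 + (h n)\<^sup>2)"
          unfolding tk using y h0[of n]
          by (intro divide_left_mono add_left_mono power_mono mult_pos_pos add_nonneg_pos) auto
        also have "\<dots> = y / ((h n)\<^sup>2 * ((x / h n - (real k + 1/2))\<^sup>2 + 1))" by (simp only: scale)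
        finally have "w n k * tree_kernel x y n k \<le> (M / 2^n) * (y / ((h n)\<^sup>2 * ((x / h n - (real k + 1/2))\<^sup>2 + 1)))"
          using wM[OF n] k M0 tk0 by (intro mult_mono) auto
        also have "\<dots> = M * y / h n * (1 / ((x / h n - (real k + 1/2))\<^sup>2 + 1))"
          using h0[of n] by (simp add: h_def power2_eq_square)
        finally show "w n k * tree_kernel x y n k \<le> M * y / h n * (1 / ((x / h n - (real k + 1/2))\<^sup>2 + 1))" .
      qed
      also have "\<dots> = M * y / h n * (\<Sum>k<2^n. 1 / ((x / h n - (real k + 1/2))\<^sup>2 + 1))"
        by (simp only: sum_distrib_left)
      also have "\<dots> \<le> M * y / h n * 7"
        using M0 y h0[of n] by (intro mult_left_mono sum_inverse_square_shift_le) auto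
      finally show ?thesis by (simp add: field_simps)
    qed
    have "(\<Sum>n<p. if n \<le> N then \<Sum>k<2^n. w n k * tree_kernel x y n k else 0) \<le> (\<Sum>n<p. 7 * M * (y / h n))"
      using lev M0 y h0 by (intro sum_mono) (auto simp: less_imp_le)
    also have "\<dots> = 7 * M * y * (\<Sum>n<p. 2^n)" by (simp add: h_def sum_distrib_left mult_ac)
    also have "\<dots> = 7 * M * (y * (2^p - 1))" using geometric_sum[of "2::real" p] by simp
    also have "y * (2^p - 1) \<le> 2"
    proof (cases p)
      case (Suc q)
      have "y \<le> 1 / 2^q" using p'[of q] Suc by (simp add: h_def)
      then have "y * 2^q \<le> 1" by (simp add: field_simps)
      then have "y * 2^p \<le> 2" using Suc by simp
      then show ?thesis using y by (simp add: algebra_simps)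
    qed simp
    then have "7 * M * (y * (2^p - 1)) \<le> 7 * M * 2" using M0 by (intro mult_left_mono) auto
    finally show ?thesis by simp
  qed
  have fine: "(\<Sum>n\<in>{p..N}. \<Sum>k<2^n. w n k * tree_kernel x y n k) \<le> 28 * M" if pN: "p \<le> N"
  proof -
    define v where "v j = x - c p j" for j
    have sub: "subsum N (\<lambda>n k. w n k * tree_kernel x y n k) p j \<le> M * h p * (2 * y / ((v j)\<^sup>2 + y\<^sup>2))" if j: "j < 2^p" for j
    proof -
      have D: "0 < (v j)\<^sup>2 + y\<^sup>2" using y by (simp add: add_nonneg_pos)
      have "subsum N (\<lambda>n k. w n k * tree_kernel x y n k) p j \<le> (\<Sum>i\<le>N-p. \<Sum>l<2^i. w (p+i) (j*2^i+l) * (2 * y / ((v j)\<^sup>2 + y\<^sup>2)))"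
        unfolding subsum_def
      proof (intro sum_mono mult_left_mono w)
        fix i l :: nat assume l: "l \<in> {..<2^i}"
        define k where "k = j*2^i+l"
        define u where "u = x - c (p+i) k"
        have hpi: "h (p+i) * 2^i = h p" by (simp add: h_def power_add)
        have "c (p+i) k - c p j = h (p+i) * ((real k + 1/2) - (real j + 1/2) * 2^i)"
          unfolding c_def hpi[symmetric] by (simp add: algebra_simps)
        also have "(real k + 1/2) - (real j + 1/2) * 2^i = real l + 1/2 - 2^i/2" by (simp add: k_def algebra_simps)
        finally have "\<bar>c (p+i) k - c p j\<bar> = h (p+i) * \<bar>real l + 1/2 - 2^i/2\<bar>" using h0[of "p+i"] by (simp add: abs_mult)
        also have "\<dots> \<le> h (p+i) * (2^i / 2)"
        proof (intro mult_left_mono)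
          have "real l + 1 \<le> 2^i" using l by (metis Suc_leI add.commute lessThan_iff numeral_power_le_of_nat_cancel_iff of_nat_Suc of_nat_le_iff of_nat_numeral of_nat_power)
          then show "\<bar>real l + 1/2 - 2^i/2\<bar> \<le> 2^i / 2" by (intro abs_leI) auto
        qed (simp add: h0 less_imp_le)
        also have "\<dots> = h p / 2" using hpi by simp
        finally have "\<bar>c (p+i) k - c p j\<bar> \<le> y / 2" using p by linarith
        then have uv: "\<bar>v j\<bar> - y/2 \<le> \<bar>u\<bar>" unfolding v_def u_def by linarith
        \<comment> \<open>The centre of a descendant is within \<open>y / 2\<close> of that of its
          ancestor, which changes the denominator by a factor of at most 2. The kernel then depends
          on the ancestor only.\<close>
        have "(v j)\<^sup>2 + y\<^sup>2 \<le> 2 * (u\<^sup>2 + y\<^sup>2)"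
        proof (cases "\<bar>v j\<bar> \<le> y/2")
          case True
          then have "\<bar>v j\<bar>\<^sup>2 \<le> (y/2)\<^sup>2" by (intro power_mono) auto
          then have "(v j)\<^sup>2 \<le> y\<^sup>2 / 4" by (simp add: power_divide)
          then have "(v j)\<^sup>2 + y\<^sup>2 \<le> y\<^sup>2 / 4 + y\<^sup>2" by simp
          also have "\<dots> \<le> 2 * y\<^sup>2" by simp
          also have "\<dots> \<le> 2 * (u\<^sup>2 + y\<^sup>2)" by simp
          finally show ?thesis .
        next
          case False
          then have "(\<bar>v j\<bar> - y/2)\<^sup>2 \<le> \<bar>u\<bar>\<^sup>2" using uv by (intro power_mono) auto
          then have "0 \<le> 2 * (\<bar>u\<bar>\<^sup>2 - (\<bar>v j\<bar> - y/2)\<^sup>2) + (\<bar>v j\<bar> - y)\<^sup>2 + y\<^sup>2 / 2"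
            by (intro add_nonneg_nonneg mult_nonneg_nonneg) (simp_all only: le_diff_eq, auto)
          moreover have "2 * (u\<^sup>2 + y\<^sup>2) - (V\<^sup>2 + y\<^sup>2) = 2 * (u\<^sup>2 - (V - y/2)\<^sup>2) + (V - y)\<^sup>2 + y\<^sup>2 / 2" for V
            by (simp add: power2_eq_square field_simps)
          from this[of "\<bar>v j\<bar>"] have "2 * (u\<^sup>2 + y\<^sup>2) - ((v j)\<^sup>2 + y\<^sup>2)
              = 2 * (\<bar>u\<bar>\<^sup>2 - (\<bar>v j\<bar> - y/2)\<^sup>2) + (\<bar>v j\<bar> - y)\<^sup>2 + y\<^sup>2 / 2" by simp
          ultimately have "0 \<le> 2 * (u\<^sup>2 + y\<^sup>2) - ((v j)\<^sup>2 + y\<^sup>2)" by metis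
          then show ?thesis by (simp only: diff_ge_0_iff_ge)
        qed
        then have d: "((v j)\<^sup>2 + y\<^sup>2) / 2 \<le> u\<^sup>2 + y\<^sup>2" by simp
        have "tree_kernel x y (p+i) k \<le> y / (u\<^sup>2 + y\<^sup>2)"
          unfolding tk u_def using y h0[of "p+i"]
          by (intro divide_left_mono add_left_mono power_mono mult_pos_pos add_nonneg_pos) auto
        also have "\<dots> \<le> y / (((v j)\<^sup>2 + y\<^sup>2) / 2)"
          using d D y by (intro divide_left_mono mult_pos_pos add_nonneg_pos) auto
        also have "\<dots> = 2 * y / ((v j)\<^sup>2 + y\<^sup>2)" by simp
        finally show "tree_kernel x y (p+i) (j*2^i+l) \<le> 2 * y / ((v j)\<^sup>2 + y\<^sup>2)" by (simp only: k_def)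
      qed
      also have "\<dots> = subsum N w p j * (2 * y / ((v j)\<^sup>2 + y\<^sup>2))"
        unfolding subsum_def by (simp only: sum_distrib_right)
      also have "\<dots> \<le> (M * h p) * (2 * y / ((v j)\<^sup>2 + y\<^sup>2))"
        using M[OF pN j] y D by (intro mult_right_mono) (auto simp: h_def)
      finally show ?thesis .
    qed
    have "(\<Sum>n\<in>{p..N}. \<Sum>k<2^n. w n k * tree_kernel x y n k) = (\<Sum>j<2^p. subsum N (\<lambda>n k. w n k * tree_kernel x y n k) p j)"
      by (rule sum_levels_eq_subsum[OF pN])
    also have "\<dots> \<le> (\<Sum>j<2^p. M * h p * (2 * y / ((v j)\<^sup>2 + y\<^sup>2)))"
      by (intro sum_mono sub) auto
    also have "\<dots> \<le> 28 * M"
    proof (cases p)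
      \<comment> \<open>Here there is a single ancestor, and \<open>y\<close> may be much larger
        than its length. In the other case \<open>y\<close> and \<open>h p\<close> are comparable
        and the sum over ancestors is a Riemann sum.\<close>
      case 0
      have "1 < y" using p 0 by (simp add: h_def)
      have "2 * y / ((v 0)\<^sup>2 + y\<^sup>2) \<le> 2 * y / y\<^sup>2"
        using y by (intro divide_left_mono) (auto intro!: mult_pos_pos add_nonneg_pos)
      also have "\<dots> \<le> 2" using \<open>1 < y\<close> by (simp add: power2_eq_square divide_le_eq)
      finally have "M * (2 * y / ((v 0)\<^sup>2 + y\<^sup>2)) \<le> M * 2" using M0 by (intro mult_left_mono) auto
      then show ?thesis using 0 M0 by (simp add: h_def)
    next
      case (Suc q)
      have "y \<le> 2 * h p" using p'[of q] Suc by (simp add: h_def)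
      have "(\<Sum>j<2^p. M * h p * (2 * y / ((v j)\<^sup>2 + y\<^sup>2))) \<le> (\<Sum>j<2^p. 2 * M * y / h p * (1 / ((x / h p - (real j + 1/2))\<^sup>2 + 1)))"
      proof (intro sum_mono)
        fix j :: nat
        have "2 * y / ((v j)\<^sup>2 + y\<^sup>2) \<le> 2 * y / ((v j)\<^sup>2 + (h p)\<^sup>2)"
          using p y h0[of p] by (intro divide_left_mono add_left_mono power_mono mult_pos_pos add_nonneg_pos) auto
        also have "\<dots> = 2 * y / ((h p)\<^sup>2 * ((x / h p - (real j + 1/2))\<^sup>2 + 1))" by (simp only: scale v_def)
        finally have "M * h p * (2 * y / ((v j)\<^sup>2 + y\<^sup>2)) \<le> M * h p * (2 * y / ((h p)\<^sup>2 * ((x / h p - (real j + 1/2))\<^sup>2 + 1)))"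
          using M0 h0[of p] by (intro mult_left_mono) auto
        also have "\<dots> = 2 * M * y / h p * (1 / ((x / h p - (real j + 1/2))\<^sup>2 + 1))"
          using h0[of p] by (simp add: power2_eq_square)
        finally show "M * h p * (2 * y / ((v j)\<^sup>2 + y\<^sup>2)) \<le> 2 * M * y / h p * (1 / ((x / h p - (real j + 1/2))\<^sup>2 + 1))" .
      qed
      also have "\<dots> = 2 * M * y / h p * (\<Sum>j<2^p. 1 / ((x / h p - (real j + 1/2))\<^sup>2 + 1))"
        by (simp only: sum_distrib_left)
      also have "\<dots> \<le> 2 * M * y / h p * 7"
        using M0 y h0[of p] by (intro mult_left_mono sum_inverse_square_shift_le) auto
      also have "\<dots> = 14 * M * (y / h p)" by simp
      also have "\<dots> \<le> 14 * M * 2"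
        using \<open>y \<le> 2 * h p\<close> M0 h0[of p] by (intro mult_left_mono) (auto simp: field_simps)
      finally show ?thesis by simp
    qed
    finally show ?thesis .
  qed
  let ?s = "\<lambda>n. \<Sum>k<2^n. w n k * tree_kernel x y n k"
  have s0: "0 \<le> ?s n" for n using w tk0 by (intro sum_nonneg mult_nonneg_nonneg)
  have "(\<Sum>n\<le>N. ?s n) = (\<Sum>n\<in>{n. n \<le> N \<and> n < p}. ?s n) + (\<Sum>n\<in>{p..N}. ?s n)"
    by (subst sum.union_disjoint[symmetric]) (auto intro!: sum.cong)
  also have "(\<Sum>n\<in>{n. n \<le> N \<and> n < p}. ?s n) = (\<Sum>n<p. if n \<le> N then ?s n else 0)"
    by (simp add: sum.If_cases) (auto intro!: sum.cong)
  also have "\<dots> + (\<Sum>n\<in>{p..N}. ?s n) \<le> 14 * M + 28 * M"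
    using coarse fine M0 by (cases "p \<le> N") auto
  also have "\<dots> \<le> 60 * M" using M0 by simp
  finally show ?thesis .
qed

section \<open>Hysteresis states on the dyadic tree\<close>

definition strict_desc :: "nat \<Rightarrow> nat \<Rightarrow> nat \<Rightarrow> nat \<Rightarrow> bool" where
  "strict_desc n k l j \<longleftrightarrow> n < l \<and> j div 2^(l-n) = k"

definition antichain :: "(nat \<times> nat) set \<Rightarrow> bool" where
  "antichain S \<longleftrightarrow> (\<forall>(l,j)\<in>S. \<forall>(l',j')\<in>S. \<not> strict_desc l j l' j')"

definition node_mass :: "(nat \<times> nat) set \<Rightarrow> real" where
  "node_mass S = (\<Sum>(l,j)\<in>S. 1 / 2^l)"

lemma div_power_Suc_two: "(j::nat) div 2^(Suc i) = j div 2^i div 2"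
  by (simp add: power_Suc2 div_mult2_eq del: power_Suc)

text \<open>Intervals of an antichain do not overlap, so their lengths inside a node add up to at
  most its length: a chosen node excludes its descendants, otherwise the two halves are treated
  separately.\<close>

lemma subsum_antichain:
  assumes S: "antichain S" and n: "n \<le> N"
  shows "subsum N (\<lambda>l j. if (l,j) \<in> S then 1/2^l else 0) n k \<le> 1/2^n"
  using n
proof (induction "N - n" arbitrary: n k)
  case 0
  then show ?case by (simp add: subsum_leaf)
next
  case (Suc d)
  let ?w = "\<lambda>l j. if (l,j) \<in> S then 1/2^l else (0::real)"
  have n: "n < N" using Suc.hyps(2) by simp
  show ?case
  proof (cases "(n,k) \<in> S")
    case True
    have zero: "?w l j = 0" if "strict_desc n k l j" for l j
      using S True that unfolding antichain_def by fastforce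
    have "subsum N ?w n k = (\<Sum>j<2^0. ?w (n+0) (k*2^0+j)) + (\<Sum>i\<in>{1..N-n}. \<Sum>j<2^i. ?w (n+i) (k*2^i+j))"
      unfolding subsum_def atMost_atLeast0 by (subst sum.atLeast_Suc_atMost) auto
    also have "(\<Sum>i\<in>{1..N-n}. \<Sum>j<2^i. ?w (n+i) (k*2^i+j)) = 0"
      by (intro sum.neutral ballI zero) (auto simp: strict_desc_def)
    finally show ?thesis using True by simp
  next
    case False
    have "subsum N ?w n k = subsum N ?w (Suc n) (2*k) + subsum N ?w (Suc n) (2*k+1)"
      using subsum_children[OF n, of ?w k] False by simp
    also have "\<dots> \<le> 1/2^Suc n + 1/2^Suc n"
      using Suc.hyps n by (intro add_mono Suc.hyps(1)) auto
    finally show ?thesis by simp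
  qed
qed

text \<open>A state moves up when \<open>a\<close> reaches its threshold and down when \<open>b\<close> reaches the complementary one.
  As the product of \<open>a\<close> and \<open>b\<close> is tiny, the two conditions exclude each other; as the thresholds grow fast,
  a change of state forces large values on a set of nodes that is small by the Carleson embedding.\<close>

fun hyst_state :: "(nat \<Rightarrow> nat \<Rightarrow> real) \<Rightarrow> (nat \<Rightarrow> nat \<Rightarrow> real) \<Rightarrow> (nat \<Rightarrow> real) \<Rightarrow> nat \<Rightarrow> nat \<Rightarrow> nat \<Rightarrow> nat" where
  "hyst_state a b \<alpha> m 0 k = 0"
| "hyst_state a b \<alpha> m (Suc n) k =
     (let s = hyst_state a b \<alpha> m n (k div 2) in
      if s < m \<and> \<alpha> s \<le> a (Suc n) k then Suc s
      else if 0 < s \<and> \<alpha> (m - s) \<le> b (Suc n) k then s - 1 else s)"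

declare hyst_state.simps(2) [simp del]

text \<open>Abstracts the two defects at dyadic points: \<open>a\<close> belongs to
  \<open>\<Theta>\<close>, \<open>b\<close> to \<open>f\<close>. The factors 8 and 64 are Harnack
  bounds for children and neighbours, \<open>a_mass\<close> and \<open>b_mass\<close> express the
  Carleson embedding, and \<open>C1\<close> and \<open>C2\<close> turn its masses into quarters.
  \<open>root\<close>, \<open>left\<close> and \<open>right\<close> keep the state 0 on the border
  of the tree.\<close>

locale hysteresis =
  fixes a b :: "nat \<Rightarrow> nat \<Rightarrow> real" and \<alpha> :: "nat \<Rightarrow> real" and m N :: nat and \<tau> C :: real
  assumes m: "1 \<le> m" and \<alpha>0: "0 < \<alpha> 0" and \<alpha>_step: "\<And>i. Suc i < m \<Longrightarrow> 64 * \<alpha> i \<le> \<alpha> (Suc i)"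
    and a0: "\<And>n k. 0 \<le> a n k" and b0: "\<And>n k. 0 \<le> b n k"
    and ab: "\<And>n k. a n k * b n k \<le> \<tau>" and \<tau>: "0 < \<tau>" "\<tau> < \<alpha> 0 * \<alpha> 0" and C: "0 \<le> C"
    and C1: "\<And>i. Suc i < m \<Longrightarrow> C * sqrt (8 * \<alpha> i) \<le> \<alpha> (Suc i) / 4"
    and C2: "C * sqrt (\<tau> / \<alpha> 0) \<le> \<alpha> 0 / 4"
    and a_child: "\<And>n k. a (Suc n) k \<le> 8 * a n (k div 2)"
    and b_child: "\<And>n k. b (Suc n) k \<le> 8 * b n (k div 2)"
    and a_nbr: "\<And>n k. a n k \<le> 64 * a n (Suc k)" "\<And>n k. a n (Suc k) \<le> 64 * a n k"
    and b_nbr: "\<And>n k. b n k \<le> 64 * b n (Suc k)" "\<And>n k. b n (Suc k) \<le> 64 * b n k"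
    and a_mass: "\<And>n k S x y. finite S \<Longrightarrow> antichain S \<Longrightarrow> (\<And>l j. (l,j) \<in> S \<Longrightarrow> l \<le> N \<and> strict_desc n k l j \<and> y \<le> a l j)
       \<Longrightarrow> k < 2^n \<Longrightarrow> 0 < x \<Longrightarrow> a n k \<le> x \<Longrightarrow> 0 < y \<Longrightarrow> node_mass S \<le> C * sqrt x / y / 2^n"
    and b_mass: "\<And>n k S x y. finite S \<Longrightarrow> antichain S \<Longrightarrow> (\<And>l j. (l,j) \<in> S \<Longrightarrow> l \<le> N \<and> strict_desc n k l j \<and> y \<le> b l j)
       \<Longrightarrow> k < 2^n \<Longrightarrow> 0 < x \<Longrightarrow> b n k \<le> x \<Longrightarrow> 0 < y \<Longrightarrow> node_mass S \<le> C * sqrt x / y / 2^n"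
    and root: "\<And>k. a 0 k < \<alpha> 0"
    and left: "\<And>n. a n 0 < \<alpha> 0" and right: "\<And>n. a n (2^n - 1) < \<alpha> 0"
begin

abbreviation st :: "nat \<Rightarrow> nat \<Rightarrow> nat" where "st \<equiv> hyst_state a b \<alpha> m"

definition ev :: "nat \<Rightarrow> nat \<Rightarrow> bool" where
  "ev n k \<longleftrightarrow> 0 < n \<and> st n k \<noteq> st (n - 1) (k div 2)"

lemma \<alpha>_pos: "i < m \<Longrightarrow> 0 < \<alpha> i"
proof (induction i)
  case (Suc i)
  then have "0 < \<alpha> i" by simp
  then have "0 < 64 * \<alpha> i" by simp
  also have "\<dots> \<le> \<alpha> (Suc i)" using Suc.prems by (rule \<alpha>_step)
  finally show ?case .
qed (use \<alpha>0 in auto)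

lemma \<alpha>_mono: "i \<le> j \<Longrightarrow> j < m \<Longrightarrow> \<alpha> i \<le> \<alpha> j"
proof (induction j rule: dec_induct)
  case (step j)
  have "\<alpha> j \<le> 64 * \<alpha> j" using \<alpha>_pos[of j] step by simp
  also have "\<dots> \<le> \<alpha> (Suc j)" using step by (intro \<alpha>_step)
  finally show ?case using step by simp
qed simp

text \<open>As \<open>\<tau>\<close> is below the square of the smallest threshold, one defect
  reaching any threshold forces the other below all of them.\<close>

lemma other_small:
  assumes "\<alpha> i \<le> x" "i < m" "x * y \<le> \<tau>" "0 \<le> y" "j < m"
  shows "y \<le> \<tau> / \<alpha> 0" "y < \<alpha> j"
proof -
  have "\<alpha> 0 * y \<le> x * y"
    using assms \<alpha>_mono[of 0 i] by (intro mult_right_mono) auto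
  then have "\<alpha> 0 * y \<le> \<tau>" using assms by simp
  then show y: "y \<le> \<tau> / \<alpha> 0" using \<alpha>0 by (simp add: field_simps)
  have "\<tau> / \<alpha> 0 < \<alpha> 0" using \<tau> \<alpha>0 by (simp add: field_simps)
  with y \<alpha>_mono[of 0 j] assms show "y < \<alpha> j" by simp
qed

lemma st_Suc_cases:
  obtains (up) "st n (k div 2) < m" "\<alpha> (st n (k div 2)) \<le> a (Suc n) k" "st (Suc n) k = Suc (st n (k div 2))"
  | (down) "0 < st n (k div 2)" "\<alpha> (m - st n (k div 2)) \<le> b (Suc n) k" "Suc (st (Suc n) k) = st n (k div 2)"
  | (same) "st n (k div 2) < m \<Longrightarrow> a (Suc n) k < \<alpha> (st n (k div 2))" "0 < st n (k div 2) \<Longrightarrow> b (Suc n) k < \<alpha> (m - st n (k div 2))"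
     "st (Suc n) k = st n (k div 2)"
  by (cases "st n (k div 2) < m \<and> \<alpha> (st n (k div 2)) \<le> a (Suc n) k";
      cases "0 < st n (k div 2) \<and> \<alpha> (m - st n (k div 2)) \<le> b (Suc n) k") (auto simp: hyst_state.simps(2) Let_def)

lemma st_le_m: "st n k \<le> m"
proof (induction n arbitrary: k)
  case (Suc n)
  show ?case by (cases rule: st_Suc_cases[of n k]) (use Suc[of "k div 2"] in auto)
qed simp

text \<open>From parent to child a defect grows by a factor of at most 8, while successive
  thresholds differ by a factor of at least 64; two thresholds are never passed at once, and a move
  by one step restores the bound. The defect that did not trigger the move is handled by
  \<open>other_small\<close>.\<close>

lemma invariant: "(st n k < m \<longrightarrow> a n k < \<alpha> (st n k)) \<and> (0 < st n k \<longrightarrow> b n k < \<alpha> (m - st n k))"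
proof (induction n arbitrary: k)
  case 0
  then show ?case using root by simp
next
  case (Suc n)
  let ?s = "st n (k div 2)"
  have IH: "?s < m \<Longrightarrow> a n (k div 2) < \<alpha> ?s" "0 < ?s \<Longrightarrow> b n (k div 2) < \<alpha> (m - ?s)" using Suc by auto
  show ?case
  proof (cases rule: st_Suc_cases[of n k])
    case up
    have "a (Suc n) k < \<alpha> (Suc ?s)" if "Suc ?s < m"
    proof -
      have "a (Suc n) k \<le> 8 * a n (k div 2)" by (rule a_child)
      also have "\<dots> < 8 * \<alpha> ?s" using IH(1) up by simp
      also have "\<dots> \<le> 64 * \<alpha> ?s" using \<alpha>_pos[of ?s] up by simp
      also have "\<dots> \<le> \<alpha> (Suc ?s)" using that by (rule \<alpha>_step)
      finally show ?thesis .
    qed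
    moreover have "b (Suc n) k < \<alpha> (m - Suc ?s)"
      using up m by (intro other_small(2)[OF up(2) up(1) ab b0]) auto
    ultimately show ?thesis using up by simp
  next
    case down
    let ?r = "st (Suc n) k"
    have r: "?s = Suc ?r" using down by simp
    have sm: "?s \<le> m" by (rule st_le_m)
    have "b (Suc n) k < \<alpha> (m - ?r)" if "0 < ?r"
    proof -
      have e: "m - ?r = Suc (m - ?s)" using r sm by simp
      have "b (Suc n) k \<le> 8 * b n (k div 2)" by (rule b_child)
      also have "\<dots> < 8 * \<alpha> (m - ?s)" using IH(2) down by simp
      also have "\<dots> \<le> 64 * \<alpha> (m - ?s)" using \<alpha>_pos[of "m - ?s"] down m by simp
      also have "\<dots> \<le> \<alpha> (m - ?r)" unfolding e using that r sm by (intro \<alpha>_step) auto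
      finally show ?thesis .
    qed
    moreover have "a (Suc n) k < \<alpha> ?r"
    proof (rule other_small(2)[OF down(2)])
      show "b (Suc n) k * a (Suc n) k \<le> \<tau>" using ab[of "Suc n" k] by (simp add: mult.commute)
      show "m - ?s < m" using down(1) m by simp
      show "?r < m" using r sm by linarith
    qed (rule a0)
    ultimately show ?thesis by simp
  next
    case same
    then show ?thesis by simp
  qed
qed

text \<open>If the states differed by two, one of the two nodes would just have moved away from the
  other, triggered by a value that the factor 64 transfers to the neighbour, against the neighbour's
  invariant. Hence horizontal jumps of the state function are single steps.\<close>

lemma neighbour_states: "st n k \<le> Suc (st n (Suc k)) \<and> st n (Suc k) \<le> Suc (st n k)"
proof (induction n arbitrary: k)
  case 0
  then show ?case by simp
next
  case (Suc n)
  have par: "st n (k div 2) \<le> Suc (st n (Suc k div 2)) \<and> st n (Suc k div 2) \<le> Suc (st n (k div 2))"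
  proof (cases "even k")
    case True
    then have "Suc k div 2 = k div 2" by simp
    then show ?thesis by simp
  next
    case False
    then have "Suc k div 2 = Suc (k div 2)" by (auto elim!: oddE)
    then show ?thesis using Suc by simp
  qed
  have main: "st (Suc n) p \<le> Suc (st (Suc n) q)"
    if pq: "a (Suc n) p \<le> 64 * a (Suc n) q" "b (Suc n) q \<le> 64 * b (Suc n) p"
      and par: "st n (p div 2) \<le> Suc (st n (q div 2))" for p q
  proof (rule ccontr)
    assume "\<not> ?thesis"
    then have c: "Suc (Suc (st (Suc n) q)) \<le> st (Suc n) p" by simp
    have invp: "0 < st (Suc n) p \<Longrightarrow> b (Suc n) p < \<alpha> (m - st (Suc n) p)"
      and invq: "st (Suc n) q < m \<Longrightarrow> a (Suc n) q < \<alpha> (st (Suc n) q)" using invariant by auto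
    have lm: "st (Suc n) p \<le> m" by (rule st_le_m)
    have "Suc (st n (p div 2)) = st (Suc n) p \<and> \<alpha> (st n (p div 2)) \<le> a (Suc n) p
        \<or> st n (q div 2) = Suc (st (Suc n) q) \<and> \<alpha> (m - st n (q div 2)) \<le> b (Suc n) q"
      by (cases rule: st_Suc_cases[of n p]; cases rule: st_Suc_cases[of n q]) (use c par in auto)
    then show False
    proof (elim disjE conjE)
      assume s: "Suc (st n (p div 2)) = st (Suc n) p" and al: "\<alpha> (st n (p div 2)) \<le> a (Suc n) p"
      let ?s = "st n (p div 2)" and ?q = "st (Suc n) q"
      have q: "Suc ?q \<le> ?s" "?s < m" using c s lm by auto
      have "\<alpha> ?s \<le> 64 * a (Suc n) q" using al pq by linarith
      also have "\<dots> < 64 * \<alpha> ?q" using invq q by simp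
      also have "\<dots> \<le> \<alpha> (Suc ?q)" using q by (intro \<alpha>_step) auto
      also have "\<dots> \<le> \<alpha> ?s" using q by (intro \<alpha>_mono)
      finally show False by simp
    next
      assume s: "st n (q div 2) = Suc (st (Suc n) q)" and al: "\<alpha> (m - st n (q div 2)) \<le> b (Suc n) q"
      let ?s = "st n (q div 2)" and ?p = "st (Suc n) p"
      have q: "Suc ?s \<le> ?p" "0 < ?p" "0 < ?s" using c s by auto
      have "\<alpha> (m - ?s) \<le> 64 * b (Suc n) p" using al pq by linarith
      also have "\<dots> < 64 * \<alpha> (m - ?p)" using invp q by simp
      also have "\<dots> \<le> \<alpha> (Suc (m - ?p))" using q lm by (intro \<alpha>_step) auto
      also have "\<dots> \<le> \<alpha> (m - ?s)" using q lm by (intro \<alpha>_mono) auto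
      finally show False by simp
    qed
  qed
  show ?case
    using main[of k "Suc k"] main[of "Suc k" k] par a_nbr b_nbr by auto
qed

lemma left_state: "st n 0 = 0"
proof (induction n)
  case (Suc n)
  then show ?case using left[of "Suc n"] m by (simp add: hyst_state.simps(2) Let_def)
qed simp

lemma right_state: "st n (2^n - 1) = 0"
proof (induction n)
  case (Suc n)
  have "(2^Suc n - 1) div 2 = (2::nat)^n - 1"
  proof -
    have "(2 * x - 1) div 2 = x - 1" for x :: nat by (cases x) auto
    then show ?thesis by simp
  qed
  then show ?case using Suc right[of "Suc n"] m by (simp add: hyst_state.simps(2) Let_def)
qed simp

text \<open>A stopping-time family: along each branch below \<open>(n, k)\<close> only the first
  change of state is kept, which makes it an antichain.\<close>

fun first_ev :: "nat \<Rightarrow> nat \<Rightarrow> nat \<Rightarrow> (nat \<times> nat) set" where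
  "first_ev 0 n k = {}"
| "first_ev (Suc d) n k =
     (if ev (Suc n) (2*k) then {(Suc n, 2*k)} else first_ev d (Suc n) (2*k)) \<union>
     (if ev (Suc n) (2*k+1) then {(Suc n, 2*k+1)} else first_ev d (Suc n) (2*k+1))"

lemma finite_first_ev: "finite (first_ev d n k)"
  by (induction d arbitrary: n k) auto

lemma strict_desc_step:
  assumes "strict_desc (Suc n) c l j" "c div 2 = k"
  shows "strict_desc n k l j"
proof -
  have "Suc n < l" using assms(1) by (simp add: strict_desc_def)
  then have "l - n = Suc (l - Suc n)" by arith
  then have "j div 2^(l-n) = (j div 2^(l - Suc n)) div 2" by (simp only: div_power_Suc_two)
  then show ?thesis using assms by (simp add: strict_desc_def)
qed

text \<open>Nothing changes before a first event, so its parent still has the state of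
  \<open>(n, k)\<close>. This tells which threshold was reached.\<close>

lemma first_ev_D:
  "(l,j) \<in> first_ev d n k \<Longrightarrow> ev l j \<and> strict_desc n k l j \<and> l \<le> n + d \<and> st (l - 1) (j div 2) = st n k"
proof (induction d arbitrary: n k)
  case (Suc d)
  have child: "(l,j) \<in> (if ev (Suc n) c then {(Suc n, c)} else first_ev d (Suc n) c) \<Longrightarrow> c div 2 = k \<Longrightarrow>
      ev l j \<and> strict_desc n k l j \<and> l \<le> n + Suc d \<and> st (l - 1) (j div 2) = st n k" for c
  proof (cases "ev (Suc n) c")
    case True
    assume "(l,j) \<in> (if ev (Suc n) c then {(Suc n, c)} else first_ev d (Suc n) c)" "c div 2 = k"
    then show ?thesis using True by (auto simp: strict_desc_def)
  next
    case False
    assume "(l,j) \<in> (if ev (Suc n) c then {(Suc n, c)} else first_ev d (Suc n) c)" and c: "c div 2 = k"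
    then have i: "(l,j) \<in> first_ev d (Suc n) c" using False by simp
    have "st (Suc n) c = st n k" using False c by (simp add: ev_def del: hyst_state.simps)
    then show ?thesis using Suc.IH[OF i] strict_desc_step[OF _ c] by auto
  qed
  show ?case using Suc.prems child[of "2*k"] child[of "2*k+1"] by auto
qed simp

lemma strict_desc_unique:
  assumes "strict_desc n k l j" "strict_desc n k' l j" shows "k = k'"
  using assms by (simp add: strict_desc_def)

lemma strict_desc_trans:
  assumes "strict_desc n k l j" "strict_desc l j l' j'" shows "strict_desc n k l' j'"
proof -
  have "l' - n = (l' - l) + (l - n)" using assms by (simp add: strict_desc_def)
  then have "j' div 2^(l'-n) = (j' div 2^(l'-l)) div 2^(l-n)" by (simp add: power_add div_mult2_eq)
  then show ?thesis using assms by (simp add: strict_desc_def)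
qed

lemma first_ev_antichain: "antichain (first_ev d n k)"
proof (induction d arbitrary: n k)
  case 0
  then show ?case by (simp add: antichain_def)
next
  case (Suc d)
  define F where "F c = (if ev (Suc n) c then {(Suc n, c)} else first_ev d (Suc n) c)" for c
  have anc: "(l,j) \<in> F c \<Longrightarrow> (l,j) = (Suc n, c) \<or> strict_desc (Suc n) c l j" for c l j
    unfolding F_def using first_ev_D by (auto split: if_splits)
  have "\<not> strict_desc l j l' j'" if x: "(l,j) \<in> F c" and y: "(l',j') \<in> F c'" for l j l' j' c c'
  proof
    assume d: "strict_desc l j l' j'"
    have "strict_desc (Suc n) c l' j'" using anc[OF x] d strict_desc_trans by blast
    then have "c = c'" using anc[OF y] strict_desc_unique by (auto simp: strict_desc_def)
    show False
    proof (cases "ev (Suc n) c")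
      case True
      then show False using x y d \<open>c = c'\<close> by (auto simp: F_def strict_desc_def)
    next
      case False
      then show False using x y d \<open>c = c'\<close> Suc.IH[of "Suc n" c] by (auto simp: F_def antichain_def)
    qed
  qed
  then have "antichain (F (2*k) \<union> F (2*k+1))" unfolding antichain_def by blast
  moreover have "first_ev (Suc d) n k = F (2*k) \<union> F (2*k+1)" by (simp only: first_ev.simps F_def)
  ultimately show ?case by simp
qed

definition first_mass :: "nat \<Rightarrow> nat \<Rightarrow> nat \<Rightarrow> real" where
  "first_mass d n k = node_mass (first_ev d n k)"

lemma first_mass_Suc:
  "first_mass (Suc d) n k =
     (if ev (Suc n) (2*k) then 1/2^Suc n else first_mass d (Suc n) (2*k)) +
     (if ev (Suc n) (2*k+1) then 1/2^Suc n else first_mass d (Suc n) (2*k+1))"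
proof -
  define F where "F c = (if ev (Suc n) c then {(Suc n, c)} else first_ev d (Suc n) c)" for c
  have anc: "(l,j) \<in> F c \<Longrightarrow> Suc n \<le> l \<and> j div 2^(l - Suc n) = c" for c l j
    unfolding F_def using first_ev_D[of l j d "Suc n" c] by (auto simp: strict_desc_def split: if_splits)
  have "F (2*k) \<inter> F (2*k+1) = {}"
  proof (rule ccontr)
    assume "F (2*k) \<inter> F (2*k+1) \<noteq> {}"
    then obtain l j where "(l,j) \<in> F (2*k)" "(l,j) \<in> F (2*k+1)" by auto
    then have "2*k = 2*k+1" using anc by metis
    then show False by simp
  qed
  then have "node_mass (F (2*k) \<union> F (2*k+1)) = node_mass (F (2*k)) + node_mass (F (2*k+1))"
    unfolding node_mass_def by (intro sum.union_disjoint) (auto simp: F_def finite_first_ev)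
  moreover have "node_mass (F c) = (if ev (Suc n) c then 1/2^Suc n else first_mass d (Suc n) c)" for c
    by (simp add: F_def node_mass_def first_mass_def)
  moreover have "first_ev (Suc d) n k = F (2*k) \<union> F (2*k+1)" by (simp only: first_ev.simps F_def)
  ultimately show ?thesis by (simp only: first_mass_def[of "Suc d"])
qed

lemma first_mass_le: "first_mass d n k \<le> 1/2^n"
proof (induction d arbitrary: n k)
  case 0
  then show ?case by (simp add: first_mass_def node_mass_def)
next
  case (Suc d)
  have "(if ev (Suc n) c then 1/2^Suc n else first_mass d (Suc n) c) \<le> 1/2^Suc n" for c
    using Suc[of "Suc n" c] by simp
  from add_mono[OF this[of "2*k"] this[of "2*k+1"]] show ?case unfolding first_mass_Suc by simp
qed


lemma antichain_subset: "antichain S \<Longrightarrow> T \<subseteq> S \<Longrightarrow> antichain T"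
  unfolding antichain_def by blast

lemma quarter:
  assumes "C * sqrt x \<le> y / 4" "0 < y"
  shows "C * sqrt x / y / 2^n \<le> 1/4 / 2^n"
proof -
  have "C * sqrt x / y \<le> 1/4" using assms by (simp add: field_simps)
  then show ?thesis by (rule divide_right_mono) simp
qed

text \<open>Just after a change both defects are far below what the next change requires: the one
  that caused it is at most 8 times the threshold passed, the other at most
  \<open>\<tau> / \<alpha> 0\<close>. By the mass bounds, next moves up and next moves down each
  cover at most a quarter of the interval.\<close>

lemma event_first_mass:
  assumes ev: "ev n k" and k: "k < 2^n" and N: "n + d \<le> N"
  shows "first_mass d n k \<le> 1/2 / 2^n"
proof -
  obtain n' where n: "n = Suc n'" using ev unfolding ev_def by (metis gr0_conv_Suc)
  define s where "s = st n k"
  define S where "S = first_ev d n k"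
  have sm: "s \<le> m" unfolding s_def by (rule st_le_m)
  define S1 where "S1 = {(l,j)\<in>S. s < m \<and> \<alpha> s \<le> a l j}"
  define S2 where "S2 = {(l,j)\<in>S. 0 < s \<and> \<alpha> (m - s) \<le> b l j}"
  have SD: "(l,j) \<in> S \<Longrightarrow> ev l j \<and> strict_desc n k l j \<and> l \<le> N \<and> st (l - 1) (j div 2) = s" for l j
    using first_ev_D[of l j d n k] N by (auto simp: S_def s_def)
  have finS: "finite S" by (simp add: S_def finite_first_ev)
  have sub: "S1 \<subseteq> S" "S2 \<subseteq> S" by (auto simp: S1_def S2_def)
  have "S \<subseteq> S1 \<union> S2"
  proof
    fix x assume xS: "x \<in> S"
    obtain l j where x: "x = (l,j)" by (cases x)
    have D: "ev l j" "st (l - 1) (j div 2) = s" using SD xS x by auto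
    obtain l' where l: "l = Suc l'" using D(1) unfolding ev_def by (metis gr0_conv_Suc)
    have "\<not> st (Suc l') j = st l' (j div 2)" using D(1) by (simp add: ev_def l)
    then have "(s < m \<and> \<alpha> s \<le> a l j) \<or> (0 < s \<and> \<alpha> (m - s) \<le> b l j)"
      using D(2) unfolding l by (cases rule: st_Suc_cases[of l' j]) simp_all
    then show "x \<in> S1 \<union> S2" using xS x by (auto simp: S1_def S2_def)
  qed
  then have S12: "S = S1 \<union> S2" using sub by blast
  have up_mass: "node_mass S1 \<le> 1/4 / 2^n" if "s < m" "0 < x" "a n k \<le> x" "C * sqrt x \<le> \<alpha> s / 4" for x
  proof -
    have "node_mass S1 \<le> C * sqrt x / \<alpha> s / 2^n"
    proof (rule a_mass)
      show "antichain S1" using antichain_subset[OF first_ev_antichain] sub(1) unfolding S_def .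
      show "finite S1" using finite_subset[OF sub(1) finS] .
      fix l j assume "(l,j) \<in> S1"
      then show "l \<le> N \<and> strict_desc n k l j \<and> \<alpha> s \<le> a l j" using SD by (auto simp: S1_def)
    qed (use that k \<alpha>_pos in auto)
    also have "\<dots> \<le> 1/4 / 2^n" using that \<alpha>_pos[of s] by (intro quarter) auto
    finally show ?thesis .
  qed
  have down_mass: "node_mass S2 \<le> 1/4 / 2^n" if "0 < s" "0 < x" "b n k \<le> x" "C * sqrt x \<le> \<alpha> (m - s) / 4" for x
  proof -
    have pos: "0 < \<alpha> (m - s)" using that m by (intro \<alpha>_pos) auto
    have "node_mass S2 \<le> C * sqrt x / \<alpha> (m - s) / 2^n"
    proof (rule b_mass)
      show "antichain S2" using antichain_subset[OF first_ev_antichain] sub(2) unfolding S_def .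
      show "finite S2" using finite_subset[OF sub(2) finS] .
      fix l j assume "(l,j) \<in> S2"
      then show "l \<le> N \<and> strict_desc n k l j \<and> \<alpha> (m - s) \<le> b l j" using SD by (auto simp: S2_def)
    qed (use that k pos in auto)
    also have "\<dots> \<le> 1/4 / 2^n" using that pos by (intro quarter) auto
    finally show ?thesis .
  qed
  have up0: "node_mass S1 \<le> 1/4 / 2^n" if "\<not> s < m" using that by (simp add: S1_def node_mass_def)
  have down0: "node_mass S2 \<le> 1/4 / 2^n" if "\<not> 0 < s" using that by (simp add: S2_def node_mass_def)
  have \<tau>\<alpha>: "0 < \<tau> / \<alpha> 0" using \<tau> \<alpha>0 by simp
  have C2': "C * sqrt (\<tau> / \<alpha> 0) \<le> \<alpha> i / 4" if "i < m" for i
    using C2 \<alpha>_mono[of 0 i] that by simp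
  have "node_mass S1 \<le> 1/4 / 2^n \<and> node_mass S2 \<le> 1/4 / 2^n"
  proof (cases rule: st_Suc_cases[of n' k])
    case up
    let ?s0 = "st n' (k div 2)"
    have s: "s = Suc ?s0" using up(3) by (simp add: s_def n)
    have "node_mass S1 \<le> 1/4 / 2^n"
    proof (cases "s < m")
      case True
      have "a n k \<le> 8 * a n' (k div 2)" unfolding n by (rule a_child)
      also have "\<dots> \<le> 8 * \<alpha> ?s0" using invariant[of n' "k div 2"] up(1) by simp
      finally show ?thesis
        using True s C1[of ?s0] \<alpha>_pos[of ?s0] up(1) by (intro up_mass[of "8 * \<alpha> ?s0"]) auto
    qed (rule up0)
    moreover have "node_mass S2 \<le> 1/4 / 2^n"
    proof (cases "0 < s")
      case True
      have "b n k \<le> \<tau> / \<alpha> 0"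
        using other_small(1)[OF up(2,1) ab b0, of 0] m by (simp add: n)
      then show ?thesis using True \<tau>\<alpha> C2'[of "m - s"] m by (intro down_mass) auto
    qed (rule down0)
    ultimately show ?thesis ..
  next
    case down
    let ?s0 = "st n' (k div 2)"
    have s: "?s0 = Suc s" using down(3) by (simp add: s_def n)
    have s0m: "?s0 \<le> m" by (rule st_le_m)
    have "node_mass S2 \<le> 1/4 / 2^n"
    proof (cases "0 < s")
      case True
      have e: "m - s = Suc (m - ?s0)" using s s0m by linarith
      have "b n k \<le> 8 * b n' (k div 2)" unfolding n by (rule b_child)
      also have "\<dots> \<le> 8 * \<alpha> (m - ?s0)" using invariant[of n' "k div 2"] down(1) by simp
      finally have "b n k \<le> 8 * \<alpha> (m - ?s0)" .
      moreover have "Suc (m - ?s0) < m" using True s s0m by linarith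
      moreover have "0 < \<alpha> (m - ?s0)" using down(1) m by (intro \<alpha>_pos) auto
      ultimately show ?thesis
        using True C1[of "m - ?s0"] e by (intro down_mass[of "8 * \<alpha> (m - ?s0)"]) auto
    qed (rule down0)
    moreover have "node_mass S1 \<le> 1/4 / 2^n"
    proof (cases "s < m")
      case True
      have "a n k \<le> \<tau> / \<alpha> 0"
      proof (rule other_small(1)[OF down(2)])
        show "b (Suc n') k * a n k \<le> \<tau>" using ab[of n k] by (simp add: mult.commute n)
        show "m - ?s0 < m" using down(1) m by simp
        show "0 < m" using m by simp
      qed (rule a0)
      then show ?thesis using True \<tau>\<alpha> C2'[of s] by (intro up_mass) auto
    qed (rule up0)
    ultimately show ?thesis by simp
  next
    case same
    then show ?thesis using ev by (simp add: ev_def n)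
  qed
  moreover have "node_mass S \<le> node_mass S1 + node_mass S2"
    unfolding S12 node_mass_def using finite_subset[OF sub(1) finS] finite_subset[OF sub(2) finS]
    by (subst sum_Un) (auto intro!: sum_nonneg)
  ultimately show ?thesis by (simp add: first_mass_def S_def[symmetric])
qed

fun desc_mass :: "nat \<Rightarrow> nat \<Rightarrow> nat \<Rightarrow> real" where
  "desc_mass 0 n k = 0"
| "desc_mass (Suc d) n k =
     ((if ev (Suc n) (2*k) then 1/2^Suc n else 0) + desc_mass d (Suc n) (2*k)) +
     ((if ev (Suc n) (2*k+1) then 1/2^Suc n else 0) + desc_mass d (Suc n) (2*k+1))"

text \<open>A geometric series: after every event the following first events have at most half its
  length, so all events together have at most twice the length of the first ones.\<close>

lemma desc_mass_le: "k < 2^n \<Longrightarrow> n + d \<le> N \<Longrightarrow> desc_mass d n k \<le> 2 * first_mass d n k"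
proof (induction d arbitrary: n k)
  case 0
  then show ?case by (simp add: first_mass_def node_mass_def)
next
  case (Suc d)
  have child: "(if ev (Suc n) c then 1/2^Suc n else 0) + desc_mass d (Suc n) c
      \<le> 2 * (if ev (Suc n) c then 1/2^Suc n else first_mass d (Suc n) c)" if c: "c < 2^Suc n" for c
  proof -
    have IH: "desc_mass d (Suc n) c \<le> 2 * first_mass d (Suc n) c" using Suc.prems c by (intro Suc.IH) auto
    show ?thesis
    proof (cases "ev (Suc n) c")
      case True
      have "first_mass d (Suc n) c \<le> 1/2 / 2^Suc n" using Suc.prems by (intro event_first_mass True c) auto
      then have "desc_mass d (Suc n) c \<le> 1 / 2^Suc n" using IH by simp
      then show ?thesis using True by simp
    qed (use IH in simp)
  qed
  show ?case
    unfolding desc_mass.simps first_mass_Suc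
    using child[of "2*k"] child[of "2*k+1"] Suc.prems(1) by simp
qed

definition wE :: "nat \<Rightarrow> nat \<Rightarrow> real" where "wE n k = (if ev n k then 1/2^n else 0)"

lemma subsum_wE: "n \<le> N \<Longrightarrow> subsum N wE n k = wE n k + desc_mass (N - n) n k"
proof (induction "N - n" arbitrary: n k)
  case 0
  then show ?case by (simp add: subsum_leaf)
next
  case (Suc d)
  have n: "n < N" using Suc.hyps(2) by simp
  have d: "N - n = Suc d" "N - Suc n = d" using Suc.hyps(2) by auto
  show ?case
    unfolding subsum_children[OF n] d
    using Suc.hyps(1)[of "Suc n"] d n by (simp add: wE_def)
qed

lemma subsum_wE_le: "n \<le> N \<Longrightarrow> k < 2^n \<Longrightarrow> subsum N wE n k \<le> 3 / 2^n"
proof -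
  assume n: "n \<le> N" and k: "k < 2^n"
  have "desc_mass (N - n) n k \<le> 2 * first_mass (N - n) n k" using n by (intro desc_mass_le k) auto
  also have "\<dots> \<le> 2 * (1 / 2^n)" by (intro mult_left_mono first_mass_le) simp
  finally have "wE n k + desc_mass (N - n) n k \<le> 1 / 2^n + 2 * (1 / 2^n)"
    by (intro add_mono) (auto simp: wE_def)
  then show ?thesis using subsum_wE[OF n] by simp
qed

section \<open>Jumps between horizontal neighbours\<close>

definition side_jump :: "nat \<Rightarrow> nat \<Rightarrow> real" where
  "side_jump n k = (if 0 < k \<and> st n (k - 1) \<noteq> st n k then 1 else 0)"

definition wV :: "nat \<Rightarrow> nat \<Rightarrow> real" where "wV n k = side_jump n k / 2^n"

lemma side_jump_odd: "side_jump (Suc n) (2*J+1) \<le> of_bool (ev (Suc n) (2*J)) + of_bool (ev (Suc n) (2*J+1))"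
  by (auto simp: side_jump_def ev_def)

lemma side_jump_even:
  "0 < J \<Longrightarrow> side_jump (Suc n) (2*J) \<le> side_jump n J + of_bool (ev (Suc n) (2*J)) + of_bool (ev (Suc n) (2*J-1))"
proof -
  assume J: "0 < J"
  have "(2*J-1) div 2 = J - 1" using J by (cases J) auto
  then show ?thesis using J by (auto simp: side_jump_def ev_def)
qed

text \<open>A jump across a vertical line is inherited from the parents or caused by an event at one
  of the two nodes. The inherited ones do not multiply from generation to generation while lengths
  halve; the events supply the rest: \<open>16 = 2 + 2 + 4 * 3\<close>.\<close>

lemma subsum_wV_le:
  assumes n: "n \<le> N" and k: "k < 2^n"
  shows "subsum N wV n k \<le> 16 / 2^n"
proof -
  define D where "D i = (\<Sum>j<2^i. side_jump (n+i) (k*2^i+j))" for i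
  define E where "E i = (\<Sum>j<2^i. of_bool (ev (n+i) (k*2^i+j)) :: real)" for i
  \<comment> \<open>The 1 pays for the leftmost node, whose left neighbour lies outside the subtree;
    the 2 counts the two vertical sides of a node with an event.\<close>
  have step: "D (Suc i) \<le> D i + 1 + 2 * E (Suc i)" for i
  proof -
    define J where "J j = k*2^i+j" for j
    define e where "e c = (of_bool (ev (n + Suc i) c) :: real)" for c
    have e0: "0 \<le> e c" for c by (simp add: e_def)
    have split: "(\<Sum>j<2^Suc i. g (k*2^Suc i+j)) = (\<Sum>j<2^i. g (2 * J j) + g (2 * J j + 1))" for g :: "nat \<Rightarrow> real"
    proof -
      have "(\<Sum>j<2^i*2. g (k*2^Suc i+j)) = (\<Sum>j<2^i. \<Sum>l<2. g (k*2^Suc i+(j*2+l)))" by (rule sum_nat_block)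
      then show ?thesis by (simp add: J_def numeral_2_eq_2 algebra_simps)
    qed
    have ev: "side_jump (n + Suc i) (2 * J j) \<le> side_jump (n+i) (J j) + e (2 * J j) + (if j = 0 then 1 else e (2 * J j - 1))" for j
    proof (cases "j = 0")
      case True
      have "side_jump (n + Suc i) (2 * J j) \<le> 1" "0 \<le> side_jump (n+i) (J j)" by (auto simp: side_jump_def)
      then show ?thesis using True e0[of "2 * J j"] by simp
    next
      case False
      then show ?thesis using side_jump_even[of "J j" "n+i"] by (simp add: J_def e_def)
    qed
    have od: "side_jump (n + Suc i) (2 * J j + 1) \<le> e (2 * J j) + e (2 * J j + 1)" for j
      using side_jump_odd[of "n+i" "J j"] by (simp add: e_def)
    have shift: "(\<Sum>j<2^i. if j = 0 then 1 else e (2 * J j - 1)) \<le> 1 + (\<Sum>j<2^i. e (2 * J j + 1))"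
    proof -
      obtain p where p: "(2::nat)^i = Suc p" by (metis gr0_conv_Suc zero_less_numeral zero_less_power)
      have "(\<Sum>j<2^i. if j = 0 then 1 else e (2 * J j - 1)) = 1 + (\<Sum>j<p. e (2 * J (Suc j) - 1))"
        unfolding p by (subst sum.lessThan_Suc_shift) simp
      also have "(\<Sum>j<p. e (2 * J (Suc j) - 1)) = (\<Sum>j<p. e (2 * J j + 1))" by (simp add: J_def)
      also have "\<dots> \<le> (\<Sum>j<2^i. e (2 * J j + 1))" unfolding p using e0 by simp
      finally show ?thesis by simp
    qed
    have "D (Suc i) = (\<Sum>j<2^i. side_jump (n + Suc i) (2 * J j) + side_jump (n + Suc i) (2 * J j + 1))"
      unfolding D_def by (rule split)
    also have "\<dots> \<le> (\<Sum>j<2^i. (side_jump (n+i) (J j) + e (2 * J j) + (if j = 0 then 1 else e (2 * J j - 1))) + (e (2 * J j) + e (2 * J j + 1)))"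
      by (intro sum_mono add_mono ev od)
    also have "\<dots> = D i + (\<Sum>j<2^i. if j = 0 then 1 else e (2 * J j - 1)) + 2 * (\<Sum>j<2^i. e (2 * J j)) + (\<Sum>j<2^i. e (2 * J j + 1))"
      by (simp only: sum.distrib D_def J_def)
    also have "\<dots> \<le> D i + 1 + 2 * ((\<Sum>j<2^i. e (2 * J j)) + (\<Sum>j<2^i. e (2 * J j + 1)))"
      using shift by simp
    also have "(\<Sum>j<2^i. e (2 * J j)) + (\<Sum>j<2^i. e (2 * J j + 1)) = E (Suc i)"
      unfolding E_def e_def[symmetric] by (simp only: split sum.distrib)
    finally show ?thesis .
  qed
  define V where "V i = D i / 2^(n+i)" for i
  define W where "W i = E i / 2^(n+i)" for i
  have stepV: "V (Suc i) \<le> V i / 2 + 1/2^n * (1/2)^Suc i + 2 * W (Suc i)" for i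
  proof -
    have "V (Suc i) \<le> (D i + 1 + 2 * E (Suc i)) / 2^(n + Suc i)"
      unfolding V_def by (intro divide_right_mono step) simp
    also have "\<dots> = V i / 2 + 1/2^n * (1/2)^Suc i + 2 * W (Suc i)"
      by (simp add: V_def W_def power_add add_divide_distrib power_one_over)
    finally show ?thesis .
  qed
  have W0: "0 \<le> W i" for i by (auto simp: W_def E_def intro!: divide_nonneg_nonneg sum_nonneg)
  have V0: "0 \<le> V i" for i by (auto simp: V_def D_def side_jump_def intro!: divide_nonneg_nonneg sum_nonneg)
  \<comment> \<open>The extra \<open>V L\<close> on the left is what the induction needs: the next
    step has \<open>2 * V (Suc L)\<close>, which \<open>stepV\<close> reduces to \<open>V L\<close>
    plus small terms.\<close>
  have tot: "(\<Sum>i\<le>L. V i) + V L \<le> 2 * V 0 + 2 * (1/2^n) * (1 - (1/2)^L) + 4 * (\<Sum>i\<le>L. W i)" for L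
  proof (induction L)
    case 0
    then show ?case using W0[of 0] by simp
  next
    case (Suc L)
    have "(\<Sum>i\<le>Suc L. V i) + V (Suc L) = (\<Sum>i\<le>L. V i) + 2 * V (Suc L)" by simp
    also have "\<dots> \<le> (\<Sum>i\<le>L. V i) + V L + 2 * (1/2^n) * (1/2)^Suc L + 4 * W (Suc L)" using stepV[of L] by simp
    also have "\<dots> \<le> 2 * V 0 + 2 * (1/2^n) * (1 - (1/2)^L) + 4 * (\<Sum>i\<le>L. W i) + 2 * (1/2^n) * (1/2)^Suc L + 4 * W (Suc L)"
      using Suc by simp
    also have "\<dots> = 2 * V 0 + 2 * (1/2^n) * (1 - (1/2)^Suc L) + 4 * (\<Sum>i\<le>Suc L. W i)"
      by (simp add: algebra_simps diff_divide_distrib)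
    finally show ?case .
  qed
  have "V 0 \<le> 1 / 2^n" by (auto simp: V_def D_def side_jump_def divide_right_mono)
  moreover have "2 * (1/2^n) * (1 - (1/2)^(N-n)) \<le> 2 * (1/2^n) * (1::real)" by (intro mult_left_mono) auto
  moreover have eW: "(\<Sum>i\<le>N-n. W i) = subsum N wE n k"
  proof -
    have "W i = (\<Sum>j<2^i. wE (n+i) (k*2^i+j))" for i
      unfolding W_def E_def wE_def sum_divide_distrib by (intro sum.cong) auto
    then show ?thesis by (simp add: subsum_def)
  qed
  moreover have eV: "(\<Sum>i\<le>N-n. V i) = subsum N wV n k"
    unfolding V_def D_def wV_def subsum_def by (simp add: sum_divide_distrib)
  ultimately have "subsum N wV n k \<le> 2 * (1/2^n) + 2 * (1/2^n) + 4 * subsum N wE n k"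
    using tot[of "N-n"] V0[of "N-n"] by linarith
  also have "\<dots> \<le> 2 * (1/2^n) + 2 * (1/2^n) + 4 * (3 / 2^n)" using subsum_wE_le[OF n k] by simp
  finally show ?thesis by simp
qed

definition wt :: "nat \<Rightarrow> nat \<Rightarrow> real" where "wt n k = wE n k + wV n k"

lemma wt_nonneg: "0 \<le> wt n k"
  by (simp add: wt_def wE_def wV_def side_jump_def)

lemma subsum_wt_le: "n \<le> N \<Longrightarrow> k < 2^n \<Longrightarrow> subsum N wt n k \<le> 20 / 2^n"
proof -
  assume n: "n \<le> N" and k: "k < 2^n"
  have "subsum N wt n k \<le> 3 / 2^n + 16 / 2^n"
    unfolding wt_def[abs_def] subsum_add using subsum_wE_le[OF n k] subsum_wV_le[OF n k] by (rule add_mono)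
  also have "\<dots> \<le> 20 / 2^n" by (simp add: divide_right_mono flip: add_divide_distrib)
  finally show ?thesis .
qed

end

section \<open>Defects of bounded functions at dyadic points\<close>

definition defect :: "(complex \<Rightarrow> complex) \<Rightarrow> complex \<Rightarrow> real" where
  "defect f z = 1 - (cmod (f z))\<^sup>2"

text \<open>The sample point of a node lies at twice the height of the top of its cell. Harnack
  discs about it then contain the whole cell and, for functions continued below the real line, also
  a cell of the last generation.\<close>

definition ctr :: "nat \<Rightarrow> nat \<Rightarrow> complex" where
  "ctr n k = Complex ((real k + 1/2) / 2^n) (2 / 2^n)"

lemma Re_ctr: "Re (ctr n k) = (real k + 1/2) / 2^n" and Im_ctr: "Im (ctr n k) = 2 / 2^n"
  by (simp_all add: ctr_def)

lemma defect_harnack_ball: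
  assumes f: "f holomorphic_on ball w r" "\<And>z. z \<in> ball w r \<Longrightarrow> cmod (f z) \<le> 1"
    and z: "cmod (z - w) \<le> q * r" and q: "0 \<le> q" "q < 1" and r: "0 < r"
  shows "defect f z \<le> 2 / (1 - q) * defect f w" "defect f w \<le> 2 / (1 - q) * defect f z"
proof -
  have "q * r < 1 * r" using q r by (intro mult_strict_right_mono) auto
  then have zb: "z \<in> ball w r" using z by (simp add: dist_norm norm_minus_commute)
  have "cmod (f z - f w) \<le> (cmod (z - w) / r) * cmod (1 - cnj (f w) * f z)"
    by (rule schwarz_pick_ball[OF f zb])
  also have "\<dots> \<le> q * cmod (1 - cnj (f w) * f z)"
    using z r by (intro mult_right_mono) (auto simp: field_simps)
  finally have 1: "cmod (f z - f w) \<le> q * cmod (1 - cnj (f w) * f z)" .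
  have "cmod (1 - cnj (f w) * f z) = cmod (1 - cnj (f z) * f w)"
    by (metis complex_cnj_cnj complex_cnj_diff complex_cnj_mult complex_cnj_one complex_mod_cnj mult.commute)
  then have 2: "cmod (f w - f z) \<le> q * cmod (1 - cnj (f z) * f w)" using 1 by (simp add: norm_minus_commute)
  have b: "cmod (f z) \<le> 1" "cmod (f w) \<le> 1" using f(2) zb r by auto
  show "defect f z \<le> 2 / (1 - q) * defect f w" unfolding defect_def by (rule pick_harnack[OF 1 b q])
  show "defect f w \<le> 2 / (1 - q) * defect f z" unfolding defect_def by (rule pick_harnack[OF 2 b(2,1) q])
qed

lemma defect_harnack:
  assumes f: "f holomorphic_on {z. - t < Im z}" "\<And>z. - t < Im z \<Longrightarrow> cmod (f z) \<le> 1"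
    and z: "cmod (z - w) \<le> q * r" and q: "0 \<le> q" "q < 1" and r: "0 < r" "r \<le> Im w + t"
  shows "defect f z \<le> 2 / (1 - q) * defect f w" "defect f w \<le> 2 / (1 - q) * defect f z"
proof -
  have sub: "ball w r \<subseteq> {z. - t < Im z}"
  proof
    fix u assume "u \<in> ball w r"
    then have "cmod (w - u) < r" by (simp add: dist_norm)
    then have "\<bar>Im (w - u)\<bar> < r" using abs_Im_le_cmod[of "w - u"] by linarith
    then show "u \<in> {z. - t < Im z}" using r by auto
  qed
  have le: "cmod (f u) \<le> 1" if "u \<in> ball w r" for u using f(2) sub that by blast
  show "defect f z \<le> 2 / (1 - q) * defect f w" "defect f w \<le> 2 / (1 - q) * defect f z"
    by (rule defect_harnack_ball[OF holomorphic_on_subset[OF f(1) sub] le z q r(1)], assumption)+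
qed

lemma defect_nonneg: "cmod (f z) \<le> 1 \<Longrightarrow> 0 \<le> defect f z"
  by (simp add: defect_def power_le_one)

lemma cmod_le_Re_Im: "\<bar>Re z\<bar> \<le> x \<Longrightarrow> \<bar>Im z\<bar> \<le> y \<Longrightarrow> cmod z \<le> x + y"
  using cmod_le[of z] by linarith

text \<open>A positive \<open>t\<close> records analytic continuation below the real line, which
  dilated functions have.\<close>

locale half_plane_fun =
  fixes f :: "complex \<Rightarrow> complex" and t :: real
  assumes hol: "f holomorphic_on {z. - t < Im z}" and le_1: "\<And>z. - t < Im z \<Longrightarrow> cmod (f z) \<le> 1" and t: "0 \<le> t"
begin

abbreviation dc :: "nat \<Rightarrow> nat \<Rightarrow> real" where "dc n k \<equiv> defect f (ctr n k)"

lemma dc_nonneg: "0 \<le> dc n k"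
proof -
  have "0 < 2 / (2::real)^n" by simp
  then have "- t < Im (ctr n k)" using t unfolding Im_ctr by linarith
  then show ?thesis by (intro defect_nonneg le_1)
qed

lemma dc_near:
  assumes "cmod (z - ctr n k) \<le> q * (2 / 2^n)" "0 \<le> q" "q < 1"
  shows "defect f z \<le> 2 / (1 - q) * dc n k" "dc n k \<le> 2 / (1 - q) * defect f z"
  using defect_harnack[OF hol le_1 assms, of] t by (simp_all add: Im_ctr)

lemma dc_child: "dc (Suc n) k \<le> 8 * dc n (k div 2)"
proof -
  have "\<bar>real k + 1/2 - (2 * real (k div 2) + 1)\<bar> \<le> 1/2"
  proof (cases "even k")
    case True
    then have "real k = 2 * real (k div 2)" by (metis dvd_mult_div_cancel of_nat_mult of_nat_numeral)
    then show ?thesis by simp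
  next
    case False
    then have "real k = 2 * real (k div 2) + 1" by (metis odd_two_times_div_two_succ of_nat_Suc of_nat_mult of_nat_numeral add.commute Suc_eq_plus1 of_nat_1 of_nat_add)
    then show ?thesis by simp
  qed
  then have "\<bar>real k + 1/2 - (2 * real (k div 2) + 1)\<bar> / 2^Suc n \<le> (1/2) / 2^Suc n" by (intro divide_right_mono) auto
  moreover have "Re (ctr (Suc n) k - ctr n (k div 2)) = (real k + 1/2 - (2 * real (k div 2) + 1)) / 2^Suc n"
    by (simp add: Re_ctr field_simps)
  ultimately have re: "\<bar>Re (ctr (Suc n) k - ctr n (k div 2))\<bar> \<le> (1/4) / 2^n" by (simp add: abs_divide)
  have im: "\<bar>Im (ctr (Suc n) k - ctr n (k div 2))\<bar> \<le> 1 / 2^n" by (simp add: Im_ctr)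
  have "cmod (ctr (Suc n) k - ctr n (k div 2)) \<le> (1/4) / 2^n + 1 / 2^n" by (rule cmod_le_Re_Im[OF re im])
  also have "\<dots> = 5/8 * (2 / 2^n)" by (simp add: field_simps)
  finally have "dc (Suc n) k \<le> 2 / (1 - 5/8) * dc n (k div 2)" by (intro dc_near) auto
  then show ?thesis using dc_nonneg[of n "k div 2"] by simp
qed

lemma dc_nbr: "dc n k \<le> 64 * dc n (Suc k)" "dc n (Suc k) \<le> 64 * dc n k"
proof -
  have "\<bar>Re (ctr n (Suc k) - ctr n k)\<bar> \<le> 1 / 2^n" "\<bar>Im (ctr n (Suc k) - ctr n k)\<bar> \<le> 0"
    by (simp_all add: Re_ctr Im_ctr flip: diff_divide_distrib)
  from cmod_le_Re_Im[OF this] have c: "cmod (ctr n (Suc k) - ctr n k) \<le> 1/2 * (2 / 2^n)" by simp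
  have "dc n k \<le> 2 / (1 - 1/2) * dc n (Suc k)" by (rule dc_near(2)[OF c]) auto
  moreover have "dc n (Suc k) \<le> 2 / (1 - 1/2) * dc n k" by (rule dc_near(1)[OF c]) auto
  ultimately show "dc n k \<le> 64 * dc n (Suc k)" "dc n (Suc k) \<le> 64 * dc n k"
    using dc_nonneg[of n k] dc_nonneg[of n "Suc k"] by simp_all
qed

end

section \<open>The Carleson embedding below a dyadic interval\<close>

lemma cayley_defect:
  assumes "Im z \<noteq> - Im z0"
  shows "1 - (cmod ((z - z0) / (z - cnj z0)))\<^sup>2 = 4 * Im z0 * Im z / (cmod (z - cnj z0))\<^sup>2"
proof -
  have nz: "z - cnj z0 \<noteq> 0" using assms by (auto simp: complex_eq_iff)
  have "(cmod (z - cnj z0))\<^sup>2 - (cmod (z - z0))\<^sup>2 = 4 * Im z0 * Im z"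
    unfolding cmod_power2 by (simp add: power2_eq_square algebra_simps)
  moreover have "1 - (x / y)\<^sup>2 = (y\<^sup>2 - x\<^sup>2) / y\<^sup>2" if "y \<noteq> 0" for x y :: real
    using that by (simp add: power_divide diff_divide_distrib)
  ultimately show ?thesis using nz unfolding norm_divide by simp
qed

lemma cayley_pair:
  assumes "zi \<noteq> cnj z0" "zj \<noteq> cnj z0"
  shows "cmod (1 - cnj ((zj - z0) / (zj - cnj z0)) * ((zi - z0) / (zi - cnj z0)))
    = 2 * \<bar>Im z0\<bar> * cmod (zi - cnj zj) / (cmod (zi - cnj z0) * cmod (zj - cnj z0))"
proof -
  have nz: "zi - cnj z0 \<noteq> 0" "cnj zj - z0 \<noteq> 0" using assms by (auto simp: complex_eq_iff)
  have "1 - cnj ((zj - z0) / (zj - cnj z0)) * ((zi - z0) / (zi - cnj z0))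
      = (z0 - cnj z0) * (cnj zj - zi) / ((zi - cnj z0) * (cnj zj - z0))"
  proof -
    have g: "1 - u / q * (v / p) = (q * p - u * v) / (p * q)" if "p \<noteq> 0" "q \<noteq> 0" for p q u v :: complex
      using that by (simp add: field_simps)
    have "(cnj zj - z0) * (zi - cnj z0) - (cnj zj - cnj z0) * (zi - z0) = (z0 - cnj z0) * (cnj zj - zi)"
      by (simp add: algebra_simps)
    then show ?thesis using g[OF nz, of "cnj zj - cnj z0" "zi - z0"] by simp
  qed
  moreover have "cmod (cnj zj - z0) = cmod (zj - cnj z0)"
    by (metis complex_cnj_cnj complex_cnj_diff complex_mod_cnj)
  moreover have "z0 - cnj z0 = of_real (2 * Im z0) * \<i>" by (simp add: complex_eq_iff)
  ultimately show ?thesis by (simp add: norm_mult norm_divide norm_minus_commute)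
qed

lemma strict_desc_geometry:
  assumes "strict_desc n k l j"
  shows "\<bar>Re (ctr l j) - Re (ctr n k)\<bar> \<le> 1/2 / 2^n" "Im (ctr l j) \<le> Im (ctr n k)"
proof -
  define i where "i = l - n"
  have l: "l = n + i" and j: "j div 2^i = k" using assms by (auto simp: strict_desc_def i_def)
  have j1: "k * 2^i \<le> j" using j by (metis div_times_less_eq_dividend)
  have j2: "j < k * 2^i + 2^i" using j by (metis add.commute dividend_less_times_div mult.commute pos2 zero_less_power)
  have r1: "real k * 2^i \<le> real j" using j1 by (metis of_nat_le_iff of_nat_mult of_nat_numeral of_nat_power)
  have "j + 1 \<le> k * 2^i + 2^i" using j2 by simp
  then have "real (j + 1) \<le> real (k * 2^i + 2^i)" by (rule of_nat_mono)
  then have r2: "real j + 1 \<le> real k * 2^i + 2^i" by simp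
  have e: "Re (ctr l j) - Re (ctr n k) = (real j + 1/2 - (real k + 1/2) * 2^i) / 2^l"
    by (simp add: Re_ctr l power_add field_simps)
  have "\<bar>real j + 1/2 - (real k + 1/2) * 2^i\<bar> \<le> 2^i / 2"
    using r1 r2 by (intro abs_leI) (auto simp: algebra_simps)
  then have "\<bar>real j + 1/2 - (real k + 1/2) * 2^i\<bar> / 2^l \<le> (2^i / 2) / 2^l" by (rule divide_right_mono) simp
  also have "\<dots> = 1/2 / 2^n" by (simp add: l power_add)
  finally show "\<bar>Re (ctr l j) - Re (ctr n k)\<bar> \<le> 1/2 / 2^n" unfolding e by (simp add: abs_divide)
  have "2 / (2::real)^l \<le> 2 / 2^n" by (intro divide_left_mono power_increasing) (auto simp: l)
  then show "Im (ctr l j) \<le> Im (ctr n k)" by (simp add: Im_ctr)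
qed

text \<open>\<open>600 = 10 * 60\<close> is the constant of the embedding, from the comparison of
  kernels and \<open>tree_poisson\<close>. The 6 collects the 3/2 of \<open>sum_defect_le\<close>,
  the 2 between \<open>1 - |F|\<close> and \<open>1 - |F|^2\<close>, and the height
  \<open>2 / 2^n\<close> of the sample point.\<close>

definition packing_const :: real where "packing_const = 6 * exp 600"

context half_plane_fun
begin

text \<open>A Cayley map sends the sample point of \<open>(n, k)\<close> to 0 and those of
  \<open>S\<close> to points \<open>w p\<close>. The lengths in an antichain form a Carleson
  packing, so \<open>sum_defect_le\<close> applies, and each node contributes at least
  \<open>y / 2\<close> times its normalised length.\<close>

lemma node_mass_le:
  assumes S: "finite S" "antichain S" and D: "\<And>l j. (l,j) \<in> S \<Longrightarrow> l \<le> N \<and> strict_desc n k l j \<and> y \<le> dc l j"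
    and k: "k < 2^n" and x: "0 < x" "dc n k \<le> x" and y: "0 < y"
  shows "node_mass S \<le> packing_const * sqrt x / y / 2^n"
proof -
  define z0 where "z0 = ctr n k"
  define y0 where "y0 = Im z0"
  have y0: "0 < y0" "y0 = 2 / 2^n" by (simp_all add: y0_def z0_def Im_ctr)
  define w where "w p = (case p of (l,j) \<Rightarrow> (ctr l j - z0) / (ctr l j - cnj z0))" for p
  define d where "d p = (case p of (l,j) \<Rightarrow> (cmod (ctr l j - cnj z0))\<^sup>2)" for p
  have Imp: "0 < Im (ctr l j)" for l j by (simp add: Im_ctr)
  have nz: "ctr l j \<noteq> cnj z0" for l j
  proof
    assume "ctr l j = cnj z0"
    then have "Im (ctr l j) = - y0" by (simp add: y0_def)
    then show False using Imp[of l j] y0(1) by simp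
  qed
  have w_def1: "1 - (cmod (w (l,j)))\<^sup>2 = 4 * y0 * Im (ctr l j) / d (l,j)" for l j
    unfolding w_def d_def y0_def using Imp[of l j] y0(1) by (simp add: cayley_defect y0_def)
  have d0: "0 < d (l,j)" for l j using nz by (simp add: d_def)
  have w1: "cmod (w p) < 1" if "p \<in> S" for p
  proof -
    obtain l j where p: "p = (l,j)" by (cases p)
    have "0 < 1 - (cmod (w (l,j)))\<^sup>2" unfolding w_def1 using y0 Imp[of l j] d0[of l j] by simp
    then show ?thesis by (simp add: p abs_square_less_1)
  qed
  have db: "d (l,j) \<le> 5 * y0\<^sup>2" if "(l,j) \<in> S" for l j
  proof -
    have sd: "strict_desc n k l j" using D[OF that] by simp
    have re: "\<bar>Re (ctr l j) - Re z0\<bar> \<le> y0 / 4" using strict_desc_geometry(1)[OF sd] y0 by (simp add: z0_def)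
    have im: "Im (ctr l j) \<le> y0" using strict_desc_geometry(2)[OF sd] by (simp add: y0_def z0_def)
    have "(Re (ctr l j) - Re z0)\<^sup>2 \<le> (y0 / 4)\<^sup>2" using power_mono[OF re, of 2] by simp
    moreover have "(Im (ctr l j) + y0)\<^sup>2 \<le> (2 * y0)\<^sup>2" using im Imp[of l j] y0 by (intro power_mono) auto
    ultimately have "d (l,j) \<le> (y0 / 4)\<^sup>2 + (2 * y0)\<^sup>2" by (simp add: d_def cmod_power2 y0_def)
    also have "\<dots> \<le> 5 * y0\<^sup>2" by (simp add: power2_eq_square)
    finally show ?thesis .
  qed
  define m where "m p = (1 / 2^fst p) / y0" for p :: "nat \<times> nat"
  have m0: "0 \<le> m p" for p using y0 by (simp add: m_def)
  have C: "(\<Sum>p\<in>{p\<in>S. fst i \<le> fst p}. m p * Re (herglotz (w p) (w i))) \<le> 600" if i: "i \<in> S" for i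
  proof -
    obtain li ji where ii: "i = (li,ji)" by (cases i)
    define zi where "zi = ctr li ji"
    have term_le: "m p * Re (herglotz (w p) (w i)) \<le> 10 * (1 / 2^fst p * tree_kernel (Re zi) (Im zi) (fst p) (snd p))"
      if p: "p \<in> S" "fst i \<le> fst p" for p
    proof -
      obtain l j where pp: "p = (l,j)" by (cases p)
      define z where "z = ctr l j"
      have lle: "li \<le> l" using p by (simp add: ii pp)
      have yy: "Im z \<le> Im zi" unfolding z_def zi_def Im_ctr using lle
        by (intro divide_left_mono power_increasing) auto
      have zpos: "0 < Im z" "0 < Im zi" by (simp_all add: z_def zi_def Im_ctr)
      have K: "(cmod (zi - cnj z))\<^sup>2 = (Re zi - (real j + 1/2) / 2^l)\<^sup>2 + (Im zi + 2 / 2^l)\<^sup>2"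
        by (simp add: cmod_power2 z_def Re_ctr Im_ctr)
      have Kpos: "0 < (cmod (zi - cnj z))\<^sup>2" using zpos by (auto simp: complex_eq_iff)
      define A B where "A = 1 - (cmod (w p))\<^sup>2" and "B = 1 - (cmod (w i))\<^sup>2"
      have A: "A = 4 * y0 * Im z / d p" "B = 4 * y0 * Im zi / d i" using w_def1 by (auto simp: A_def B_def pp ii z_def zi_def)
      have AB: "0 \<le> A" "0 \<le> B" "A \<le> 1" "B \<le> 1" using w1[OF p(1)] w1[OF i] by (auto simp: A_def B_def power_le_one)
      have "1 - (cmod (w p))\<^sup>2 * (cmod (w i))\<^sup>2 = A + B - A * B" by (simp add: A_def B_def algebra_simps)
      also have "\<dots> \<le> A + B" using AB by simp
      finally have num: "1 - (cmod (w p))\<^sup>2 * (cmod (w i))\<^sup>2 \<le> A + B" .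
      have "cmod (1 - cnj (w p) * w i) = 2 * \<bar>Im z0\<bar> * cmod (zi - cnj z) / (cmod (zi - cnj z0) * cmod (z - cnj z0))"
        unfolding w_def pp ii z_def zi_def prod.case by (intro cayley_pair nz)
      then have den: "(cmod (1 - cnj (w p) * w i))\<^sup>2 = 4 * y0\<^sup>2 * (cmod (zi - cnj z))\<^sup>2 / (d i * d p)"
        by (simp add: power_divide power_mult_distrib d_def pp ii z_def zi_def y0_def)
      have dpos: "0 < d i" "0 < d p" using d0 by (auto simp: pp ii)
      have "Re (herglotz (w p) (w i)) \<le> (A + B) / (4 * y0\<^sup>2 * (cmod (zi - cnj z))\<^sup>2 / (d i * d p))"
        unfolding Re_herglotz den using num y0 Kpos dpos by (intro divide_right_mono) auto
      also have "\<dots> = (Im z * d i + Im zi * d p) / (y0 * (cmod (zi - cnj z))\<^sup>2)"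
      proof -
        have "(4 * y * a / u + 4 * y * b / v) / (4 * y\<^sup>2 * D / (v * u)) = (a * v + b * u) / (y * D)"
          if "y \<noteq> 0" "D \<noteq> 0" "u \<noteq> 0" "v \<noteq> 0" for y a b u v D :: real
          using that by (simp add: field_simps power2_eq_square)
        from this[of y0 "(cmod (zi - cnj z))\<^sup>2" "d p" "d i" "Im z" "Im zi"] show ?thesis
          unfolding A using y0 Kpos dpos by simp
      qed
      \<comment> \<open>The restriction to levels not coarser than that of \<open>i\<close> enters
        here: it gives \<open>Im z \<le> Im zi\<close>, so both terms are controlled by
        \<open>Im zi\<close>.\<close>
      also have "\<dots> \<le> (Im zi * (5 * y0\<^sup>2) + Im zi * (5 * y0\<^sup>2)) / (y0 * (cmod (zi - cnj z))\<^sup>2)"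
        using yy zpos db[of li ji] db[of l j] i p dpos y0 Kpos
        by (intro divide_right_mono add_mono mult_mono) (auto simp: ii pp)
      also have "\<dots> = 10 * y0 * (Im zi / (cmod (zi - cnj z))\<^sup>2)"
        using y0 by (simp add: power2_eq_square field_simps)
      finally have "m p * Re (herglotz (w p) (w i)) \<le> m p * (10 * y0 * (Im zi / (cmod (zi - cnj z))\<^sup>2))"
        by (intro mult_left_mono m0)
      also have "\<dots> = 10 * (1 / 2^l * (Im zi / (cmod (zi - cnj z))\<^sup>2))" using y0(1) by (simp add: m_def pp)
      finally show ?thesis unfolding K by (simp add: tree_kernel_def pp)
    qed
    have tk0: "0 \<le> tree_kernel (Re zi) (Im zi) l j" for l j
      by (simp add: tree_kernel_def zi_def Im_ctr)
    have "(\<Sum>p\<in>{p\<in>S. fst i \<le> fst p}. m p * Re (herglotz (w p) (w i)))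
        \<le> (\<Sum>p\<in>{p\<in>S. fst i \<le> fst p}. 10 * (1 / 2^fst p * tree_kernel (Re zi) (Im zi) (fst p) (snd p)))"
      by (intro sum_mono term_le) auto
    also have "\<dots> \<le> (\<Sum>p\<in>S. 10 * (1 / 2^fst p * tree_kernel (Re zi) (Im zi) (fst p) (snd p)))"
      using S tk0 by (intro sum_mono2) auto
    also have "\<dots> = 10 * (\<Sum>p\<in>S. 1 / 2^fst p * tree_kernel (Re zi) (Im zi) (fst p) (snd p))"
      by (simp add: sum_distrib_left)
    also have "(\<Sum>p\<in>S. 1 / 2^fst p * tree_kernel (Re zi) (Im zi) (fst p) (snd p))
        \<le> (\<Sum>l\<le>N. \<Sum>j<2^l. (if (l,j) \<in> S then 1/2^l else 0) * tree_kernel (Re zi) (Im zi) l j)"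
    proof -
      let ?T = "Sigma {..N} (\<lambda>l. {..<2^l::nat})"
      have "S \<subseteq> ?T"
      proof
        fix p assume p: "p \<in> S"
        obtain l j where pp: "p = (l,j)" by (cases p)
        have sd: "strict_desc n k l j" "l \<le> N" using D p by (auto simp: pp)
        have "j < (k + 1) * 2^(l-n)"
          using sd(1) unfolding strict_desc_def
          by (metis add.commute dividend_less_times_div mult.commute mult_Suc_right plus_1_eq_Suc pos2 zero_less_power)
        also have "\<dots> \<le> 2^n * 2^(l-n)" using k by (intro mult_right_mono) auto
        also have "\<dots> = 2^l" using sd by (simp add: strict_desc_def flip: power_add)
        finally show "p \<in> ?T" using sd by (simp add: pp)
      qed
      then have "(\<Sum>p\<in>S. 1 / 2^fst p * tree_kernel (Re zi) (Im zi) (fst p) (snd p))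
          = (\<Sum>p\<in>?T. if p \<in> S then 1 / 2^fst p * tree_kernel (Re zi) (Im zi) (fst p) (snd p) else 0)"
        by (subst sum.inter_restrict[symmetric]) (auto simp: Int_absorb1)
      also have "\<dots> = (\<Sum>(l,j)\<in>?T. (if (l,j) \<in> S then 1/2^l else 0) * tree_kernel (Re zi) (Im zi) l j)"
        by (intro sum.cong) auto
      also have "\<dots> = (\<Sum>l\<le>N. \<Sum>j<2^l. (if (l,j) \<in> S then 1/2^l else 0) * tree_kernel (Re zi) (Im zi) l j)"
        by (subst sum.Sigma) auto
      finally show ?thesis by simp
    qed
    also have "\<dots> \<le> 60 * 1"
      by (intro tree_poisson) (auto intro: subsum_antichain[OF S(2)] simp: zi_def Im_ctr)
    finally show ?thesis by simp
  qed
  define G where "G u = (z0 - cnj z0 * u) / (1 - u)" for u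
  have G: "Im (G u) > 0" if "cmod u < 1" for u
  proof -
    have u1: "1 - u \<noteq> 0" using that by auto
    have "Im (G u) = y0 * (1 - (cmod u)\<^sup>2) / (cmod (1 - u))\<^sup>2"
      unfolding G_def Im_divide cmod_power2 by (simp add: y0_def power2_eq_square algebra_simps)
    moreover have "(cmod u)\<^sup>2 < 1" using that by (simp add: abs_square_less_1)
    ultimately show ?thesis using y0 u1 by simp
  qed
  define F where "F u = f (G u)" for u
  have Fhol: "F holomorphic_on ball 0 1"
    unfolding F_def
  proof (rule holomorphic_on_compose_gen[OF _ hol, unfolded o_def])
    show "G holomorphic_on ball 0 1" unfolding G_def by (intro holomorphic_intros) auto
    show "G ` ball 0 1 \<subseteq> {z. - t < Im z}" using G t by force
  qed
  have F1: "cmod (F u) \<le> 1" if "cmod u < 1" for u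
    unfolding F_def using G[OF that] t by (intro le_1) simp
  have Gw: "G (w (l,j)) = ctr l j" for l j
  proof -
    define z where "z = ctr l j"
    have n1: "z - cnj z0 \<noteq> 0" using nz by (simp add: z_def)
    have n2: "z0 - cnj z0 \<noteq> 0" using y0 by (auto simp: complex_eq_iff y0_def)
    have "z0 - cnj z0 * ((z - z0) / (z - cnj z0)) = z * (z0 - cnj z0) / (z - cnj z0)"
      using n1 by (simp add: field_simps)
    moreover have "1 - (z - z0) / (z - cnj z0) = (z0 - cnj z0) / (z - cnj z0)"
      using n1 by (simp add: field_simps)
    ultimately have "G (w (l,j)) = (z * (z0 - cnj z0) / (z - cnj z0)) / ((z0 - cnj z0) / (z - cnj z0))"
      by (simp only: G_def w_def prod.case z_def)
    also have "\<dots> = z" using n1 n2 by simp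
    finally show ?thesis by (simp add: z_def)
  qed
  have half: "1 - cmod v \<ge> (1 - (cmod v)\<^sup>2) / 2" "1 - cmod v \<le> 1 - (cmod v)\<^sup>2" if "cmod v \<le> 1" for v :: complex
  proof -
    have "0 \<le> (cmod v - 1)\<^sup>2" by simp
    then show "1 - cmod v \<ge> (1 - (cmod v)\<^sup>2) / 2" by (simp add: power2_eq_square field_simps)
    have "cmod v * cmod v \<le> cmod v * 1" using that by (intro mult_left_mono) auto
    then show "1 - cmod v \<le> 1 - (cmod v)\<^sup>2" by (simp add: power2_eq_square)
  qed
  have "G 0 = z0" by (simp add: G_def)
  then have "1 - cmod (F 0) \<le> x"
    using half(2)[OF F1[of 0]] x(2) by (simp add: F_def defect_def z0_def)
  then have main: "(\<Sum>p\<in>S. m p * (1 - cmod (F (w p)))) \<le> exp 600 * (3/2 * sqrt x)"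
    using C by (intro sum_defect_le[where lev = fst] S w1 m0 Fhol F1 x) auto
  have "node_mass S * (y / 2 / y0) = (\<Sum>p\<in>S. m p * (y / 2))"
    unfolding node_mass_def sum_distrib_right by (intro sum.cong) (auto simp: m_def)
  also have "\<dots> \<le> (\<Sum>p\<in>S. m p * (1 - cmod (F (w p))))"
  proof (intro sum_mono mult_left_mono m0)
    fix p assume p: "p \<in> S"
    obtain l j where pp: "p = (l,j)" by (cases p)
    have "y \<le> dc l j" using D p by (auto simp: pp)
    moreover have "cmod (F (w p)) \<le> 1" using F1 w1[OF p] by blast
    from half(1)[OF this] have "defect f (ctr l j) / 2 \<le> 1 - cmod (F (w p))"
      by (simp add: F_def pp Gw defect_def)
    ultimately show "y / 2 \<le> 1 - cmod (F (w p))" by linarith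
  qed
  also note main
  finally have "node_mass S \<le> exp 600 * (3/2 * sqrt x) / (y / 2 / y0)"
    using y y0(1) by (simp add: field_simps)
  also have "\<dots> = packing_const * sqrt x / y / 2^n" by (simp add: y0(2) packing_const_def)
  finally show ?thesis .
qed

end

text \<open>The thresholds are built from the top: \<open>\<alpha> (m - 1) = min \<eta> 1\<close>,
  and each lower one is the square of the next divided by \<open>K\<close>. The 64 in
  \<open>K\<close> gives the ratio of neighbours, \<open>128 * C^2\<close> the square root
  condition; \<open>\<tau>\<close> is chosen last.\<close>

lemma thresholds_exist:
  fixes C \<eta> :: real
  assumes m: "1 \<le> m" and C: "0 \<le> C" and \<eta>: "0 < \<eta>"
  obtains \<alpha> :: "nat \<Rightarrow> real" and \<tau> where "0 < \<alpha> 0" "\<And>i. Suc i < m \<Longrightarrow> 64 * \<alpha> i \<le> \<alpha> (Suc i)"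
    "\<And>i. Suc i < m \<Longrightarrow> C * sqrt (8 * \<alpha> i) \<le> \<alpha> (Suc i) / 4" "\<And>i. i < m \<Longrightarrow> \<alpha> i \<le> \<eta>"
    "0 < \<tau>" "\<tau> < \<alpha> 0 * \<alpha> 0" "C * sqrt (\<tau> / \<alpha> 0) \<le> \<alpha> 0 / 4"
proof -
  define K where "K = 64 + 128 * C\<^sup>2"
  have K: "64 \<le> K" "128 * C\<^sup>2 \<le> K" by (simp_all add: K_def)
  define \<beta> where "\<beta> = rec_nat (min \<eta> 1) (\<lambda>_ b. b\<^sup>2 / K)"
  have \<beta>0: "\<beta> 0 = min \<eta> 1" and \<beta>S: "\<beta> (Suc j) = (\<beta> j)\<^sup>2 / K" for j by (simp_all add: \<beta>_def)
  have b: "0 < \<beta> j \<and> \<beta> j \<le> min \<eta> 1" for j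
  proof (induction j)
    case (Suc j)
    have "(\<beta> j)\<^sup>2 / K \<le> \<beta> j * 1 / 1"
      using Suc K by (intro frac_le) (auto simp: power2_eq_square intro!: mult_mono)
    also have "\<dots> \<le> min \<eta> 1" using Suc by simp
    finally have "\<beta> (Suc j) \<le> min \<eta> 1" unfolding \<beta>S .
    moreover have "0 < \<beta> (Suc j)" using Suc K by (simp add: \<beta>S)
    ultimately show ?case by simp
  qed (use \<eta> in \<open>auto simp: \<beta>0\<close>)
  have s1: "64 * \<beta> (Suc j) \<le> \<beta> j" for j
  proof -
    have "64 * (\<beta> j)\<^sup>2 \<le> K * (\<beta> j * 1)"
      using b[of j] K by (intro mult_mono) (auto simp: power2_eq_square)
    then show ?thesis using K by (simp add: \<beta>S field_simps)
  qed
  have s2: "C * sqrt (8 * \<beta> (Suc j)) \<le> \<beta> j / 4" for j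
  proof (rule power2_le_imp_le)
    have "C\<^sup>2 * 8 / K \<le> 1 / 16" using K by (simp add: field_simps)
    then have "(C\<^sup>2 * 8 / K) * (\<beta> j)\<^sup>2 \<le> 1 / 16 * (\<beta> j)\<^sup>2" by (intro mult_right_mono) auto
    then show "(C * sqrt (8 * \<beta> (Suc j)))\<^sup>2 \<le> (\<beta> j / 4)\<^sup>2"
      using b[of "Suc j"] by (simp add: power_mult_distrib power_divide \<beta>S)
  qed (use b[of j] in auto)
  define \<alpha> where "\<alpha> i = \<beta> (m - 1 - i)" for i
  have ai: "m - 1 - i = Suc (m - 1 - Suc i)" if "Suc i < m" for i using that by simp
  define \<tau> where "\<tau> = min (\<alpha> 0 * \<alpha> 0 / 2) (\<alpha> 0 * (\<alpha> 0 / (4 * (C + 1)))\<^sup>2)"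
  have a0: "0 < \<alpha> 0" using b by (simp add: \<alpha>_def)
  show thesis
  proof (rule that[of \<alpha> \<tau>])
    show "64 * \<alpha> i \<le> \<alpha> (Suc i)" if "Suc i < m" for i
      unfolding \<alpha>_def ai[OF that] by (rule s1)
    show "C * sqrt (8 * \<alpha> i) \<le> \<alpha> (Suc i) / 4" if "Suc i < m" for i
      unfolding \<alpha>_def ai[OF that] by (rule s2)
    show "\<alpha> i \<le> \<eta>" for i using b by (auto simp: \<alpha>_def)
    show "0 < \<tau>" using a0 C by (simp add: \<tau>_def)
    have "\<tau> \<le> \<alpha> 0 * \<alpha> 0 / 2" by (simp add: \<tau>_def)
    also have "\<dots> < \<alpha> 0 * \<alpha> 0" using a0 by simp
    finally show "\<tau> < \<alpha> 0 * \<alpha> 0" .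
    have "\<tau> / \<alpha> 0 \<le> (\<alpha> 0 / (4 * (C + 1)))\<^sup>2" using a0 by (simp add: \<tau>_def field_simps)
    then have "sqrt (\<tau> / \<alpha> 0) \<le> sqrt ((\<alpha> 0 / (4 * (C + 1)))\<^sup>2)" by (rule real_sqrt_le_mono)
    also have "\<dots> = \<alpha> 0 / (4 * (C + 1))" using a0 C by simp
    finally have "C * sqrt (\<tau> / \<alpha> 0) \<le> C * (\<alpha> 0 / (4 * (C + 1)))" using C by (intro mult_left_mono)
    also have "\<dots> \<le> \<alpha> 0 / 4" using C a0 by (simp add: field_simps)
    finally show "C * sqrt (\<tau> / \<alpha> 0) \<le> \<alpha> 0 / 4" .
  qed (rule a0)
qed

lemma hysteresis_half_plane:
  assumes T: "half_plane_fun \<Theta> t" and f: "half_plane_fun f t"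
    and m: "1 \<le> m" and \<alpha>: "0 < \<alpha> 0" "\<And>i. Suc i < m \<Longrightarrow> 64 * \<alpha> i \<le> \<alpha> (Suc i)"
    "\<And>i. Suc i < m \<Longrightarrow> packing_const * sqrt (8 * \<alpha> i) \<le> \<alpha> (Suc i) / 4"
    and \<tau>: "0 < \<tau>" "\<tau> < \<alpha> 0 * \<alpha> 0" "packing_const * sqrt (\<tau> / \<alpha> 0) \<le> \<alpha> 0 / 4"
    and prod: "\<And>z. 0 < Im z \<Longrightarrow> defect \<Theta> z * defect f z \<le> \<tau>"
    and out: "\<And>z. 0 < Im z \<Longrightarrow> \<not> (1/4 < Re z \<and> Re z < 3/4 \<and> Im z < 1/2) \<Longrightarrow> defect \<Theta> z < \<alpha> 0"
  shows "hysteresis (\<lambda>n k. defect \<Theta> (ctr n k)) (\<lambda>n k. defect f (ctr n k)) \<alpha> m N \<tau> packing_const"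
proof -
  interpret T: half_plane_fun \<Theta> t by (rule T)
  interpret f: half_plane_fun f t by (rule f)
  have ip: "0 < Im (ctr n k)" for n k by (simp add: Im_ctr)
  show ?thesis
  proof
    show "1 \<le> m" "0 < \<alpha> 0" "0 < \<tau>" "\<tau> < \<alpha> 0 * \<alpha> 0" by fact+
    show "0 \<le> packing_const" by (simp add: packing_const_def)
    show "defect \<Theta> (ctr 0 k) < \<alpha> 0" for k
      by (rule out[OF ip]) (simp add: Im_ctr)
    \<comment> \<open>Sample points of the first column satisfy \<open>Im = 4 * Re\<close>, those of
      the last one \<open>Im = 4 * (1 - Re)\<close>; inside \<open>1/4 < Re < 3/4\<close> they are
      therefore higher than 1, outside the central rectangle.\<close>
    show "defect \<Theta> (ctr n 0) < \<alpha> 0" for n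
    proof (rule out[OF ip])
      show "\<not> (1/4 < Re (ctr n 0) \<and> Re (ctr n 0) < 3/4 \<and> Im (ctr n 0) < 1/2)"
        by (simp add: Re_ctr Im_ctr field_simps)
    qed
    show "defect \<Theta> (ctr n (2^n - 1)) < \<alpha> 0" for n
    proof (rule out[OF ip])
      have "Re (ctr n (2^n - 1)) = 1 - 1/2 / 2^n" by (simp add: Re_ctr of_nat_diff field_simps)
      moreover have "Im (ctr n (2^n - 1)) = 4 * (1/2 / 2^n)" by (simp add: Im_ctr)
      ultimately show "\<not> (1/4 < Re (ctr n (2^n - 1)) \<and> Re (ctr n (2^n - 1)) < 3/4 \<and> Im (ctr n (2^n - 1)) < 1/2)"
        by linarith
    qed
    show "node_mass S \<le> packing_const * sqrt x / y / 2^n"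
      if "finite S" "antichain S" "\<And>l j. (l,j) \<in> S \<Longrightarrow> l \<le> N \<and> strict_desc n k l j \<and> y \<le> T.dc l j"
        "k < 2^n" "0 < x" "T.dc n k \<le> x" "0 < y" for n k S x y
      by (rule T.node_mass_le[OF that])
    show "node_mass S \<le> packing_const * sqrt x / y / 2^n"
      if "finite S" "antichain S" "\<And>l j. (l,j) \<in> S \<Longrightarrow> l \<le> N \<and> strict_desc n k l j \<and> y \<le> f.dc l j"
        "k < 2^n" "0 < x" "f.dc n k \<le> x" "0 < y" for n k S x y
      by (rule f.node_mass_le[OF that])
  qed (use \<alpha> \<tau> prod[OF ip] T.dc_nonneg f.dc_nonneg T.dc_child f.dc_child T.dc_nbr f.dc_nbr in auto)
qed

section \<open>Cauchy integrals over segments and rectangles\<close>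

text \<open>The difference quotient of \<open>a\<close> is an average of \<open>deriv a\<close> over a segment, so that the
  singularity of the Cauchy kernel on the segment of integration disappears.\<close>

lemma divided_difference_integral:
  assumes U: "open U" "convex U" and a: "a holomorphic_on U" and pq: "closed_segment p q \<subseteq> U"
    and \<rho>: "continuous_on (closed_segment p q) \<rho>"
  obtains R where "R holomorphic_on U"
    "\<And>z. z \<in> U \<Longrightarrow> z \<notin> closed_segment p q \<Longrightarrow>
       R z = contour_integral (linepath p q) (\<lambda>\<zeta>. \<rho> \<zeta> * ((a \<zeta> - a z) / (\<zeta> - z)))"
proof -
  define \<gamma> where "\<gamma> = linepath p q"
  have \<gamma>: "\<gamma> t \<in> closed_segment p q" if "t \<in> {0..1}" for t
    using that linepath_in_path[of t p q] by (simp add: \<gamma>_def)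
  have \<gamma>c: "continuous_on A \<gamma>" for A unfolding \<gamma>_def by (rule continuous_on_linepath)
  define f where "f z ts = deriv a (\<gamma> (fst ts) + of_real (snd ts) * (z - \<gamma> (fst ts))) * (\<rho> (\<gamma> (fst ts)) * (q - p))"
    for z and ts :: "real \<times> real"
  define fx where "fx z ts = (deriv (deriv a) (\<gamma> (fst ts) + of_real (snd ts) * (z - \<gamma> (fst ts))) * of_real (snd ts)) * (\<rho> (\<gamma> (fst ts)) * (q - p))"
    for z and ts :: "real \<times> real"
  have cb: "cbox (0,0) (1,1) = {0..1::real} \<times> {0..1::real}" by (simp add: cbox_Pair_eq)
  have inU: "\<gamma> t + of_real s * (z - \<gamma> t) \<in> U" if "z \<in> U" "t \<in> {0..1}" "s \<in> {0..1}" for z t s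
  proof -
    have "(1 - s) *\<^sub>R \<gamma> t + s *\<^sub>R z \<in> U"
      using U(2) \<gamma>[OF that(2)] pq that by (intro convexD_alt) auto
    then show ?thesis by (simp add: scaleR_conv_of_real algebra_simps)
  qed
  have a1: "deriv a holomorphic_on U" by (rule holomorphic_deriv[OF a U(1)])
  have a2: "deriv (deriv a) holomorphic_on U" by (rule holomorphic_deriv[OF a1 U(1)])
  have pcont: "continuous_on (U \<times> cbox (0,0) (1,1)) (\<lambda>(z,ts). \<gamma> (fst ts) + of_real (snd ts) * (z - \<gamma> (fst ts)))"
    unfolding split_def by (intro continuous_intros continuous_on_compose2[OF \<gamma>c[of UNIV]]) auto
  have \<rho>cont: "continuous_on (U \<times> cbox (0,0) (1,1)) (\<lambda>(z,ts). \<rho> (\<gamma> (fst ts)))"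
    unfolding split_def
    by (intro continuous_on_compose2[OF \<rho>] continuous_on_compose2[OF \<gamma>c[of UNIV]] continuous_intros) (auto intro: \<gamma>)
  have fxcont: "continuous_on (U \<times> cbox (0,0) (1,1)) (\<lambda>(z,ts). fx z ts)"
  proof -
    have "continuous_on (U \<times> cbox (0,0) (1,1)) (\<lambda>x. deriv (deriv a) ((\<lambda>(z,ts). \<gamma> (fst ts) + of_real (snd ts) * (z - \<gamma> (fst ts))) x))"
      by (rule continuous_on_compose2[OF holomorphic_on_imp_continuous_on[OF a2] pcont]) (auto intro!: inU simp: cb)
    then show ?thesis unfolding fx_def using \<rho>cont
      unfolding split_def by (intro continuous_intros) auto
  qed
  have fcont: "continuous_on (U \<times> cbox (0,0) (1,1)) (\<lambda>(z,ts). f z ts)"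
  proof -
    have "continuous_on (U \<times> cbox (0,0) (1,1)) (\<lambda>x. deriv a ((\<lambda>(z,ts). \<gamma> (fst ts) + of_real (snd ts) * (z - \<gamma> (fst ts))) x))"
      by (rule continuous_on_compose2[OF holomorphic_on_imp_continuous_on[OF a1] pcont]) (auto intro!: inU simp: cb)
    then show ?thesis unfolding f_def using \<rho>cont
      unfolding split_def by (intro continuous_intros) auto
  qed
  have fcont1: "continuous_on (cbox (0,0) (1,1)) (f z)" if "z \<in> U" for z
  proof -
    have "continuous_on (cbox (0,0) (1,1)) (\<lambda>ts. (\<lambda>(z,ts). f z ts) (z, ts))"
      by (rule continuous_on_compose2[OF fcont]) (use that in \<open>auto intro!: continuous_intros\<close>)
    then show ?thesis by simp
  qed
  \<comment> \<open>A double integral with smooth integrand: it is holomorphic by differentiation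
    under the integral sign, and Fubini with the fundamental theorem recovers the difference
    quotient off the segment.\<close>
  define R where "R z = integral (cbox (0,0) (1,1)) (f z)" for z
  have "R holomorphic_on U"
    unfolding R_def
  proof (rule leibniz_rule_holomorphic[OF _ _ fxcont U(2)])
    fix z ts assume z: "z \<in> U" and ts: "ts \<in> cbox (0::real,0::real) (1,1)"
    have w: "\<gamma> (fst ts) + of_real (snd ts) * (z - \<gamma> (fst ts)) \<in> U"
      using inU[OF z, of "fst ts" "snd ts"] ts by (auto simp: cb mem_Times_iff)
    have d: "(deriv a has_field_derivative deriv (deriv a) (\<gamma> (fst ts) + of_real (snd ts) * (z - \<gamma> (fst ts))))
        (at (\<gamma> (fst ts) + of_real (snd ts) * (z - \<gamma> (fst ts))))"
      by (rule holomorphic_derivI[OF a1 U(1) w])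
    have "((\<lambda>z. \<gamma> (fst ts) + of_real (snd ts) * (z - \<gamma> (fst ts))) has_field_derivative of_real (snd ts)) (at z within U)"
      by (auto intro!: derivative_eq_intros)
    from DERIV_chain2[OF d this]
    show "((\<lambda>z. f z ts) has_field_derivative fx z ts) (at z within U)"
      unfolding f_def fx_def by (intro DERIV_cmult_right)
  next
    show "f z integrable_on cbox (0,0) (1,1)" if "z \<in> U" for z
      by (rule integrable_continuous[OF fcont1[OF that]])
  qed
  moreover have "R z = contour_integral (linepath p q) (\<lambda>\<zeta>. \<rho> \<zeta> * ((a \<zeta> - a z) / (\<zeta> - z)))"
    if z: "z \<in> U" "z \<notin> closed_segment p q" for z
  proof -
    have inner: "integral (cbox 0 1) (\<lambda>s. f z (t, s)) = \<rho> (\<gamma> t) * ((a (\<gamma> t) - a z) / (\<gamma> t - z)) * (q - p)"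
      if t: "t \<in> {0..1}" for t
    proof -
      have nz: "z - \<gamma> t \<noteq> 0" using \<gamma>[OF t] z(2) by auto
      have "((\<lambda>s. deriv a (\<gamma> t + of_real s * (z - \<gamma> t)) * (z - \<gamma> t)) has_integral
          (a (\<gamma> t + of_real 1 * (z - \<gamma> t)) - a (\<gamma> t + of_real 0 * (z - \<gamma> t)))) {0..1}"
      proof (rule fundamental_theorem_of_calculus)
        fix s :: real assume s: "s \<in> {0..1}"
        have "((\<lambda>w. a (\<gamma> t + w * (z - \<gamma> t))) has_field_derivative deriv a (\<gamma> t + of_real s * (z - \<gamma> t)) * (z - \<gamma> t)) (at (of_real s))"
          by (rule DERIV_chain2[where g = "\<lambda>w. \<gamma> t + w * (z - \<gamma> t)"], rule holomorphic_derivI[OF a U(1) inU[OF z(1) t s]])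
             (auto intro!: derivative_eq_intros)
        then have "((\<lambda>x. a (\<gamma> t + of_real x * (z - \<gamma> t))) has_vector_derivative deriv a (\<gamma> t + of_real s * (z - \<gamma> t)) * (z - \<gamma> t)) (at s)"
          by (rule has_vector_derivative_real_field)
        then show "((\<lambda>x. a (\<gamma> t + of_real x * (z - \<gamma> t))) has_vector_derivative deriv a (\<gamma> t + of_real s * (z - \<gamma> t)) * (z - \<gamma> t)) (at s within {0..1})"
          by (rule has_vector_derivative_at_within)
      qed simp
      then have "((\<lambda>s. deriv a (\<gamma> t + of_real s * (z - \<gamma> t)) * (z - \<gamma> t)) has_integral (a z - a (\<gamma> t))) {0..1}"
        by simp
      then have "((\<lambda>s. deriv a (\<gamma> t + of_real s * (z - \<gamma> t)) * (z - \<gamma> t) * (\<rho> (\<gamma> t) * (q - p) / (z - \<gamma> t)))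
         has_integral (a z - a (\<gamma> t)) * (\<rho> (\<gamma> t) * (q - p) / (z - \<gamma> t))) {0..1}"
        by (rule has_integral_mult_left)
      moreover have "(\<lambda>s. deriv a (\<gamma> t + of_real s * (z - \<gamma> t)) * (z - \<gamma> t) * (\<rho> (\<gamma> t) * (q - p) / (z - \<gamma> t))) = (\<lambda>s. f z (t, s))"
        using nz by (auto simp: f_def)
      ultimately have "((\<lambda>s. f z (t, s)) has_integral (a z - a (\<gamma> t)) * (\<rho> (\<gamma> t) * (q - p) / (z - \<gamma> t))) {0..1}" by simp
      then have "integral {0..1} (\<lambda>s. f z (t, s)) = (a z - a (\<gamma> t)) * (\<rho> (\<gamma> t) * (q - p) / (z - \<gamma> t))"
        by (rule integral_unique)
      also have "\<dots> = \<rho> (\<gamma> t) * ((a z - a (\<gamma> t)) / (z - \<gamma> t)) * (q - p)" by simp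
      also have "(a z - a (\<gamma> t)) / (z - \<gamma> t) = (a (\<gamma> t) - a z) / (\<gamma> t - z)"
        by (metis minus_diff_eq minus_divide_divide)
      finally show ?thesis by (simp add: cbox_interval)
    qed
    have "R z = integral (cbox 0 1) (\<lambda>t. integral (cbox 0 1) (\<lambda>s. f z (t, s)))"
      unfolding R_def by (rule integral_prod_continuous[OF fcont1[OF z(1)]])
    also have "\<dots> = integral (cbox 0 1) (\<lambda>t. \<rho> (\<gamma> t) * ((a (\<gamma> t) - a z) / (\<gamma> t - z)) * (q - p))"
      by (intro integral_cong inner) (simp add: cbox_interval)
    also have "\<dots> = contour_integral (linepath p q) (\<lambda>\<zeta>. \<rho> \<zeta> * ((a \<zeta> - a z) / (\<zeta> - z)))"
      by (simp add: contour_integral_integral \<gamma>_def cbox_interval)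
    finally show ?thesis .
  qed
  ultimately show thesis by (rule that)
qed

lemma cauchy_segment_holomorphic:
  assumes "continuous_on (closed_segment p q) \<rho>" "open U" "U \<inter> closed_segment p q = {}"
  shows "(\<lambda>z. contour_integral (linepath p q) (\<lambda>\<zeta>. \<rho> \<zeta> / (\<zeta> - z))) holomorphic_on U"
proof -
  define F where "F z = contour_integral (linepath p q) (\<lambda>\<zeta>. \<rho> \<zeta> / (\<zeta> - z))" for z
  have "(F has_field_derivative of_nat 1 * contour_integral (linepath p q) (\<lambda>u. \<rho> u / (u - z) ^ Suc 1)) (at z)"
    if z: "z \<in> U" for z
    unfolding F_def
  proof (rule Cauchy_next_derivative(2)[where S = U and B = "cmod (q - p)"])
    show "continuous_on (path_image (linepath p q)) \<rho>" using assms(1) by simp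
    show "cmod (vector_derivative (linepath p q) (at t)) \<le> cmod (q - p)" for t by simp
    fix w assume w: "w \<in> U - path_image (linepath p q)"
    have "(\<lambda>u. \<rho> u / (u - w) ^ 1) contour_integrable_on linepath p q"
      using w assms(1) by (intro contour_integrable_continuous_linepath continuous_intros) auto
    from has_contour_integral_integral[OF this]
    show "((\<lambda>u. \<rho> u / (u - w) ^ 1) has_contour_integral contour_integral (linepath p q) (\<lambda>\<zeta>. \<rho> \<zeta> / (\<zeta> - w))) (linepath p q)"
      by simp
  qed (use z assms in auto)
  then show ?thesis using assms(2) unfolding F_def[symmetric] holomorphic_on_open[OF assms(2)] by blast
qed

lemma cauchy_rectangle:
  assumes lt: "Re lo < Re hi" "Im lo < Im hi" and f: "f holomorphic_on cbox lo hi"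
  shows "z \<in> box lo hi \<Longrightarrow> contour_integral (rectpath lo hi) (\<lambda>\<zeta>. f \<zeta> / (\<zeta> - z)) = 2 * of_real pi * \<i> * f z"
    and "z \<notin> cbox lo hi \<Longrightarrow> contour_integral (rectpath lo hi) (\<lambda>\<zeta>. f \<zeta> / (\<zeta> - z)) = 0"
proof -
  assume z: "z \<in> box lo hi"
  have "((\<lambda>\<zeta>. f \<zeta> / (\<zeta> - z)) has_contour_integral (2 * pi * \<i> * winding_number (rectpath lo hi) z * f z)) (rectpath lo hi)"
  proof (rule Cauchy_integral_formula_convex_simple[OF convex_box(1) f])
    show "z \<in> interior (cbox lo hi)" using z by (simp add: interior_cbox)
    have "path_image (rectpath lo hi) = cbox lo hi - box lo hi"
      using lt by (intro path_image_rectpath_cbox_minus_box) auto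
    then show "path_image (rectpath lo hi) \<subseteq> cbox lo hi - {z}" using z by auto
  qed auto
  then show "contour_integral (rectpath lo hi) (\<lambda>\<zeta>. f \<zeta> / (\<zeta> - z)) = 2 * of_real pi * \<i> * f z"
    using winding_number_rectpath[OF z] by (simp add: contour_integral_unique)
next
  assume z: "z \<notin> cbox lo hi"
  have "((\<lambda>\<zeta>. f \<zeta> / (\<zeta> - z)) has_contour_integral 0) (rectpath lo hi)"
  proof (rule Cauchy_theorem_convex_simple[OF _ convex_box(1)])
    show "(\<lambda>\<zeta>. f \<zeta> / (\<zeta> - z)) holomorphic_on cbox lo hi" using z f by (intro holomorphic_intros) auto
    show "path_image (rectpath lo hi) \<subseteq> cbox lo hi" using lt by (intro path_image_rectpath_subset_cbox) auto
  qed auto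
  then show "contour_integral (rectpath lo hi) (\<lambda>\<zeta>. f \<zeta> / (\<zeta> - z)) = 0" by (rule contour_integral_unique)
qed

text \<open>All sides are oriented to the right or upwards, so a side shared by two cells gives the
  same integral with opposite signs.\<close>

lemma contour_integral_rectpath:
  assumes lt: "Re lo \<le> Re hi" "Im lo \<le> Im hi" and f: "continuous_on (path_image (rectpath lo hi)) f"
  shows "contour_integral (rectpath lo hi) f =
     contour_integral (linepath (Complex (Re lo) (Im lo)) (Complex (Re hi) (Im lo))) f
   + contour_integral (linepath (Complex (Re hi) (Im lo)) (Complex (Re hi) (Im hi))) f
   - contour_integral (linepath (Complex (Re lo) (Im hi)) (Complex (Re hi) (Im hi))) f
   - contour_integral (linepath (Complex (Re lo) (Im lo)) (Complex (Re lo) (Im hi))) f"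
proof -
  define a2 a4 where "a2 = Complex (Re hi) (Im lo)" and "a4 = Complex (Re lo) (Im hi)"
  have rp: "rectpath lo hi = linepath lo a2 +++ linepath a2 hi +++ linepath hi a4 +++ linepath a4 lo"
    by (simp add: rectpath_def a2_def a4_def Let_def)
  have pim: "path_image (rectpath lo hi) = closed_segment lo a2 \<union> closed_segment a2 hi \<union> closed_segment hi a4 \<union> closed_segment a4 lo"
    unfolding rp by (simp add: path_image_join Un_assoc)
  have i: "f contour_integrable_on linepath lo a2" "f contour_integrable_on linepath a2 hi"
       "f contour_integrable_on linepath hi a4" "f contour_integrable_on linepath a4 lo"
    using f unfolding pim by (auto intro!: contour_integrable_continuous_linepath elim!: continuous_on_subset)
  have "contour_integral (rectpath lo hi) f = contour_integral (linepath lo a2) f + (contour_integral (linepath a2 hi) f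
     + (contour_integral (linepath hi a4) f + contour_integral (linepath a4 lo) f))"
    unfolding rp using i by (simp add: contour_integrable_join)
  also have "contour_integral (linepath hi a4) f = - contour_integral (linepath a4 hi) f"
    using contour_integral_reversepath[of "linepath a4 hi" f] by simp
  also have "contour_integral (linepath a4 lo) f = - contour_integral (linepath lo a4) f"
    using contour_integral_reversepath[of "linepath lo a4" f] by simp
  finally show ?thesis by (simp add: a2_def a4_def)
qed

text \<open>The primitive is a logarithm and the end points are conjugate relative to
  \<open>x\<close>, so moduli cancel and twice an argument remains, whatever \<open>x\<close>,
  \<open>c\<close> and \<open>h\<close> are. The sign \<open>s\<close> moves the path into the right
  half plane, away from the branch cut.\<close>

lemma vertical_cauchy_bound:
  assumes d: "x \<noteq> c" and h: "0 < h"
  shows "cmod (contour_integral (linepath (Complex c (-h)) (Complex c h)) (\<lambda>\<zeta>. 1 / (\<zeta> - of_real x))) \<le> 2 * pi"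
proof -
  define s where "s = (if c < x then -1 else 1 :: real)"
  have seg: "Re \<zeta> = c" if "\<zeta> \<in> closed_segment (Complex c (-h)) (Complex c h)" for \<zeta>
    using that by (auto simp: in_segment) (simp add: algebra_simps)
  have pos: "Re (of_real s * (\<zeta> - of_real x)) > 0" if "Re \<zeta> = c" for \<zeta>
    using that d by (auto simp: s_def)
  let ?F = "\<lambda>\<zeta>. Ln (of_real s * (\<zeta> - of_real x))"
  have "((\<lambda>\<zeta>. 1 / (\<zeta> - of_real x)) has_contour_integral (?F (pathfinish (linepath (Complex c (-h)) (Complex c h))) - ?F (pathstart (linepath (Complex c (-h)) (Complex c h)))))
     (linepath (Complex c (-h)) (Complex c h))"
  proof (rule contour_integral_primitive)
    fix \<zeta> assume "\<zeta> \<in> closed_segment (Complex c (-h)) (Complex c h)"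
    then have p: "Re (of_real s * (\<zeta> - of_real x)) > 0" by (intro pos seg)
    then have nn: "of_real s * (\<zeta> - of_real x) \<notin> \<real>\<^sub>\<le>\<^sub>0" using complex_nonpos_Reals_iff by force
    have nz: "\<zeta> - of_real x \<noteq> 0" using p by auto
    have "(?F has_field_derivative inverse (of_real s * (\<zeta> - of_real x)) * of_real s) (at \<zeta>)"
      by (rule DERIV_chain2[where g = "\<lambda>\<zeta>. of_real s * (\<zeta> - of_real x)"], rule has_field_derivative_Ln[OF nn])
         (auto intro!: derivative_eq_intros)
    moreover have "inverse (of_real s * (\<zeta> - of_real x)) * of_real s = 1 / (\<zeta> - of_real x)"
      using nz by (simp add: s_def field_simps)
    ultimately show "(?F has_field_derivative 1 / (\<zeta> - of_real x)) (at \<zeta> within closed_segment (Complex c (-h)) (Complex c h))"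
      by (simp add: has_field_derivative_at_within)
  qed auto
  then have e: "contour_integral (linepath (Complex c (-h)) (Complex c h)) (\<lambda>\<zeta>. 1 / (\<zeta> - of_real x)) = ?F (Complex c h) - ?F (Complex c (-h))"
    by (simp add: contour_integral_unique)
  define w where "w = of_real s * (Complex c h - of_real x)"
  have w: "Re w > 0" unfolding w_def by (intro pos) simp
  have cw: "of_real s * (Complex c (-h) - of_real x) = cnj w" by (simp add: w_def complex_eq_iff)
  have "?F (Complex c h) - ?F (Complex c (-h)) = Ln w - cnj (Ln w)"
    using w by (subst cnj_Ln) (auto simp: cw w_def complex_nonpos_Reals_iff)
  also have "\<dots> = of_real (2 * Im (Ln w)) * \<i>" by (simp add: complex_eq_iff)
  finally have "cmod (?F (Complex c h) - ?F (Complex c (-h))) = 2 * \<bar>Im (Ln w)\<bar>" by (simp add: norm_mult)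
  also have "\<dots> \<le> 2 * pi"
  proof -
    have "w \<noteq> 0" using w by auto
    from Im_Ln_le_pi[OF this] mpi_less_Im_Ln[OF this] show ?thesis by linarith
  qed
  finally show ?thesis using e by simp
qed

lemma bounded_holomorphic_lipschitz:
  assumes f: "f holomorphic_on G" and G: "open G" and S: "convex S" and r: "0 < r"
    and sub: "\<And>p. p \<in> S \<Longrightarrow> cball p r \<subseteq> G" and B: "\<And>z. z \<in> G \<Longrightarrow> cmod (f z) \<le> B"
    and xy: "x \<in> S" "y \<in> S"
  shows "cmod (f x - f y) \<le> B / r * cmod (x - y)"
proof (rule field_differentiable_bound[OF S _ _ xy])
  fix p assume p: "p \<in> S"
  have pG: "p \<in> G" using sub[OF p] r by auto
  show "(f has_field_derivative deriv f p) (at p within S)"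
    using holomorphic_derivI[OF f G pG] by (rule has_field_derivative_at_within)
  have "cmod ((deriv ^^ 1) f p) \<le> fact 1 * B / r ^ 1"
  proof (rule Cauchy_inequality[OF _ _ r])
    show "f holomorphic_on ball p r" using sub[OF p] by (intro holomorphic_on_subset[OF f]) auto
    show "continuous_on (cball p r) f"
      using sub[OF p] by (intro continuous_on_subset[OF holomorphic_on_imp_continuous_on[OF f]])
    fix x assume "cmod (p - x) = r"
    then show "cmod (f x) \<le> B" using sub[OF p] by (intro B) (auto simp: dist_norm)
  qed
  then show "cmod (deriv f p) \<le> B / r" by simp
qed

text \<open>Maximum principle on large half discs: the arc is handled by the bound at infinity, and
  analyticity slightly below the real line gives continuity up to it.\<close>

lemma half_plane_maximum:
  assumes h: "0 < h" and G: "G holomorphic_on {z. - h < Im z}" and real: "\<And>x. cmod (G (of_real x)) \<le> L"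
    and inf: "\<And>e. 0 < e \<Longrightarrow> \<exists>R. \<forall>z. 0 \<le> Im z \<longrightarrow> R \<le> cmod z \<longrightarrow> cmod (G z) \<le> L + e"
    and z: "0 < Im z"
  shows "cmod (G z) \<le> L"
proof (rule field_le_epsilon)
  fix e :: real assume e: "0 < e"
  obtain R0 where R0: "\<And>z. 0 \<le> Im z \<Longrightarrow> R0 \<le> cmod z \<Longrightarrow> cmod (G z) \<le> L + e" using inf[OF e] by blast
  define R where "R = max R0 (cmod z + 1)"
  define S where "S = {z. 0 < Im z} \<inter> ball 0 R"
  have oS: "open S" unfolding S_def by (intro open_Int open_halfspace_Im_gt open_ball)
  have cS: "closure S \<subseteq> {z. 0 \<le> Im z} \<inter> cball 0 R"
    by (rule closure_minimal) (auto simp: S_def closed_halfspace_Im_ge intro!: closed_Int)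
  have Gc: "continuous_on {z. 0 \<le> Im z} G"
    using h by (intro continuous_on_subset[OF holomorphic_on_imp_continuous_on[OF G]]) auto
  show "cmod (G z) \<le> L + e"
  proof (rule maximum_modulus_frontier[of G S])
    show "G holomorphic_on interior S"
      unfolding interior_open[OF oS] using h by (intro holomorphic_on_subset[OF G]) (auto simp: S_def)
    show "continuous_on (closure S) G" using cS by (intro continuous_on_subset[OF Gc]) auto
    show "bounded S" by (auto simp: S_def intro!: bounded_Int)
    show "z \<in> S" using z by (auto simp: S_def R_def)
    fix w assume w: "w \<in> frontier S"
    then have w1: "0 \<le> Im w" "cmod w \<le> R" "w \<notin> S"
      using cS oS by (auto simp: frontier_def interior_open)
    show "cmod (G w) \<le> L + e"
    proof (cases "Im w = 0")
      case True
      then have "w = of_real (Re w)" by (simp add: complex_eq_iff)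
      then show ?thesis using real[of "Re w"] e by simp
    next
      case False
      then have "cmod w = R" using w1 by (auto simp: S_def)
      then show ?thesis using w1 by (intro R0) (auto simp: R_def)
    qed
  qed
qed

section \<open>Dyadic cells in a strip\<close>

text \<open>Summation by parts; the two vanishing end values remove the outer left and right
  sides.\<close>

lemma telescope_columns:
  fixes \<psi> L :: "nat \<Rightarrow> complex"
  assumes "\<psi> 0 = 0" "\<psi> (K - 1) = 0"
  shows "(\<Sum>k<K. \<psi> k * (L (Suc k) - L k)) = (\<Sum>k<K. (if k = 0 then 0 else \<psi> (k - 1) - \<psi> k) * L k)"
proof -
  have "(\<Sum>k<K. \<psi> k * L (Suc k)) = (\<Sum>k<K. if k = 0 then 0 else \<psi> (k - 1) * L k) + (if K = 0 then 0 else \<psi> (K - 1) * L K)"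
    by (induction K) auto
  then have "(\<Sum>k<K. \<psi> k * L (Suc k)) = (\<Sum>k<K. if k = 0 then 0 else \<psi> (k - 1) * L k)" using assms(2) by simp
  then have "(\<Sum>k<K. \<psi> k * (L (Suc k) - L k)) = (\<Sum>k<K. (if k = 0 then 0 else \<psi> (k - 1) * L k) - \<psi> k * L k)"
    by (simp add: right_diff_distrib sum_subtractf)
  also have "\<dots> = (\<Sum>k<K. (if k = 0 then 0 else \<psi> (k - 1) - \<psi> k) * L k)"
    by (rule sum.cong[OF refl]) (auto simp: assms(1) algebra_simps)
  finally show ?thesis .
qed

lemma sum_lessThan_double: "(\<Sum>k<2*(K::nat). G k) = (\<Sum>k<K. G (2*k) + (G (2*k+1) :: 'a :: comm_monoid_add))"
  by (induction K) (auto simp: algebra_simps)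

text \<open>Summation by parts over the dyadic cells: \<open>T n k\<close> and \<open>L n k\<close> stand for the integrals over the top
  and the left edge of the cell \<open>(n, k)\<close>, and \<open>B k\<close> for those over the bottom edges of the last generation.\<close>

lemma cell_summation:
  fixes \<psi> T L :: "nat \<Rightarrow> nat \<Rightarrow> complex"
  assumes \<psi>: "\<psi> 0 0 = 0" "\<And>n. \<psi> n 0 = 0" "\<And>n. \<psi> n (2^n - 1) = 0"
  shows "(\<Sum>n\<le>N. \<Sum>k<2^n. \<psi> n k * ((if n < N then T (Suc n) (2*k) + T (Suc n) (2*k+1) else B k)
            + L n (Suc k) - T n k - L n k))
       = (\<Sum>n\<le>N. \<Sum>k<2^n. (if n = 0 then 0 else \<psi> (n - 1) (k div 2) - \<psi> n k) * T n k
            + (if k = 0 then 0 else \<psi> n (k - 1) - \<psi> n k) * L n k) + (\<Sum>k<2^N. \<psi> N k * B k)"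
proof -
  define D where "D n = (\<Sum>k<2^n. if n = 0 then 0 else \<psi> (n - 1) (k div 2) * T n k)" for n
  define A where "A n = (\<Sum>k<2^n. \<psi> n k * T n k)" for n
  define V where "V n = (\<Sum>k<2^n. (if k = 0 then 0 else \<psi> n (k - 1) - \<psi> n k) * L n k)" for n
  define BB where "BB = (\<Sum>k<2^N. \<psi> N k * B k)"
  have ch: "(\<Sum>k<2^n. \<psi> n k * (T (Suc n) (2*k) + T (Suc n) (2*k+1))) = D (Suc n)" for n
  proof -
    have "D (Suc n) = (\<Sum>k<2*2^n. \<psi> n (k div 2) * T (Suc n) k)" by (simp add: D_def)
    also have "\<dots> = (\<Sum>k<2^n. \<psi> n k * T (Suc n) (2*k) + \<psi> n k * T (Suc n) (2*k+1))"
      unfolding sum_lessThan_double by simp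
    finally show ?thesis by (simp add: distrib_left)
  qed
  have col: "(\<Sum>k<2^n. \<psi> n k * ((if n < N then T (Suc n) (2*k) + T (Suc n) (2*k+1) else B k)
            + L n (Suc k) - T n k - L n k)) = (if n < N then D (Suc n) else BB) + V n - A n" if "n \<le> N" for n
  proof -
    have "(\<Sum>k<2^n. \<psi> n k * ((if n < N then T (Suc n) (2*k) + T (Suc n) (2*k+1) else B k) + L n (Suc k) - T n k - L n k))
      = (\<Sum>k<2^n. \<psi> n k * (if n < N then T (Suc n) (2*k) + T (Suc n) (2*k+1) else B k))
        + (\<Sum>k<2^n. \<psi> n k * (L n (Suc k) - L n k)) - A n"
      unfolding A_def sum.distrib[symmetric] sum_subtractf[symmetric]
      by (rule sum.cong[OF refl]) (simp add: algebra_simps)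
    also have "(\<Sum>k<2^n. \<psi> n k * (L n (Suc k) - L n k)) = V n"
      unfolding V_def by (rule telescope_columns[OF \<psi>(2,3)])
    also have "(\<Sum>k<2^n. \<psi> n k * (if n < N then T (Suc n) (2*k) + T (Suc n) (2*k+1) else B k)) = (if n < N then D (Suc n) else BB)"
    proof (cases "n < N")
      case True then show ?thesis using ch[of n] by simp
    next
      case False
      then have "n = N" using that by simp
      then show ?thesis by (simp add: BB_def)
    qed
    finally show ?thesis .
  qed
  have row: "(\<Sum>k<2^n. (if n = 0 then 0 else \<psi> (n - 1) (k div 2) - \<psi> n k) * T n k
            + (if k = 0 then 0 else \<psi> n (k - 1) - \<psi> n k) * L n k) = D n + V n - A n" for n
  proof -
    have "(\<Sum>k<2^n. (if n = 0 then 0 else \<psi> (n - 1) (k div 2) - \<psi> n k) * T n k) = D n - A n"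
      unfolding D_def A_def sum_subtractf[symmetric]
      by (rule sum.cong[OF refl]) (auto simp: algebra_simps \<psi>)
    then show ?thesis by (simp add: sum.distrib V_def)
  qed
  have D0: "D 0 = 0" by (simp add: D_def)
  have "(\<Sum>n\<le>N. (if n < N then D (Suc n) else BB)) = (\<Sum>n<N. D (Suc n)) + BB"
    by (simp add: lessThan_Suc_atMost[symmetric])
  also have "(\<Sum>n<N. D (Suc n)) = (\<Sum>n\<le>N. D n)"
    unfolding lessThan_Suc_atMost[symmetric] sum.lessThan_Suc_shift by (simp add: D0)
  finally have "(\<Sum>n\<le>N. (if n < N then D (Suc n) else BB) + V n - A n) = (\<Sum>n\<le>N. D n + V n - A n) + BB"
    by (simp add: sum.distrib sum_subtractf)
  moreover have "(\<Sum>n\<le>N. \<Sum>k<2^n. \<psi> n k * ((if n < N then T (Suc n) (2*k) + T (Suc n) (2*k+1) else B k)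
            + L n (Suc k) - T n k - L n k)) = (\<Sum>n\<le>N. (if n < N then D (Suc n) else BB) + V n - A n)"
    by (rule sum.cong[OF refl]) (simp only: col atMost_iff)
  moreover have "(\<Sum>n\<le>N. \<Sum>k<2^n. (if n = 0 then 0 else \<psi> (n - 1) (k div 2) - \<psi> n k) * T n k
            + (if k = 0 then 0 else \<psi> n (k - 1) - \<psi> n k) * L n k) = (\<Sum>n\<le>N. D n + V n - A n)"
    by (simp only: row)
  ultimately show ?thesis by (simp only: BB_def)
qed

lemma cmod_le_squares:
  assumes "\<bar>Re z\<bar> \<le> x" "\<bar>Im z\<bar> \<le> y" "x\<^sup>2 + y\<^sup>2 \<le> c\<^sup>2" "0 \<le> c"
  shows "cmod z \<le> c"
proof -
  have "(Re z)\<^sup>2 \<le> x\<^sup>2" "(Im z)\<^sup>2 \<le> y\<^sup>2" using power_mono[OF assms(1), of 2] power_mono[OF assms(2), of 2] by auto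
  then have "(cmod z)\<^sup>2 \<le> c\<^sup>2" using assms(3) unfolding cmod_power2 by linarith
  then show ?thesis using assms(4) by (rule power2_le_imp_le)
qed

context half_plane_fun
begin

lemma dc_cell:
  assumes "\<bar>Re z - Re (ctr n k)\<bar> \<le> 1/2 / 2^n" "1/2 / 2^n \<le> Im z" "Im z \<le> 1 / 2^n"
  shows "defect f z \<le> 10 * dc n k"
proof -
  have i: "Im (ctr n k) = 2 * (1 / 2^n)" by (simp add: Im_ctr)
  have "cmod (z - ctr n k) \<le> 8/5 * (1 / 2^n)"
  proof (rule cmod_le_squares)
    show "\<bar>Re (z - ctr n k)\<bar> \<le> 1/2 * (1 / 2^n)" using assms(1) by simp
    have e: "1/2 / 2^n = 1/2 * (1 / (2::real)^n)" by simp
    show "\<bar>Im (z - ctr n k)\<bar> \<le> 3/2 * (1 / 2^n)" using assms(2,3) unfolding minus_complex.sel i e by linarith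
    show "(1/2 * (1 / (2::real)^n))\<^sup>2 + (3/2 * (1 / 2^n))\<^sup>2 \<le> (8/5 * (1 / 2^n))\<^sup>2"
    proof -
      have "(1/2 * x)\<^sup>2 + (3/2 * x)\<^sup>2 \<le> (8/5 * x)\<^sup>2" for x :: real
        using zero_le_power2[of x] by (simp add: power2_eq_square)
      then show ?thesis .
    qed
  qed simp
  then have "defect f z \<le> 2 / (1 - 4/5) * dc n k" by (intro dc_near(1)) auto
  then show ?thesis by simp
qed

text \<open>With \<open>h = 1 / 2^N\<close>, continuation to depth \<open>t \<ge> 4 * h\<close>
  leaves room for a disc of radius \<open>6 * h\<close> about the sample point at height
  \<open>2 * h\<close>, enough to cover a cell that crosses the real line.\<close>

lemma dc_bottom:
  assumes t: "4 / 2^N \<le> t" and z: "\<bar>Re z - Re (ctr N k)\<bar> \<le> 1 / 2^N" "\<bar>Im z\<bar> \<le> 5/4 / 2^N"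
  shows "defect f z \<le> 10 * dc N k"
proof -
  define h where "h = 1 / (2::real)^N"
  have h: "0 < h" by (simp add: h_def)
  have i: "Im (ctr N k) = 2 * h" by (simp add: Im_ctr h_def)
  have "cmod (z - ctr N k) \<le> 4/5 * (6 * h)"
  proof (rule cmod_le_squares)
    show "\<bar>Re (z - ctr N k)\<bar> \<le> h" using z(1) by (simp add: h_def)
    have e: "5/4 / 2^N = 5/4 * h" by (simp add: h_def)
    show "\<bar>Im (z - ctr N k)\<bar> \<le> 13/4 * h" using z(2) h unfolding minus_complex.sel i e by linarith
    show "h\<^sup>2 + (13/4 * h)\<^sup>2 \<le> (4/5 * (6 * h))\<^sup>2" using zero_le_power2[of h] by (simp add: power2_eq_square)
  qed (use h in simp)
  moreover have "6 * h \<le> Im (ctr N k) + t" using t by (simp add: i h_def)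
  ultimately have "defect f z \<le> 2 / (1 - 4/5) * dc N k"
    using h by (intro defect_harnack(1)[OF hol le_1]) auto
  then show ?thesis by simp
qed

end

text \<open>10 is the Harnack factor between a sample point and its cell, and
  \<open>10 * \<eta> \<le> 3/4\<close> turns the resulting defect into modulus at least 1/2.
  \<open>t4\<close> lets the last generation reach below the real line.\<close>

locale bezout_strip = Th: half_plane_fun \<Theta> t + Fn: half_plane_fun f t +
    hysteresis "\<lambda>n k. defect \<Theta> (ctr n k)" "\<lambda>n k. defect f (ctr n k)" \<alpha> m N \<tau> packing_const
  for \<Theta> f t \<alpha> m N \<tau> +
  fixes \<eta> :: real
  assumes \<eta>: "0 \<le> \<eta>" "10 * \<eta> \<le> 3/4" and \<alpha>_le: "\<And>i. i < m \<Longrightarrow> \<alpha> i \<le> \<eta>" and t4: "4 / 2^N \<le> t"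
    and out: "\<And>z. - t < Im z \<Longrightarrow> \<not> (0 < Re z \<and> Re z < 1 \<and> Im z < 1) \<Longrightarrow> defect \<Theta> z \<le> 10 * \<eta>"
begin

definition h :: real where "h = 1 / 2^N"
definition \<psi> :: "nat \<Rightarrow> nat \<Rightarrow> real" where "\<psi> n k = real (st n k) / real m"
text \<open>Cells of the last generation extend down to \<open>- h\<close>. The real line then
  contains no horizontal edge and is crossed only by vertical edges of that generation.\<close>

definition low :: "nat \<Rightarrow> real" where "low n = (if n < N then 1/2 / 2^n else - h)"
definition lo :: "nat \<Rightarrow> nat \<Rightarrow> complex" where "lo n k = Complex (real k / 2^n) (low n)"
definition hi :: "nat \<Rightarrow> nat \<Rightarrow> complex" where "hi n k = Complex (real (Suc k) / 2^n) (1 / 2^n)"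
definition top_left :: "nat \<Rightarrow> nat \<Rightarrow> complex" where "top_left n k = Complex (real k / 2^n) (1 / 2^n)"

abbreviation cell :: "nat \<Rightarrow> nat \<Rightarrow> complex set" where "cell n k \<equiv> cbox (lo n k) (hi n k)"

lemma h_pos: "0 < h" by (simp add: h_def)

lemma h_le: "n \<le> N \<Longrightarrow> h \<le> 1 / 2^n" by (simp add: h_def frac_le power_increasing)

lemma t_h: "4 * h \<le> t" using t4 by (simp add: h_def)

lemma low_less: "low n < 1 / 2^n"
proof -
  have p: "0 < 1 / (2::real)^n" by simp
  have "1/2 / 2^n = 1/2 * (1 / (2::real)^n)" by simp
  then have "1/2 / 2^n < 1 / (2::real)^n" "- h < 1 / 2^n" using h_pos p by linarith+
  then show ?thesis by (simp add: low_def)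
qed

lemma low_ge: "- h \<le> low n"
proof -
  have "0 < 1/2 / (2::real)^n" by simp
  then show ?thesis using h_pos less_trans[of "-h" 0 "1/2 / 2^n"] by (auto simp: low_def less_imp_le)
qed

lemma cell_iff:
  "z \<in> cell n k \<longleftrightarrow> real k / 2^n \<le> Re z \<and> Re z \<le> real (Suc k) / 2^n \<and> low n \<le> Im z \<and> Im z \<le> 1 / 2^n"
  "z \<in> box (lo n k) (hi n k) \<longleftrightarrow> real k / 2^n < Re z \<and> Re z < real (Suc k) / 2^n \<and> low n < Im z \<and> Im z < 1 / 2^n"
  by (auto simp: in_cbox_complex_iff in_box_complex_iff lo_def hi_def)

lemma Re_center: "real k / 2^n \<le> x \<Longrightarrow> x \<le> real (Suc k) / 2^n \<Longrightarrow> \<bar>x - Re (ctr n k)\<bar> \<le> 1/2 / 2^n"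
  by (auto simp: Re_ctr abs_le_iff add_divide_distrib)

lemma cell_defect:
  assumes n: "n \<le> N" and z: "z \<in> cell n k"
  shows "defect \<Theta> z \<le> 10 * defect \<Theta> (ctr n k)" "defect f z \<le> 10 * defect f (ctr n k)"
proof -
  have zz: "real k / 2^n \<le> Re z" "Re z \<le> real (Suc k) / 2^n" "low n \<le> Im z" "Im z \<le> 1 / 2^n"
    using z by (simp_all add: cell_iff)
  have re: "\<bar>Re z - Re (ctr n k)\<bar> \<le> 1/2 / 2^n" using zz by (intro Re_center)
  have "defect \<Theta> z \<le> 10 * defect \<Theta> (ctr n k) \<and> defect f z \<le> 10 * defect f (ctr n k)"
  proof (cases "n < N")
    case True
    then show ?thesis using re zz(3,4) by (intro conjI Th.dc_cell Fn.dc_cell) (auto simp: low_def)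
  next
    case False
    then have nN: "n = N" using n by simp
    have "\<bar>Im z\<bar> \<le> h" using zz(3,4) by (auto simp: nN low_def h_def)
    also have "h \<le> 5/4 / 2^N" by (simp add: h_def divide_simps)
    finally have im: "\<bar>Im z\<bar> \<le> 5/4 / 2^N" .
    have "1/2 / 2^n \<le> 1 / (2::real)^n" by (simp add: divide_simps)
    then have "\<bar>Re z - Re (ctr N k)\<bar> \<le> 1 / 2^N" using re unfolding nN by linarith
    then show ?thesis using im t4 unfolding nN by (intro conjI Th.dc_bottom Fn.dc_bottom)
  qed
  then show "defect \<Theta> z \<le> 10 * defect \<Theta> (ctr n k)" "defect f z \<le> 10 * defect f (ctr n k)" by auto
qed

lemma center_defect_f: "0 < st n k \<Longrightarrow> defect f (ctr n k) \<le> \<eta>"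
  using invariant[of n k] \<alpha>_le[of "m - st n k"] m by force

lemma center_defect_\<Theta>: "st n k < m \<Longrightarrow> defect \<Theta> (ctr n k) \<le> \<eta>"
  using invariant[of n k] \<alpha>_le[of "st n k"] by force

lemma cell_f: "n \<le> N \<Longrightarrow> z \<in> cell n k \<Longrightarrow> 0 < st n k \<Longrightarrow> defect f z \<le> 10 * \<eta>"
  using cell_defect(2)[of n z k] center_defect_f[of n k] by linarith

lemma cell_\<Theta>: "n \<le> N \<Longrightarrow> z \<in> cell n k \<Longrightarrow> st n k < m \<Longrightarrow> defect \<Theta> z \<le> 10 * \<eta>"
  using cell_defect(1)[of n z k] center_defect_\<Theta>[of n k] by linarith

lemma half_le: "defect g z \<le> 10 * \<eta> \<Longrightarrow> 1/2 \<le> cmod (g z)"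
proof -
  assume "defect g z \<le> 10 * \<eta>"
  then have "(1/2)\<^sup>2 \<le> (cmod (g z))\<^sup>2" using \<eta> by (simp add: defect_def power2_eq_square)
  then show ?thesis by (rule power2_le_imp_le) simp
qed

text \<open>\<open>True\<close> stands for the top edge of a cell, \<open>False\<close> for its left
  edge. Lower and right edges belong to other cells, except at the right border, where the state is
  0, and at the bottom, which \<open>Q\<close> treats.\<close>

definition edge_start :: "bool \<Rightarrow> nat \<Rightarrow> nat \<Rightarrow> complex" where "edge_start d n k = (if d then top_left n k else lo n k)"
definition edge_end :: "bool \<Rightarrow> nat \<Rightarrow> nat \<Rightarrow> complex" where "edge_end d n k = (if d then hi n k else top_left n k)"
abbreviation edge :: "bool \<Rightarrow> nat \<Rightarrow> nat \<Rightarrow> complex set" where "edge d n k \<equiv> closed_segment (edge_start d n k) (edge_end d n k)"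
definition jump :: "bool \<Rightarrow> nat \<Rightarrow> nat \<Rightarrow> real" where
  "jump d n k = (if d then (if n = 0 then 0 else \<psi> (n - 1) (k div 2) - \<psi> n k)
     else (if k = 0 then 0 else \<psi> n (k - 1) - \<psi> n k))"

lemma edge_top: "\<zeta> \<in> edge True n k \<longleftrightarrow> Im \<zeta> = 1 / 2^n \<and> real k / 2^n \<le> Re \<zeta> \<and> Re \<zeta> \<le> real (Suc k) / 2^n"
proof -
  have "real k / 2^n \<le> real (Suc k) / 2^n" by (simp add: divide_right_mono)
  then show ?thesis by (auto simp: edge_start_def edge_end_def top_left_def hi_def closed_segment_same_Im closed_segment_eq_real_ivl)
qed

lemma edge_left: "\<zeta> \<in> edge False n k \<longleftrightarrow> Re \<zeta> = real k / 2^n \<and> low n \<le> Im \<zeta> \<and> Im \<zeta> \<le> 1 / 2^n"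
  using low_less[of n] by (auto simp: edge_start_def edge_end_def top_left_def lo_def closed_segment_same_Re closed_segment_eq_real_ivl)

lemma edge_subset_cell: "edge d n k \<subseteq> cell n k"
proof -
  have "real k / 2^n \<le> real (Suc k) / 2^n" by (simp add: divide_right_mono)
  then show ?thesis using low_less[of n] by (cases d) (auto simp: edge_top edge_left cell_iff(1) simp del: of_nat_Suc)
qed

lemma left_edge_subset_previous: "0 < k \<Longrightarrow> edge False n k \<subseteq> cell n (k - 1)"
proof -
  assume "0 < k"
  then have "Suc (k - 1) = k" by simp
  moreover have "real (k - 1) / 2^n \<le> real k / 2^n" by (simp add: divide_right_mono)
  ultimately show ?thesis by (auto simp: edge_left cell_iff(1) simp del: of_nat_Suc)
qed

lemma top_edge_subset_parent:
  assumes n: "0 < n" "n \<le> N"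
  shows "edge True n k \<subseteq> cell (n - 1) (k div 2)"
proof -
  obtain l where l: "n = Suc l" using n(1) by (cases n) auto
  have "2 * (k div 2) \<le> k" "k + 1 \<le> 2 * Suc (k div 2)" by auto
  then have "real (2 * (k div 2)) \<le> real k" "real (k + 1) \<le> real (2 * Suc (k div 2))" by (simp_all only: of_nat_le_iff)
  then have "real (k div 2) / 2^l \<le> real k / 2^n" "real (Suc k) / 2^n \<le> real (Suc (k div 2)) / 2^l"
    by (simp_all add: l divide_simps)
  moreover have "low l = 1 / 2^n" "1 / 2^n \<le> 1 / (2::real)^l" using n by (simp_all add: l low_def divide_simps)
  ultimately show ?thesis by (auto simp: edge_top cell_iff(1) l simp del: of_nat_Suc)
qed

text \<open>The states on the two sides differ, so one is below \<open>m\<close> and the other is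
  positive: \<open>\<Theta>\<close> is large on one side, \<open>f\<close> on the other, and on the
  edge both are. The density with \<open>\<Theta> * f\<close> in the denominator is therefore
  bounded.\<close>

lemma edge_cells:
  assumes n: "n \<le> N" and k: "k < 2^n" and j: "jump d n k \<noteq> 0"
  obtains n1 k1 n2 k2 where "n1 \<le> N" "k1 < 2^n1" "edge d n k \<subseteq> cell n1 k1" "st n1 k1 < m"
    "n2 \<le> N" "k2 < 2^n2" "edge d n k \<subseteq> cell n2 k2" "0 < st n2 k2"
proof -
  define n' k' where "n' = (if d then n - 1 else n)" and "k' = (if d then k div 2 else k - 1)"
  have 1: "n' \<le> N" using n by (auto simp: n'_def)
  have d0: "d \<Longrightarrow> 0 < n" "\<not> d \<Longrightarrow> 0 < k" using j by (auto simp: jump_def split: if_splits)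
  have 2: "k' < 2^n'"
  proof (cases d)
    case True
    then obtain l where "n = Suc l" using d0 by (cases n) auto
    then show ?thesis using k True by (auto simp: n'_def k'_def)
  next
    case False
    then show ?thesis using k by (simp add: n'_def k'_def)
  qed
  have 3: "edge d n k \<subseteq> cell n' k'"
    using top_edge_subset_parent[of n k] left_edge_subset_previous[of k n] d0 n
    by (cases d) (auto simp: n'_def k'_def)
  have "\<psi> n' k' \<noteq> \<psi> n k" using j by (auto simp: jump_def n'_def k'_def split: if_splits)
  then have "st n' k' \<noteq> st n k" by (auto simp: \<psi>_def)
  then consider "st n' k' < st n k" | "st n k < st n' k'" by linarith
  then show thesis
  proof cases
    case 1
    then have "st n' k' < m" "0 < st n k" using st_le_m[of n k] by auto
    then show ?thesis using that[OF \<open>n' \<le> N\<close> 2 3 _ n k edge_subset_cell] by blast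
  next
    case b: 2
    then have "st n k < m" "0 < st n' k'" using st_le_m[of n' k'] by auto
    then show ?thesis using that[OF n k edge_subset_cell _ \<open>n' \<le> N\<close> 2 3] by blast
  qed
qed

lemma edge_defect:
  assumes "n \<le> N" "k < 2^n" "jump d n k \<noteq> 0" "\<zeta> \<in> edge d n k"
  shows "defect \<Theta> \<zeta> \<le> 10 * \<eta>" "defect f \<zeta> \<le> 10 * \<eta>"
  using edge_cells[OF assms(1-3)] cell_\<Theta> cell_f assms(4) by (metis subsetD)+

text \<open>Vertical and horizontal jumps are single steps of size \<open>1 / m\<close>; the factor
  \<open>2^n\<close> undoes the interval length contained in \<open>wt\<close>.\<close>

lemma sum_jump_le: "(\<Sum>d\<in>UNIV. \<bar>jump d n k\<bar>) \<le> 2^n * wt n k / real m"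
proof -
  have m0: "0 < real m" using m by simp
  have top: "\<bar>jump True n k\<bar> \<le> of_bool (ev n k) / real m"
  proof (cases n)
    case 0 then show ?thesis by (simp add: jump_def)
  next
    case (Suc l)
    have "\<bar>real (st l (k div 2)) - real (st (Suc l) k)\<bar> \<le> of_bool (ev n k)"
      by (cases rule: st_Suc_cases[of l k]) (auto simp: ev_def Suc)
    then have "\<bar>real (st l (k div 2)) - real (st (Suc l) k)\<bar> / real m \<le> of_bool (ev n k) / real m" by (simp add: divide_right_mono)
    then show ?thesis using m0 by (simp add: jump_def \<psi>_def Suc diff_divide_distrib[symmetric] abs_divide)
  qed
  have left: "\<bar>jump False n k\<bar> \<le> side_jump n k / real m"
  proof (cases k)
    case 0 then show ?thesis by (simp add: jump_def side_jump_def)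
  next
    case (Suc j)
    have "\<bar>real (st n j) - real (st n (Suc j))\<bar> \<le> side_jump n k"
      using neighbour_states[of n j] by (auto simp: side_jump_def Suc)
    then have "\<bar>real (st n j) - real (st n (Suc j))\<bar> / real m \<le> side_jump n k / real m" by (simp add: divide_right_mono)
    then show ?thesis using m0 by (simp add: jump_def \<psi>_def Suc diff_divide_distrib[symmetric] abs_divide)
  qed
  have "(\<Sum>d\<in>UNIV. \<bar>jump d n k\<bar>) = \<bar>jump True n k\<bar> + \<bar>jump False n k\<bar>" by (simp add: UNIV_bool)
  also have "\<dots> \<le> of_bool (ev n k) / real m + side_jump n k / real m" using top left by linarith
  also have "\<dots> = 2^n * wt n k / real m"
    by (simp add: wt_def wE_def wV_def distrib_left add_divide_distrib)
  finally show ?thesis .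
qed

end

section \<open>The correcting Cauchy integral\<close>

context bezout_strip
begin

definition nodes :: "nat \<Rightarrow> (nat \<times> nat) set" where "nodes n = Sigma {n..N} (\<lambda>l. {..<2^l})"

text \<open>The real part of \<open>\<i> / (z - cnj (ctr l j))\<close>: a Poisson kernel with pole
  at the reflected sample point.\<close>

definition pk :: "nat \<Rightarrow> nat \<Rightarrow> complex \<Rightarrow> real" where
  "pk l j z = (Im z + 2/2^l) / ((Re z - (real j + 1/2) / 2^l)\<^sup>2 + (Im z + 2/2^l)\<^sup>2)"

text \<open>The exponential is Jones' device: on the real line its modulus damps the contribution of a node
  by that of all nodes of the same or a later generation, so that the sum over all nodes telescopes.\<close>

definition E :: "nat \<Rightarrow> complex \<Rightarrow> complex" where
  "E n z = exp (- (\<Sum>p\<in>nodes n. of_real (wt (fst p) (snd p) / 20) * (\<i> / (z - cnj (ctr (fst p) (snd p))))))"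

text \<open>The pole factor supplies one power of decay; with the decay of \<open>I\<close> on the
  real line it gives the square in the denominator of \<open>pk\<close>.\<close>

definition \<kappa> :: "nat \<Rightarrow> nat \<Rightarrow> complex \<Rightarrow> complex" where
  "\<kappa> n k z = E n z / (z - cnj (ctr n k))"

text \<open>Division by \<open>\<kappa>\<close> at \<open>\<zeta>\<close> normalises the kernel to 1
  there, so \<open>\<kappa> n k z * I d n k z\<close> jumps across the edge like the plain Cauchy
  integral of \<open>1 / (\<Theta> * f)\<close>.\<close>

definition dens :: "nat \<Rightarrow> nat \<Rightarrow> complex \<Rightarrow> complex" where
  "dens n k \<zeta> = 1 / (\<kappa> n k \<zeta> * \<Theta> \<zeta> * f \<zeta>)"

lemma finite_nodes: "finite (nodes n)" by (simp add: nodes_def)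

lemma nodes_D: "p \<in> nodes n \<Longrightarrow> n \<le> fst p \<and> fst p \<le> N \<and> snd p < 2 ^ fst p"
  by (auto simp: nodes_def)

lemma sum_nodes: "(\<Sum>p\<in>nodes 0. F (fst p) (snd p)) = (\<Sum>n\<le>N. \<Sum>k<2^n. F n k)"
  unfolding nodes_def by (subst sum.Sigma) (auto simp: split_def atLeast0AtMost)

lemma norm_E: "cmod (E n z) = exp (- (\<Sum>p\<in>nodes n. wt (fst p) (snd p) / 20 * pk (fst p) (snd p) z))"
proof -
  have "Re (of_real (wt l j / 20) * (\<i> / (z - cnj (ctr l j)))) = wt l j / 20 * pk l j z" for l j
  proof -
    have "Re (\<i> / (z - cnj (ctr l j))) = pk l j z" by (simp add: Re_divide pk_def Re_ctr Im_ctr)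
    then show ?thesis by (metis Re_complex_of_real Im_complex_of_real times_complex.sel(1) mult_zero_left diff_zero)
  qed
  then show ?thesis by (simp only: E_def norm_exp_eq_Re uminus_complex.sel Re_sum)
qed

text \<open>The weights \<open>wt / 20\<close> satisfy the packing condition with constant 1, so
  \<open>tree_poisson\<close> bounds the exponent by \<open>52 * 60 = 3120\<close>. The 52 is
  generous enough for edges above and across the real line alike.\<close>

lemma E_lower:
  assumes y: "0 < y" and P: "\<And>l j. n \<le> l \<Longrightarrow> l \<le> N \<Longrightarrow> pk l j \<zeta> \<le> 52 * tree_kernel (Re \<zeta>) y l j"
  shows "exp (- 3120) \<le> cmod (E n \<zeta>)"
proof -
  have tk: "0 \<le> tree_kernel x y l j" for x l j using y by (simp add: tree_kernel_def)
  have "(\<Sum>p\<in>nodes n. wt (fst p) (snd p) / 20 * pk (fst p) (snd p) \<zeta>)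
      \<le> (\<Sum>p\<in>nodes n. wt (fst p) (snd p) / 20 * (52 * tree_kernel (Re \<zeta>) y (fst p) (snd p)))"
    using P nodes_D wt_nonneg by (intro sum_mono mult_left_mono) auto
  also have "\<dots> \<le> (\<Sum>p\<in>nodes 0. wt (fst p) (snd p) / 20 * (52 * tree_kernel (Re \<zeta>) y (fst p) (snd p)))"
    using tk wt_nonneg by (intro sum_mono2 finite_nodes) (auto simp: nodes_def)
  also have "\<dots> = 52 * (\<Sum>n\<le>N. \<Sum>k<2^n. wt n k / 20 * tree_kernel (Re \<zeta>) y n k)"
    unfolding sum_nodes[symmetric] sum_distrib_left by (rule sum.cong[OF refl]) simp
  also have "(\<Sum>n\<le>N. \<Sum>k<2^n. wt n k / 20 * tree_kernel (Re \<zeta>) y n k) \<le> 60 * 1"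
  proof (rule tree_poisson[OF _ _ y])
    show "0 \<le> wt n k / 20" for n k using wt_nonneg[of n k] by simp
    fix n k assume nk: "n \<le> N" "k < (2::nat)^n"
    have "subsum N (\<lambda>n k. wt n k / 20) n k = subsum N wt n k / 20"
      by (simp add: subsum_def sum_divide_distrib)
    then show "subsum N (\<lambda>n k. wt n k / 20) n k \<le> 1 / 2^n" using subsum_wt_le[OF nk] by simp
  qed
  finally show ?thesis unfolding norm_E by simp
qed

text \<open>Points down to \<open>- 5/4 * h\<close> are still \<open>3/4 * h\<close> above the poles
  at \<open>- 2 * h\<close>, so the kernel is comparable with the one at height \<open>h\<close>, to
  which \<open>tree_poisson\<close> applies.\<close>

lemma E_lower_bottom:
  assumes im: "\<bar>Im \<zeta>\<bar> \<le> 5/4 * h"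
  shows "exp (- 3120) \<le> cmod (E N \<zeta>)"
proof (rule E_lower[OF h_pos])
  fix l j assume l: "N \<le> l" "l \<le> N"
  define u where "u = Im \<zeta> + 2 * h"
  define X where "X = (Re \<zeta> - (real j + 1/2) / 2^l)\<^sup>2"
  have u: "3/4 * h \<le> u" "u \<le> 13/4 * h" using im h_pos unfolding u_def by linarith+
  have X: "0 \<le> X" by (simp add: X_def)
  have "l = N" using l by simp
  then have cofactor: "2 / 2^l = 2 * h" by (simp only: h_def)
  have p: "pk l j \<zeta> = u / (X + u\<^sup>2)" by (simp add: pk_def cofactor u_def X_def)
  have tk: "tree_kernel (Re \<zeta>) h l j = h / (X + (3*h)\<^sup>2)" by (simp add: tree_kernel_def cofactor X_def)
  have "u * X \<le> 52 * h * X" using u h_pos X by (intro mult_right_mono) auto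
  moreover have "u * (9 * h\<^sup>2) \<le> 52 * h * u\<^sup>2"
  proof -
    have "u * h * (9 * h) \<le> u * h * (52 * u)" using u h_pos by (intro mult_left_mono) auto
    then show ?thesis by (simp add: power2_eq_square mult_ac)
  qed
  ultimately have "u * (X + (3*h)\<^sup>2) \<le> 52 * h * (X + u\<^sup>2)" by (simp add: distrib_left power_mult_distrib)
  moreover have "0 < X + u\<^sup>2" "0 < X + (3*h)\<^sup>2" using X u h_pos by (simp_all add: add_nonneg_pos)
  ultimately have "u / (X + u\<^sup>2) \<le> 52 * h / (X + (3*h)\<^sup>2)" by (simp add: frac_le_eq pos_divide_le_eq pos_le_divide_eq)
  then show "pk l j \<zeta> \<le> 52 * tree_kernel (Re \<zeta>) h l j" by (simp add: p tk)
qed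

lemma E_lower_top:
  assumes im: "1/2 / 2^n \<le> Im \<zeta>"
  shows "exp (- 3120) \<le> cmod (E n \<zeta>)"
proof (rule E_lower)
  have p: "0 < 1/2 / (2::real)^n" by simp
  show y: "0 < Im \<zeta>" by (rule less_le_trans[OF p im])
  fix l j assume l: "n \<le> l" "l \<le> N"
  have "2 / 2^l \<le> 2 / (2::real)^n" using l by (intro divide_left_mono power_increasing) auto
  also have "\<dots> = 4 * (1/2 / 2^n)" by simp
  also have "\<dots> \<le> 4 * Im \<zeta>" using im by linarith
  finally have "Im \<zeta> + 2/2^l \<le> 52 * Im \<zeta>" using y by linarith
  then show "pk l j \<zeta> \<le> 52 * tree_kernel (Re \<zeta>) (Im \<zeta>) l j"
    unfolding pk_def tree_kernel_def times_divide_eq_right by (rule divide_right_mono) auto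
qed

lemma low_edge: "n < N \<Longrightarrow> low n = 1/2 / 2^n" "low N = - h" by (simp_all add: low_def)

lemma E_lower_edge:
  assumes n: "n \<le> N" and \<zeta>: "\<zeta> \<in> edge d n k"
  shows "exp (- 3120) \<le> cmod (E n \<zeta>)"
proof (cases "n < N \<or> d")
  case True
  have "1/2 / 2^n \<le> 1 / (2::real)^n" by (simp add: divide_simps)
  then have "1/2 / 2^n \<le> Im \<zeta>" using \<zeta> True by (cases d) (auto simp: edge_top edge_left low_edge simp del: of_nat_Suc)
  then show ?thesis by (rule E_lower_top)
next
  case False
  then have "n = N" using n by auto
  then have "- h \<le> Im \<zeta>" "Im \<zeta> \<le> h" using \<zeta> False by (auto simp: edge_left low_edge h_def)
  then have "\<bar>Im \<zeta>\<bar> \<le> 5/4 * h" using h_pos by linarith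
  then show ?thesis using \<open>n = N\<close> E_lower_bottom by simp
qed

lemma edge_near:
  assumes n: "n \<le> N" and \<zeta>: "\<zeta> \<in> edge d n k"
  shows "cmod (\<zeta> - cnj (ctr n k)) \<le> 4 / 2^n" "\<bar>Im \<zeta>\<bar> \<le> 1 / 2^n"
proof -
  have c: "\<zeta> \<in> cell n k" using edge_subset_cell \<zeta> by blast
  then have re: "\<bar>Re \<zeta> - Re (ctr n k)\<bar> \<le> 1/2 / 2^n" by (intro Re_center) (auto simp: cell_iff)
  have "- h \<le> Im \<zeta>" "Im \<zeta> \<le> 1 / 2^n" using c low_ge[of n] by (auto simp: cell_iff)
  then show im: "\<bar>Im \<zeta>\<bar> \<le> 1 / 2^n" using h_le[OF n] by linarith
  have "cmod (\<zeta> - cnj (ctr n k)) \<le> 1/2 * (1 / 2^n) + 3 * (1 / 2^n)"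
  proof (rule cmod_le_Re_Im)
    show "\<bar>Re (\<zeta> - cnj (ctr n k))\<bar> \<le> 1/2 * (1 / 2^n)" using re by simp
    have e: "Im (cnj (ctr n k)) = - (2 * (1 / 2^n))" by (simp add: Im_ctr)
    show "\<bar>Im (\<zeta> - cnj (ctr n k))\<bar> \<le> 3 * (1 / 2^n)" using im unfolding minus_complex.sel e by linarith
  qed
  also have "1/2 * (1 / 2^n) + 3 * (1 / 2^n) \<le> 4 / (2::real)^n" by (simp add: divide_simps)
  finally show "cmod (\<zeta> - cnj (ctr n k)) \<le> 4 / 2^n" .
qed

lemma pole_outside: "- 2 * h < Im z \<Longrightarrow> n \<le> N \<Longrightarrow> z \<noteq> cnj (ctr n k)"
proof
  assume a: "- 2 * h < Im z" "n \<le> N" "z = cnj (ctr n k)"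
  have "Im z = - (2 * (1 / 2^n))" using a(3) by (simp add: Im_ctr)
  then show False using a(1) h_le[OF a(2)] by linarith
qed

lemma E_nonzero: "E n z \<noteq> 0" by (simp add: E_def)

lemma E_holomorphic: "E n holomorphic_on {z. - 2 * h < Im z}"
  unfolding E_def using pole_outside nodes_D by (intro holomorphic_intros) auto

lemma \<kappa>_holomorphic: "n \<le> N \<Longrightarrow> \<kappa> n k holomorphic_on {z. - 2 * h < Im z}"
  unfolding \<kappa>_def using pole_outside by (intro holomorphic_intros E_holomorphic) auto

lemma \<kappa>_nonzero: "n \<le> N \<Longrightarrow> - 2 * h < Im z \<Longrightarrow> \<kappa> n k z \<noteq> 0"
  using pole_outside E_nonzero by (simp add: \<kappa>_def)

lemma hol_strip: "\<Theta> holomorphic_on {z. - 2 * h < Im z}" "f holomorphic_on {z. - 2 * h < Im z}"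
  using t_h h_pos by (auto intro!: holomorphic_on_subset[OF Th.hol] holomorphic_on_subset[OF Fn.hol])

lemma dens_holomorphic:
  assumes "n \<le> N" "S \<subseteq> {z. - 2 * h < Im z}" "\<And>z. z \<in> S \<Longrightarrow> \<Theta> z \<noteq> 0" "\<And>z. z \<in> S \<Longrightarrow> f z \<noteq> 0"
  shows "dens n k holomorphic_on S"
  unfolding dens_def using assms \<kappa>_nonzero
  by (intro holomorphic_intros holomorphic_on_subset[OF \<kappa>_holomorphic] holomorphic_on_subset[OF hol_strip(1)]
      holomorphic_on_subset[OF hol_strip(2)]) auto

lemma edge_strip: "n \<le> N \<Longrightarrow> edge d n k \<subseteq> {z. - 2 * h < Im z}"
  using edge_subset_cell[of d n k] low_ge[of n] h_pos by (force simp: cell_iff)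

lemma edge_nonzero:
  assumes "n \<le> N" "k < 2^n" "jump d n k \<noteq> 0" "\<zeta> \<in> edge d n k"
  shows "\<Theta> \<zeta> \<noteq> 0" "f \<zeta> \<noteq> 0"
  using edge_defect[OF assms] half_le[of \<Theta> \<zeta>] half_le[of f \<zeta>] by auto

lemma dens_continuous:
  assumes "n \<le> N" "k < 2^n" "jump d n k \<noteq> 0"
  shows "continuous_on (edge d n k) (dens n k)"
  by (intro holomorphic_on_imp_continuous_on dens_holomorphic assms(1) edge_strip edge_nonzero[OF assms])

lemma dens_le:
  assumes E: "exp (- 3120) \<le> cmod (E n \<zeta>)" and "1/2 \<le> cmod (\<Theta> \<zeta>)" "1/2 \<le> cmod (f \<zeta>)"
  shows "cmod (dens n k \<zeta>) \<le> 4 * exp 3120 * cmod (\<zeta> - cnj (ctr n k))"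
proof -
  have e0: "0 < exp (- 3120 :: real)" by simp
  have "exp (- 3120) * (1/2 * (1/2)) \<le> cmod (E n \<zeta>) * (cmod (\<Theta> \<zeta>) * cmod (f \<zeta>))"
    using assms by (intro mult_mono) auto
  moreover have "exp (- 3120) * (1/2 * (1/2)) = 1 / (4 * exp (3120 :: real))" by (simp add: exp_minus inverse_eq_divide)
  ultimately have l: "1 / (4 * exp 3120) \<le> cmod (E n \<zeta>) * (cmod (\<Theta> \<zeta>) * cmod (f \<zeta>))" by simp
  have "0 < cmod (E n \<zeta>) * (cmod (\<Theta> \<zeta>) * cmod (f \<zeta>))" by (rule less_le_trans[OF _ l]) simp
  then have "1 / (cmod (E n \<zeta>) * (cmod (\<Theta> \<zeta>) * cmod (f \<zeta>))) \<le> 1 / (1 / (4 * exp 3120))"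
    by (intro divide_left_mono[OF l] mult_pos_pos) auto
  then have "1 / (cmod (E n \<zeta>) * (cmod (\<Theta> \<zeta>) * cmod (f \<zeta>))) \<le> 4 * exp 3120" by simp
  then have "1 / (cmod (E n \<zeta>) * (cmod (\<Theta> \<zeta>) * cmod (f \<zeta>))) * cmod (\<zeta> - cnj (ctr n k)) \<le> 4 * exp 3120 * cmod (\<zeta> - cnj (ctr n k))"
    by (rule mult_right_mono) simp
  then show ?thesis by (simp add: dens_def \<kappa>_def norm_mult norm_divide mult_ac)
qed

lemma dens_le_edge:
  assumes "n \<le> N" "k < 2^n" "jump d n k \<noteq> 0" "\<zeta> \<in> edge d n k"
  shows "cmod (dens n k \<zeta>) \<le> 16 * exp 3120 / 2^n"
proof -
  have "cmod (dens n k \<zeta>) \<le> 4 * exp 3120 * cmod (\<zeta> - cnj (ctr n k))"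
    using assms by (intro dens_le E_lower_edge half_le edge_defect)
  also have "\<dots> \<le> 4 * exp 3120 * (4 / 2^n)"
    using edge_near(1)[OF assms(1,4)] by (intro mult_left_mono) auto
  finally show ?thesis by simp
qed

lemma edge_length: "n \<le> N \<Longrightarrow> cmod (edge_end d n k - edge_start d n k) \<le> 2 / 2^n"
proof -
  assume n: "n \<le> N"
  have p: "0 < 1 / (2::real)^n" by simp
  show ?thesis
  proof (cases d)
    case True
    then have "cmod (edge_end d n k - edge_start d n k) \<le> 1 / 2^n + 0"
      by (intro cmod_le_Re_Im) (simp_all add: edge_start_def edge_end_def top_left_def hi_def diff_divide_distrib[symmetric])
    also have "\<dots> \<le> 2 * (1 / 2^n)" using p by linarith
    finally show ?thesis by simp
  next
    case False
    have "cmod (edge_end d n k - edge_start d n k) \<le> 0 + 2 * (1 / 2^n)"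
    proof (rule cmod_le_Re_Im)
      show "\<bar>Re (edge_end d n k - edge_start d n k)\<bar> \<le> 0" using False by (simp add: edge_start_def edge_end_def top_left_def lo_def)
      have e: "Im (edge_end d n k - edge_start d n k) = 1 / 2^n - low n" using False by (simp add: edge_start_def edge_end_def top_left_def lo_def)
      show "\<bar>Im (edge_end d n k - edge_start d n k)\<bar> \<le> 2 * (1 / 2^n)"
        unfolding e using low_less[of n] low_ge[of n] h_le[OF n] by linarith
    qed
    then show ?thesis by simp
  qed
qed

definition I :: "bool \<Rightarrow> nat \<Rightarrow> nat \<Rightarrow> complex \<Rightarrow> complex" where
  "I d n k z = contour_integral (linepath (edge_start d n k) (edge_end d n k)) (\<lambda>\<zeta>. dens n k \<zeta> / (\<zeta> - z))"

lemma I_has_integral: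
  assumes "n \<le> N" "k < 2^n" "jump d n k \<noteq> 0" "z \<notin> edge d n k"
  shows "((\<lambda>\<zeta>. dens n k \<zeta> / (\<zeta> - z)) has_contour_integral I d n k z) (linepath (edge_start d n k) (edge_end d n k))"
  unfolding I_def using assms(4)
  by (intro has_contour_integral_integral contour_integrable_continuous_linepath continuous_intros dens_continuous assms(1-3)) auto

lemma I_far:
  assumes nk: "n \<le> N" "k < 2^n" "jump d n k \<noteq> 0" and far: "\<And>\<zeta>. \<zeta> \<in> edge d n k \<Longrightarrow> r \<le> cmod (\<zeta> - z)" and r: "0 < r"
  shows "cmod (I d n k z) \<le> 32 * exp 3120 / r"
proof -
  have p: "1 / (2::real)^n \<le> 1" by simp
  have "cmod (I d n k z) \<le> (16 * exp 3120 / 2^n) / r * cmod (edge_end d n k - edge_start d n k)"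
  proof (rule has_contour_integral_bound_linepath[OF I_has_integral[OF nk]])
    show "z \<notin> edge d n k" using far[of z] r by auto
    fix \<zeta> assume \<zeta>: "\<zeta> \<in> edge d n k"
    show "cmod (dens n k \<zeta> / (\<zeta> - z)) \<le> (16 * exp 3120 / 2^n) / r"
      unfolding norm_divide using dens_le_edge[OF nk \<zeta>] far[OF \<zeta>] r by (intro frac_le) auto
  qed (use r in auto)
  also have "\<dots> \<le> (16 * exp 3120 / 2^n) / r * (2 / 2^n)" using edge_length[OF nk(1)] r by (intro mult_left_mono) auto
  also have "\<dots> = 32 * exp 3120 / r * ((1 / 2^n) * (1 / 2^n))" by simp
  also have "\<dots> \<le> 32 * exp 3120 / r * (1 * 1)" using r by (intro mult_left_mono mult_mono) auto
  finally show ?thesis by simp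
qed

text \<open>At an eighth of the edge scale or more, \<open>|\<zeta> - z|\<close> is comparable with
  the distance to the pole: \<open>33 = 1 + 4 * 8\<close>. The constant
  \<open>16 * 33 * 2 = 1056\<close> is rounded up to agree with \<open>I_crossing\<close>.\<close>

lemma I_medium:
  assumes nk: "n \<le> N" "k < 2^n" "jump d n k \<noteq> 0" and far: "\<And>\<zeta>. \<zeta> \<in> edge d n k \<Longrightarrow> 1/8 * (1/2^n) \<le> cmod (\<zeta> - z)"
    and z: "z \<noteq> cnj (ctr n k)"
  shows "cmod (I d n k z) \<le> 2000 * exp 3120 * (1/2^n)\<^sup>2 / cmod (z - cnj (ctr n k))"
proof -
  define s where "s = 1 / (2::real)^n"
  define w where "w = cmod (z - cnj (ctr n k))"
  have w: "0 < w" using z by (simp add: w_def)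
  have s: "0 < s" by (simp add: s_def)
  have "cmod (I d n k z) \<le> (16 * exp 3120 * s) * (33 / w) * cmod (edge_end d n k - edge_start d n k)"
  proof (rule has_contour_integral_bound_linepath[OF I_has_integral[OF nk]])
    have "\<not> 1/8 * (1/2^n) \<le> (0::real)" by (simp add: not_le)
    then show "z \<notin> edge d n k" using far[of z] by auto
    fix \<zeta> assume \<zeta>: "\<zeta> \<in> edge d n k"
    have "w \<le> cmod (z - \<zeta>) + cmod (\<zeta> - cnj (ctr n k))"
      unfolding w_def using norm_triangle_ineq[of "z - \<zeta>" "\<zeta> - cnj (ctr n k)"] by simp
    also have "\<dots> \<le> cmod (z - \<zeta>) + 4 * s" using edge_near(1)[OF nk(1) \<zeta>] by (simp add: s_def)
    also have "\<dots> \<le> 33 * cmod (\<zeta> - z)" using far[OF \<zeta>] by (simp add: s_def norm_minus_commute)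
    finally have "w / 33 \<le> cmod (\<zeta> - z)" by simp
    then have "cmod (dens n k \<zeta>) / cmod (\<zeta> - z) \<le> (16 * exp 3120 * s) / (w / 33)"
      using dens_le_edge[OF nk \<zeta>] w by (intro frac_le) (auto simp: s_def)
    then show "cmod (dens n k \<zeta> / (\<zeta> - z)) \<le> (16 * exp 3120 * s) * (33 / w)" by (simp add: norm_divide)
  qed (use w s in auto)
  also have "\<dots> \<le> (16 * exp 3120 * s) * (33 / w) * (2 * s)"
    using edge_length[OF nk(1)] w s by (intro mult_left_mono) (auto simp: s_def)
  also have "\<dots> = 1056 * (exp 3120 * s\<^sup>2 / w)" by (simp add: power2_eq_square)
  also have "\<dots> \<le> 2000 * (exp 3120 * s\<^sup>2 / w)" using w by (intro mult_right_mono) auto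
  finally show ?thesis by (simp add: s_def w_def)
qed

text \<open>The left edges of the last generation cross the real line. There the density is Lipschitz at
  the scale of the edge, and the integral of the Cauchy kernel alone is bounded.\<close>

lemma I_crossing:
  assumes k: "k < 2^N" "jump False N k \<noteq> 0" and x: "x \<noteq> real k * h" "\<bar>x - real k * h\<bar> \<le> h/8"
  shows "cmod (I False N k (of_real x)) \<le> 2000 * exp 3120 * h\<^sup>2 / cmod (of_real x - cnj (ctr N k))"
proof -
  define c where "c = real k * h"
  define G where "G = box (Complex (c - h/2) (- 5/4 * h)) (Complex (c + h/2) (5/4 * h))"
  define S where "S = cbox (Complex (c - h/8) (- h)) (Complex (c + h/8) h)"
  define B where "B = 20 * exp 3120 * h"
  have k0: "0 < k" and ne: "st N (k - 1) \<noteq> st N k" using k(2) by (auto simp: jump_def \<psi>_def split: if_splits)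
  have G: "\<bar>Re z - c\<bar> < h/2" "\<bar>Im z\<bar> \<le> 5/4 * h" if "z \<in> G" for z
  proof -
    have "c - h/2 < Re z" "Re z < c + h/2" "- 5/4 * h < Im z" "Im z < 5/4 * h"
      using that by (simp_all only: G_def in_box_complex_iff complex.sel greaterThanLessThan_iff)
    then show "\<bar>Re z - c\<bar> < h/2" "\<bar>Im z\<bar> \<le> 5/4 * h" by linarith+
  qed
  have ctr: "Re (ctr N k) = c + h/2" "Re (ctr N (k - 1)) = c - h/2" "Im (ctr N k) = 2 * h"
    using k0 by (simp_all add: Re_ctr Im_ctr c_def h_def add_divide_distrib of_nat_diff diff_divide_distrib)
  have near: "\<bar>Re z - Re (ctr N j)\<bar> \<le> 1/2^N" if "z \<in> G" "j = k \<or> j = k - 1" for z j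
    using G(1)[OF that(1)] that(2) unfolding abs_le_iff abs_less_iff h_def[symmetric] by (auto simp only: ctr)
  \<comment> \<open>\<open>G\<close> lies in Harnack range of the sample points on both sides of the
    edge, so one side bounds the defect of \<open>\<Theta>\<close> and the other that of
    \<open>f\<close>.\<close>
  obtain k1 k2 where k12: "k1 = k \<or> k1 = k - 1" "k2 = k \<or> k2 = k - 1" "st N k1 < m" "0 < st N k2"
  proof (cases "st N k < st N (k - 1)")
    case True then show thesis using st_le_m[of N "k - 1"] that[of k "k - 1"] by auto
  next
    case False then show thesis using st_le_m[of N k] ne that[of "k - 1" k] by auto
  qed
  have half: "1/2 \<le> cmod (\<Theta> z)" "1/2 \<le> cmod (f z)" if z: "z \<in> G" for z
  proof -
    have im: "\<bar>Im z\<bar> \<le> 5/4 / 2^N" using G(2)[OF z] by (simp add: h_def)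
    have "defect \<Theta> z \<le> 10 * \<eta>"
      using Th.dc_bottom[OF t4 near[OF z k12(1)] im] center_defect_\<Theta>[OF k12(3)] by linarith
    then show "1/2 \<le> cmod (\<Theta> z)" by (rule half_le)
    have "defect f z \<le> 10 * \<eta>"
      using Fn.dc_bottom[OF t4 near[OF z k12(2)] im] center_defect_f[OF k12(4)] by linarith
    then show "1/2 \<le> cmod (f z)" by (rule half_le)
  qed
  have GB: "cmod (dens N k z) \<le> B" if z: "z \<in> G" for z
  proof -
    have "cmod (z - cnj (ctr N k)) \<le> h + 13/4 * h"
    proof (rule cmod_le_Re_Im)
      show "\<bar>Re (z - cnj (ctr N k))\<bar> \<le> h" using near[OF z, of k] by (simp add: h_def)
      show "\<bar>Im (z - cnj (ctr N k))\<bar> \<le> 13/4 * h" using G(2)[OF z] h_pos by (simp add: ctr) 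
    qed
    then have w: "cmod (z - cnj (ctr N k)) \<le> 5 * h" using h_pos by linarith
    have "cmod (dens N k z) \<le> 4 * exp 3120 * cmod (z - cnj (ctr N k))"
      using half[OF z] G(2)[OF z] by (intro dens_le E_lower_bottom)
    also have "\<dots> \<le> 4 * exp 3120 * (5 * h)" using w by (intro mult_left_mono) auto
    finally show ?thesis by (simp add: B_def)
  qed
  have hol: "dens N k holomorphic_on G"
  proof (rule dens_holomorphic)
    show "G \<subseteq> {z. - 2 * h < Im z}" using h_pos by (auto simp: G_def in_box_complex_iff)
    show "\<Theta> z \<noteq> 0" "f z \<noteq> 0" if "z \<in> G" for z using half[OF that] by auto
  qed simp
  have oG: "open G" by (simp add: G_def open_box)
  have cS: "convex S" by (simp add: S_def)
  have sub: "cball p (h/8) \<subseteq> G" if p: "p \<in> S" for p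
  proof
    fix z assume "z \<in> cball p (h/8)"
    then have d: "cmod (z - p) \<le> h/8" by (simp add: dist_norm norm_minus_commute)
    have "\<bar>Re z - Re p\<bar> \<le> h/8" "\<bar>Im z - Im p\<bar> \<le> h/8"
      using abs_Re_le_cmod[of "z - p"] abs_Im_le_cmod[of "z - p"] d by auto
    moreover have "c - h/8 \<le> Re p" "Re p \<le> c + h/8" "- h \<le> Im p" "Im p \<le> h"
      using p by (auto simp: S_def in_cbox_complex_iff)
    ultimately show "z \<in> G" using h_pos unfolding G_def in_box_complex_iff complex.sel abs_le_iff greaterThanLessThan_iff
      by (intro conjI) linarith+
  qed
  have xc: "c - h/8 \<le> x" "x \<le> c + h/8" using x(2) unfolding c_def by linarith+
  have xS: "of_real x \<in> S" using xc h_pos by (simp add: S_def in_cbox_complex_iff)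
  have lip: "cmod (dens N k \<zeta> - dens N k (of_real x)) \<le> B / (h/8) * cmod (\<zeta> - of_real x)" if "\<zeta> \<in> S" for \<zeta>
    by (rule bounded_holomorphic_lipschitz[OF hol oG cS _ sub GB that xS]) (use h_pos in auto)
  have ce: "c = real k / 2^N" by (simp add: c_def h_def)
  have ends: "edge_start False N k = Complex c (- h)" "edge_end False N k = Complex c h"
    by (simp_all add: edge_start_def edge_end_def lo_def top_left_def low_edge ce) (simp add: h_def)
  have xe: "of_real x \<notin> edge False N k" using x(1) by (simp add: edge_left c_def[symmetric] ce[symmetric])
  have eS: "\<zeta> \<in> S" if "\<zeta> \<in> edge False N k" for \<zeta>
    using that h_pos by (auto simp: edge_left low_edge S_def in_cbox_complex_iff ce h_def)
  define J where "J = contour_integral (linepath (Complex c (-h)) (Complex c h)) (\<lambda>\<zeta>. 1 / (\<zeta> - of_real x))"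
  have J: "((\<lambda>\<zeta>. 1 / (\<zeta> - of_real x)) has_contour_integral J) (linepath (edge_start False N k) (edge_end False N k))"
    unfolding J_def ends using xe unfolding ends
    by (intro has_contour_integral_integral contour_integrable_continuous_linepath continuous_intros) auto
  have Jb: "cmod J \<le> 2 * pi" unfolding J_def using x(1) h_pos by (intro vertical_cauchy_bound) (auto simp: c_def)
  \<comment> \<open>Subtracting the density at \<open>x\<close> leaves a bounded difference
    quotient; the part subtracted is that density times \<open>J\<close>, and \<open>J\<close> is
    bounded by \<open>2 * pi\<close>.\<close>
  have diff: "((\<lambda>\<zeta>. dens N k \<zeta> / (\<zeta> - of_real x) - dens N k (of_real x) * (1 / (\<zeta> - of_real x))) has_contour_integral
      (I False N k (of_real x) - dens N k (of_real x) * J)) (linepath (edge_start False N k) (edge_end False N k))"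
    by (intro has_contour_integral_diff has_contour_integral_lmul I_has_integral J k xe order_refl)
  have B0: "0 \<le> B" using h_pos by (simp add: B_def)
  have "cmod (I False N k (of_real x) - dens N k (of_real x) * J) \<le> B / (h/8) * cmod (edge_end False N k - edge_start False N k)"
  proof (rule has_contour_integral_bound_linepath[OF diff])
    fix \<zeta> assume \<zeta>: "\<zeta> \<in> edge False N k"
    have nz: "\<zeta> - of_real x \<noteq> 0" using \<zeta> xe by auto
    have "cmod (dens N k \<zeta> / (\<zeta> - of_real x) - dens N k (of_real x) * (1 / (\<zeta> - of_real x)))
       = cmod (dens N k \<zeta> - dens N k (of_real x)) / cmod (\<zeta> - of_real x)"
      by (simp add: diff_divide_distrib[symmetric] norm_divide)
    also have "\<dots> \<le> B / (h/8)" using lip[OF eS[OF \<zeta>]] nz by (subst pos_divide_le_eq) auto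
    finally show "cmod (dens N k \<zeta> / (\<zeta> - of_real x) - dens N k (of_real x) * (1 / (\<zeta> - of_real x))) \<le> B / (h/8)" .
  qed (use h_pos B0 in simp)
  also have "\<dots> \<le> B / (h/8) * (2 * h)"
    using edge_length[of N False k] h_pos B0 by (intro mult_left_mono) (auto simp: h_def)
  also have "\<dots> = 16 * B" using h_pos by (simp add: field_simps)
  finally have d1: "cmod (I False N k (of_real x) - dens N k (of_real x) * J) \<le> 16 * B" .
  have "of_real x \<in> G" using sub[OF xS] h_pos by auto
  then have "cmod (dens N k (of_real x) * J) \<le> B * (2 * pi)"
    unfolding norm_mult using Jb GB B0 by (intro mult_mono) auto
  also have "\<dots> \<le> B * 7" using pi_less_4 pi_approx B0 by (intro mult_left_mono) auto
  finally have "cmod (I False N k (of_real x)) \<le> 23 * B"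
    using d1 norm_triangle_ineq[of "I False N k (of_real x) - dens N k (of_real x) * J" "dens N k (of_real x) * J"] by simp
  also have "\<dots> = 460 * exp 3120 * h" by (simp add: B_def)
  also have "\<dots> \<le> 2000 * exp 3120 * h\<^sup>2 / cmod (of_real x - cnj (ctr N k))"
  proof -
    have "cmod (of_real x - cnj (ctr N k)) \<le> 5/8 * h + 2 * h"
    proof (rule cmod_le_Re_Im)
      have e: "Re (of_real x - cnj (ctr N k)) = x - (c + h/2)" by (simp add: ctr)
      show "\<bar>Re (of_real x - cnj (ctr N k))\<bar> \<le> 5/8 * h" unfolding e using xc h_pos by linarith
      show "\<bar>Im (of_real x - cnj (ctr N k))\<bar> \<le> 2 * h" using h_pos by (simp add: ctr)
    qed
    then have w: "cmod (of_real x - cnj (ctr N k)) \<le> 3 * h" using h_pos by linarith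
    have w0: "0 < cmod (of_real x - cnj (ctr N k))" using pole_outside[of "of_real x" N k] h_pos by simp
    have "460 * exp 3120 * h * cmod (of_real x - cnj (ctr N k)) \<le> 460 * exp 3120 * h * (3 * h)"
      using w h_pos by (intro mult_left_mono) auto
    also have "\<dots> = 1380 * (exp 3120 * h\<^sup>2)" by (simp add: power2_eq_square)
    also have "\<dots> \<le> 2000 * (exp 3120 * h\<^sup>2)" by (intro mult_right_mono) auto
    finally show ?thesis using w0 by (simp add: pos_le_divide_eq)
  qed
  finally show ?thesis .
qed

text \<open>A real point is at least \<open>1/2 / 2^n\<close> below an edge that does not cross the
  line. Crossing edges are divided between \<open>I_medium\<close> and \<open>I_crossing\<close> at
  horizontal distance \<open>h / 8\<close>.\<close>

lemma I_real:
  assumes nk: "n \<le> N" "k < 2^n" "jump d n k \<noteq> 0" and x: "of_real x \<notin> edge d n k"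
  shows "cmod (I d n k (of_real x)) \<le> 2000 * exp 3120 * (1/2^n)\<^sup>2 / cmod (of_real x - cnj (ctr n k))"
proof -
  have np: "of_real x \<noteq> cnj (ctr n k)" using pole_outside[of "of_real x" n k] h_pos nk by simp
  consider "n < N \<or> d" | "n = N" "\<not> d" "h/8 \<le> \<bar>x - real k * h\<bar>" | "n = N" "\<not> d" "\<bar>x - real k * h\<bar> \<le> h/8"
    using nk(1) by linarith
  then show ?thesis
  proof cases
    case 1
    show ?thesis
    proof (rule I_medium[OF nk _ np])
      fix \<zeta> assume \<zeta>: "\<zeta> \<in> edge d n k"
      have "1/2 / 2^n \<le> 1 / (2::real)^n" by (simp add: divide_simps)
      then have "1/2 / 2^n \<le> Im \<zeta>" using \<zeta> 1 by (cases d) (auto simp: edge_top edge_left low_edge simp del: of_nat_Suc)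
      moreover have "1/8 * (1/2^n) \<le> 1/2 / (2::real)^n" by (simp add: divide_simps)
      ultimately show "1/8 * (1/2^n) \<le> cmod (\<zeta> - of_real x)" using abs_Im_le_cmod[of "\<zeta> - of_real x"] by simp
    qed
  next
    case 2
    show ?thesis
    proof (rule I_medium[OF nk _ np])
      fix \<zeta> assume \<zeta>: "\<zeta> \<in> edge d n k"
      then have "Re \<zeta> = real k * h" using 2 by (simp add: edge_left h_def)
      then have "h/8 \<le> cmod (\<zeta> - of_real x)" using 2(3) abs_Re_le_cmod[of "\<zeta> - of_real x"] by (simp add: abs_minus_commute)
      then show "1/8 * (1/2^n) \<le> cmod (\<zeta> - of_real x)" using 2(1) by (simp add: h_def)
    qed
  next
    case 3
    then have "x \<noteq> real k * h" using x by (auto simp: edge_left low_edge h_def)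
    then show ?thesis using I_crossing[of k x] 3 nk by (simp add: h_def)
  qed
qed

definition corr :: "complex \<Rightarrow> complex" where
  "corr z = 1 / (2 * of_real pi * \<i>) * (\<Sum>n\<le>N. \<Sum>k<2^n. \<Sum>d\<in>UNIV. of_real (jump d n k) * (\<kappa> n k z * I d n k z))"

text \<open>By \<open>I_real\<close>, an edge contributes at most its jump times
  \<open>2 ^ (- n) * pk * |E n|\<close>, up to a constant, and the jumps of a node sum to
  \<open>2^n * wt / m\<close>. With \<open>A = wt / 20 * pk\<close> the whole sum is a multiple of
  that in \<open>jones_telescoping_le_1\<close>, and \<open>1 / m\<close> remains.
  \<open>4000 = 20000 / 5\<close> because \<open>2 * pi \<ge> 5\<close>.\<close>

lemma corr_real:
  assumes x: "\<And>d n k. n \<le> N \<Longrightarrow> k < 2^n \<Longrightarrow> jump d n k \<noteq> 0 \<Longrightarrow> of_real x \<notin> edge d n k"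
  shows "cmod (corr (of_real x)) \<le> 4000 * exp 3120 / m"
proof -
  define A where "A l j = wt l j / 20 * pk l j (of_real x)" for l j
  have m0: "0 < real m" using m by simp
  have E_eq: "cmod (E n (of_real x)) = exp (- (\<Sum>p\<in>nodes n. A (fst p) (snd p)))" for n
    by (simp add: norm_E A_def)
  have pk0: "0 \<le> pk l j (of_real x)" for l j by (simp add: pk_def)
  have trm: "cmod (of_real (jump d n k) * (\<kappa> n k (of_real x) * I d n k (of_real x)))
      \<le> \<bar>jump d n k\<bar> * (1000 * exp 3120 / 2^n * pk n k (of_real x) * cmod (E n (of_real x)))"
    if nk: "n \<le> N" "k < 2^n" for d n k
  proof (cases "jump d n k = 0")
    case False
    define w where "w = cmod (of_real x - cnj (ctr n k))"
    have w0: "0 < w" using pole_outside[of "of_real x" n k] h_pos nk by (simp add: w_def)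
    have "w\<^sup>2 = (x - (real k + 1/2) / 2^n)\<^sup>2 + (2/2^n)\<^sup>2" unfolding w_def cmod_power2 by (simp add: Re_ctr Im_ctr)
    then have pk: "pk n k (of_real x) = (2/2^n) / w\<^sup>2" by (simp add: pk_def)
    have "cmod (\<kappa> n k (of_real x) * I d n k (of_real x)) \<le> cmod (E n (of_real x)) / w * (2000 * exp 3120 * (1/2^n)\<^sup>2 / w)"
      unfolding norm_mult \<kappa>_def norm_divide w_def[symmetric]
      using I_real[OF nk False x[OF nk False]] w0 by (intro mult_left_mono) (auto simp: w_def)
    also have "\<dots> = 1000 * exp 3120 / 2^n * pk n k (of_real x) * cmod (E n (of_real x))"
      by (simp add: pk power2_eq_square mult_ac)
    finally show ?thesis unfolding norm_mult[of "of_real _"] by (intro mult_mono) auto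
  qed simp
  have "cmod (\<Sum>n\<le>N. \<Sum>k<2^n. \<Sum>d\<in>UNIV. of_real (jump d n k) * (\<kappa> n k (of_real x) * I d n k (of_real x)))
     \<le> (\<Sum>n\<le>N. \<Sum>k<2^n. \<Sum>d\<in>UNIV. \<bar>jump d n k\<bar> * (1000 * exp 3120 / 2^n * pk n k (of_real x) * cmod (E n (of_real x))))"
    by (intro sum_norm_le trm) auto
  also have "\<dots> = (\<Sum>n\<le>N. \<Sum>k<2^n. (\<Sum>d\<in>UNIV. \<bar>jump d n k\<bar>) * (1000 * exp 3120 / 2^n * pk n k (of_real x) * cmod (E n (of_real x))))"
    by (simp only: sum_distrib_right)
  also have "\<dots> \<le> (\<Sum>n\<le>N. \<Sum>k<2^n. (2^n * wt n k / real m) * (1000 * exp 3120 / 2^n * pk n k (of_real x) * cmod (E n (of_real x))))"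
    using pk0 by (intro sum_mono mult_right_mono sum_jump_le mult_nonneg_nonneg) auto
  also have "\<dots> = (\<Sum>n\<le>N. \<Sum>k<2^n. 20000 * exp 3120 / m * (A n k * exp (- (\<Sum>p\<in>nodes n. A (fst p) (snd p)))))"
    by (intro sum.cong refl) (simp add: A_def E_eq)
  also have "\<dots> = 20000 * exp 3120 / m * (\<Sum>p\<in>nodes 0. A (fst p) (snd p) * exp (- (\<Sum>q\<in>nodes (fst p). A (fst q) (snd q))))"
    unfolding sum_distrib_left sum_nodes[symmetric] ..
  also have "\<dots> \<le> 20000 * exp 3120 / m * 1"
  proof (rule mult_left_mono)
    have "nodes (fst p) = {q \<in> nodes 0. fst p \<le> fst q}" for p :: "nat \<times> nat" by (auto simp: nodes_def)
    then show "(\<Sum>p\<in>nodes 0. A (fst p) (snd p) * exp (- (\<Sum>q\<in>nodes (fst p). A (fst q) (snd q)))) \<le> 1"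
      using jones_telescoping_le_1[of "nodes 0" "\<lambda>p. A (fst p) (snd p)" fst] finite_nodes wt_nonneg pk0
      by (simp add: A_def)
  qed (use m0 in simp)
  finally have S: "cmod (\<Sum>n\<le>N. \<Sum>k<2^n. \<Sum>d\<in>UNIV. of_real (jump d n k) * (\<kappa> n k (of_real x) * I d n k (of_real x)))
      \<le> 20000 * exp 3120 / m" by simp
  have "cmod (corr (of_real x)) \<le> 1 / (2 * pi) * (20000 * exp 3120 / m)"
    unfolding corr_def norm_mult[of "1 / _"] using S by (intro mult_mono) (auto simp: norm_divide norm_mult)
  also have "\<dots> \<le> 1 / 5 * (20000 * exp 3120 / m)"
    using pi_approx m0 by (intro mult_right_mono divide_left_mono) auto
  finally show ?thesis by simp
qed

end

section \<open>The Bezout equation in the half plane\<close>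

lemma eventually_avoid_finite:
  assumes "finite (X :: real set)"
  shows "\<forall>\<^sub>F \<delta> in at_right 0. c + \<delta> \<notin> X"
proof -
  have "finite ((\<lambda>y. y - c) ` X)" using assms by simp
  then have "\<not> 0 islimpt ((\<lambda>y. y - c) ` X)" by (rule islimpt_finite)
  then have "\<forall>\<^sub>F \<delta> in at 0. \<delta> \<notin> (\<lambda>y. y - c) ` X" by (simp add: islimpt_iff_eventually)
  then have "\<forall>\<^sub>F \<delta> in at_right 0. \<delta> \<notin> (\<lambda>y. y - c) ` X" by (rule filter_leD[OF at_le, rotated]) simp
  then show ?thesis by (rule eventually_mono) (force simp: image_iff)
qed

context bezout_strip
begin

text \<open>Points on no cell boundary, where \<open>\<Psi>\<close> is unambiguous and all Cauchy
  integrals exist. Each point above \<open>- h\<close> is a limit of such points along the diagonal;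
  a real point is one along the real line, since no horizontal edge has height 0.\<close>

definition generic :: "complex \<Rightarrow> bool" where
  "generic z \<longleftrightarrow> - h < Im z \<and> (\<forall>n\<le>N. \<forall>k<2^n. z \<in> box (lo n k) (hi n k) \<or> z \<notin> cell n k)"

definition \<Psi> :: "complex \<Rightarrow> real" where
  "\<Psi> z = (\<Sum>n\<le>N. \<Sum>k<2^n. if z \<in> box (lo n k) (hi n k) then \<psi> n k else 0)"

definition Xs :: "real set" where "Xs = (\<lambda>(n,k). real k / 2^n) ` ({..N} \<times> {..2^N})"
definition Ys :: "real set" where "Ys = low ` {..N} \<union> (\<lambda>n. 1 / 2^n) ` {..N}"

lemma finite_Xs: "finite Xs" and finite_Ys: "finite Ys" by (simp_all add: Xs_def Ys_def)

lemma zero_notin_Ys: "0 \<notin> Ys"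
  using h_pos by (auto simp: Ys_def low_def)

lemma genericI: "- h < Im z \<Longrightarrow> Re z \<notin> Xs \<Longrightarrow> Im z \<notin> Ys \<Longrightarrow> generic z"
  unfolding generic_def
proof (intro conjI allI impI)
  fix n k assume a: "- h < Im z" "Re z \<notin> Xs" "Im z \<notin> Ys" and n: "n \<le> N" "k < (2::nat)^n"
  have "(2::nat)^n \<le> 2^N" using n(1) by (intro power_increasing) auto
  then have "(n, k) \<in> {..N} \<times> {..2^N}" "(n, Suc k) \<in> {..N} \<times> {..2^N}"
    using n le_trans[of k "2^n" "2^N"] le_trans[of "Suc k" "2^n" "2^N"] by auto
  then have "real k / 2^n \<in> Xs" "real (Suc k) / 2^n \<in> Xs" unfolding Xs_def by (force simp del: of_nat_Suc)+
  moreover have "low n \<in> Ys" "1 / 2^n \<in> Ys" using n by (auto simp: Ys_def)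
  ultimately have ne: "Re z \<noteq> real k / 2^n" "Re z \<noteq> real (Suc k) / 2^n" "Im z \<noteq> low n" "Im z \<noteq> 1 / 2^n" using a by metis+
  then show "z \<in> box (lo n k) (hi n k) \<or> z \<notin> cell n k"
    unfolding cell_iff by linarith
qed

lemma generic_diagonal: "- h < Im z \<Longrightarrow> \<forall>\<^sub>F \<delta> in at_right 0. generic (z + of_real \<delta> * (1 + \<i>))"
proof -
  assume z: "- h < Im z"
  have "\<forall>\<^sub>F \<delta> in at_right (0::real). 0 < \<delta>" by (simp add: eventually_at_right_less)
  then show ?thesis using eventually_avoid_finite[OF finite_Xs, of "Re z"] eventually_avoid_finite[OF finite_Ys, of "Im z"]
  proof eventually_elim
    case (elim \<delta>)
    then show ?case using z by (intro genericI) auto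
  qed
qed

lemma generic_real: "\<forall>\<^sub>F \<delta> in at_right 0. generic (of_real (x + \<delta>))"
  using eventually_avoid_finite[OF finite_Xs, of x]
proof eventually_elim
  case (elim \<delta>)
  then show ?case using zero_notin_Ys h_pos by (intro genericI) auto
qed

lemma box_unique:
  assumes "z \<in> box (lo n k) (hi n k)" "z \<in> box (lo n' k') (hi n' k')" "n \<le> N" "n' \<le> N"
  shows "n = n' \<and> k = k'"
proof -
  have lev: "\<not> n < n'" if "z \<in> box (lo n k) (hi n k)" "z \<in> box (lo n' k') (hi n' k')" "n' \<le> N" for n n' k k'
  proof
    assume l: "n < n'"
    then have "1 / 2^n' \<le> 1 / (2::real)^Suc n" by (intro divide_left_mono power_increasing) auto
    also have "1 / (2::real)^Suc n = low n" using l that(3) by (simp add: low_def)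
    finally show False using that by (auto simp: cell_iff)
  qed
  have n: "n = n'" using lev[OF assms(1,2)] lev[OF assms(2,1)] assms(3,4) by linarith
  have col: "\<not> k < k'" if "z \<in> box (lo n k) (hi n k)" "z \<in> box (lo n k') (hi n k')" for k k'
  proof
    assume "k < k'"
    then have "real (Suc k) / 2^n \<le> real k' / 2^n" by (intro divide_right_mono of_nat_mono) auto
    then show False using that by (auto simp: cell_iff simp del: of_nat_Suc)
  qed
  have "k = k'" using col[of k k'] col[of k' k] assms(1,2) unfolding n by linarith
  then show ?thesis using n by simp
qed

lemma cells_cover:
  assumes re: "0 < Re z" "Re z < 1" and im: "- h < Im z" "Im z < 1"
  obtains n k where "n \<le> N" "k < 2^n" "z \<in> cell n k"
proof -
  obtain n where n: "n \<le> N" "low n \<le> Im z" "Im z \<le> 1 / 2^n"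
  proof (cases "Im z \<le> h")
    case True
    then show thesis using im by (intro that[of N]) (auto simp: low_edge h_def)
  next
    case False
    define Q where "Q n \<longleftrightarrow> 1/2 / (2::real)^n \<le> Im z" for n
    have "N \<noteq> 0"
    proof
      assume "N = 0"
      then have "h = 1" unfolding h_def by simp
      then show False using False im(2) by linarith
    qed
    then obtain M where M: "N = Suc M" by (cases N) auto
    have "h = 1/2 / 2^M" unfolding h_def by (simp add: M)
    then have "Q M" unfolding Q_def using False by linarith
    define n where "n = (LEAST n. Q n)"
    have Qn: "Q n" and nM: "n \<le> M" unfolding n_def by (rule LeastI[of Q M], fact) (rule Least_le, fact)
    have "Im z \<le> 1 / 2^n"
    proof (cases n)
      case 0 then show ?thesis using im by simp
    next
      case (Suc l)
      then have "\<not> Q l" using not_less_Least[of l Q] by (simp add: n_def[symmetric])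
      then show ?thesis by (simp add: Q_def Suc)
    qed
    moreover have nN: "n < N" using nM M by linarith
    ultimately show thesis using Qn by (intro that[of n]) (simp_all add: Q_def low_edge(1)[OF nN])
  qed
  define k where "k = nat \<lfloor>Re z * 2^n\<rfloor>"
  have p: "0 \<le> Re z * 2^n" using re by simp
  have k1: "real k \<le> Re z * 2^n" "Re z * 2^n \<le> real (Suc k)" using p unfolding k_def by (simp_all add: of_nat_nat) linarith
  have "Re z * 2^n < 2^n" using re by simp
  then have "real k < real (2^n)" using k1(1) unfolding of_nat_power of_nat_numeral by linarith
  then have k2: "k < 2^n" by (simp only: of_nat_less_iff)
  have "z \<in> cell n k" using n k1 by (auto simp: cell_iff pos_divide_le_eq pos_le_divide_eq simp del: of_nat_Suc)
  then show thesis using that n(1) k2 by blast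
qed

lemma \<Psi>_cases:
  assumes z: "generic z"
  obtains n k where "n \<le> N" "k < 2^n" "z \<in> box (lo n k) (hi n k)" "\<Psi> z = \<psi> n k"
  | "\<Psi> z = 0" "\<And>n k. n \<le> N \<Longrightarrow> k < 2^n \<Longrightarrow> z \<notin> cell n k"
proof (cases "\<exists>n k. n \<le> N \<and> k < 2^n \<and> z \<in> box (lo n k) (hi n k)")
  case True
  then obtain n k where nk: "n \<le> N" "k < 2^n" "z \<in> box (lo n k) (hi n k)" by blast
  have "\<Psi> z = (\<Sum>n'\<le>N. \<Sum>k'<2^n'. if n' = n then (if k' = k then \<psi> n k else 0) else 0)"
    unfolding \<Psi>_def
  proof (rule sum.cong[OF refl], rule sum.cong[OF refl])
    fix n' k' assume n': "n' \<in> {..N}"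
    show "(if z \<in> box (lo n' k') (hi n' k') then \<psi> n' k' else 0) = (if n' = n then (if k' = k then \<psi> n k else 0) else 0)"
    proof (cases "z \<in> box (lo n' k') (hi n' k')")
      case True
      then have "n = n' \<and> k = k'" using n' by (intro box_unique[OF nk(3) _ nk(1)]) auto
      then show ?thesis using True by simp
    qed (use nk(3) in auto)
  qed
  also have "\<dots> = (\<Sum>n'\<le>N. if n' = n then (\<Sum>k'<2^n. if k' = k then \<psi> n k else 0) else 0)"
    by (intro sum.cong refl) auto
  also have "\<dots> = \<psi> n k" using nk by (simp add: sum.delta)
  finally show thesis using that(1) nk by blast
next
  case False
  then have "\<Psi> z = 0" unfolding \<Psi>_def by (intro sum.neutral) auto
  moreover have "z \<notin> cell n k" if "n \<le> N" "k < 2^n" for n k using False z that unfolding generic_def by blast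
  ultimately show thesis using that(2) by blast
qed

lemma box_cell: "z \<in> box (lo n k) (hi n k) \<Longrightarrow> z \<in> cell n k"
  by (auto simp: cell_iff simp del: of_nat_Suc)

lemma \<psi>_bounds: "0 \<le> \<psi> n k" "\<psi> n k \<le> 1" "\<psi> n k \<noteq> 0 \<Longrightarrow> 0 < st n k" "\<psi> n k \<noteq> 1 \<Longrightarrow> st n k < m"
  using m st_le_m[of n k] by (auto simp: \<psi>_def intro: le_neq_implies_less)

text \<open>Inside a cell this is the invariant of the hysteresis, spread by Harnack; off the cells
  \<open>\<Psi>\<close> is 0, and \<open>out\<close> says that \<open>\<Theta>\<close> is nearly
  unimodular.\<close>

lemma \<Psi>_bounds:
  assumes z: "generic z"
  shows "0 \<le> \<Psi> z" "\<Psi> z \<le> 1" "\<Psi> z \<noteq> 0 \<Longrightarrow> defect f z \<le> 10 * \<eta>" "\<Psi> z \<noteq> 1 \<Longrightarrow> defect \<Theta> z \<le> 10 * \<eta>"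
proof -
  have "0 \<le> \<Psi> z \<and> \<Psi> z \<le> 1 \<and> (\<Psi> z \<noteq> 0 \<longrightarrow> defect f z \<le> 10 * \<eta>) \<and> (\<Psi> z \<noteq> 1 \<longrightarrow> defect \<Theta> z \<le> 10 * \<eta>)"
  proof (cases rule: \<Psi>_cases[OF z])
    case (1 n k)
    then show ?thesis using \<psi>_bounds[of n k] cell_f[OF 1(1) box_cell[OF 1(3)]] cell_\<Theta>[OF 1(1) box_cell[OF 1(3)]] by auto
  next
    case 2
    have zi: "- h < Im z" using z by (simp add: generic_def)
    have "\<not> (0 < Re z \<and> Re z < 1 \<and> Im z < 1)"
    proof
      assume "0 < Re z \<and> Re z < 1 \<and> Im z < 1"
      then obtain n k where "n \<le> N" "k < 2^n" "z \<in> cell n k" using zi by (auto elim: cells_cover)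
      then show False using 2 by blast
    qed
    then have "defect \<Theta> z \<le> 10 * \<eta>" using zi t_h h_pos by (intro out) auto
    then show ?thesis using 2 by simp
  qed
  then show "0 \<le> \<Psi> z" "\<Psi> z \<le> 1" "\<Psi> z \<noteq> 0 \<Longrightarrow> defect f z \<le> 10 * \<eta>" "\<Psi> z \<noteq> 1 \<Longrightarrow> defect \<Theta> z \<le> 10 * \<eta>" by auto
qed

lemma edge_notin_box: "\<zeta> \<in> edge d n k \<Longrightarrow> \<zeta> \<notin> box (lo n k) (hi n k)"
  by (cases d) (auto simp: edge_top edge_left cell_iff simp del: of_nat_Suc)

lemma generic_off_edges: "generic z \<Longrightarrow> n \<le> N \<Longrightarrow> k < 2^n \<Longrightarrow> z \<notin> edge d n k"
  using edge_notin_box edge_subset_cell unfolding generic_def by blast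

definition bq :: "nat \<Rightarrow> complex" where "bq k = Complex (real (Suc k) / 2^N) (- h)"

lemma bottom_subset_cell: "closed_segment (lo N k) (bq k) \<subseteq> cell N k"
proof -
  have "- h \<le> 1 / 2^N" using h_pos by (simp add: h_def)
  moreover have "real k / 2^N \<le> real (Suc k) / 2^N" by (intro divide_right_mono of_nat_mono) auto
  ultimately have "lo N k \<in> cell N k" "bq k \<in> cell N k"
    unfolding cell_iff by (auto simp: lo_def bq_def low_edge simp del: of_nat_Suc)
  then show ?thesis by (intro closed_segment_subset convex_box)
qed

text \<open>The bottom edge lies on the line \<open>Im = - h\<close>, so this term is analytic where
  the solution is sought and enters \<open>g\<close> unchanged.\<close>

definition Q :: "nat \<Rightarrow> complex \<Rightarrow> complex" where
  "Q k z = contour_integral (linepath (lo N k) (bq k)) (\<lambda>\<zeta>. 1 / f \<zeta> / (\<zeta> - z))"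

text \<open>Cauchy's formula for \<open>\<psi> / f\<close> on one cell: either
  \<open>\<psi> n k\<close> is 0 and both sides vanish, or \<open>f\<close> has no zero on the cell.
  The bottom side is expressed through the top edges of the two children, which makes the sum over
  cells rearrangeable.\<close>

lemma cell_contour:
  assumes z: "generic z" and n: "n \<le> N" and k: "k < 2^n"
  defines "C \<equiv> \<lambda>d n k. contour_integral (linepath (edge_start d n k) (edge_end d n k)) (\<lambda>\<zeta>. 1 / f \<zeta> / (\<zeta> - z))"
  shows "of_real (\<psi> n k) * ((if n < N then C True (Suc n) (2*k) + C True (Suc n) (2*k+1) else Q k z)
      + C False n (Suc k) - C True n k - C False n k)
    = (2 * of_real pi * \<i>) * (of_real (if z \<in> box (lo n k) (hi n k) then \<psi> n k else 0) / f z)"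
proof (cases "\<psi> n k = 0")
  case False
  then have s: "0 < st n k" by (rule \<psi>_bounds)
  have fnz: "f \<zeta> \<noteq> 0" if "\<zeta> \<in> cell n k" for \<zeta> using half_le[OF cell_f[OF n that s]] by auto
  have lt: "Re (lo n k) < Re (hi n k)" "Im (lo n k) < Im (hi n k)"
    using low_less[of n] by (simp_all add: lo_def hi_def divide_strict_right_mono)
  have "cell n k \<subseteq> {z. - 2 * h < Im z}" using low_ge[of n] h_pos by (auto simp: cell_iff)
  then have hol: "(\<lambda>\<zeta>. 1 / f \<zeta>) holomorphic_on cell n k"
    using fnz by (intro holomorphic_intros holomorphic_on_subset[OF hol_strip(2)]) auto
  have pim: "path_image (rectpath (lo n k) (hi n k)) = cell n k - box (lo n k) (hi n k)"
    using lt by (intro path_image_rectpath_cbox_minus_box) auto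
  have zz: "z \<in> box (lo n k) (hi n k) \<or> z \<notin> cell n k" using z n k unfolding generic_def by blast
  then have zn: "z \<notin> path_image (rectpath (lo n k) (hi n k))" unfolding pim Diff_iff by meson
  have cont: "continuous_on (path_image (rectpath (lo n k) (hi n k))) (\<lambda>\<zeta>. 1 / f \<zeta> / (\<zeta> - z))"
  proof (rule continuous_on_divide)
    have "path_image (rectpath (lo n k) (hi n k)) \<subseteq> cell n k" unfolding pim by (rule Diff_subset)
    then show "continuous_on (path_image (rectpath (lo n k) (hi n k))) (\<lambda>\<zeta>. 1 / f \<zeta>)"
      by (rule continuous_on_subset[OF holomorphic_on_imp_continuous_on[OF hol]])
    show "continuous_on (path_image (rectpath (lo n k) (hi n k))) (\<lambda>\<zeta>. \<zeta> - z)" by (intro continuous_intros)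
    show "\<forall>\<zeta>\<in>path_image (rectpath (lo n k) (hi n k)). \<zeta> - z \<noteq> 0" using zn right_minus_eq by metis
  qed
  define Bo where "Bo = contour_integral (linepath (lo n k) (Complex (real (Suc k) / 2^n) (low n))) (\<lambda>\<zeta>. 1 / f \<zeta> / (\<zeta> - z))"
  have rect: "contour_integral (rectpath (lo n k) (hi n k)) (\<lambda>\<zeta>. 1 / f \<zeta> / (\<zeta> - z)) = Bo + C False n (Suc k) - C True n k - C False n k"
    using contour_integral_rectpath[OF less_imp_le[OF lt(1)] less_imp_le[OF lt(2)] cont]
    by (simp add: Bo_def C_def edge_start_def edge_end_def lo_def hi_def top_left_def del: of_nat_Suc)
  have Bo: "Bo = (if n < N then C True (Suc n) (2*k) + C True (Suc n) (2*k+1) else Q k z)"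
  proof (cases "n < N")
    case True
    define a c b where "a = top_left (Suc n) (2*k)" and "c = top_left (Suc n) (2*k+1)" and "b = hi (Suc n) (2*k+1)"
    have ab: "lo n k = a" "Complex (real (Suc k) / 2^n) (low n) = b"
      using True by (simp_all add: a_def b_def lo_def top_left_def hi_def low_def complex_eq_iff field_simps)
    have hc: "hi (Suc n) (2*k) = c" by (simp add: hi_def c_def top_left_def)
    have seg: "closed_segment a b \<subseteq> path_image (rectpath (lo n k) (hi n k))"
    proof -
      have "path_image (rectpath (lo n k) (hi n k)) = path_image (linepath (lo n k) (Complex (real (Suc k) / 2^n) (low n))) \<union>
         path_image (linepath (Complex (real (Suc k) / 2^n) (low n)) (hi n k) +++ linepath (hi n k) (top_left n k) +++ linepath (top_left n k) (lo n k))"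
        unfolding rectpath_def Let_def by (subst path_image_join) (simp_all add: lo_def hi_def top_left_def del: of_nat_Suc)
      then show ?thesis unfolding ab by auto
    qed
    have "contour_integral (linepath a b) (\<lambda>\<zeta>. 1 / f \<zeta> / (\<zeta> - z))
        = contour_integral (linepath a c) (\<lambda>\<zeta>. 1 / f \<zeta> / (\<zeta> - z)) + contour_integral (linepath c b) (\<lambda>\<zeta>. 1 / f \<zeta> / (\<zeta> - z))"
    proof (rule contour_integral_split[of _ _ _ "1/2"])
      show "continuous_on (closed_segment a b) (\<lambda>\<zeta>. 1 / f \<zeta> / (\<zeta> - z))" by (rule continuous_on_subset[OF cont seg])
      show "c - a = (1/2) *\<^sub>R (b - a)" by (simp add: a_def b_def c_def top_left_def hi_def complex_eq_iff field_simps)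
    qed auto
    moreover have "edge_start True (Suc n) (2*k) = a" "edge_end True (Suc n) (2*k) = c" "edge_start True (Suc n) (2*k+1) = c" "edge_end True (Suc n) (2*k+1) = b"
      unfolding edge_start_def edge_end_def if_True hc by (simp_all only: a_def b_def c_def)
    ultimately show ?thesis unfolding Bo_def ab C_def by (simp only: True if_True)
  next
    case False
    then have "n = N" using n by simp
    then show ?thesis by (simp add: Bo_def Q_def bq_def low_edge)
  qed
  have X: "(if n < N then C True (Suc n) (2*k) + C True (Suc n) (2*k+1) else Q k z) + C False n (Suc k) - C True n k - C False n k
      = contour_integral (rectpath (lo n k) (hi n k)) (\<lambda>\<zeta>. 1 / f \<zeta> / (\<zeta> - z))"
    unfolding rect Bo ..
  show ?thesis
    unfolding X
  proof (cases "z \<in> box (lo n k) (hi n k)")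
    case True
    then show "of_real (\<psi> n k) * contour_integral (rectpath (lo n k) (hi n k)) (\<lambda>\<zeta>. 1 / f \<zeta> / (\<zeta> - z))
      = (2 * of_real pi * \<i>) * (of_real (if z \<in> box (lo n k) (hi n k) then \<psi> n k else 0) / f z)"
      unfolding cauchy_rectangle(1)[OF lt hol True] if_P[OF True] by (simp add: mult_ac)
  next
    case F: False
    then have "z \<notin> cell n k" using zz by meson
    then show "of_real (\<psi> n k) * contour_integral (rectpath (lo n k) (hi n k)) (\<lambda>\<zeta>. 1 / f \<zeta> / (\<zeta> - z))
      = (2 * of_real pi * \<i>) * (of_real (if z \<in> box (lo n k) (hi n k) then \<psi> n k else 0) / f z)"
      using cauchy_rectangle(2)[OF lt hol] F by simp
  qed
qed simp

text \<open>Summing \<open>cell_contour\<close> and rearranging by \<open>cell_summation\<close>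
  writes \<open>\<Psi> / f\<close> as the Cauchy integral of its own jumps; only edges between
  different states and the bottom survive.\<close>

lemma \<Psi>_representation:
  assumes z: "generic z"
  shows "(2 * of_real pi * \<i>) * (of_real (\<Psi> z) / f z)
    = (\<Sum>n\<le>N. \<Sum>k<2^n. \<Sum>d\<in>UNIV. of_real (jump d n k) *
         contour_integral (linepath (edge_start d n k) (edge_end d n k)) (\<lambda>\<zeta>. 1 / f \<zeta> / (\<zeta> - z)))
      + (\<Sum>k<2^N. of_real (\<psi> N k) * Q k z)"
proof -
  define C where "C = (\<lambda>d n k. contour_integral (linepath (edge_start d n k) (edge_end d n k)) (\<lambda>\<zeta>. 1 / f \<zeta> / (\<zeta> - z)))"
  have "(2 * of_real pi * \<i>) * (of_real (\<Psi> z) / f z)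
     = (\<Sum>n\<le>N. \<Sum>k<2^n. (2 * of_real pi * \<i>) * (of_real (if z \<in> box (lo n k) (hi n k) then \<psi> n k else 0) / f z))"
    unfolding \<Psi>_def of_real_sum sum_divide_distrib sum_distrib_left ..
  also have "\<dots> = (\<Sum>n\<le>N. \<Sum>k<2^n. of_real (\<psi> n k) * ((if n < N then C True (Suc n) (2*k) + C True (Suc n) (2*k+1) else Q k z)
      + C False n (Suc k) - C True n k - C False n k))"
    unfolding C_def by (rule sum.cong[OF refl], rule sum.cong[OF refl], rule cell_contour[OF z, symmetric]) auto
  also have "\<dots> = (\<Sum>n\<le>N. \<Sum>k<2^n. (if n = 0 then 0 else of_real (\<psi> (n - 1) (k div 2)) - of_real (\<psi> n k)) * C True n k
            + (if k = 0 then 0 else of_real (\<psi> n (k - 1)) - of_real (\<psi> n k)) * C False n k) + (\<Sum>k<2^N. of_real (\<psi> N k) * Q k z)"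
    by (rule cell_summation) (simp_all only: \<psi>_def left_state right_state, simp_all)
  also have "(\<Sum>n\<le>N. \<Sum>k<2^n. (if n = 0 then 0 else of_real (\<psi> (n - 1) (k div 2)) - of_real (\<psi> n k)) * C True n k
            + (if k = 0 then 0 else of_real (\<psi> n (k - 1)) - of_real (\<psi> n k)) * C False n k)
        = (\<Sum>n\<le>N. \<Sum>k<2^n. \<Sum>d\<in>UNIV. of_real (jump d n k) * C d n k)"
    by (rule sum.cong[OF refl], rule sum.cong[OF refl]) (auto simp: UNIV_bool jump_def)
  finally show ?thesis by (simp only: C_def)
qed

abbreviation strip :: "complex set" where "strip \<equiv> {z. - 2 * h < Im z}"

text \<open>Replacing \<open>1\<close> by \<open>1 - \<Theta> z * \<kappa> z / (\<Theta> \<zeta> * \<kappa> \<zeta>)\<close> in the Cauchy integral of the jump of \<open>\<psi> / f\<close> over an edge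
  removes its singularity there, at the price of the multiple \<open>\<Theta> * corr\<close> of \<open>\<Theta>\<close>.\<close>

definition Rq :: "bool \<Rightarrow> nat \<Rightarrow> nat \<Rightarrow> complex \<Rightarrow> complex" where
  "Rq d n k = (SOME R. R holomorphic_on strip \<and> (\<forall>z\<in>strip. z \<notin> edge d n k \<longrightarrow>
      R z = contour_integral (linepath (edge_start d n k) (edge_end d n k))
        (\<lambda>\<zeta>. dens n k \<zeta> * ((\<Theta> \<zeta> * \<kappa> n k \<zeta> - \<Theta> z * \<kappa> n k z) / (\<zeta> - z)))))"

lemma Rq:
  assumes nk: "n \<le> N" "k < 2^n" "jump d n k \<noteq> 0"
  shows "Rq d n k holomorphic_on strip"
    and "z \<in> strip \<Longrightarrow> z \<notin> edge d n k \<Longrightarrow> Rq d n k z =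
      contour_integral (linepath (edge_start d n k) (edge_end d n k)) (\<lambda>\<zeta>. 1 / f \<zeta> / (\<zeta> - z)) - \<Theta> z * (\<kappa> n k z * I d n k z)"
proof -
  have oc: "open strip" "convex strip" by (simp_all add: open_halfspace_Im_gt convex_halfspace_Im_gt)
  have hol: "(\<lambda>z. \<Theta> z * \<kappa> n k z) holomorphic_on strip"
    by (intro holomorphic_intros hol_strip \<kappa>_holomorphic nk)
  have "\<exists>R. R holomorphic_on strip \<and> (\<forall>z\<in>strip. z \<notin> edge d n k \<longrightarrow>
      R z = contour_integral (linepath (edge_start d n k) (edge_end d n k))
        (\<lambda>\<zeta>. dens n k \<zeta> * ((\<Theta> \<zeta> * \<kappa> n k \<zeta> - \<Theta> z * \<kappa> n k z) / (\<zeta> - z))))"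
  proof (rule divided_difference_integral[OF oc hol edge_strip[OF nk(1)] dens_continuous[OF nk]])
    fix R assume "R holomorphic_on strip" "\<And>z. z \<in> strip \<Longrightarrow> z \<notin> edge d n k \<Longrightarrow>
      R z = contour_integral (linepath (edge_start d n k) (edge_end d n k))
        (\<lambda>\<zeta>. dens n k \<zeta> * ((\<Theta> \<zeta> * \<kappa> n k \<zeta> - \<Theta> z * \<kappa> n k z) / (\<zeta> - z)))"
    then show ?thesis by (intro exI[of _ R] conjI ballI impI)
  qed
  note R0 = someI_ex[OF this, folded Rq_def]
  note R1 = conjunct1[OF R0] and R2 = conjunct2[OF R0, rule_format]
  show "Rq d n k holomorphic_on strip" by (rule R1)
  assume z: "z \<in> strip" "z \<notin> edge d n k"
  have fc: "continuous_on (edge d n k) (\<lambda>\<zeta>. 1 / f \<zeta> / (\<zeta> - z))"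
    using z edge_nonzero[OF nk] by (intro continuous_intros
        continuous_on_subset[OF holomorphic_on_imp_continuous_on[OF hol_strip(2)] edge_strip[OF nk(1)]]) auto
  have "((\<lambda>\<zeta>. 1 / f \<zeta> / (\<zeta> - z) - \<Theta> z * \<kappa> n k z * (dens n k \<zeta> / (\<zeta> - z))) has_contour_integral
      (contour_integral (linepath (edge_start d n k) (edge_end d n k)) (\<lambda>\<zeta>. 1 / f \<zeta> / (\<zeta> - z)) - \<Theta> z * \<kappa> n k z * I d n k z))
      (linepath (edge_start d n k) (edge_end d n k))"
    by (intro has_contour_integral_diff has_contour_integral_lmul I_has_integral[OF nk z(2)]
        has_contour_integral_integral contour_integrable_continuous_linepath fc)
  then have "((\<lambda>\<zeta>. dens n k \<zeta> * ((\<Theta> \<zeta> * \<kappa> n k \<zeta> - \<Theta> z * \<kappa> n k z) / (\<zeta> - z))) has_contour_integral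
      (contour_integral (linepath (edge_start d n k) (edge_end d n k)) (\<lambda>\<zeta>. 1 / f \<zeta> / (\<zeta> - z)) - \<Theta> z * \<kappa> n k z * I d n k z))
      (linepath (edge_start d n k) (edge_end d n k))"
  proof (rule has_contour_integral_eq)
    fix \<zeta> assume "\<zeta> \<in> path_image (linepath (edge_start d n k) (edge_end d n k))"
    then have \<zeta>: "\<zeta> \<in> edge d n k" by simp
    have "\<Theta> \<zeta> \<noteq> 0" "f \<zeta> \<noteq> 0" "\<kappa> n k \<zeta> \<noteq> 0" "\<zeta> - z \<noteq> 0"
      using edge_nonzero[OF nk \<zeta>] \<kappa>_nonzero[OF nk(1), of \<zeta> k] edge_strip[OF nk(1), of d k] \<zeta> z(2) by auto
    then have e: "1 / f \<zeta> / (\<zeta> - z) = dens n k \<zeta> * (\<Theta> \<zeta> * \<kappa> n k \<zeta> / (\<zeta> - z))" by (simp add: dens_def)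
    show "1 / f \<zeta> / (\<zeta> - z) - \<Theta> z * \<kappa> n k z * (dens n k \<zeta> / (\<zeta> - z))
        = dens n k \<zeta> * ((\<Theta> \<zeta> * \<kappa> n k \<zeta> - \<Theta> z * \<kappa> n k z) / (\<zeta> - z))"
      unfolding e diff_divide_distrib right_diff_distrib by (simp add: mult_ac)
  qed
  then show "Rq d n k z = contour_integral (linepath (edge_start d n k) (edge_end d n k)) (\<lambda>\<zeta>. 1 / f \<zeta> / (\<zeta> - z)) - \<Theta> z * (\<kappa> n k z * I d n k z)"
    unfolding R2[OF z] by (simp add: contour_integral_unique mult.assoc)
qed

text \<open>Built from the regularised integrals so that it is analytic across the edges and at the
  zeros of \<open>f\<close>; that it corrects \<open>\<Psi> / f\<close> by a multiple of
  \<open>\<Theta>\<close> appears in \<open>g_generic\<close>.\<close>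

definition g :: "complex \<Rightarrow> complex" where
  "g z = 1 / (2 * of_real pi * \<i>) * ((\<Sum>n\<le>N. \<Sum>k<2^n. \<Sum>d\<in>UNIV. of_real (jump d n k) * Rq d n k z)
      + (\<Sum>k<2^N. of_real (\<psi> N k) * Q k z))"

abbreviation upper :: "complex set" where "upper \<equiv> {z. - h < Im z}"

lemma open_upper: "open upper" by (simp add: open_halfspace_Im_gt)

lemma scaled_holomorphic: "(c \<noteq> 0 \<Longrightarrow> F holomorphic_on S) \<Longrightarrow> (\<lambda>z. c * F z) holomorphic_on S"
  by (cases "c = 0") (auto intro!: holomorphic_intros)

lemma g_holomorphic: "g holomorphic_on upper"
proof -
  have su: "upper \<subseteq> strip" using h_pos by auto
  have R: "(\<lambda>z. of_real (jump d n k) * Rq d n k z) holomorphic_on upper" if "n \<le> N" "k < 2^n" for d n k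
    using Rq(1)[OF that, of d] su by (intro scaled_holomorphic) (auto intro: holomorphic_on_subset)
  have q: "(\<lambda>z. of_real (\<psi> N k) * Q k z) holomorphic_on upper" for k
  proof (rule scaled_holomorphic)
    assume "of_real (\<psi> N k) \<noteq> (0::complex)"
    then have s: "0 < st N k" by (intro \<psi>_bounds) auto
    have fnz: "f \<zeta> \<noteq> 0" if "\<zeta> \<in> cell N k" for \<zeta> using half_le[OF cell_f[OF order_refl that s]] by auto
    have "cell N k \<subseteq> strip" using low_ge[of N] h_pos by (auto simp: cell_iff)
    then have "continuous_on (closed_segment (lo N k) (bq k)) (\<lambda>\<zeta>. 1 / f \<zeta>)"
      using fnz bottom_subset_cell[of k]
      by (intro continuous_intros continuous_on_subset[OF holomorphic_on_imp_continuous_on[OF hol_strip(2)]]) auto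
    moreover have "upper \<inter> closed_segment (lo N k) (bq k) = {}"
      by (auto simp: lo_def bq_def low_edge closed_segment_same_Im)
    ultimately show "Q k holomorphic_on upper"
      unfolding Q_def by (rule cauchy_segment_holomorphic[OF _ open_upper])
  qed
  have "(\<lambda>z. \<Sum>n\<le>N. \<Sum>k<2^n. \<Sum>d\<in>UNIV. of_real (jump d n k) * Rq d n k z) holomorphic_on upper"
    "(\<lambda>z. \<Sum>k<2^N. of_real (\<psi> N k) * Q k z) holomorphic_on upper"
    by (intro holomorphic_on_sum R; simp) (intro holomorphic_on_sum q)
  then show ?thesis unfolding g_def by (intro holomorphic_on_mult[OF holomorphic_on_const] holomorphic_on_add)
qed

lemma generic_strip: "generic z \<Longrightarrow> z \<in> strip" using h_pos by (auto simp: generic_def)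

lemma g_generic:
  assumes z: "generic z"
  shows "g z = of_real (\<Psi> z) / f z - \<Theta> z * corr z"
proof -
  define C where "C d n k = contour_integral (linepath (edge_start d n k) (edge_end d n k)) (\<lambda>\<zeta>. 1 / f \<zeta> / (\<zeta> - z))" for d n k
  define p where "p = 2 * of_real pi * \<i>"
  have p0: "p \<noteq> 0" by (simp add: p_def)
  have "(\<Sum>n\<le>N. \<Sum>k<2^n. \<Sum>d\<in>UNIV. of_real (jump d n k) * Rq d n k z)
     = (\<Sum>n\<le>N. \<Sum>k<2^n. \<Sum>d\<in>UNIV. of_real (jump d n k) * C d n k - \<Theta> z * (of_real (jump d n k) * (\<kappa> n k z * I d n k z)))"
  proof (rule sum.cong[OF refl], rule sum.cong[OF refl], rule sum.cong[OF refl])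
    fix n k d assume nk: "n \<in> {..N}" "k \<in> {..<(2::nat)^n}"
    show "of_real (jump d n k) * Rq d n k z = of_real (jump d n k) * C d n k - \<Theta> z * (of_real (jump d n k) * (\<kappa> n k z * I d n k z))"
    proof (cases "jump d n k = 0")
      case False
      then have e: "Rq d n k z = C d n k - \<Theta> z * (\<kappa> n k z * I d n k z)"
        unfolding C_def using nk by (intro Rq(2) generic_strip z generic_off_edges) auto
      show ?thesis unfolding e right_diff_distrib by (simp add: mult_ac)
    qed simp
  qed
  also have "\<dots> = (\<Sum>n\<le>N. \<Sum>k<2^n. \<Sum>d\<in>UNIV. of_real (jump d n k) * C d n k)
      - \<Theta> z * (\<Sum>n\<le>N. \<Sum>k<2^n. \<Sum>d\<in>UNIV. of_real (jump d n k) * (\<kappa> n k z * I d n k z))"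
    by (simp only: sum_subtractf sum_distrib_left)
  also have "(\<Sum>n\<le>N. \<Sum>k<2^n. \<Sum>d\<in>UNIV. of_real (jump d n k) * (\<kappa> n k z * I d n k z)) = p * corr z"
    using p0 unfolding corr_def p_def[symmetric] by simp
  finally have e: "(\<Sum>n\<le>N. \<Sum>k<2^n. \<Sum>d\<in>UNIV. of_real (jump d n k) * Rq d n k z)
     = (\<Sum>n\<le>N. \<Sum>k<2^n. \<Sum>d\<in>UNIV. of_real (jump d n k) * C d n k) - \<Theta> z * (p * corr z)" .
  have "g z = 1 / p * (p * (of_real (\<Psi> z) / f z) - \<Theta> z * (p * corr z))"
    unfolding g_def p_def[symmetric] e \<Psi>_representation[OF z, folded C_def p_def] diff_add_eq ..
  also have "\<dots> = of_real (\<Psi> z) / f z - \<Theta> z * corr z" using p0 by (simp add: diff_divide_distrib)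
  finally show ?thesis .
qed

text \<open>At a zero of \<open>f\<close> the defect 1 exceeds \<open>10 * \<eta>\<close>, so
  \<open>\<Psi>\<close> vanishes there and the identity persists.\<close>

lemma f_g_generic:
  assumes z: "generic z"
  shows "1 - f z * g z = of_real (1 - \<Psi> z) + f z * \<Theta> z * corr z"
proof (cases "f z = 0")
  case True
  then have "\<not> defect f z \<le> 10 * \<eta>" using \<eta> by (simp add: defect_def)
  then have "\<Psi> z = 0" using \<Psi>_bounds(3)[OF z] by blast
  then show ?thesis using True by simp
next
  case False
  then show ?thesis by (simp add: g_generic[OF z] algebra_simps)
qed

text \<open>Near a zero of \<open>\<Theta>\<close> all cells have \<open>\<psi> = 1\<close>, so \<open>1 - f * g\<close> is \<open>\<Theta> * f * corr\<close> there.\<close>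

definition cofactor :: "complex \<Rightarrow> complex" where
  "cofactor z = (if \<Theta> z = 0 then f z * corr z else (1 - f z * g z) / \<Theta> z)"

lemma near_zero:
  assumes z0: "- h < Im z0" "\<Theta> z0 = 0"
  obtains U where "open U" "z0 \<in> U" "U \<subseteq> upper" "corr holomorphic_on U" "\<And>z. z \<in> U \<Longrightarrow> 1 - f z * g z = \<Theta> z * (f z * corr z)"
proof -
  define bad where "bad = {p \<in> nodes 0. st (fst p) (snd p) < m}"
  \<comment> \<open>Removing the closed cells of state below \<open>m\<close> removes every edge
    with a jump, since each borders on such a cell. \<open>z0\<close> survives because
    \<open>|\<Theta>| \<ge> 1/2\<close> on those cells and outside the unit square.\<close>
  define U where "U = {z. - h < Im z} \<inter> {z. Im z < 1} \<inter> {z. 0 < Re z} \<inter> {z. Re z < 1} - (\<Union>p\<in>bad. cell (fst p) (snd p))"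
  have big: "\<not> defect \<Theta> z0 \<le> 10 * \<eta>" using z0 \<eta> by (simp add: defect_def)
  have oU: "open U"
    unfolding U_def bad_def using finite_nodes
    by (intro open_Diff open_Int open_halfspace_Im_gt open_halfspace_Im_lt open_halfspace_Re_gt open_halfspace_Re_lt closed_UN) auto
  have "- t < Im z0" using z0(1) t_h h_pos by linarith
  then have "0 < Re z0 \<and> Re z0 < 1 \<and> Im z0 < 1" using out[of z0] big by blast
  moreover have "z0 \<notin> cell n k" if "(n, k) \<in> bad" for n k
    using that cell_\<Theta>[of n z0 k] big by (auto simp: bad_def nodes_def)
  ultimately have z0U: "z0 \<in> U" using z0 by (auto simp: U_def)
  have sub: "U \<subseteq> upper" by (auto simp: U_def)
  have notbad: "\<not> st n k < m" if "z \<in> U" "z \<in> cell n k" "n \<le> N" "k < 2^n" for z n k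
  proof
    assume "st n k < m"
    then have "(n, k) \<in> bad" using that by (simp add: bad_def nodes_def)
    then show False using that(1,2) by (force simp: U_def)
  qed
  have off: "U \<inter> edge d n k = {}" if nk: "n \<le> N" "k < 2^n" "jump d n k \<noteq> 0" for d n k
  proof -
    obtain n1 k1 where e: "n1 \<le> N" "k1 < 2^n1" "edge d n k \<subseteq> cell n1 k1" "st n1 k1 < m"
      using edge_cells[OF nk] by metis
    show ?thesis using notbad[OF _ _ e(1,2)] e(3,4) by blast
  qed
  have ch: "corr holomorphic_on U"
  proof -
    have tr: "(\<lambda>z. of_real (jump d n k) * (\<kappa> n k z * I d n k z)) holomorphic_on U" if nk: "n \<le> N" "k < 2^n" for d n k
    proof (rule scaled_holomorphic)
      assume "of_real (jump d n k) \<noteq> (0::complex)"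
      then have j: "jump d n k \<noteq> 0" by simp
      have "I d n k holomorphic_on U"
        unfolding I_def by (rule cauchy_segment_holomorphic[OF dens_continuous[OF nk j] oU off[OF nk j]])
      moreover have "\<kappa> n k holomorphic_on U"
        using sub h_pos by (intro holomorphic_on_subset[OF \<kappa>_holomorphic[OF nk(1)]]) auto
      ultimately show "(\<lambda>z. \<kappa> n k z * I d n k z) holomorphic_on U" by (intro holomorphic_intros)
    qed
    have "(\<lambda>z. \<Sum>n\<le>N. \<Sum>k<2^n. \<Sum>d\<in>UNIV. of_real (jump d n k) * (\<kappa> n k z * I d n k z)) holomorphic_on U"
      by (intro holomorphic_on_sum tr) auto
    then show ?thesis unfolding corr_def by (rule holomorphic_on_mult[OF holomorphic_on_const])
  qed
  have fU: "f holomorphic_on U" "\<Theta> holomorphic_on U" "g holomorphic_on U"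
    using sub h_pos by (auto intro!: holomorphic_on_subset[OF hol_strip(1)] holomorphic_on_subset[OF hol_strip(2)] holomorphic_on_subset[OF g_holomorphic])
  have gen: "1 - f z * g z = \<Theta> z * (f z * corr z)" if z: "z \<in> U" "generic z" for z
  proof -
    have "0 < Re z" "Re z < 1" "- h < Im z" "Im z < 1" using z(1) by (auto simp: U_def)
    then obtain n' k' where c: "n' \<le> N" "k' < 2^n'" "z \<in> cell n' k'" by (rule cells_cover)
    have "\<Psi> z = 1"
    proof (cases rule: \<Psi>_cases[OF z(2)])
      case (1 n k)
      then have "\<not> st n k < m" using notbad[OF z(1) box_cell[OF 1(3)] 1(1,2)] by simp
      then show ?thesis using 1(4) \<psi>_bounds(4)[of n k] by auto
    next
      case 2
      then show ?thesis using c by blast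
    qed
    then show ?thesis using f_g_generic[OF z(2)] by (simp add: mult_ac)
  qed
  \<comment> \<open>\<open>F\<close> vanishes at generic points and is continuous on
    \<open>U\<close>; the diagonal approach makes it vanish on all of \<open>U\<close>.\<close>
  define F where "F z = 1 - f z * g z - \<Theta> z * (f z * corr z)" for z
  have Fc: "continuous_on U F"
    unfolding F_def by (intro holomorphic_on_imp_continuous_on holomorphic_intros fU ch)
  have "F z = 0" if z: "z \<in> U" for z
  proof -
    have lim0: "((\<lambda>\<delta>. z + of_real \<delta> * (1 + \<i>)) \<longlongrightarrow> z + of_real 0 * (1 + \<i>)) (at_right 0)"
      by (intro tendsto_intros)
    then have lim: "((\<lambda>\<delta>. z + of_real \<delta> * (1 + \<i>)) \<longlongrightarrow> z) (at_right 0)" by simp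
    have evU: "\<forall>\<^sub>F \<delta> in at_right 0. z + of_real \<delta> * (1 + \<i>) \<in> U" by (rule topological_tendstoD[OF lim oU z])
    have "isCont F z" using Fc oU z by (simp add: continuous_on_eq_continuous_at)
    then have "((\<lambda>\<delta>. F (z + of_real \<delta> * (1 + \<i>))) \<longlongrightarrow> F z) (at_right 0)" by (rule isCont_tendsto_compose[OF _ lim])
    moreover have "\<forall>\<^sub>F \<delta> in at_right 0. F (z + of_real \<delta> * (1 + \<i>)) = 0"
      using evU generic_diagonal[OF subsetD[OF sub z, simplified]]
    proof eventually_elim
      case (elim \<delta>)
      show ?case using gen[OF elim] by (simp add: F_def)
    qed
    then have "((\<lambda>\<delta>. F (z + of_real \<delta> * (1 + \<i>))) \<longlongrightarrow> 0) (at_right 0)" by (rule tendsto_eventually)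
    ultimately show ?thesis by (intro tendsto_unique[OF _ _ ]) auto
  qed
  then have "1 - f z * g z = \<Theta> z * (f z * corr z)" if "z \<in> U" for z using that by (simp add: F_def)
  then show thesis using that[OF oU z0U sub ch] by blast
qed

lemma bezout_identity: "- h < Im z \<Longrightarrow> f z * g z + \<Theta> z * cofactor z = 1"
proof (cases "\<Theta> z = 0")
  case True
  assume z: "- h < Im z"
  obtain U where zU: "z \<in> U" and e: "\<And>z. z \<in> U \<Longrightarrow> 1 - f z * g z = \<Theta> z * (f z * corr z)"
    using near_zero[OF z True] by metis
  show ?thesis using e[OF zU] True by simp
qed (simp add: cofactor_def)

lemma cofactor_holomorphic: "cofactor holomorphic_on upper"
proof -
  have "\<exists>V. open V \<and> z \<in> V \<and> cofactor holomorphic_on V" if z: "z \<in> upper" for z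
  proof (cases "\<Theta> z = 0")
    case True
    obtain U where U: "open U" "z \<in> U" "U \<subseteq> upper" "corr holomorphic_on U" "\<And>z. z \<in> U \<Longrightarrow> 1 - f z * g z = \<Theta> z * (f z * corr z)"
      using z True by (auto elim: near_zero)
    have "(\<lambda>z. f z * corr z) holomorphic_on U"
      using U(3) h_pos by (intro holomorphic_intros U holomorphic_on_subset[OF hol_strip(2)]) auto
    then have "cofactor holomorphic_on U"
      by (rule holomorphic_transform) (use U(5) in \<open>simp add: cofactor_def\<close>)
    then show ?thesis using U by blast
  next
    case False
    have tc: "continuous_on upper \<Theta>"
      using h_pos by (intro holomorphic_on_imp_continuous_on holomorphic_on_subset[OF hol_strip(1)]) auto
    define V where "V = upper \<inter> \<Theta> -` (- {0})"
    have oV: "open V" unfolding V_def by (rule continuous_open_preimage[OF tc open_upper]) auto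
    have "(\<lambda>z. (1 - f z * g z) / \<Theta> z) holomorphic_on V"
      using h_pos by (intro holomorphic_intros holomorphic_on_subset[OF hol_strip(1)] holomorphic_on_subset[OF hol_strip(2)] holomorphic_on_subset[OF g_holomorphic])
        (auto simp: V_def)
    then have "cofactor holomorphic_on V" by (rule holomorphic_transform) (simp add: cofactor_def V_def)
    then show ?thesis using oV z False by (auto simp: V_def)
  qed
  then have "cofactor field_differentiable at z" if "z \<in> upper" for z
    using that holomorphic_on_imp_differentiable_at by blast
  then show ?thesis by (simp add: holomorphic_on_def field_differentiable_at_within)
qed

section \<open>Bounds for the two coefficients\<close>

definition lev :: real where "lev = 1 / sqrt (1 - 10 * \<eta>)"

lemma inverse_le_lev: "defect F z \<le> 10 * \<eta> \<Longrightarrow> 1 / cmod (F z) \<le> lev"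
proof -
  assume d: "defect F z \<le> 10 * \<eta>"
  have p: "0 < sqrt (1 - 10 * \<eta>)" using \<eta> by simp
  have "sqrt (1 - 10 * \<eta>) \<le> sqrt ((cmod (F z))\<^sup>2)" using d by (intro real_sqrt_le_mono) (simp add: defect_def)
  then have le: "sqrt (1 - 10 * \<eta>) \<le> cmod (F z)" by simp
  show ?thesis unfolding lev_def using p le by (intro divide_left_mono mult_pos_pos) auto
qed

lemma lev_pos: "0 \<le> lev" using \<eta> by (simp add: lev_def)

text \<open>\<open>|f|\<close> is close to 1 where \<open>\<Psi> \<noteq> 0\<close>, and
  \<open>|\<Theta>|\<close> where \<open>\<Psi> \<noteq> 1\<close>. So \<open>\<Psi> / |f|\<close>
  and \<open>(1 - \<Psi>) / |\<Theta>|\<close> are both at most \<open>lev\<close>, and the rest is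
  \<open>corr\<close>.\<close>

lemma bounds_generic:
  assumes z: "generic z"
  shows "cmod (g z) \<le> lev + cmod (corr z)" "cmod (cofactor z) \<le> lev + cmod (corr z)"
proof -
  have zt: "- t < Im z" using z t_h h_pos by (auto simp: generic_def)
  have T1: "cmod (\<Theta> z) \<le> 1" "cmod (f z) \<le> 1" using Th.le_1[OF zt] Fn.le_1[OF zt] by auto
  have q: "a / cmod (F z) \<le> lev" if "0 \<le> a" "a \<le> 1" "a \<noteq> 0 \<Longrightarrow> defect F z \<le> 10 * \<eta>" for a F
  proof (cases "a = 0")
    case False
    have "a / cmod (F z) \<le> 1 / cmod (F z)" using that by (intro divide_right_mono) auto
    then show ?thesis using inverse_le_lev[OF that(3)[OF False]] by linarith
  qed (simp add: lev_pos)
  have "cmod (g z) \<le> cmod (of_real (\<Psi> z) / f z) + cmod (\<Theta> z * corr z)"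
    unfolding g_generic[OF z] by (rule norm_triangle_ineq4)
  also have "cmod (of_real (\<Psi> z) / f z) = \<Psi> z / cmod (f z)" using \<Psi>_bounds(1)[OF z] by (simp add: norm_divide)
  also have "\<dots> \<le> lev" using \<Psi>_bounds[OF z] by (intro q) auto
  also have "cmod (\<Theta> z * corr z) \<le> cmod (corr z)" using T1 by (simp add: norm_mult mult_left_le_one_le)
  finally show "cmod (g z) \<le> lev + cmod (corr z)" by simp
  show "cmod (cofactor z) \<le> lev + cmod (corr z)"
  proof (cases "\<Theta> z = 0")
    case True
    then show ?thesis using T1 lev_pos mult_left_le_one_le[of "cmod (corr z)" "cmod (f z)"] by (simp add: cofactor_def norm_mult)
  next
    case False
    then have "cofactor z = of_real (1 - \<Psi> z) / \<Theta> z + f z * corr z"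
      unfolding cofactor_def f_g_generic[OF z] by (simp add: add_divide_distrib)
    then have "cmod (cofactor z) \<le> cmod (of_real (1 - \<Psi> z) / \<Theta> z) + cmod (f z * corr z)" by (simp only: norm_triangle_ineq)
    also have "cmod (of_real (1 - \<Psi> z) / \<Theta> z) = (1 - \<Psi> z) / cmod (\<Theta> z)"
      using \<Psi>_bounds(2)[OF z] by (simp only: norm_divide norm_of_real)
    also have "\<dots> \<le> lev" using \<Psi>_bounds[OF z] by (intro q) auto
    also have "cmod (f z * corr z) \<le> cmod (corr z)" using T1 by (simp add: norm_mult mult_left_le_one_le)
    finally show ?thesis by simp
  qed
qed

text \<open>A real point on a vertical edge is reached as a limit of generic real points, where
  \<open>corr_real\<close> applies.\<close>

lemma bound_real:
  assumes G: "G = g \<or> G = cofactor"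
  shows "cmod (G (of_real x)) \<le> lev + 4000 * exp 3120 / m"
proof -
  have "G holomorphic_on upper" using G g_holomorphic cofactor_holomorphic by auto
  then have "isCont G (of_real x)"
    using open_upper h_pos holomorphic_on_imp_continuous_on continuous_on_eq_continuous_at by fastforce
  moreover have "((\<lambda>\<delta>. of_real (x + \<delta>)) \<longlongrightarrow> (of_real (x + 0) :: complex)) (at_right 0)" by (intro tendsto_intros)
  ultimately have "((\<lambda>\<delta>. G (of_real (x + \<delta>))) \<longlongrightarrow> G (of_real x)) (at_right 0)"
    using isCont_tendsto_compose[of "of_real x" G "\<lambda>\<delta>. of_real (x + \<delta>)"] by simp
  then have "((\<lambda>\<delta>. cmod (G (of_real (x + \<delta>)))) \<longlongrightarrow> cmod (G (of_real x))) (at_right 0)" by (rule tendsto_norm)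
  moreover have "\<forall>\<^sub>F \<delta> in at_right 0. cmod (G (of_real (x + \<delta>))) \<le> lev + 4000 * exp 3120 / m"
    using generic_real[of x]
  proof eventually_elim
    case (elim \<delta>)
    have "cmod (corr (of_real (x + \<delta>))) \<le> 4000 * exp 3120 / m"
      using generic_off_edges[OF elim] by (intro corr_real)
    then show ?case using bounds_generic[OF elim] G by auto
  qed
  ultimately show ?thesis by (rule tendsto_upperbound) simp
qed

text \<open>In the closed upper half plane \<open>|E n z| \<le> 1\<close>, so
  \<open>\<kappa>\<close> decays like \<open>1 / |z|\<close> and \<open>corr\<close> tends to 0. The
  constant \<open>D\<close> may depend on \<open>N\<close>, since it only affects the radius
  \<open>R\<close>.\<close>

lemma bound_infinity:
  assumes G: "G = g \<or> G = cofactor" and e: "0 < e"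
  shows "\<exists>R. \<forall>z. 0 \<le> Im z \<longrightarrow> R \<le> cmod z \<longrightarrow> cmod (G z) \<le> lev + 4000 * exp 3120 / m + e"
proof -
  define D where "D = (\<Sum>n\<le>N. \<Sum>k<2^n. \<Sum>d\<in>UNIV. \<bar>jump d n k\<bar> * (32 * exp 3120))"
  have D0: "0 \<le> D" unfolding D_def by (intro sum_nonneg mult_nonneg_nonneg) auto
  have "cmod (G z) \<le> lev + 4000 * exp 3120 / m + e" if z: "0 \<le> Im z" "4 + D / e \<le> cmod z" for z
  proof -
    have De: "0 \<le> D / e" using D0 e by simp
    have z4: "4 \<le> cmod z" using z(2) De by linarith
    have small: "cmod \<zeta> \<le> 2" if "\<zeta> \<in> cell n k" "n \<le> N" "k < 2^n" for \<zeta> n k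
    proof -
      have "real (Suc k) \<le> real (2^n)" using that(3) by (intro of_nat_mono) simp
      then have r1: "real (Suc k) / 2^n \<le> 1" by simp
      have r2: "0 \<le> real k / 2^n" "1 / (2::real)^n \<le> 1" by simp_all
      have "\<bar>Re \<zeta>\<bar> \<le> 1" "\<bar>Im \<zeta>\<bar> \<le> 1"
        using that(1) r1 r2 low_ge[of n] h_le[OF that(2)] unfolding cell_iff by linarith+
      then show ?thesis using cmod_le_Re_Im[of \<zeta> 1 1] by simp
    qed
    have gen: "generic z"
      unfolding generic_def
    proof (intro conjI allI impI disjI2 notI)
      show "- h < Im z" using h_pos z(1) by linarith
      fix n k assume "n \<le> N" "k < (2::nat)^n" "z \<in> cell n k"
      then have "cmod z \<le> 2" by (intro small)
      then show False using z4 by linarith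
    qed
    have trm: "cmod (of_real (jump d n k) * (\<kappa> n k z * I d n k z)) \<le> \<bar>jump d n k\<bar> * (32 * exp 3120) / (cmod z - 3)"
      if nk: "n \<le> N" "k < 2^n" for d n k
    proof (cases "jump d n k = 0")
      case False
      have c3: "cmod (cnj (ctr n k)) \<le> 1 + 2"
      proof (rule cmod_le_Re_Im)
        have "real (Suc k) \<le> real (2^n)" using nk(2) by (intro of_nat_mono) simp
        then show "\<bar>Re (cnj (ctr n k))\<bar> \<le> 1" by (simp add: Re_ctr)
        show "\<bar>Im (cnj (ctr n k))\<bar> \<le> 2" by (simp add: Im_ctr divide_simps)
      qed
      have w: "cmod z - 3 \<le> cmod (z - cnj (ctr n k))" using c3 norm_triangle_ineq2[of z "cnj (ctr n k)"] by linarith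
      have "0 \<le> pk l j z" for l j using z(1) by (simp add: pk_def)
      then have "cmod (E n z) \<le> 1" unfolding norm_E using wt_nonneg by (auto intro!: sum_nonneg mult_nonneg_nonneg)
      then have "cmod (\<kappa> n k z) \<le> 1 / (cmod z - 3)"
        unfolding \<kappa>_def norm_divide using w z4 by (intro frac_le) auto
      moreover have "cmod (I d n k z) \<le> 32 * exp 3120 / 1"
      proof (rule I_far[OF nk False])
        fix \<zeta> assume "\<zeta> \<in> edge d n k"
        then have "cmod \<zeta> \<le> 2" using edge_subset_cell small nk by blast
        then show "1 \<le> cmod (\<zeta> - z)" using z4 norm_triangle_ineq2[of z \<zeta>] by (simp add: norm_minus_commute)
      qed simp
      ultimately have "cmod (\<kappa> n k z * I d n k z) \<le> 1 / (cmod z - 3) * (32 * exp 3120)"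
        unfolding norm_mult using z4 by (intro mult_mono) auto
      then have "\<bar>jump d n k\<bar> * cmod (\<kappa> n k z * I d n k z) \<le> \<bar>jump d n k\<bar> * (1 / (cmod z - 3) * (32 * exp 3120))"
        by (rule mult_left_mono) simp
      then show ?thesis by (simp add: norm_mult)
    qed simp
    have "cmod (\<Sum>n\<le>N. \<Sum>k<2^n. \<Sum>d\<in>UNIV. of_real (jump d n k) * (\<kappa> n k z * I d n k z))
        \<le> (\<Sum>n\<le>N. \<Sum>k<2^n. \<Sum>d\<in>UNIV. \<bar>jump d n k\<bar> * (32 * exp 3120) / (cmod z - 3))"
      by (intro sum_norm_le trm) auto
    also have "\<dots> = D / (cmod z - 3)" by (simp only: D_def sum_divide_distrib)
    finally have S: "cmod (\<Sum>n\<le>N. \<Sum>k<2^n. \<Sum>d\<in>UNIV. of_real (jump d n k) * (\<kappa> n k z * I d n k z)) \<le> D / (cmod z - 3)" .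
    have "cmod (corr z) \<le> 1 / (2 * pi) * (D / (cmod z - 3))"
      unfolding corr_def norm_mult[of "1 / _"] using S by (intro mult_mono) (auto simp: norm_divide norm_mult)
    also have "\<dots> \<le> 1 * (D / (cmod z - 3))"
      using pi_approx D0 z4 by (intro mult_right_mono) auto
    also have "\<dots> \<le> e"
    proof -
      have "D / e \<le> cmod z - 3" using z(2) by linarith
      then have "D \<le> e * (cmod z - 3)" using e by (simp add: pos_divide_le_eq mult.commute)
      then show ?thesis using z4 by (simp add: pos_divide_le_eq)
    qed
    finally have "cmod (corr z) \<le> e" .
    moreover have "0 \<le> 4000 * exp 3120 / real m" by simp
    moreover have "cmod (G z) \<le> lev + cmod (corr z)" using bounds_generic[OF gen] G by auto
    ultimately show ?thesis by linarith
  qed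
  then show ?thesis by blast
qed

theorem bezout_upper_half_plane:
  obtains u v where "u holomorphic_on {z. 0 < Im z}" "v holomorphic_on {z. 0 < Im z}"
    "\<And>z. 0 < Im z \<Longrightarrow> f z * u z + \<Theta> z * v z = 1"
    "\<And>z. 0 < Im z \<Longrightarrow> cmod (u z) \<le> 1 / sqrt (1 - 10 * \<eta>) + 4000 * exp 3120 / m"
    "\<And>z. 0 < Im z \<Longrightarrow> cmod (v z) \<le> 1 / sqrt (1 - 10 * \<eta>) + 4000 * exp 3120 / m"
proof
  have sub: "{z. 0 < Im z} \<subseteq> upper" using h_pos by auto
  show "g holomorphic_on {z. 0 < Im z}" "cofactor holomorphic_on {z. 0 < Im z}"
    by (rule holomorphic_on_subset[OF g_holomorphic sub], rule holomorphic_on_subset[OF cofactor_holomorphic sub])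
  show "f z * g z + \<Theta> z * cofactor z = 1" if "0 < Im z" for z using bezout_identity[of z] h_pos that by simp
  show "cmod (g z) \<le> 1 / sqrt (1 - 10 * \<eta>) + 4000 * exp 3120 / m" if "0 < Im z" for z
    unfolding lev_def[symmetric]
    by (rule half_plane_maximum[OF h_pos g_holomorphic _ _ that]) (simp_all add: bound_real bound_infinity)
  show "cmod (cofactor z) \<le> 1 / sqrt (1 - 10 * \<eta>) + 4000 * exp 3120 / m" if "0 < Im z" for z
    unfolding lev_def[symmetric]
    by (rule half_plane_maximum[OF h_pos cofactor_holomorphic _ _ that]) (simp_all add: bound_real bound_infinity)
qed

end

section \<open>The Bezout equation in the disc\<close>

text \<open>\<open>N\<close> is fixed here by \<open>4 / 2^N \<le> t\<close>. The bounds do not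
  involve it, so it may depend on the functions.\<close>

lemma half_plane_bezout:
  assumes T: "half_plane_fun \<Theta> t" and f: "half_plane_fun f t" and t: "0 < t"
    and m: "1 \<le> m" and \<alpha>: "0 < \<alpha> 0" "\<And>i. Suc i < m \<Longrightarrow> 64 * \<alpha> i \<le> \<alpha> (Suc i)"
    "\<And>i. Suc i < m \<Longrightarrow> packing_const * sqrt (8 * \<alpha> i) \<le> \<alpha> (Suc i) / 4" "\<And>i. i < m \<Longrightarrow> \<alpha> i \<le> \<eta>"
    and \<tau>: "0 < \<tau>" "\<tau> < \<alpha> 0 * \<alpha> 0" "packing_const * sqrt (\<tau> / \<alpha> 0) \<le> \<alpha> 0 / 4"
    and \<eta>: "0 \<le> \<eta>" "10 * \<eta> \<le> 3/4"
    and prod: "\<And>z. 0 < Im z \<Longrightarrow> defect \<Theta> z * defect f z \<le> \<tau>"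
    and out: "\<And>z. - t < Im z \<Longrightarrow> \<not> (1/4 < Re z \<and> Re z < 3/4 \<and> Im z < 1/2) \<Longrightarrow> defect \<Theta> z < \<alpha> 0"
  obtains u v where "u holomorphic_on {z. 0 < Im z}" "v holomorphic_on {z. 0 < Im z}"
    "\<And>z. 0 < Im z \<Longrightarrow> f z * u z + \<Theta> z * v z = 1"
    "\<And>z. 0 < Im z \<Longrightarrow> cmod (u z) \<le> 1 / sqrt (1 - 10 * \<eta>) + 4000 * exp 3120 / m"
    "\<And>z. 0 < Im z \<Longrightarrow> cmod (v z) \<le> 1 / sqrt (1 - 10 * \<eta>) + 4000 * exp 3120 / m"
proof -
  obtain N where "4 / t < 2^N" using real_arch_pow[of 2 "4 / t"] by auto
  then have tN: "4 / 2^N \<le> t" using t by (simp add: field_simps)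
  have hy: "hysteresis (\<lambda>n k. defect \<Theta> (ctr n k)) (\<lambda>n k. defect f (ctr n k)) \<alpha> m N \<tau> packing_const"
    by (rule hysteresis_half_plane[OF T f m \<alpha>(1,2,3) \<tau> prod]) (use out t in auto)
  have bs: "bezout_strip \<Theta> f t \<alpha> m N \<tau> \<eta>"
  proof (intro bezout_strip.intro bezout_strip_axioms.intro T f hy \<eta> \<alpha>(4) tN)
    fix z assume z: "- t < Im z" "\<not> (0 < Re z \<and> Re z < 1 \<and> Im z < 1)"
    then have "defect \<Theta> z < \<alpha> 0" by (intro out) auto
    also have "\<alpha> 0 \<le> \<eta>" using m by (intro \<alpha>(4)) auto
    finally show "defect \<Theta> z \<le> 10 * \<eta>" using \<eta> by linarith
  qed
  show thesis by (rule bezout_strip.bezout_upper_half_plane[OF bs]) (rule that)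
qed

text \<open>Maps the upper half plane onto the disc, with \<open>1/2 + \<i> * \<mu>\<close> going to
  0. For small \<open>\<mu>\<close> everything away from 1/2 lands near 1, which confines the
  variation of a dilated function to the middle of the unit square.\<close>

definition cay :: "real \<Rightarrow> complex \<Rightarrow> complex" where
  "cay \<mu> w = (w - 1/2 - \<i> * of_real \<mu>) / (w - 1/2 + \<i> * of_real \<mu>)"

definition cay_inv :: "real \<Rightarrow> complex \<Rightarrow> complex" where
  "cay_inv \<mu> z = 1/2 + \<i> * of_real \<mu> * ((1 + z) / (1 - z))"

lemma cay_cay_inv: "0 < \<mu> \<Longrightarrow> cmod z < 1 \<Longrightarrow> cay \<mu> (cay_inv \<mu> z) = z"
proof -
  assume l: "0 < \<mu>" and z: "cmod z < 1"
  have nz: "1 - z \<noteq> 0" using z by auto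
  have "cay_inv \<mu> z - 1/2 - \<i> * of_real \<mu> = \<i> * of_real \<mu> * (2 / (1 - z)) * z"
    "cay_inv \<mu> z - 1/2 + \<i> * of_real \<mu> = \<i> * of_real \<mu> * (2 / (1 - z))"
    using nz by (simp_all add: cay_inv_def field_simps)
  then show ?thesis using l nz by (simp add: cay_def)
qed

lemma Im_cay_inv: "0 < \<mu> \<Longrightarrow> cmod z < 1 \<Longrightarrow> 0 < Im (cay_inv \<mu> z)"
proof -
  assume l: "0 < \<mu>" and z: "cmod z < 1"
  have nz: "1 - z \<noteq> 0" using z by auto
  have "Re ((1 + z) / (1 - z)) = (Re (1 + z) * Re (1 - z) + Im (1 + z) * Im (1 - z)) / (cmod (1 - z))\<^sup>2"
    unfolding Re_divide cmod_power2 ..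
  also have "Re (1 + z) * Re (1 - z) + Im (1 + z) * Im (1 - z) = 1 - (cmod z)\<^sup>2"
    unfolding cmod_power2 by (simp add: algebra_simps power2_eq_square)
  also have "0 < (1 - (cmod z)\<^sup>2) / (cmod (1 - z))\<^sup>2"
    using z nz by (intro divide_pos_pos) (auto simp: power_less_one_iff abs_square_less_1)
  finally have "0 < \<mu> * Re ((1 + z) / (1 - z))" using l by simp
  moreover have "Im (1/2 + \<i> * of_real \<mu> * Z) = \<mu> * Re Z" for Z by simp
  ultimately show ?thesis unfolding cay_inv_def by (simp only:)
qed

text \<open>Slightly below the real line the image leaves the disc by a controlled amount, and
  multiplication by \<open>r < 1\<close> brings it back. This yields continuation to depth
  \<open>t = s * \<mu>\<close>.\<close>

lemma cay_square_le:
  assumes l: "0 < \<mu>" and s: "0 < s" "s \<le> 1/2" and w: "- (s * \<mu>) < Im w"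
  shows "w - 1/2 + \<i> * of_real \<mu> \<noteq> 0" "(cmod (cay \<mu> w))\<^sup>2 \<le> 1 + 16 * s"
proof -
  define d where "d = (Re w - 1/2)\<^sup>2 + (Im w + \<mu>)\<^sup>2"
  have "s * \<mu> \<le> 1/2 * \<mu>" using s l by (intro mult_right_mono) auto
  then have im: "\<mu> / 2 < Im w + \<mu>" using w by linarith
  then have "(\<mu> / 2)\<^sup>2 \<le> (Im w + \<mu>)\<^sup>2" using l by (intro power_mono) auto
  then have d: "\<mu>\<^sup>2 / 4 \<le> d" unfolding d_def by (simp add: power_divide add_increasing)
  have d0: "0 < d" using l by (intro less_le_trans[OF _ d]) simp
  have den: "(cmod (w - 1/2 + \<i> * of_real \<mu>))\<^sup>2 = d" by (simp add: cmod_power2 d_def)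
  then show "w - 1/2 + \<i> * of_real \<mu> \<noteq> 0" using d0 by auto
  have num: "(cmod (w - 1/2 - \<i> * of_real \<mu>))\<^sup>2 = d - 4 * \<mu> * Im w"
    unfolding cmod_power2 by (simp add: d_def power2_eq_square algebra_simps)
  have "- (4 * \<mu> * Im w) \<le> 4 * \<mu> * (s * \<mu>)" using mult_left_mono[of "- Im w" "s * \<mu>" "4 * \<mu>"] w l by simp
  also have "\<dots> = 16 * s * (\<mu>\<^sup>2 / 4)" by (simp add: power2_eq_square)
  also have "\<dots> \<le> 16 * s * d" using d s by (intro mult_left_mono) auto
  finally have "d - 4 * \<mu> * Im w \<le> (1 + 16 * s) * d" by (simp add: algebra_simps)
  then show "(cmod (cay \<mu> w))\<^sup>2 \<le> 1 + 16 * s"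
    using d0 by (simp add: cay_def norm_divide power_divide num den pos_divide_le_eq)
qed

lemma cay_near_1:
  assumes l: "0 < \<mu>" "\<mu> \<le> 1/8" and w: "\<not> (1/4 < Re w \<and> Re w < 3/4 \<and> Im w < 1/2)"
  shows "cmod (cay \<mu> w - 1) \<le> 16 * \<mu>"
proof -
  have "1/4 \<le> cmod (w - 1/2)"
    using abs_Re_le_cmod[of "w - 1/2"] abs_Im_le_cmod[of "w - 1/2"] w by (auto simp: abs_if split: if_splits)
  then have d: "1/8 \<le> cmod (w - 1/2 + \<i> * of_real \<mu>)"
    using norm_triangle_ineq4[of "w - 1/2 + \<i> * of_real \<mu>" "\<i> * of_real \<mu>"] l by (simp add: norm_mult)
  then have nz: "w - 1/2 + \<i> * of_real \<mu> \<noteq> 0" by auto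
  have "cay \<mu> w - 1 = - (2 * \<i> * of_real \<mu>) / (w - 1/2 + \<i> * of_real \<mu>)"
    using nz by (simp add: cay_def divide_diff_eq_iff)
  then have "cmod (cay \<mu> w - 1) = 2 * \<mu> / cmod (w - 1/2 + \<i> * of_real \<mu>)"
    using l by (simp add: norm_divide norm_mult)
  also have "\<dots> \<le> 2 * \<mu> / (1/8)" using d l by (intro divide_left_mono) auto
  finally show ?thesis by simp
qed

text \<open>A small defect of \<open>\<Theta>\<close> at the single point \<open>r\<close> persists
  nearby, and for small \<open>\<mu>\<close> the dilated Cayley map sends everything outside the
  central rectangle there. The half plane result then applies with bounds free of \<open>r\<close>,
  and \<open>cay_inv\<close> carries the solution back.\<close>

lemma dilated_bezout:
  assumes hol: "\<Theta> holomorphic_on ball 0 1" "f holomorphic_on ball 0 1"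
    and le: "\<And>z. cmod z < 1 \<Longrightarrow> cmod (\<Theta> z) \<le> 1" "\<And>z. cmod z < 1 \<Longrightarrow> cmod (f z) \<le> 1"
    and r: "0 < r" "r < 1"
    and m: "1 \<le> m" and \<alpha>: "0 < \<alpha> 0" "\<And>i. Suc i < m \<Longrightarrow> 64 * \<alpha> i \<le> \<alpha> (Suc i)"
    "\<And>i. Suc i < m \<Longrightarrow> packing_const * sqrt (8 * \<alpha> i) \<le> \<alpha> (Suc i) / 4" "\<And>i. i < m \<Longrightarrow> \<alpha> i \<le> \<eta>"
    and \<tau>: "0 < \<tau>" "\<tau> < \<alpha> 0 * \<alpha> 0" "packing_const * sqrt (\<tau> / \<alpha> 0) \<le> \<alpha> 0 / 4"
    and \<eta>: "0 \<le> \<eta>" "10 * \<eta> \<le> 3/4"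
    and prod: "\<And>z. cmod z < 1 \<Longrightarrow> defect \<Theta> z * defect f z \<le> \<tau>"
    and at1: "defect \<Theta> (of_real r) < \<alpha> 0"
  obtains u v where "u holomorphic_on ball 0 1" "v holomorphic_on ball 0 1"
    "\<And>z. cmod z < 1 \<Longrightarrow> f (of_real r * z) * u z + \<Theta> (of_real r * z) * v z = 1"
    "\<And>z. cmod z < 1 \<Longrightarrow> cmod (u z) \<le> 1 / sqrt (1 - 10 * \<eta>) + 4000 * exp 3120 / m"
    "\<And>z. cmod z < 1 \<Longrightarrow> cmod (v z) \<le> 1 / sqrt (1 - 10 * \<eta>) + 4000 * exp 3120 / m"
proof -
  have "isCont \<Theta> (of_real r)"
    using holomorphic_on_imp_continuous_on[OF hol(1)] r by (auto simp: continuous_on_eq_continuous_at)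
  then have "isCont (defect \<Theta>) (of_real r)" unfolding defect_def by (intro continuous_intros)
  then have "\<forall>\<^sub>F z in at (of_real r). defect \<Theta> z < \<alpha> 0"
    unfolding continuous_at using at1 by (rule order_tendstoD(2))
  then obtain \<delta> where \<delta>: "0 < \<delta>" "\<And>z. z \<noteq> of_real r \<Longrightarrow> dist z (of_real r) < \<delta> \<Longrightarrow> defect \<Theta> z < \<alpha> 0"
    unfolding eventually_at by auto
  \<comment> \<open>16 is the constant of \<open>cay_near_1\<close>; 17 makes the inequality
    strict.\<close>
  define \<mu> where "\<mu> = min (1/8) (\<delta> / 17)"
  have \<mu>: "0 < \<mu>" "\<mu> \<le> 1/8" "16 * \<mu> < \<delta>" using \<delta>(1) by (auto simp: \<mu>_def min_def)
  \<comment> \<open>Keeps \<open>1 + 16 * s\<close> below \<open>1 / r^2\<close>, so that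
    \<open>r * cay \<mu> w\<close> stays in the disc.\<close>
  define s where "s = min (1/2) ((1 / r\<^sup>2 - 1) / 32)"
  have "r\<^sup>2 < 1" using r by (simp add: power_less_one_iff)
  then have rr: "1 < 1 / r\<^sup>2" using r by simp
  have s: "0 < s" "s \<le> 1/2" "32 * s \<le> 1 / r\<^sup>2 - 1" using rr by (auto simp: s_def min_def)
  define t where "t = s * \<mu>"
  have t: "0 < t" using s \<mu> by (simp add: t_def)
  have disc: "cmod (of_real r * cay \<mu> w) < 1" if w: "- t < Im w" for w
  proof -
    have "(cmod (cay \<mu> w))\<^sup>2 \<le> 1 + 16 * s" using w by (intro cay_square_le \<mu> s) (simp add: t_def)
    also have "\<dots> < 1 / r\<^sup>2" using s by linarith
    finally have "r\<^sup>2 * (cmod (cay \<mu> w))\<^sup>2 < 1" using r by (simp add: pos_less_divide_eq mult.commute)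
    then have "(cmod (of_real r * cay \<mu> w))\<^sup>2 < 1" by (simp add: norm_mult power_mult_distrib)
    then show ?thesis by (simp add: power_less_one_iff abs_square_less_1)
  qed
  have cayhol: "(\<lambda>w. of_real r * cay \<mu> w) holomorphic_on {w. - t < Im w}"
    unfolding cay_def using cay_square_le(1)[OF \<mu>(1) s(1,2)] by (intro holomorphic_intros) (auto simp: t_def)
  have comp: "half_plane_fun (\<lambda>w. F (of_real r * cay \<mu> w)) t"
    if F: "F holomorphic_on ball 0 1" "\<And>z. cmod z < 1 \<Longrightarrow> cmod (F z) \<le> 1" for F
  proof
    have "(F \<circ> (\<lambda>w. of_real r * cay \<mu> w)) holomorphic_on {w. - t < Im w}"
      by (rule holomorphic_on_compose_gen[OF cayhol F(1)]) (auto simp: disc)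
    then show "(\<lambda>w. F (of_real r * cay \<mu> w)) holomorphic_on {w. - t < Im w}" by (simp add: o_def)
    show "cmod (F (of_real r * cay \<mu> w)) \<le> 1" if "- t < Im w" for w using disc[OF that] by (rule F(2))
  qed (use t in simp)
  obtain u v where uv: "u holomorphic_on {z. 0 < Im z}" "v holomorphic_on {z. 0 < Im z}"
    "\<And>z. 0 < Im z \<Longrightarrow> f (of_real r * cay \<mu> z) * u z + \<Theta> (of_real r * cay \<mu> z) * v z = 1"
    "\<And>z. 0 < Im z \<Longrightarrow> cmod (u z) \<le> 1 / sqrt (1 - 10 * \<eta>) + 4000 * exp 3120 / m"
    "\<And>z. 0 < Im z \<Longrightarrow> cmod (v z) \<le> 1 / sqrt (1 - 10 * \<eta>) + 4000 * exp 3120 / m"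
  proof (rule half_plane_bezout[OF comp[OF hol(1) le(1)] comp[OF hol(2) le(2)] t m \<alpha> \<tau> \<eta>])
    show "defect (\<lambda>w. \<Theta> (of_real r * cay \<mu> w)) z * defect (\<lambda>w. f (of_real r * cay \<mu> w)) z \<le> \<tau>" if "0 < Im z" for z
      using prod[OF disc[of z]] that t by (simp add: defect_def)
    show "defect (\<lambda>w. \<Theta> (of_real r * cay \<mu> w)) z < \<alpha> 0"
      if z: "- t < Im z" "\<not> (1/4 < Re z \<and> Re z < 3/4 \<and> Im z < 1/2)" for z
    proof -
      have "dist (of_real r * cay \<mu> z) (of_real r) = r * cmod (cay \<mu> z - 1)"
        using r unfolding dist_norm by (metis abs_of_pos mult.right_neutral norm_mult norm_of_real right_diff_distrib)
      also have "\<dots> \<le> 1 * (16 * \<mu>)" using r cay_near_1[OF \<mu>(1,2) z(2)] by (intro mult_mono) auto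
      also have "\<dots> < \<delta>" using \<mu> by simp
      finally have "defect \<Theta> (of_real r * cay \<mu> z) < \<alpha> 0"
        using \<delta>(2)[of "of_real r * cay \<mu> z"] at1 by (cases "of_real r * cay \<mu> z = of_real r") auto
      then show ?thesis by (simp add: defect_def)
    qed
  next
    fix u v assume "u holomorphic_on {z. 0 < Im z}" "v holomorphic_on {z. 0 < Im z}"
      "\<And>z. 0 < Im z \<Longrightarrow> f (of_real r * cay \<mu> z) * u z + \<Theta> (of_real r * cay \<mu> z) * v z = 1"
      "\<And>z. 0 < Im z \<Longrightarrow> cmod (u z) \<le> 1 / sqrt (1 - 10 * \<eta>) + 4000 * exp 3120 / m"
      "\<And>z. 0 < Im z \<Longrightarrow> cmod (v z) \<le> 1 / sqrt (1 - 10 * \<eta>) + 4000 * exp 3120 / m"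
    then show thesis by (rule that)
  qed
  have ihol: "cay_inv \<mu> holomorphic_on ball 0 1"
    unfolding cay_inv_def by (intro holomorphic_intros) auto
  have im: "cay_inv \<mu> ` ball 0 1 \<subseteq> {z. 0 < Im z}" using Im_cay_inv[OF \<mu>(1)] by auto
  show thesis
  proof (rule that[of "u \<circ> cay_inv \<mu>" "v \<circ> cay_inv \<mu>"])
    show "u \<circ> cay_inv \<mu> holomorphic_on ball 0 1" by (rule holomorphic_on_compose_gen[OF ihol uv(1) im])
    show "v \<circ> cay_inv \<mu> holomorphic_on ball 0 1" by (rule holomorphic_on_compose_gen[OF ihol uv(2) im])
    fix z :: complex assume z: "cmod z < 1"
    note i = Im_cay_inv[OF \<mu>(1) z]
    show "f (of_real r * z) * (u \<circ> cay_inv \<mu>) z + \<Theta> (of_real r * z) * (v \<circ> cay_inv \<mu>) z = 1"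
      using uv(3)[OF i] by (simp add: cay_cay_inv[OF \<mu>(1) z])
    show "cmod ((u \<circ> cay_inv \<mu>) z) \<le> 1 / sqrt (1 - 10 * \<eta>) + 4000 * exp 3120 / m" using uv(4)[OF i] by simp
    show "cmod ((v \<circ> cay_inv \<mu>) z) \<le> 1 / sqrt (1 - 10 * \<eta>) + 4000 * exp 3120 / m" using uv(5)[OF i] by simp
  qed
qed

text \<open>The bound \<open>L\<close> does not depend on \<open>r\<close>, so Montel's theorem
  applies to one coefficient and then, along the subsequence, to the other; continuity of
  \<open>f\<close> and \<open>\<Theta>\<close> inside the disc passes the identity to the
  limit.\<close>

lemma dilation_limit:
  assumes hol: "\<Theta> holomorphic_on ball 0 1" "f holomorphic_on ball 0 1"
    and ex: "\<And>r. 0 < r \<Longrightarrow> r < 1 \<Longrightarrow> \<exists>u v. u holomorphic_on ball 0 1 \<and> v holomorphic_on ball 0 1 \<and>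
      (\<forall>z. cmod z < 1 \<longrightarrow> f (of_real r * z) * u z + \<Theta> (of_real r * z) * v z = 1 \<and> cmod (u z) \<le> L \<and> cmod (v z) \<le> L)"
  shows "\<exists>u v. u holomorphic_on ball 0 1 \<and> v holomorphic_on ball 0 1 \<and>
      (\<forall>z. cmod z < 1 \<longrightarrow> f z * u z + \<Theta> z * v z = 1 \<and> cmod (u z) \<le> L \<and> cmod (v z) \<le> L)"
proof -
  define r where "r n = 1 - 1 / real (n + 2)" for n
  have r: "0 < r n" "r n < 1" for n by (simp_all add: r_def field_simps)
  have "\<forall>n. \<exists>uv. fst uv holomorphic_on ball 0 1 \<and> snd uv holomorphic_on ball 0 1 \<and>
      (\<forall>z. cmod z < 1 \<longrightarrow> f (of_real (r n) * z) * fst uv z + \<Theta> (of_real (r n) * z) * snd uv z = 1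
        \<and> cmod (fst uv z) \<le> L \<and> cmod (snd uv z) \<le> L)"
  proof
    fix n
    obtain u v where "u holomorphic_on ball 0 1 \<and> v holomorphic_on ball 0 1 \<and>
      (\<forall>z. cmod z < 1 \<longrightarrow> f (of_real (r n) * z) * u z + \<Theta> (of_real (r n) * z) * v z = 1 \<and> cmod (u z) \<le> L \<and> cmod (v z) \<le> L)"
      using ex[OF r[of n]] by auto
    then show "\<exists>uv. fst uv holomorphic_on ball 0 1 \<and> snd uv holomorphic_on ball 0 1 \<and>
      (\<forall>z. cmod z < 1 \<longrightarrow> f (of_real (r n) * z) * fst uv z + \<Theta> (of_real (r n) * z) * snd uv z = 1
        \<and> cmod (fst uv z) \<le> L \<and> cmod (snd uv z) \<le> L)" by (intro exI[of _ "(u, v)"]) simp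
  qed
  then obtain w where w: "\<forall>n. fst (w n) holomorphic_on ball 0 1 \<and> snd (w n) holomorphic_on ball 0 1 \<and>
      (\<forall>z. cmod z < 1 \<longrightarrow> f (of_real (r n) * z) * fst (w n) z + \<Theta> (of_real (r n) * z) * snd (w n) z = 1
        \<and> cmod (fst (w n) z) \<le> L \<and> cmod (snd (w n) z) \<le> L)"
    by (rule choice[THEN exE])
  define \<H> where "\<H> = {h :: complex \<Rightarrow> complex. h holomorphic_on ball 0 1 \<and> (\<forall>z\<in>ball 0 1. cmod (h z) \<le> L)}"
  have \<H>1: "h holomorphic_on ball 0 1" if "h \<in> \<H>" for h using that by (simp add: \<H>_def)
  have \<H>2: "\<exists>B. \<forall>h\<in>\<H>. \<forall>z\<in>K. cmod (h z) \<le> B" if "K \<subseteq> ball 0 1" for K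
    using that by (intro exI[of _ L]) (auto simp: \<H>_def)
  have "range (\<lambda>n. fst (w n)) \<subseteq> \<H>" using w by (auto simp: \<H>_def)
  then obtain u p where u: "u holomorphic_on ball 0 1" "strict_mono (p :: nat \<Rightarrow> nat)"
      "\<And>z. z \<in> ball 0 1 \<Longrightarrow> (\<lambda>n. fst (w (p n)) z) \<longlonglongrightarrow> u z"
    using Montel[of "ball 0 1" \<H> "\<lambda>n. fst (w n)"] \<H>1 \<H>2 by (metis open_ball)
  have "range (\<lambda>n. snd (w (p n))) \<subseteq> \<H>" using w by (auto simp: \<H>_def)
  then obtain v q where v: "v holomorphic_on ball 0 1" "strict_mono (q :: nat \<Rightarrow> nat)"
      "\<And>z. z \<in> ball 0 1 \<Longrightarrow> (\<lambda>n. snd (w (p (q n))) z) \<longlonglongrightarrow> v z"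
    using Montel[of "ball 0 1" \<H> "\<lambda>n. snd (w (p n))"] \<H>1 \<H>2 by (metis open_ball)
  have "f z * u z + \<Theta> z * v z = 1 \<and> cmod (u z) \<le> L \<and> cmod (v z) \<le> L" if z: "cmod z < 1" for z
  proof -
    have zb: "z \<in> ball 0 1" using z by simp
    have ul: "(\<lambda>n. fst (w (p (q n))) z) \<longlonglongrightarrow> u z"
      using LIMSEQ_subseq_LIMSEQ[OF u(3)[OF zb] v(2)] by (simp add: o_def)
    note vl = v(3)[OF zb]
    have "(\<lambda>n. 1 / real (n + 2)) \<longlonglongrightarrow> 0" by (rule LIMSEQ_ignore_initial_segment) (rule lim_1_over_n)
    then have "(\<lambda>n. 1 - 1 / real (n + 2)) \<longlonglongrightarrow> 1 - 0" by (intro tendsto_intros)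
    then have "r \<longlonglongrightarrow> 1" by (simp add: r_def[abs_def])
    then have "(\<lambda>n. r (p (q n))) \<longlonglongrightarrow> 1"
      using LIMSEQ_subseq_LIMSEQ[OF _ strict_mono_o[OF u(2) v(2)], of r 1] by (simp add: o_def)
    then have "(\<lambda>n. of_real (r (p (q n))) * z) \<longlonglongrightarrow> of_real 1 * z" by (intro tendsto_intros)
    then have rz: "(\<lambda>n. of_real (r (p (q n))) * z) \<longlonglongrightarrow> z" by simp
    have c: "isCont \<Theta> z" "isCont f z"
      using hol[THEN holomorphic_on_imp_continuous_on] z by (auto simp: continuous_on_eq_continuous_at)
    have "(\<lambda>n. f (of_real (r (p (q n))) * z) * fst (w (p (q n))) z + \<Theta> (of_real (r (p (q n))) * z) * snd (w (p (q n))) z)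
       \<longlonglongrightarrow> f z * u z + \<Theta> z * v z"
      by (intro tendsto_intros ul vl isCont_tendsto_compose[OF c(1) rz] isCont_tendsto_compose[OF c(2) rz])
    moreover have "(\<lambda>n. f (of_real (r (p (q n))) * z) * fst (w (p (q n))) z + \<Theta> (of_real (r (p (q n))) * z) * snd (w (p (q n))) z)
       = (\<lambda>n. 1)" using w z by auto
    ultimately have "f z * u z + \<Theta> z * v z = 1" by (simp add: LIMSEQ_const_iff)
    moreover have "cmod (u z) \<le> L" by (rule LIMSEQ_le_const2[OF tendsto_norm[OF ul]]) (use w z in auto)
    moreover have "cmod (v z) \<le> L" by (rule LIMSEQ_le_const2[OF tendsto_norm[OF vl]]) (use w z in auto)
    ultimately show ?thesis by simp
  qed
  then show ?thesis using u(1) v(1) by blast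
qed

theorem sharp_corona_two:
  assumes \<epsilon>: "0 < \<epsilon>"
  shows "\<exists>\<tau>>0. \<forall>f \<Theta>. f holomorphic_on ball 0 1 \<and> \<Theta> holomorphic_on ball 0 1 \<and>
      (\<forall>z. cmod z < 1 \<longrightarrow> cmod (f z) \<le> 1 \<and> cmod (\<Theta> z) \<le> 1 \<and> defect f z * defect \<Theta> z \<le> \<tau>) \<longrightarrow>
      (\<exists>u v. u holomorphic_on ball 0 1 \<and> v holomorphic_on ball 0 1 \<and>
        (\<forall>z. cmod z < 1 \<longrightarrow> f z * u z + \<Theta> z * v z = 1 \<and> cmod (u z) \<le> 1 + \<epsilon> \<and> cmod (v z) \<le> 1 + \<epsilon>))"
proof -
  \<comment> \<open>\<open>\<epsilon>\<close> is split in halves: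
    \<open>q = sqrt (1 - 10 * \<eta>)\<close> bounds the inverse moduli by
    \<open>1 + \<epsilon>/2\<close>, and \<open>m\<close> makes the correction at most
    \<open>\<epsilon>/2\<close>. \<open>q \<ge> 1/2\<close> gives
    \<open>10 * \<eta> \<le> 3/4\<close>.\<close>
  define q where "q = max (1/2) (1 / (1 + \<epsilon>/2))"
  define \<eta> where "\<eta> = (1 - q\<^sup>2) / 10"
  have q: "1/2 \<le> q" "q < 1" "1 / (1 + \<epsilon>/2) \<le> q" using \<epsilon> by (auto simp: q_def)
  have "(1/2)\<^sup>2 \<le> q\<^sup>2" using q by (intro power_mono) auto
  moreover have "q\<^sup>2 < 1" using q by (simp add: power_less_one_iff)
  ultimately have \<eta>: "0 < \<eta>" "10 * \<eta> \<le> 3/4" by (simp_all add: \<eta>_def power2_eq_square)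
  have "1 - 10 * \<eta> = q\<^sup>2" by (simp add: \<eta>_def diff_divide_distrib)
  then have "sqrt (1 - 10 * \<eta>) = q" using q by simp
  moreover have "1 / q \<le> 1 + \<epsilon>/2" using q \<epsilon> by (simp add: field_simps)
  ultimately have L1: "1 / sqrt (1 - 10 * \<eta>) \<le> 1 + \<epsilon>/2" by simp
  obtain m where m: "max 1 (8000 * exp 3120 / \<epsilon>) < real m" using reals_Archimedean2 by blast
  then have m1: "1 \<le> m" and m2: "8000 * exp 3120 < \<epsilon> * real m" using \<epsilon> by (auto simp: pos_divide_less_eq mult.commute)
  have "4000 * exp 3120 / m \<le> \<epsilon>/2" using m1 m2 by (simp add: pos_divide_le_eq)
  then have L: "1 / sqrt (1 - 10 * \<eta>) + 4000 * exp 3120 / m \<le> 1 + \<epsilon>" using L1 by linarith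
  have pc: "0 \<le> packing_const" by (simp add: packing_const_def)
  obtain \<alpha> \<tau> where \<alpha>: "0 < \<alpha> 0" "\<And>i. Suc i < m \<Longrightarrow> 64 * \<alpha> i \<le> \<alpha> (Suc i)"
    "\<And>i. Suc i < m \<Longrightarrow> packing_const * sqrt (8 * \<alpha> i) \<le> \<alpha> (Suc i) / 4" "\<And>i. i < m \<Longrightarrow> \<alpha> i \<le> \<eta>"
    and \<tau>: "0 < \<tau>" "\<tau> < \<alpha> 0 * \<alpha> 0" "packing_const * sqrt (\<tau> / \<alpha> 0) \<le> \<alpha> 0 / 4"
    using thresholds_exist[OF m1 pc \<eta>(1)] by metis
  show ?thesis
  proof (intro exI[of _ \<tau>] conjI \<tau>(1) allI impI)
    fix f \<Theta> :: "complex \<Rightarrow> complex"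
    assume A: "f holomorphic_on ball 0 1 \<and> \<Theta> holomorphic_on ball 0 1 \<and>
      (\<forall>z. cmod z < 1 \<longrightarrow> cmod (f z) \<le> 1 \<and> cmod (\<Theta> z) \<le> 1 \<and> defect f z * defect \<Theta> z \<le> \<tau>)"
    then have hol: "f holomorphic_on ball 0 1" "\<Theta> holomorphic_on ball 0 1" by auto
    have f1: "cmod (f z) \<le> 1" and T1: "cmod (\<Theta> z) \<le> 1" and prod: "defect f z * defect \<Theta> z \<le> \<tau>" if "cmod z < 1" for z
      using A that by auto
    have prod': "\<And>z. cmod z < 1 \<Longrightarrow> defect \<Theta> z * defect f z \<le> \<tau>" using prod by (simp add: mult.commute)
    show "\<exists>u v. u holomorphic_on ball 0 1 \<and> v holomorphic_on ball 0 1 \<and>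
        (\<forall>z. cmod z < 1 \<longrightarrow> f z * u z + \<Theta> z * v z = 1 \<and> cmod (u z) \<le> 1 + \<epsilon> \<and> cmod (v z) \<le> 1 + \<epsilon>)"
    proof (rule dilation_limit[OF hol(2,1)])
      fix r :: real assume r: "0 < r" "r < 1"
      \<comment> \<open>Since \<open>\<tau> < \<alpha> 0 * \<alpha> 0\<close>, at least one function
        has small defect at \<open>r\<close>. It takes the part of \<open>\<Theta>\<close>; the
        assertion is symmetric in the two.\<close>
      have "defect \<Theta> (of_real r) < \<alpha> 0 \<or> defect f (of_real r) < \<alpha> 0"
      proof (rule ccontr)
        assume "\<not> ?thesis"
        then have "\<alpha> 0 * \<alpha> 0 \<le> defect \<Theta> (of_real r) * defect f (of_real r)"
          using \<alpha>(1) by (intro mult_mono) auto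
        then show False using prod'[of "of_real r"] r \<tau>(2) by simp
      qed
      then show "\<exists>u v. u holomorphic_on ball 0 1 \<and> v holomorphic_on ball 0 1 \<and>
        (\<forall>z. cmod z < 1 \<longrightarrow> f (of_real r * z) * u z + \<Theta> (of_real r * z) * v z = 1 \<and> cmod (u z) \<le> 1 + \<epsilon> \<and> cmod (v z) \<le> 1 + \<epsilon>)"
      proof
        assume a: "defect \<Theta> (of_real r) < \<alpha> 0"
        show ?thesis
        proof (rule dilated_bezout[OF hol(2,1) T1 f1 r m1 \<alpha> \<tau> less_imp_le[OF \<eta>(1)] \<eta>(2) prod' a])
          fix u v assume uv: "u holomorphic_on ball 0 1" "v holomorphic_on ball 0 1"
            "\<And>z. cmod z < 1 \<Longrightarrow> f (of_real r * z) * u z + \<Theta> (of_real r * z) * v z = 1"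
            "\<And>z. cmod z < 1 \<Longrightarrow> cmod (u z) \<le> 1 / sqrt (1 - 10 * \<eta>) + 4000 * exp 3120 / m"
            "\<And>z. cmod z < 1 \<Longrightarrow> cmod (v z) \<le> 1 / sqrt (1 - 10 * \<eta>) + 4000 * exp 3120 / m"
          show ?thesis
            by (intro exI[of _ u] exI[of _ v] conjI allI impI uv order_trans[OF uv(4) L] order_trans[OF uv(5) L])
        qed
      next
        assume a: "defect f (of_real r) < \<alpha> 0"
        show ?thesis
        proof (rule dilated_bezout[OF hol f1 T1 r m1 \<alpha> \<tau> less_imp_le[OF \<eta>(1)] \<eta>(2) prod a])
          fix u v assume uv: "u holomorphic_on ball 0 1" "v holomorphic_on ball 0 1"
            "\<And>z. cmod z < 1 \<Longrightarrow> \<Theta> (of_real r * z) * u z + f (of_real r * z) * v z = 1"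
            "\<And>z. cmod z < 1 \<Longrightarrow> cmod (u z) \<le> 1 / sqrt (1 - 10 * \<eta>) + 4000 * exp 3120 / m"
            "\<And>z. cmod z < 1 \<Longrightarrow> cmod (v z) \<le> 1 / sqrt (1 - 10 * \<eta>) + 4000 * exp 3120 / m"
          have uv3: "\<And>z. cmod z < 1 \<Longrightarrow> f (of_real r * z) * v z + \<Theta> (of_real r * z) * u z = 1"
            using uv(3) by (simp add: add.commute)
          show ?thesis
            by (intro exI[of _ v] exI[of _ u] conjI allI impI uv(1,2) uv3 order_trans[OF uv(4) L] order_trans[OF uv(5) L])
        qed
      qed
    qed
  qed
qed

text \<open>The corona theorem applies because the product of defects is small everywhere: at
  distance at least \<open>t\<close> from the zeros \<open>|\<Theta>|\<close> is near 1, and closer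
  to a zero the Harnack inequality carries the smallness of the defect of \<open>f\<close> over from
  that zero.\<close>

lemma SIP_if_SUP_eta:
  assumes inn: "inner_function \<Theta>" and sup: "(SUP t\<in>{0<..<1}. eta \<Theta> t) = 1"
  shows "SIP \<Theta>"
  unfolding SIP_def
proof (intro allI impI)
  fix \<epsilon> :: real assume "0 < \<epsilon>"
  from sharp_corona_two[OF this] obtain \<tau> where \<tau>: "0 < \<tau>" and corona: "\<forall>f \<Theta>. f holomorphic_on ball 0 1 \<and> \<Theta> holomorphic_on ball 0 1 \<and>
      (\<forall>z. cmod z < 1 \<longrightarrow> cmod (f z) \<le> 1 \<and> cmod (\<Theta> z) \<le> 1 \<and> defect f z * defect \<Theta> z \<le> \<tau>) \<longrightarrow>
      (\<exists>u v. u holomorphic_on ball 0 1 \<and> v holomorphic_on ball 0 1 \<and>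
        (\<forall>z. cmod z < 1 \<longrightarrow> f z * u z + \<Theta> z * v z = 1 \<and> cmod (u z) \<le> 1 + \<epsilon> \<and> cmod (v z) \<le> 1 + \<epsilon>))" by auto
  have "ereal (1 - \<tau>/2) < (SUP t\<in>{0<..<1}. eta \<Theta> t)" using \<tau> by (simp add: sup one_ereal_def)
  then obtain t where t: "0 < t" "t < 1" "ereal (1 - \<tau>/2) < eta \<Theta> t" by (auto simp: less_SUP_iff)
  \<comment> \<open>\<open>8 * \<delta> \<le> \<tau> * (1 - t)\<close> combines a defect of at most
    \<open>4 * \<delta>\<close> at the zeros with the Harnack factor
    \<open>2 / (1 - t)\<close>.\<close>
  define \<delta> where "\<delta> = min (1/2) (\<tau> * (1 - t) / 8)"
  have \<delta>: "0 < \<delta>" "\<delta> \<le> 1/2" "8 * \<delta> \<le> \<tau> * (1 - t)" using \<tau> t by (auto simp: \<delta>_def min_def)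
  have TH: "\<Theta> \<in> Hinf" and Th: "\<Theta> holomorphic_on ball 0 1" using inn by (auto simp: inner_function_def inner_holomorphic)
  have T1: "cmod (\<Theta> z) \<le> 1" if "cmod z < 1" for z using inner_le_1[OF inn that] .
  show "\<exists>\<delta>>0. \<forall>f\<in>Hinf. quot_norm \<Theta> f \<le> 1 \<and> (INF z\<in>zero_set \<Theta>. ereal (cmod (f z))) \<ge> ereal (1 - \<delta>) \<longrightarrow>
        (\<exists>h. quot_inverse \<Theta> f h \<and> quot_norm \<Theta> h \<le> 1 + \<epsilon>)"
  proof (intro exI[of _ \<delta>] conjI \<delta>(1) ballI impI)
    fix f assume f: "f \<in> Hinf" and "quot_norm \<Theta> f \<le> 1 \<and> (INF z\<in>zero_set \<Theta>. ereal (cmod (f z))) \<ge> ereal (1 - \<delta>)"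
    then have qn: "quot_norm \<Theta> f < 1 + \<delta>" and inf: "ereal (1 - \<delta>) \<le> (INF z\<in>zero_set \<Theta>. ereal (cmod (f z)))"
      using \<delta>(1) by auto
    obtain g where g: "g \<in> Hinf" "\<And>z. cmod z < 1 \<Longrightarrow> cmod (f z + g z * \<Theta> z) \<le> 1 + \<delta>"
      using quot_norm_representative[OF f TH qn] by metis
    \<comment> \<open>The argument uses a representative of norm at most
      \<open>1 + \<delta>\<close>; dividing by \<open>1 + \<delta>\<close> brings it into the unit
      ball.\<close>
    define F where "F z = (f z + g z * \<Theta> z) / of_real (1 + \<delta>)" for z
    have d1: "0 < 1 + \<delta>" "complex_of_real (1 + \<delta>) \<noteq> 0" using \<delta>(1) by (auto simp del: of_real_add)
    have nF: "cmod (F z) = cmod (f z + g z * \<Theta> z) / (1 + \<delta>)" for z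
      unfolding F_def norm_divide norm_of_real using d1 by simp
    have Fh: "F holomorphic_on ball 0 1"
      unfolding F_def[abs_def] using d1 by (intro holomorphic_intros HinfD(1)[OF f] HinfD(1)[OF g(1)] Th) auto
    have F1: "cmod (F z) \<le> 1" if "cmod z < 1" for z
      using g(2)[OF that] d1 by (simp add: nF)
    have Fa: "defect F a \<le> 4 * \<delta>" if a: "a \<in> zero_set \<Theta>" for a
    proof -
      have "ereal (1 - \<delta>) \<le> ereal (cmod (f a))" using inf a by (simp add: le_INF_iff)
      then have fa: "1 - \<delta> \<le> cmod (f a)" by simp
      have "(1 - 2 * \<delta>) * (1 + \<delta>) \<le> 1 - \<delta>" using zero_le_square[of \<delta>] by (simp add: algebra_simps)
      then have "1 - 2 * \<delta> \<le> (1 - \<delta>) / (1 + \<delta>)" using d1(1) by (simp only: pos_le_divide_eq)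
      also have "\<dots> \<le> cmod (F a)" using fa d1 a by (simp add: nF zero_set_def divide_right_mono)
      finally have "(1 - 2 * \<delta>)\<^sup>2 \<le> (cmod (F a))\<^sup>2" using \<delta> by (intro power_mono) auto
      moreover have "1 - 4 * \<delta> \<le> (1 - 2 * \<delta>)\<^sup>2" by (simp add: power2_eq_square algebra_simps)
      ultimately show ?thesis by (simp add: defect_def)
    qed
    have prod: "defect F z * defect \<Theta> z \<le> \<tau>" if z: "cmod z < 1" for z
    proof (cases "ereal t \<le> rho_set z (zero_set \<Theta>)")
      case True
      have "ereal (1 - \<tau>/2) < ereal (cmod (\<Theta> z))" using t(3) eta_le_norm[OF z True] by (rule less_le_trans)
      then have "1 - \<tau>/2 < cmod (\<Theta> z)" by simp
      moreover have "(1 - cmod (\<Theta> z)) * (1 + cmod (\<Theta> z)) \<le> (1 - cmod (\<Theta> z)) * 2"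
        using T1[OF z] by (intro mult_left_mono) auto
      moreover have "(1 - cmod (\<Theta> z)) * (1 + cmod (\<Theta> z)) = defect \<Theta> z"
        by (simp add: defect_def power2_eq_square algebra_simps)
      ultimately have "defect \<Theta> z \<le> \<tau>" by simp
      moreover have "0 \<le> defect \<Theta> z" "0 \<le> defect F z" "defect F z \<le> 1"
        by (rule defect_nonneg, rule T1[OF z], rule defect_nonneg, rule F1[OF z], simp add: defect_def)
      ultimately show ?thesis using mult_left_le_one_le[of "defect \<Theta> z" "defect F z"] by linarith
    next
      case False
      then obtain a where a: "a \<in> zero_set \<Theta>" "rho z a < t" using rho_set_geI[of "zero_set \<Theta>" t z] by force
      have ad: "cmod a < 1" using a by (simp add: zero_set_def)
      have "cmod (F z - F a) \<le> rho z a * cmod (1 - cnj (F a) * F z)" by (rule schwarz_pick[OF Fh F1 z ad])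
      also have "\<dots> \<le> t * cmod (1 - cnj (F a) * F z)" using a(2) by (intro mult_right_mono) auto
      finally have "1 - (cmod (F z))\<^sup>2 \<le> 2 / (1 - t) * (1 - (cmod (F a))\<^sup>2)"
        using t by (intro pick_harnack F1 z ad) auto
      then have "defect F z \<le> 2 / (1 - t) * defect F a" by (simp add: defect_def)
      also have "\<dots> \<le> 2 / (1 - t) * (4 * \<delta>)" using Fa[OF a(1)] t by (intro mult_left_mono) auto
      also have "\<dots> \<le> \<tau>" using \<delta>(3) t by (simp add: pos_divide_le_eq)
      finally have "defect F z \<le> \<tau>" .
      moreover have "0 \<le> defect \<Theta> z" "0 \<le> defect F z" "defect \<Theta> z \<le> 1"
        by (rule defect_nonneg, rule T1[OF z], rule defect_nonneg, rule F1[OF z], simp add: defect_def)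
      ultimately show ?thesis using mult_right_le_one_le[of "defect F z" "defect \<Theta> z"] by linarith
    qed
    obtain u v where uv: "u holomorphic_on ball 0 1" "v holomorphic_on ball 0 1"
      "\<forall>z. cmod z < 1 \<longrightarrow> F z * u z + \<Theta> z * v z = 1 \<and> cmod (u z) \<le> 1 + \<epsilon> \<and> cmod (v z) \<le> 1 + \<epsilon>"
      using corona[rule_format, of F \<Theta>] Fh Th F1 T1 prod by auto
    \<comment> \<open>\<open>F\<close> equals \<open>c * f\<close> modulo \<open>\<Theta>\<close>,
      so the Bezout coefficient \<open>u\<close> of \<open>F\<close> makes \<open>c * u\<close> an
      inverse of \<open>f\<close>.\<close>
    define c where "c = 1 / complex_of_real (1 + \<delta>)"
    have nc: "cmod c \<le> 1" unfolding c_def norm_divide norm_of_real using \<delta>(1) by simp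
    have uH: "u \<in> Hinf" and vH: "v \<in> Hinf" using uv by (auto intro!: HinfI[where K = "1 + \<epsilon>"])
    have hH: "(\<lambda>z. c * u z) \<in> Hinf" by (intro Hinf_mult Hinf_const uH)
    have kH: "(\<lambda>z. - 1 * (v z + c * (g z * u z))) \<in> Hinf"
      by (intro Hinf_mult Hinf_add Hinf_const uH vH g(1))
    have e: "f z * (c * u z) - 1 = \<Theta> z * (- 1 * (v z + c * (g z * u z)))" if "cmod z < 1" for z
    proof -
      have "F z * u z + \<Theta> z * v z = 1" using uv(3) that by blast
      moreover have "F z = c * (f z + g z * \<Theta> z)" by (simp add: F_def c_def)
      ultimately have "c * (f z + g z * \<Theta> z) * u z + \<Theta> z * v z = 1" by simp
      then show ?thesis by (simp add: algebra_simps eq_neg_iff_add_eq_0)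
    qed
    have "quot_eq \<Theta> (\<lambda>z. f z * (c * u z)) (\<lambda>z. 1)"
      unfolding quot_eq_def using e by (intro bexI[OF _ kH]) auto
    then have "quot_inverse \<Theta> f (\<lambda>z. c * u z)" using hH by (simp add: quot_inverse_def)
    moreover have "quot_norm \<Theta> (\<lambda>z. c * u z) \<le> 1 + \<epsilon>"
    proof (rule quot_norm_le[OF hH TH Hinf_const[of 0]])
      fix z :: complex assume z: "cmod z < 1"
      have "cmod (c * u z) \<le> 1 * (1 + \<epsilon>)" unfolding norm_mult using nc uv(3) z by (intro mult_mono) auto
      then show "cmod (c * u z + 0 * \<Theta> z) \<le> 1 + \<epsilon>" by simp
    qed
    ultimately show "\<exists>h. quot_inverse \<Theta> f h \<and> quot_norm \<Theta> h \<le> 1 + \<epsilon>" by blast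
  qed
qed

text \<open>For the converse of \<open>SIP_if_SUP_eta\<close>: the SIP excludes that
  \<open>eta\<close> vanishes identically, and the dichotomy then leaves only the value 1.\<close>

theorem corollary1p5:
  fixes \<Theta> :: "complex \<Rightarrow> complex"
  assumes "inner_function \<Theta>" and "\<Theta> \<in> class_M"
  shows "((SUP t\<in>{0<..<1}. eta \<Theta> t) = 1 \<or> (\<forall>t\<in>{0<..<1}. eta \<Theta> t = 0)) \<and>
         ((SUP t\<in>{0<..<1}. eta \<Theta> t) = 1 \<longleftrightarrow> SIP \<Theta>)"
  using SUP_eta_dichotomy[OF assms] SIP_if_SUP_eta[OF assms(1)] SIP_imp_eta_nonzero[OF assms(1)] by blast

end
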